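(* Let $\Sigma\to\Sigma_0$ be the $\mathbb Z$-cover of a closed oriented hyperbolic surface associated with a nontrivial homotopy class $\varphi$ of maps $\Sigma_0\to\mathbb R/\mathbb Z$, let $\lambda\subset\Sigma$ be the preimage of the distance minimizing lamination $\lambda_0\subset\Sigma_0$, and let $|V(\mathcal G)|$ be the (finite) number of weak components of $\lambda$. Then there are exactly $2|V(\mathcal G)|+1$ distinct $N$-orbit closures $\overline{Nx}$, $x\in T^1\Sigma$, in $T^1\Sigma$, up to $A$-translation (that is, up to the equivalence $\overline{Nx}\sim a_t\overline{Nx}$, $t\in\mathbb R$).
   Context: $G=\mathrm{PSL}_2(\mathbb R)$, $T^1\Sigma_0\cong G/\Gamma_0$, $\Gamma=\ker\varphi_*$, $\Sigma=\mathbb H^2/\Gamma$, $T^1\Sigma\cong G/\Gamma$. $A=\{a_t=\mathrm{diag}(e^{t/2},e^{-t/2})\}$ acts on the left as the geodesic flow; $N$ is the lower unipotent subgroup, whose orbits are stable horocycles. A representative of $\varphi$ is tight if its Lipschitz constant equals $\sup_\gamma\deg(\varphi|_\gamma)/\ell(\gamma)$ over closed curves $\gamma\subset\Sigma_0$; its stretch set is the set of points whose local Lipschitz constant equals the global one. $\lambda_0$ is the intersection of the stretch sets of all tight representatives of $\varphi$; it is a geodesic lamination. A weak component of $\lambda$ is a (maximal) sublamination $\mu\subset\lambda$ such that the $\varepsilon$-neighborhood of $\mu$ is connected for every $\varepsilon>0$. The set $V(\mathcal G)$ (the vertex set of the "slack graph") contains one element for each weak component of $\lambda$. *)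

theory Defs
  imports
    "HOL-Analysis.Analysis"
    "HOL-Algebra.Left_Coset"
    "HOL-Algebra.Elementary_Groups"
begin

definition quotient_topology :: "'a topology \<Rightarrow> ('a \<Rightarrow> 'b) \<Rightarrow> 'b topology" where
  "quotient_topology X q =
     topology (\<lambda>U. U \<subseteq> q ` topspace X \<and> openin X {x \<in> topspace X. q x \<in> U})"

lemma openin_quotient_topology:
  "openin (quotient_topology X q) U \<longleftrightarrow>
     U \<subseteq> q ` topspace X \<and> openin X {x \<in> topspace X. q x \<in> U}"
proof -
  have "istopology (\<lambda>U. U \<subseteq> q ` topspace X \<and> openin X {x \<in> topspace X. q x \<in> U})"
    unfolding istopology_def
  proof (intro conjI allI impI)
    fix S T
    assume S: "S \<subseteq> q ` topspace X \<and> openin X {x \<in> topspace X. q x \<in> S}"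
      and T: "T \<subseteq> q ` topspace X \<and> openin X {x \<in> topspace X. q x \<in> T}"
    show "S \<inter> T \<subseteq> q ` topspace X" using S by blast
    have "{x \<in> topspace X. q x \<in> S \<inter> T} =
        {x \<in> topspace X. q x \<in> S} \<inter> {x \<in> topspace X. q x \<in> T}" by blast
    then show "openin X {x \<in> topspace X. q x \<in> S \<inter> T}" using S T by (simp only: openin_Int)
  next
    fix K
    assume K: "\<forall>U\<in>K. U \<subseteq> q ` topspace X \<and> openin X {x \<in> topspace X. q x \<in> U}"
    then show "\<Union>K \<subseteq> q ` topspace X" by blast
    have "openin X (\<Union>U\<in>K. {x \<in> topspace X. q x \<in> U})"
      using K by (intro openin_Union) blast
    moreover have "{x \<in> topspace X. q x \<in> \<Union>K} = (\<Union>U\<in>K. {x \<in> topspace X. q x \<in> U})" by blast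
    ultimately show "openin X {x \<in> topspace X. q x \<in> \<Union>K}" by (simp only:)
  qed
  then show ?thesis
    by (simp only: quotient_topology_def topology_inverse')
qed

lemma topspace_quotient_topology: "topspace (quotient_topology X q) = q ` topspace X"
proof
  show "topspace (quotient_topology X q) \<subseteq> q ` topspace X"
    using openin_topspace[of "quotient_topology X q"] by (simp only: openin_quotient_topology)
  have "{x \<in> topspace X. q x \<in> q ` topspace X} = topspace X" by blast
  then show "q ` topspace X \<subseteq> topspace (quotient_topology X q)"
    by (intro openin_subset) (simp only: openin_quotient_topology openin_topspace subset_refl simp_thms)
qed

lemma quotient_map_quotient_topology: "quotient_map X (quotient_topology X q) q"
  by (simp add: quotient_map_def openin_quotient_topology topspace_quotient_topology)


section \<open>The group \<open>PSL\<^sub>2(\<real>)\<close>\<close>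

definition SL2R :: "(real^2^2) monoid" where
  "SL2R = \<lparr>carrier = {A. det A = 1}, monoid.mult = (**), one = mat 1\<rparr>"

text \<open>Elements of \<open>PSL\<^sub>2(\<real>)\<close> are the cosets \<open>{A, - A}\<close>.\<close>

definition PSL2R :: "(real^2^2) set monoid" where
  "PSL2R = SL2R Mod {mat 1, - mat 1}"

definition psl :: "real^2^2 \<Rightarrow> (real^2^2) set" where
  "psl A = {mat 1, - mat 1} #>\<^bsub>SL2R\<^esub> A"

lemma psl_eq: "psl A = {A, - A}"
proof -
  have "- mat 1 ** A = - A"
    by (simp add: matrix_matrix_mult_def mat_def vec_eq_iff sum.delta if_distrib
        if_distribR cong: if_cong)
  then show ?thesis by (auto simp: psl_def r_coset_def SL2R_def)
qed

lemma carrier_PSL2R: "carrier PSL2R = psl ` {A. det A = 1}"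
  by (auto simp: PSL2R_def FactGroup_def RCOSETS_def psl_def SL2R_def)

definition PSL2R_topology :: "(real^2^2) set topology" where
  "PSL2R_topology = quotient_topology (top_of_set (carrier SL2R)) psl"

definition geodesic_elt :: "real \<Rightarrow> (real^2^2) set" where
  "geodesic_elt t = psl (vector [vector [exp (t/2), 0], vector [0, exp (- t/2)]])"

definition horocycle_elt :: "real \<Rightarrow> (real^2^2) set" where
  "horocycle_elt s = psl (vector [vector [1, 0], vector [s, 1]])"


section \<open>The hyperbolic plane and its quotients\<close>

definition upper_half_plane :: "complex set" where
  "upper_half_plane = {z. Im z > 0}"

definition hdist :: "complex \<Rightarrow> complex \<Rightarrow> real" where
  "hdist z w = arcosh (1 + (cmod (z - w))\<^sup>2 / (2 * Im z * Im w))"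

text \<open>The value below does not depend on the chosen representative.\<close>

definition psl_act :: "(real^2^2) set \<Rightarrow> complex \<Rightarrow> complex" where
  "psl_act P z = (let A = (SOME A. A \<in> P) in
     moebius (complex_of_real (A$1$1)) (of_real (A$1$2)) (of_real (A$2$1)) (of_real (A$2$2)) z)"

lemma psl_act_psl:
  "psl_act (psl A) z =
     moebius (complex_of_real (A$1$1)) (of_real (A$1$2)) (of_real (A$2$1)) (of_real (A$2$2)) z"
proof -
  have "(SOME B. B \<in> psl A) \<in> psl A"
    by (rule someI[of _ A]) (simp add: psl_eq)
  then have "(SOME B. B \<in> psl A) = A \<or> (SOME B. B \<in> psl A) = - A"
    by (simp add: psl_eq)
  then show ?thesis
  proof
    assume "(SOME B. B \<in> psl A) = - A"
    moreover have "moebius (- a) (- b) (- c) (- d) z = moebius a b c d z" for a b c d :: complex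
    proof -
      have "- a * z + - b = - (a * z + b)" "- c * z + - d = - (c * z + d)" by simp_all
      then show ?thesis by (simp only: moebius_def minus_divide_divide)
    qed
    ultimately show ?thesis by (simp only: psl_act_def Let_def vector_uminus_component of_real_minus)
  qed (simp only: psl_act_def Let_def)
qed

definition surface_proj :: "(real^2^2) set set \<Rightarrow> complex \<Rightarrow> complex set" where
  "surface_proj \<Gamma> z = (\<lambda>P. psl_act P z) ` \<Gamma>"

definition surface :: "(real^2^2) set set \<Rightarrow> complex set set" where
  "surface \<Gamma> = surface_proj \<Gamma> ` upper_half_plane"

definition surface_topology :: "(real^2^2) set set \<Rightarrow> complex set topology" where
  "surface_topology \<Gamma> = quotient_topology (top_of_set upper_half_plane) (surface_proj \<Gamma>)"

definition surface_dist :: "complex set \<Rightarrow> complex set \<Rightarrow> real" where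
  "surface_dist p q = (INF (z, w)\<in>p \<times> q. hdist z w)"

text \<open>
  The closed oriented hyperbolic surfaces are the quotients of the upper half-plane by the
  discrete subgroups of \<open>PSL\<^sub>2(\<real>)\<close> that act freely and cocompactly.
\<close>

definition closed_surface_group :: "(real^2^2) set set \<Rightarrow> bool" where
  "closed_surface_group \<Gamma> \<longleftrightarrow>
     subgroup \<Gamma> PSL2R \<and>
     subtopology PSL2R_topology \<Gamma> = discrete_topology \<Gamma> \<and>
     (\<forall>P\<in>\<Gamma>. \<forall>z\<in>upper_half_plane. psl_act P z = z \<longrightarrow> P = \<one>\<^bsub>PSL2R\<^esub>) \<and>
     compact_space (surface_topology \<Gamma>)"

text \<open>
  The unit tangent bundle is \<open>G/\<Gamma>\<close> with \<open>G = PSL\<^sub>2(\<real>)\<close>. The coset \<open>g\<Gamma>\<close> stands for the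
  \<open>\<Gamma>\<close>-orbit of \<open>g\<^sup>-\<^sup>1 v\<close>, where \<open>v\<close> is the unit vector at \<open>\<i>\<close> that points to \<open>0\<close>. Thus left
  multiplication by the diagonal elements is the geodesic flow, and the orbits of the lower
  unipotent group are the stable horocycles.
\<close>

definition unit_tangent_bundle :: "(real^2^2) set set \<Rightarrow> (real^2^2) set set set" where
  "unit_tangent_bundle \<Gamma> = lcosets\<^bsub>PSL2R\<^esub> \<Gamma>"

definition unit_tangent_topology :: "(real^2^2) set set \<Rightarrow> (real^2^2) set set topology" where
  "unit_tangent_topology \<Gamma> = quotient_topology PSL2R_topology (\<lambda>g. g <#\<^bsub>PSL2R\<^esub> \<Gamma>)"

definition N_orbit :: "(real^2^2) set set \<Rightarrow> (real^2^2) set set set" where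
  "N_orbit x = range (\<lambda>s. horocycle_elt s <#\<^bsub>PSL2R\<^esub> x)"

definition A_translate :: "real \<Rightarrow> (real^2^2) set set set \<Rightarrow> (real^2^2) set set set" where
  "A_translate t C = (\<lambda>x. geodesic_elt t <#\<^bsub>PSL2R\<^esub> x) ` C"

definition N_orbit_closures :: "(real^2^2) set set \<Rightarrow> (real^2^2) set set set set" where
  "N_orbit_closures \<Gamma> =
     (\<lambda>x. unit_tangent_topology \<Gamma> closure_of N_orbit x) ` unit_tangent_bundle \<Gamma>"

definition A_equiv :: "(real^2^2) set set \<Rightarrow>
    ((real^2^2) set set set \<times> (real^2^2) set set set) set" where
  "A_equiv \<Gamma> = {(C, D). C \<in> N_orbit_closures \<Gamma> \<and> D \<in> N_orbit_closures \<Gamma> \<and>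
     (\<exists>t. D = A_translate t C)}"


section \<open>Maps to the circle \<open>\<real>/\<int>\<close> and the associated \<open>\<int>\<close>-cover\<close>

definition circle_proj :: "real \<Rightarrow> real set" where
  "circle_proj x = {y. y - x \<in> \<int>}"

definition circle_topology :: "real set topology" where
  "circle_topology = quotient_topology euclideanreal circle_proj"

text \<open>The distance on \<open>\<real>/\<int>\<close> is \<^const>\<open>setdist\<close> of the two cosets.\<close>

definition circle_degree :: "(real \<Rightarrow> real set) \<Rightarrow> int" where
  "circle_degree c = (THE n. \<exists>l. continuous_on {0..1} l \<and>
     (\<forall>t\<in>{0..1}. c t = circle_proj (l t)) \<and> l 1 - l 0 = of_int n)"

definition homotopy_class_of ::
    "(real^2^2) set set \<Rightarrow> (complex set \<Rightarrow> real set) \<Rightarrow> (complex set \<Rightarrow> real set) set" where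
  "homotopy_class_of \<Gamma>\<^sub>0 f =
     {g. homotopic_with (\<lambda>_. True) (surface_topology \<Gamma>\<^sub>0) circle_topology f g}"

text \<open>
  The homomorphism induced on \<open>\<Gamma>\<^sub>0 = \<pi>\<^sub>1(\<Sigma>\<^sub>0)\<close>: the class of \<open>P\<close> is represented by the closed
  curve that is the image of a path in the upper half-plane from \<open>\<i>\<close> to \<open>P\<i>\<close>.
\<close>

definition induced_hom ::
    "(real^2^2) set set \<Rightarrow> (complex set \<Rightarrow> real set) \<Rightarrow> (real^2^2) set \<Rightarrow> int" where
  "induced_hom \<Gamma>\<^sub>0 f P =
     circle_degree (\<lambda>t. f (surface_proj \<Gamma>\<^sub>0 (linepath \<i> (psl_act P \<i>) t)))"

definition cover_group ::
    "(real^2^2) set set \<Rightarrow> (complex set \<Rightarrow> real set) \<Rightarrow> (real^2^2) set set" where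
  "cover_group \<Gamma>\<^sub>0 f = kernel (PSL2R\<lparr>carrier := \<Gamma>\<^sub>0\<rparr>) integer_group (induced_hom \<Gamma>\<^sub>0 f)"


section \<open>Tight maps and the distance minimizing lamination\<close>

definition lipschitz_const ::
    "(complex set \<Rightarrow> real set) \<Rightarrow> complex set set \<Rightarrow> ereal" where
  "lipschitz_const f S =
     (INF L\<in>{L. 0 \<le> L \<and> (\<forall>p\<in>S. \<forall>q\<in>S. setdist (f p) (f q) \<le> L * surface_dist p q)}. ereal L)"

definition local_lipschitz_const ::
    "(real^2^2) set set \<Rightarrow> (complex set \<Rightarrow> real set) \<Rightarrow> complex set \<Rightarrow> ereal" where
  "local_lipschitz_const \<Gamma>\<^sub>0 f p =
     (INF r\<in>{0<..}. lipschitz_const f {q \<in> surface \<Gamma>\<^sub>0. surface_dist p q < r})"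

definition curve_length :: "(real \<Rightarrow> complex set) \<Rightarrow> ereal" where
  "curve_length c = (SUP ts\<in>{ts. sorted ts \<and> set ts \<subseteq> {0..1}}.
     ereal (\<Sum>i<length ts - 1. surface_dist (c (ts ! i)) (c (ts ! Suc i))))"

definition closed_curve :: "(real^2^2) set set \<Rightarrow> (real \<Rightarrow> complex set) \<Rightarrow> bool" where
  "closed_curve \<Gamma>\<^sub>0 c \<longleftrightarrow>
     continuous_map (top_of_set {0..1}) (surface_topology \<Gamma>\<^sub>0) c \<and> c 0 = c 1"

text \<open>Curves of infinite length contribute the value \<open>0\<close>; constant curves are excluded.\<close>

definition tight :: "(real^2^2) set set \<Rightarrow> (complex set \<Rightarrow> real set) \<Rightarrow> bool" where
  "tight \<Gamma>\<^sub>0 f \<longleftrightarrow>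
     lipschitz_const f (surface \<Gamma>\<^sub>0) =
       (SUP c\<in>{c. closed_curve \<Gamma>\<^sub>0 c \<and> curve_length c > 0}.
          ereal (of_int (circle_degree (f \<circ> c))) / curve_length c)"

definition stretch_set ::
    "(real^2^2) set set \<Rightarrow> (complex set \<Rightarrow> real set) \<Rightarrow> complex set set" where
  "stretch_set \<Gamma>\<^sub>0 f =
     {p \<in> surface \<Gamma>\<^sub>0. local_lipschitz_const \<Gamma>\<^sub>0 f p = lipschitz_const f (surface \<Gamma>\<^sub>0)}"

definition minimizing_lamination ::
    "(real^2^2) set set \<Rightarrow> (complex set \<Rightarrow> real set) \<Rightarrow> complex set set" where
  "minimizing_lamination \<Gamma>\<^sub>0 f =
     surface \<Gamma>\<^sub>0 \<inter> (\<Inter>g\<in>{g \<in> homotopy_class_of \<Gamma>\<^sub>0 f. tight \<Gamma>\<^sub>0 g}. stretch_set \<Gamma>\<^sub>0 g)"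

text \<open>
  The covering map sends a point of the cover, which is an orbit of the smaller group, to the
  orbit of \<open>\<Gamma>\<^sub>0\<close> that contains it.
\<close>

definition lifted_lamination ::
    "(real^2^2) set set \<Rightarrow> (complex set \<Rightarrow> real set) \<Rightarrow> complex set set" where
  "lifted_lamination \<Gamma>\<^sub>0 f =
     {p \<in> surface (cover_group \<Gamma>\<^sub>0 f). \<exists>q\<in>minimizing_lamination \<Gamma>\<^sub>0 f. p \<subseteq> q}"


section \<open>Laminations and weak components\<close>

text \<open>
  A complete geodesic of the surface is the projection of an isometric embedding of \<open>\<real>\<close> in the
  hyperbolic plane; it is simple if it is injective or a simple closed curve.
\<close>

definition simple_geodesic :: "(real^2^2) set set \<Rightarrow> complex set set \<Rightarrow> bool" where
  "simple_geodesic \<Gamma> l \<longleftrightarrow>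
     (\<exists>\<sigma>. range \<sigma> \<subseteq> upper_half_plane \<and> (\<forall>s t. hdist (\<sigma> s) (\<sigma> t) = \<bar>s - t\<bar>) \<and>
        l = range (surface_proj \<Gamma> \<circ> \<sigma>) \<and>
        (inj (surface_proj \<Gamma> \<circ> \<sigma>) \<or>
         (\<exists>T>0. (\<forall>t. surface_proj \<Gamma> (\<sigma> (t + T)) = surface_proj \<Gamma> (\<sigma> t)) \<and>
                inj_on (surface_proj \<Gamma> \<circ> \<sigma>) {0..<T})))"

definition geodesic_lamination :: "(real^2^2) set set \<Rightarrow> complex set set \<Rightarrow> bool" where
  "geodesic_lamination \<Gamma> \<mu> \<longleftrightarrow>
     closedin (surface_topology \<Gamma>) \<mu> \<and>
     (\<exists>L. (\<forall>l\<in>L. simple_geodesic \<Gamma> l) \<and> disjoint L \<and> \<mu> = \<Union>L)"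

definition nbhd :: "(real^2^2) set set \<Rightarrow> complex set set \<Rightarrow> real \<Rightarrow> complex set set" where
  "nbhd \<Gamma> \<mu> \<epsilon> = {p \<in> surface \<Gamma>. \<exists>q\<in>\<mu>. surface_dist p q < \<epsilon>}"

definition weakly_connected_sublamination ::
    "(real^2^2) set set \<Rightarrow> complex set set \<Rightarrow> complex set set \<Rightarrow> bool" where
  "weakly_connected_sublamination \<Gamma> \<Lambda> \<mu> \<longleftrightarrow>
     geodesic_lamination \<Gamma> \<mu> \<and> \<mu> \<subseteq> \<Lambda> \<and> \<mu> \<noteq> {} \<and>
     (\<forall>\<epsilon>>0. connectedin (surface_topology \<Gamma>) (nbhd \<Gamma> \<mu> \<epsilon>))"

definition weak_components ::
    "(real^2^2) set set \<Rightarrow> complex set set \<Rightarrow> complex set set set" where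
  "weak_components \<Gamma> \<Lambda> =
     {\<mu>. weakly_connected_sublamination \<Gamma> \<Lambda> \<mu> \<and>
         (\<forall>\<nu>. weakly_connected_sublamination \<Gamma> \<Lambda> \<nu> \<and> \<mu> \<subseteq> \<nu> \<longrightarrow> \<nu> = \<mu>)}"

end

theory Submission
  imports Defs
begin

text \<open>
  A horocycle orbit in \<open>G/\<Gamma>\<close> is recorded by the first row \<open>v\<close> of a representing matrix, so orbit closures
  correspond to closures of \<open>\<Gamma>\<close>-orbits of nonzero vectors and the geodesic flow acts by positive scaling.
  Scale the lifts \<open>u\<close> of the tight maps to be 1-Lipschitz. As in weak KAM theory, the preimage of the
  lamination is the Aubry set of this family, and its chain classes are the weak components; they are
  finitely many because thin gaps between leaves of different classes cannot accumulate.

  If the \<open>\<Gamma>\<close>-orbit of \<open>v\<close> accumulates at \<open>0\<close>, it is dense, by Hedlund's argument with hyperbolic elements.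
  Otherwise the ray to the base point of the horocycle climbs \<open>u\<close> or \<open>- u\<close> at unit speed up to a bounded
  error and is attracted by one class. The class and the infimum of \<open>u\<close> plus the horofunction
  determine the orbit closure, and scaling shifts the infimum arbitrarily. This leaves one
  closure for each class and each sign, and the dense one.
\<close>

section \<open>The upper half-plane and horofunctions\<close>

text \<open>The obstacle is that a horofunction can be made invariant only under \<open>Gam\<close>,
  not equivariant under the cocompact group \<open>G\<close>. The resulting function
  \<open>Uf v\<close> stays at bounded distance from \<open>u\<close>, and the excess
  \<open>u - Uf v\<close> is what tells orbit closures apart: it is bounded below by
  \<open>lev u v\<close> and takes this value on the class that attracts the ray. For this the
  excess has to be constant on a chain class, although the leaves of one class are linked only by
  chains of arbitrarily small jumps. Along a leaf, constancy comes from recurrence and a pigeonhole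
  argument that replaces equivariance. Across leaves the argument is of Sard type: exchanging the
  ends of two leaves bounds the difference of their excesses by the square of their distance; a
  transversal is one-dimensional, so the excess omits values in every interval, and a chain of small
  jumps cannot pass an omitted value. The second sign is the same theory applied to
  \<open>- phi\<close>.\<close>

definition mk :: "real \<Rightarrow> real \<Rightarrow> real \<Rightarrow> real \<Rightarrow> real^2^2" where
 "mk a b c d = vector [vector [a, b], vector [c, d]]"

lemma mk_nth [simp]:
 "mk a b c d $ 1 $ 1 = a" "mk a b c d $ 1 $ 2 = b" "mk a b c d $ 2 $ 1 = c" "mk a b c d $ 2 $ 2 = d"
 by (simp_all add: mk_def)

lemma mat2_eq_iff: "A = B \<longleftrightarrow> A$1$1 = B$1$1 \<and> A$1$2 = B$1$2 \<and> A$2$1 = B$2$1 \<and> A$2$2 = B$2$2"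
 for A B :: "real^2^2"
 by (auto simp: vec_eq_iff forall_2)

lemma mk_eq_iff [simp]: "mk a b c d = mk a' b' c' d' \<longleftrightarrow> a = a' \<and> b = b' \<and> c = c' \<and> d = d'"
 by (simp add: mat2_eq_iff)

lemma mk_collapse: "mk (A$1$1) (A$1$2) (A$2$1) (A$2$2) = A"
 by (simp add: mat2_eq_iff)

lemma mk_cases: obtains a b c d where "A = mk a b c d"
 using mk_collapse[of A] by metis

lemma mk_mult [simp]:
 "mk a b c d ** mk a' b' c' d' = mk (a*a' + b*c') (a*b' + b*d') (c*a' + d*c') (c*b' + d*d')"
 by (simp add: mat2_eq_iff matrix_matrix_mult_def sum_2)

lemma mat_one_mk: "mat 1 = mk 1 0 0 1"
 by (simp add: mat2_eq_iff mat_def)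

lemma uminus_mk [simp]: "- mk a b c d = mk (-a) (-b) (-c) (-d)"
 by (simp add: mat2_eq_iff)

lemma det_mk [simp]: "det (mk a b c d) = a*d - b*c"
 by (simp add: det_2)

text \<open>The adjugate is the inverse on determinant one, but polynomial in the entries, so that
  continuity and \<open>adj_mult\<close> hold without side conditions.\<close>

definition adj :: "real^2^2 \<Rightarrow> real^2^2" where
 "adj A = mk (A$2$2) (- A$1$2) (- A$2$1) (A$1$1)"

lemma adj_mk [simp]: "adj (mk a b c d) = mk d (-b) (-c) a"
 by (simp add: adj_def)

lemma det_adj [simp]: "det (adj A) = det A"
 by (cases A rule: mk_cases) (simp add: mult.commute)

lemma adj_adj [simp]: "adj (adj A) = A"
 by (cases A rule: mk_cases) simp

lemma adj_mult: "adj (A ** B) = adj B ** adj A"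
 by (cases A rule: mk_cases; cases B rule: mk_cases) (simp add: algebra_simps)

lemma adj_left: "det A = 1 ==> adj A ** A = mat 1"
 by (cases A rule: mk_cases) (simp add: mat_one_mk algebra_simps)

lemma adj_right: "det A = 1 ==> A ** adj A = mat 1"
 by (cases A rule: mk_cases) (simp add: mat_one_mk algebra_simps)

lemma adj_cancel: "det A = 1 ==> adj A ** (A ** B) = B" "det A = 1 ==> A ** (adj A ** B) = B"
 by (simp_all add: matrix_mul_assoc adj_left adj_right)

lemma det_mult1: "det A = 1 ==> det B = 1 ==> det (A ** B) = 1" for A B :: "real^2^2"
 by (simp add: det_mul)

section \<open>Moebius transformations of the upper half-plane\<close>

definition act :: "real^2^2 \<Rightarrow> complex \<Rightarrow> complex" where
 "act A z = (of_real (A$1$1) * z + of_real (A$1$2)) / (of_real (A$2$1) * z + of_real (A$2$2))"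

lemma psl_act_eq_act: "psl_act (psl A) z = act A z"
 by (simp add: psl_act_psl act_def moebius_def)

abbreviation UH :: "complex set" where "UH \<equiv> upper_half_plane"

lemma UH_iff: "z \<in> UH \<longleftrightarrow> Im z > 0"
 by (simp add: upper_half_plane_def)

lemma act_denom:
 fixes A :: "real^2^2"
 assumes "det A = 1" "Im z > 0"
 shows "of_real (A$2$1) * z + of_real (A$2$2) \<noteq> (0::complex)"
proof
 assume "of_real (A$2$1) * z + of_real (A$2$2) = (0::complex)"
 hence "Im (of_real (A$2$1) * z + of_real (A$2$2)) = 0" "Re (of_real (A$2$1) * z + of_real (A$2$2)) = 0"
  by simp_all
 thus False using assms by (auto simp: det_2)
qed

lemma Im_act:
 assumes "det A = 1" "Im z > 0"
 shows "Im (act A z) = Im z / (cmod (of_real (A$2$1) * z + of_real (A$2$2)))\<^sup>2"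
proof -
 let ?n = "of_real (A$1$1) * z + of_real (A$1$2)" and ?d = "of_real (A$2$1) * z + of_real (A$2$2)"
 have "Im (?n / ?d) = Im (?n * cnj ?d) / (cmod ?d)\<^sup>2"
  by (simp add: complex_div_cnj[of ?n] Im_divide_of_real flip: of_real_power)
 also have "Im (?n * cnj ?d) = det A * Im z"
  by (simp add: det_2 algebra_simps)
 finally show ?thesis using assms by (simp add: act_def)
qed

lemma act_UH: "det A = 1 ==> z \<in> UH ==> act A z \<in> UH"
 using act_denom by (auto simp: UH_iff Im_act intro!: divide_pos_pos)

lemma act_mult:
 assumes "det A = 1" "det B = 1" "z \<in> UH"
 shows "act (A ** B) z = act A (act B z)"
proof -
 have 1: "of_real (B$2$1) * z + of_real (B$2$2) \<noteq> (0::complex)"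
  using act_denom assms by (auto simp: UH_iff)
 have 2: "of_real ((A**B)$2$1) * z + of_real ((A**B)$2$2) \<noteq> (0::complex)"
  using act_denom[OF det_mult1[OF assms(1,2)]] assms by (auto simp: UH_iff)
 let ?n = "of_real (B$1$1) * z + of_real (B$1$2)" and ?d = "of_real (B$2$1) * z + of_real (B$2$2)"
 have gen: "(a * (n/d) + b) / (c * (n/d) + e) = (a*n + b*d) / (c*n + e*d)" if "d \<noteq> 0" for a b c d e n :: complex
 proof -
  have "a * (n/d) + b = (a*n + b*d)/d" "c * (n/d) + e = (c*n + e*d)/d" using that by (simp_all add: field_simps)
  thus ?thesis using that by simp
 qed
 have "act A (act B z) = (of_real (A$1$1) * ?n + of_real (A$1$2) * ?d) / (of_real (A$2$1) * ?n + of_real (A$2$2) * ?d)"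
  unfolding act_def by (rule gen[OF 1])
 also have "\<dots> = act (A ** B) z"
  by (simp add: act_def matrix_matrix_mult_def sum_2 algebra_simps)
 finally show ?thesis by simp
qed

lemma act_one [simp]: "act (mat 1) z = z"
 by (simp add: act_def mat_one_mk)

lemma act_uminus [simp]: "act (- A) z = act A z"
proof -
 have "act (- A) z = (- (of_real (A$1$1) * z + of_real (A$1$2))) / (- (of_real (A$2$1) * z + of_real (A$2$2)))"
  by (simp add: act_def)
 thus ?thesis by (simp only: minus_divide_divide act_def)
qed

lemma act_adj: "det A = 1 ==> z \<in> UH ==> act (adj A) (act A z) = z"
 "det A = 1 ==> z \<in> UH ==> act A (act (adj A) z) = z"
 by (simp_all flip: act_mult add: adj_left adj_right)

section \<open>Frames and unit speed geodesics\<close>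

definition dg :: "real \<Rightarrow> real^2^2" where
 "dg t = mk (exp (t/2)) 0 0 (exp (- t/2))"

lemma det_dg [simp]: "det (dg t) = 1"
 by (simp add: dg_def flip: exp_add)

lemma dg_add: "dg s ** dg t = dg (s + t)"
 by (simp add: dg_def add_divide_distrib flip: exp_add)

lemma dg_zero [simp]: "dg 0 = mat 1"
 by (simp add: dg_def mat_one_mk)

lemma adj_dg [simp]: "adj (dg t) = dg (- t)"
 by (simp add: dg_def)

text \<open>A matrix of determinant one is read as a frame with base point \<open>pt g\<close>.
  Right multiplication by \<open>dg t\<close> is the geodesic flow, left multiplication acts by
  isometries, and the two commute.\<close>

definition pt :: "real^2^2 \<Rightarrow> complex" where "pt g = act g \<i>"

abbreviation "geo g t \<equiv> pt (g ** dg t)"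

lemma i_UH [simp]: "\<i> \<in> UH" by (simp add: UH_iff)

lemma pt_UH [simp]: "det g = 1 ==> pt g \<in> UH"
 by (simp add: pt_def act_UH)

lemma act_pt: "det A = 1 ==> det g = 1 ==> act A (pt g) = pt (A ** g)"
 by (simp add: pt_def act_mult)

lemma pt_uminus [simp]: "pt (- g) = pt g"
 by (simp add: pt_def)

lemma pt_one [simp]: "pt (mat 1) = \<i>"
 by (simp add: pt_def)

lemma pt_dg: "pt (dg t) = \<i> * of_real (exp t)"
proof -
 have "exp (t/2) / exp (-(t/2)) = exp t" by (simp flip: exp_diff)
 hence "complex_of_real (exp (t/2)) / of_real (exp (-(t/2))) = of_real (exp t)"
  by (simp only: flip: of_real_divide)
 thus ?thesis by (simp add: pt_def act_def dg_def mult.commute flip: times_divide_eq_right)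
qed

lemma pt_mk:
 assumes "a*d - b*c = 1"
 shows "pt (mk a b c d) = Complex ((a*c + b*d) / (c\<^sup>2 + d\<^sup>2)) (1 / (c\<^sup>2 + d\<^sup>2))"
proof -
 have nz: "c\<^sup>2 + d\<^sup>2 \<noteq> 0" using assms by (auto simp: sum_power2_eq_zero_iff)
 have "pt (mk a b c d) = (of_real a * \<i> + of_real b) / (of_real c * \<i> + of_real d)"
  by (simp add: pt_def act_def)
 also have "\<dots> = Complex ((a*c + b*d) / (c\<^sup>2 + d\<^sup>2)) (1 / (c\<^sup>2 + d\<^sup>2))"
  using assms nz by (simp add: complex_eq_iff Re_divide Im_divide power2_eq_square algebra_simps)
 finally show ?thesis .
qed

lemma ex_frame: assumes "z \<in> UH" obtains g where "det g = 1" "pt g = z"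
proof -
 let ?y = "sqrt (Im z)"
 have y: "?y > 0" "?y\<^sup>2 = Im z" using assms by (auto simp: UH_iff)
 let ?g = "mk ?y (Re z / ?y) 0 (1 / ?y)"
 have 1: "?y * (1 / ?y) - Re z / ?y * 0 = 1" using y by simp
 have "pt ?g = z" using y by (simp add: pt_mk[OF 1] complex_eq_iff field_simps power2_eq_square)
 moreover have "det ?g = 1" using y by simp
 ultimately show ?thesis using that by blast
qed

section \<open>The hyperbolic distance\<close>

definition cd :: "complex \<Rightarrow> complex \<Rightarrow> real" where
 "cd z w = 1 + (cmod (z - w))\<^sup>2 / (2 * Im z * Im w)"

lemma hdist_cd: "hdist z w = arcosh (cd z w)"
 by (simp add: hdist_def cd_def)

lemma cd_ge1: "z \<in> UH ==> w \<in> UH ==> cd z w \<ge> 1"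
 by (simp add: cd_def UH_iff)

lemma hdist_nonneg [simp]: "z \<in> UH ==> w \<in> UH ==> hdist z w \<ge> 0"
 by (simp add: hdist_cd cd_ge1 arcosh_nonneg_real)

lemma cosh_hdist: "z \<in> UH ==> w \<in> UH ==> cosh (hdist z w) = cd z w"
 by (simp add: hdist_cd cosh_arcosh_real cd_ge1)

lemma hdist_commute: "hdist z w = hdist w z"
 by (simp add: hdist_def norm_minus_commute mult.commute mult.left_commute)

lemma hdist_self [simp]: "hdist z z = 0"
 by (simp add: hdist_def)

lemma hdist_eqI: "z \<in> UH ==> w \<in> UH ==> t \<ge> 0 ==> cosh t = cd z w ==> hdist z w = t"
 by (metis arcosh_cosh_real hdist_cd)

lemma hdist_zero_iff: "z \<in> UH ==> w \<in> UH ==> hdist z w = 0 \<longleftrightarrow> z = w"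
 using cosh_hdist[of z w] by (auto simp: cd_def UH_iff)

lemma cd_act:
 assumes "det A = 1" "z \<in> UH" "w \<in> UH"
 shows "cd (act A z) (act A w) = cd z w"
proof -
 let ?p = "of_real (A$2$1) * z + of_real (A$2$2)" and ?q = "of_real (A$2$1) * w + of_real (A$2$2) :: complex"
 have p: "?p \<noteq> 0" "?q \<noteq> 0" using act_denom assms by (auto simp: UH_iff)
 have d: "complex_of_real (A$1$1) * of_real (A$2$2) - of_real (A$1$2) * of_real (A$2$1) = 1"
  using assms(1) by (simp add: det_2 flip: of_real_mult of_real_diff)
 have "act A z - act A w = (complex_of_real (A$1$1) * of_real (A$2$2) - of_real (A$1$2) * of_real (A$2$1)) * (z - w) / (?p * ?q)"
  using p by (simp add: act_def field_simps)
 hence "act A z - act A w = (z - w) / (?p * ?q)" using d by simp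
 hence "(cmod (act A z - act A w))\<^sup>2 = (cmod (z - w))\<^sup>2 / ((cmod ?p)\<^sup>2 * (cmod ?q)\<^sup>2)"
  by (simp add: norm_divide norm_mult power_divide power_mult_distrib)
 moreover have "Im (act A z) = Im z / (cmod ?p)\<^sup>2" "Im (act A w) = Im w / (cmod ?q)\<^sup>2"
  using assms by (auto simp: Im_act UH_iff)
 ultimately show ?thesis using p assms by (simp add: cd_def UH_iff)
qed

lemma hdist_act: "det A = 1 ==> z \<in> UH ==> w \<in> UH ==> hdist (act A z) (act A w) = hdist z w"
 by (simp add: hdist_cd cd_act)

text \<open>The squared Hilbert-Schmidt norm. By \<open>cd_i_pt\<close> half of it is
  \<open>cosh\<close> of the distance from i to \<open>pt A\<close>, so matrix norms and
  displacements control each other.\<close>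

definition nsq :: "real^2^2 \<Rightarrow> real" where
 "nsq A = (A$1$1)\<^sup>2 + (A$1$2)\<^sup>2 + (A$2$1)\<^sup>2 + (A$2$2)\<^sup>2"

lemma nsq_mk [simp]: "nsq (mk a b c d) = a\<^sup>2 + b\<^sup>2 + c\<^sup>2 + d\<^sup>2"
 by (simp add: nsq_def)

lemma nsq_norm: "nsq A = (norm A)\<^sup>2"
 by (simp add: nsq_def norm_vec_def L2_set_def sum_2 sum_nonneg)

lemma cd_i_pt:
 assumes "det g = 1"
 shows "cd \<i> (pt g) = nsq g / 2"
proof (cases g rule: mk_cases)
 case (1 a b c d)
 have det: "a*d - b*c = 1" using assms 1 by simp
 have nz: "c\<^sup>2 + d\<^sup>2 > 0" using det
  by (metis add_nonneg_nonneg less_eq_real_def mult_zero_left mult_zero_right diff_zero sum_power2_eq_zero_iff zero_le_power2 zero_neq_one)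
 let ?n = "c\<^sup>2 + d\<^sup>2"
 have key: "(a*c+b*d)\<^sup>2 + 1 = (a\<^sup>2+b\<^sup>2) * ?n"
 proof -
  have "(a*c+b*d)\<^sup>2 + (a*d - b*c)\<^sup>2 = (a\<^sup>2+b\<^sup>2) * ?n"
   by (simp add: power2_eq_square algebra_simps)
  thus ?thesis using det by simp
 qed
 have "(cmod (\<i> - pt g))\<^sup>2 = ((a*c+b*d)/?n)\<^sup>2 + (1 - 1/?n)\<^sup>2"
  using pt_mk[OF det] 1 by (simp add: cmod_power2)
 hence "cd \<i> (pt g) = 1 + (((a*c+b*d)/?n)\<^sup>2 + (1 - 1/?n)\<^sup>2) / (2 / ?n)"
  using pt_mk[OF det] 1 by (simp add: cd_def)
 also have "\<dots> = 1 + (((a*c+b*d)\<^sup>2 + 1) + ?n\<^sup>2 - 2 * ?n) / (2 * ?n)"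
 proof -
  have "1 + ((P/n)\<^sup>2 + (1 - 1/n)\<^sup>2) / (2 / n) = 1 + ((P\<^sup>2 + 1) + n\<^sup>2 - 2 * n) / (2 * n)" if "n > 0" for P n :: real
   using that by (simp add: field_simps power2_eq_square)
  from this[OF nz] show ?thesis .
 qed
 also have "\<dots> = (a\<^sup>2 + b\<^sup>2 + ?n) / 2"
 proof -
  have "1 + (Q * n + n\<^sup>2 - 2 * n) / (2 * n) = (Q + n) / 2" if "n > 0" for Q n :: real
   using that by (simp add: field_simps power2_eq_square)
  from this[OF nz] show ?thesis unfolding key .
 qed
 finally show ?thesis using 1 by simp
qed

lemma cd_pt:
 assumes "det g = 1" "det h = 1"
 shows "cd (pt g) (pt h) = nsq (adj g ** h) / 2"
proof -
 have "cd (pt g) (pt h) = cd (act (adj g) (pt g)) (act (adj g) (pt h))"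
  using assms by (simp add: cd_act)
 also have "\<dots> = cd \<i> (pt (adj g ** h))"
  using assms by (simp add: act_pt adj_left)
 finally show ?thesis using assms by (simp add: cd_i_pt det_mult1)
qed

lemma cosh_hdist_pt: "det g = 1 ==> det h = 1 ==> cosh (hdist (pt g) (pt h)) = nsq (adj g ** h) / 2"
 by (simp add: cosh_hdist cd_pt)

lemma nsq_dg_mk_dg:
 "nsq (dg s ** mk a b c d ** dg t) = a\<^sup>2 * exp (s+t) + b\<^sup>2 * exp (s-t) + c\<^sup>2 * exp (t-s) + d\<^sup>2 * exp (-s-t)"
proof -
 have e: "(exp (x/2) * a * exp (y/2))\<^sup>2 = a\<^sup>2 * exp (x + y)" for x y a :: real
 proof -
  have "(exp (x/2) * exp (y/2))\<^sup>2 = exp (x + y)"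
   by (simp add: exp_add [symmetric] exp_double [symmetric] field_simps)
  thus ?thesis by (simp add: power_mult_distrib mult_ac)
 qed
 show ?thesis
  using e[of s a t] e[of s b "-t"] e[of "-s" c t] e[of "-s" d "-t"]
  by (simp add: dg_def)
qed

text \<open>The relative position of two geodesics is the matrix \<open>adj g ** h\<close>, and the
  flow multiplies its four entries by exponentials. Later estimates on pairs of rays or leaves read
  off these coefficients.\<close>

lemma cosh_hdist_geo:
 assumes "det g = 1" "det h = 1" "adj g ** h = mk a b c d"
 shows "cosh (hdist (geo g s) (geo h t)) =
  (a\<^sup>2 * exp (t-s) + b\<^sup>2 * exp (-s-t) + c\<^sup>2 * exp (s+t) + d\<^sup>2 * exp (s-t)) / 2"
proof -
 have "adj (g ** dg s) ** (h ** dg t) = dg (-s) ** mk a b c d ** dg t"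
  by (simp add: adj_mult matrix_mul_assoc flip: assms(3))
 thus ?thesis using assms
  by (simp add: cosh_hdist_pt det_mult1 nsq_dg_mk_dg)
qed

lemma hdist_geo: assumes "det g = 1" shows "hdist (geo g s) (geo g t) = \<bar>s - t\<bar>"
proof (rule hdist_eqI)
 have "adj g ** g = mk 1 0 0 1" using adj_left[OF assms] by (simp add: mat_one_mk)
 from cosh_hdist_geo[OF assms assms this, of s t]
 show "cosh \<bar>s - t\<bar> = cd (geo g s) (geo g t)"
  using assms by (simp add: cosh_hdist det_mult1) (simp add: cosh_def abs_if)
qed (use assms in \<open>simp_all add: det_mult1\<close>)

definition rot :: "real \<Rightarrow> real^2^2" where
 "rot tht = mk (cos tht) (sin tht) (- sin tht) (cos tht)"

lemma det_rot [simp]: "det (rot tht) = 1"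
 by (simp add: rot_def flip: power2_eq_square)

lemma pt_rot [simp]: "pt (rot tht) = \<i>"
proof -
 have 1: "cos tht * cos tht - sin tht * (- sin tht) = 1" by (simp flip: power2_eq_square)
 show ?thesis unfolding rot_def by (simp add: pt_mk[OF 1] complex_eq_iff)
qed

text \<open>Move the first point to i and rotate about i. Increasing the angle of \<open>rot\<close>
  by \<open>pi/2\<close> is a half-turn, which reverses the sign of the real part, so the second
  point meets the imaginary axis for some angle; if it lies below i there, one more half-turn puts
  it above.\<close>

lemma pair_frame:
 assumes "z \<in> UH" "w \<in> UH"
 obtains g where "det g = 1" "pt g = z" "geo g (hdist z w) = w"
proof -
 obtain h where h: "det h = 1" "pt h = z" using ex_frame assms by blast
 define w' where "w' = act (adj h) w"
 have w': "w' \<in> UH" using h assms by (simp add: w'_def act_UH)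
 define f where "f tht = Re (act (rot tht) w')" for tht
 have den: "of_real (- sin tht) * w' + of_real (cos tht) \<noteq> (0::complex)" for tht
  using act_denom[OF det_rot[of tht], of w'] w' by (simp add: rot_def UH_iff)
 have cont: "continuous_on {0..pi/2} f"
  unfolding f_def act_def rot_def mk_nth
  using den by (intro continuous_intros) auto
 have quart: "act (rot (tht + pi/2)) w' = - 1 / act (rot tht) w'" for tht
 proof -
  have n: "act (rot tht) w' \<noteq> 0" using act_UH[OF det_rot w', of tht] by (auto simp: UH_iff)
  have sc: "sin (tht + pi/2) = cos tht" "cos (tht + pi/2) = - sin tht" by (simp_all add: sin_add cos_add)
  show ?thesis using den[of tht] den[of "tht + pi/2"] n
   unfolding act_def rot_def mk_nth sc by (simp add: divide_simps) (simp add: algebra_simps)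
 qed
 have Re_inv: "Re (- 1 / x) = - Re x / (cmod x)\<^sup>2" for x
  by (simp add: Re_divide cmod_power2)
 have "\<exists>tht. f tht = 0"
 proof -
  have "f (pi/2) = - f 0 / (cmod (act (rot 0) w'))\<^sup>2"
   using quart[of 0] Re_inv by (simp add: f_def)
  hence "f 0 \<le> 0 \<and> 0 \<le> f (pi/2) \<or> f (pi/2) \<le> 0 \<and> 0 \<le> f 0"
   by (smt (verit) divide_nonneg_nonneg divide_nonpos_nonneg zero_le_power2)
  thus ?thesis
   using IVT'[of f 0 0 "pi/2", OF _ _ _ cont] IVT2'[of f "pi/2" 0 0, OF _ _ _ cont]
   by auto
 qed
 then obtain tht0 where t0: "f tht0 = 0" by blast
 obtain tht where th: "Re (act (rot tht) w') = 0" "Im (act (rot tht) w') \<ge> 1"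
 proof (cases "Im (act (rot tht0) w') \<ge> 1")
  case True thus ?thesis using that t0 by (auto simp: f_def)
 next
  case False
  let ?x = "act (rot tht0) w'"
  have x: "Re ?x = 0" "Im ?x > 0" using t0 act_UH[OF det_rot w', of tht0] by (auto simp: f_def UH_iff)
  have "Re (- 1 / ?x) = 0" "Im (- 1 / ?x) = 1 / Im ?x" using x
   by (simp_all add: Re_divide Im_divide power2_eq_square)
  thus ?thesis using that[of "tht0 + pi/2"] quart[of tht0] False x by simp
 qed
 define D where "D = ln (Im (act (rot tht) w'))"
 have D: "D \<ge> 0" "act (rot tht) w' = pt (dg D)" using th
  by (simp_all add: D_def pt_dg complex_eq_iff)
 define g where "g = h ** adj (rot tht)"
 have g: "det g = 1" using h by (simp add: g_def det_mult1)
 have gp: "pt g = z"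
 proof -
  have "adj (rot tht) = rot (-tht)" by (simp add: rot_def)
  hence "pt g = act h (pt (rot (-tht)))" using h by (simp only: g_def act_pt det_rot)
  thus ?thesis using h by (simp only: pt_rot) (simp add: pt_def)
 qed
 have "geo g D = act h (act (adj (rot tht)) (pt (dg D)))"
  using h by (simp add: g_def act_pt matrix_mul_assoc det_mult1)
 also have "\<dots> = w" using D(2) w' h assms by (simp add: act_adj w'_def flip: D(2))
 finally have gw: "geo g D = w" .
 have "hdist z w = D"
  using hdist_geo[OF g, of 0 D] gp gw D by simp
 thus ?thesis using that g gp gw by blast
qed

section \<open>Busemann functions and rays to a boundary point\<close>

definition horo :: "real^2 \<Rightarrow> complex \<Rightarrow> real" where
 "horo v z = ln ((cmod (of_real (v$1) * z + of_real (v$2)))\<^sup>2 / Im z)"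

lemma vec2_eq_iff: "v = w \<longleftrightarrow> v$1 = w$1 \<and> v$2 = w$2" for v w :: "real^2"
 by (auto simp: vec_eq_iff forall_2)

lemma vmult_nth [simp]:
 "(v v* A)$1 = v$1 * A$1$1 + v$2 * A$2$1" "(v v* A)$2 = v$1 * A$1$2 + v$2 * A$2$2"
 for A :: "real^2^2"
 by (simp_all add: vector_matrix_mult_def sum_2 mult.commute)

lemma vmult_assoc: "(v v* A) v* B = v v* (A ** B)" for A B :: "real^2^2"
 by (simp add: vec2_eq_iff matrix_matrix_mult_def sum_2 algebra_simps)

lemma vmult_one [simp]: "v v* mat 1 = v" for v :: "real^2"
 by (simp add: vec2_eq_iff mat_one_mk)

lemma vmult_uminus [simp]: "v v* (- A) = - (v v* A)" "(- v) v* A = - (v v* A)" for A :: "real^2^2"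
 by (simp_all add: vec2_eq_iff)

lemma vmult_scaleR: "(c *\<^sub>R v) v* A = c *\<^sub>R (v v* A)" for A :: "real^2^2"
 by (simp add: vec2_eq_iff algebra_simps)

lemma vmult_cancel: "det A = 1 ==> (v v* A) v* adj A = v" "det A = 1 ==> (v v* adj A) v* A = v" for A :: "real^2^2"
 by (simp_all add: vmult_assoc adj_left adj_right)

lemma vmult_zero [simp]: "0 v* A = 0" for A :: "real^2^2"
 by (simp add: vec2_eq_iff)

lemma vmult_nonzero: "det A = 1 ==> v \<noteq> 0 ==> v v* A \<noteq> 0" for A :: "real^2^2"
 by (metis vmult_cancel(1) vmult_zero)

text \<open>\<open>horo v\<close> is a Busemann function based at \<open>- v$2 / v$1\<close>.
  Indexing by row vectors instead of boundary points fixes the additive constant, and the isometries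
  then act by plain right multiplication on the index.\<close>

lemma horo_act:
 assumes "det A = 1" "z \<in> UH"
 shows "horo v (act A z) = horo (v v* A) z"
proof -
 let ?d = "of_real (A$2$1) * z + of_real (A$2$2)"
 have d: "?d \<noteq> 0" using act_denom assms by (auto simp: UH_iff)
 have "of_real (v$1) * act A z + of_real (v$2) = (of_real ((v v* A)$1) * z + of_real ((v v* A)$2)) / ?d"
  using d by (simp add: act_def field_simps)
 moreover have "Im (act A z) = Im z / (cmod ?d)\<^sup>2" using assms by (simp add: Im_act UH_iff)
 ultimately show ?thesis using d by (simp add: horo_def norm_divide power_divide)
qed

lemma norm_vec2: "(norm v)\<^sup>2 = (v$1)\<^sup>2 + (v$2)\<^sup>2" for v :: "real^2"
 by (simp add: norm_vec_def L2_set_def sum_2)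

lemma horo_pt:
 assumes "det g = 1"
 shows "horo v (pt g) = ln ((norm (v v* g))\<^sup>2)"
proof -
 have "horo w \<i> = ln ((norm w)\<^sup>2)" for w
  by (simp add: horo_def norm_vec2 cmod_power2 add.commute)
 thus ?thesis using assms horo_act[of g \<i> v] by (simp add: pt_def)
qed

lemma horo_geo:
 assumes "det g = 1"
 shows "horo v (geo g t) = ln (((v v* g)$1)\<^sup>2 * exp t + ((v v* g)$2)\<^sup>2 * exp (- t))"
proof -
 have "(norm (w v* dg t))\<^sup>2 = (w$1)\<^sup>2 * exp t + (w$2)\<^sup>2 * exp (- t)" for w :: "real^2"
  by (simp add: norm_vec2 dg_def power_mult_distrib flip: exp_double)
 thus ?thesis using assms by (simp add: horo_pt det_mult1 flip: vmult_assoc)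
qed

lemma horo_scaleR:
 assumes "c \<noteq> 0" "v \<noteq> 0" "z \<in> UH"
 shows "horo (c *\<^sub>R v) z = horo v z + ln (c\<^sup>2)"
proof -
 obtain g where g: "det g = 1" "pt g = z" using ex_frame assms by blast
 have "norm (v v* g) > 0" using vmult_nonzero assms g by simp
 thus ?thesis using assms g horo_pt[OF g(1)]
  by (simp add: vmult_scaleR power_mult_distrib ln_mult)
qed

lemma vec2_nonzero: "v \<noteq> 0 \<longleftrightarrow> (v$1)\<^sup>2 + (v$2)\<^sup>2 > 0" for v :: "real^2"
 by (metis norm_vec2 zero_less_norm_iff zero_less_power2 norm_eq_zero)

text \<open>Along the geodesic between the points the exponential of \<open>horo v\<close> is
  \<open>a * exp t + b * exp (- t)\<close> with nonnegative coefficients, so it shrinks at most by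
  the factor \<open>exp (- t)\<close>.\<close>

lemma horo_lipschitz:
 assumes "v \<noteq> 0" "z \<in> UH" "w \<in> UH"
 shows "horo v z - horo v w \<le> hdist z w"
proof -
 obtain g where g: "det g = 1" "pt g = z" "geo g (hdist z w) = w"
  using pair_frame assms by blast
 define D where "D = hdist z w"
 define a where "a = ((v v* g)$1)\<^sup>2"
 define b where "b = ((v v* g)$2)\<^sup>2"
 have ab: "a \<ge> 0" "b \<ge> 0" "a + b > 0"
  using vmult_nonzero[OF g(1) assms(1)] vec2_nonzero[of "v v* g"] by (auto simp: a_def b_def)
 have D: "D \<ge> 0" using assms by (simp add: D_def)
 have z: "horo v z = ln (a + b)" using horo_geo[OF g(1), of v 0] g by (simp add: a_def b_def)
 have w: "horo v w = ln (a * exp D + b * exp (- D))"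
  using horo_geo[OF g(1), of v D] g by (simp add: a_def b_def D_def)
 have "exp (-D) \<le> exp D" using D by simp
 hence le: "exp (-D) * (a + b) \<le> a * exp D + b * exp (- D)"
  using ab by (simp add: algebra_simps mult_left_mono)
 have "ln (a + b) - D = ln (exp (-D) * (a + b))" using ab by (simp add: ln_mult)
 also have "\<dots> \<le> ln (a * exp D + b * exp (- D))"
  using le ab by (smt (verit) exp_gt_zero ln_le_cancel_iff mult_pos_pos)
 finally show ?thesis using z w by (simp add: D_def)
qed

lemma vmult_surj: "det g = 1 ==> \<exists>v. v v* g = w" for g :: "real^2^2"
 using vmult_cancel(2) by blast

text \<open>The horofunction based at the forward endpoint of the joining geodesic drops at unit
  speed. Distance is therefore a maximum of differences of horofunctions, which is how the triangle
  inequality is obtained.\<close>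

lemma horo_attains:
 assumes "z \<in> UH" "w \<in> UH"
 shows "\<exists>v. v \<noteq> 0 \<and> horo v z - horo v w = hdist z w"
proof -
 obtain g where g: "det g = 1" "pt g = z" "geo g (hdist z w) = w"
  using pair_frame assms by blast
 obtain v :: "real^2" where v: "v v* g = vector [0, 1]" using vmult_surj g by blast
 hence "(v v* g)$2 = 1" "(v v* g)$1 = 0" by (simp_all del: vmult_nth)
 hence "horo v z = 0" "horo v w = - hdist z w" "v \<noteq> 0"
  using horo_geo[OF g(1), of v 0] horo_geo[OF g(1), of v "hdist z w"] g by (auto simp del: vmult_nth)
 thus ?thesis by auto
qed

lemma hdist_triangle:
 assumes "x \<in> UH" "y \<in> UH" "z \<in> UH"
 shows "hdist x z \<le> hdist x y + hdist y z"
proof -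
 obtain v where "v \<noteq> 0" "horo v x - horo v z = hdist x z" using horo_attains assms by blast
 thus ?thesis using horo_lipschitz[of v x y] horo_lipschitz[of v y z] assms by simp
qed

lemma vec2_rotate:
 fixes v :: "real^2"
 obtains tht where "(v v* rot tht)$1 = 0" "(v v* rot tht)$2 = norm v"
proof (cases "v = 0")
 case True thus ?thesis using that[of 0] by simp
next
 case False
 let ?r = "norm v"
 have r: "?r > 0" using False by simp
 have "(v$2 / ?r)\<^sup>2 + (v$1 / ?r)\<^sup>2 = ((v$1)\<^sup>2 + (v$2)\<^sup>2) / ?r\<^sup>2" by (simp add: power_divide add_divide_distrib)
 also have "\<dots> = 1" using r by (simp flip: norm_vec2)
 finally obtain t where t: "v$2 / ?r = cos t" "v$1 / ?r = sin t" using sincos_total_2pi by metis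
 hence e: "v$2 = ?r * cos t" "v$1 = ?r * sin t" using r by (simp_all add: field_simps)
 have "(v v* rot t)$1 = 0" by (simp add: rot_def) (simp add: e)
 have "(v v* rot t)$2 = ?r * ((sin t)\<^sup>2 + (cos t)\<^sup>2)"
  unfolding vmult_nth rot_def mk_nth e(1) e(2) by algebra
 also have "\<dots> = ?r" by (simp only: sin_cos_squared_add mult_1_right)
 finally have "(v v* rot t)$2 = ?r" .
 with \<open>(v v* rot t)$1 = 0\<close> show ?thesis using that by simp
qed

text \<open>The equation \<open>(v v* g)$1 = 0\<close> says that the geodesic of \<open>g\<close>
  ends at the base point of \<open>v\<close>. Rays to a base point are described in this form
  throughout.\<close>

lemma horo_ray:
 fixes v :: "real^2"
 assumes "z \<in> UH"
 obtains g r where "det g = 1" "pt g = z" "(v v* g)$1 = 0" "(v v* g)$2 = r" "r \<ge> 0"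
proof -
 obtain h where h: "det h = 1" "pt h = z" using ex_frame assms by blast
 obtain tht where t: "((v v* h) v* rot tht)$1 = 0" "((v v* h) v* rot tht)$2 = norm (v v* h)"
  using vec2_rotate by blast
 have "pt (h ** rot tht) = act h (pt (rot tht))" using h by (simp only: act_pt det_rot)
 also have "\<dots> = z" using h by (simp only: pt_rot) (simp add: pt_def)
 finally show ?thesis using that[of "h ** rot tht"] t h
  by (simp del: vmult_nth add: vmult_assoc det_mult1)
qed

lemma horo_ray_level:
 assumes "det g = 1" "v \<noteq> 0" "(v v* g)$1 = 0"
 shows "horo v (geo g t) = horo v (pt g) - t"
proof -
 have "(v v* g)$2 \<noteq> 0" using vmult_nonzero[OF assms(1,2)] assms(3) by (auto simp: vec2_eq_iff)
 thus ?thesis using horo_geo[OF assms(1), of v t] horo_geo[OF assms(1), of v 0] assms(3)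
  by (simp add: ln_mult del: vmult_nth)
qed

text \<open>Frames of two rays to one base point differ by an upper triangular matrix, and equal
  levels force diagonal entries of square one. The \<open>cosh\<close> of the distance at time
  \<open>t\<close> is then \<open>1 + b\<^sup>2 * exp (- 2 * t) / 2\<close>.\<close>

lemma horo_rays_asymptotic:
 assumes "det g = 1" "det h = 1" "v \<noteq> 0" "(v v* g)$1 = 0" "(v v* h)$1 = 0"
  and "horo v (pt g) = horo v (pt h)"
 shows "((\<lambda>t. hdist (geo g t) (geo h t)) \<longlongrightarrow> 0) at_top"
proof -
 obtain a b c d where k: "adj g ** h = mk a b c d" by (rule mk_cases)
 have det: "a*d - b*c = 1" using det_mult1[of "adj g" h] assms(1,2) k by simp
 have "h = g ** mk a b c d" using adj_cancel(2)[OF assms(1), of h] k by simp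
 hence vh: "v v* h = (v v* g) v* mk a b c d" by (simp add: vmult_assoc)
 let ?r = "(v v* g)$2"
 have r: "?r \<noteq> 0" using vmult_nonzero[OF assms(1,3)] assms(4) by (auto simp: vec2_eq_iff)
 have "(v v* h)$1 = ?r * c" "(v v* h)$2 = ?r * d" using vh assms(4) by (simp_all del: vmult_nth) (simp_all add: vmult_nth[of "v v* g"] del: vmult_nth)
 hence c: "c = 0" and d: "(v v* h)$2 = ?r * d" using assms(5) r by auto
 have ad: "a * d = 1" using det c by simp
 have "ln (?r\<^sup>2) = ln ((?r * d)\<^sup>2)"
  using assms(6) horo_geo[OF assms(1), of v 0] horo_geo[OF assms(2), of v 0] assms(4,5) d by (simp del: vmult_nth)
 hence "?r\<^sup>2 = (?r * d)\<^sup>2" using r ad by (subst (asm) ln_inj_iff) (auto simp del: vmult_nth)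
 hence d2: "d\<^sup>2 = 1" using r by (simp add: power_mult_distrib del: vmult_nth)
 hence a2: "a\<^sup>2 = 1" using ad by (metis mult_cancel_left2 power_mult_distrib power_one mult.commute)
 have "cosh (hdist (geo g t) (geo h t)) = 1 + b\<^sup>2 * exp (- 2 * t) / 2" for t
  using cosh_hdist_geo[OF assms(1,2) k, of t t] c a2 d2 by simp
 hence eq: "hdist (geo g t) (geo h t) = arcosh (1 + b\<^sup>2 * exp (- 2 * t) / 2)" for t
  using assms(1,2) by (metis arcosh_cosh_real det_dg det_mult1 hdist_nonneg pt_UH)
 have "((\<lambda>t. 1 + b\<^sup>2 * exp (- 2 * t) / 2) \<longlongrightarrow> 1 + b\<^sup>2 * 0 / 2) at_top"
  by (intro tendsto_intros filterlim_compose[OF exp_at_bot] filterlim_tendsto_neg_mult_at_bot[OF tendsto_const] filterlim_ident) auto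
 hence "((\<lambda>t. arcosh (1 + b\<^sup>2 * exp (- 2 * t) / 2)) \<longlongrightarrow> arcosh (1 + b\<^sup>2 * 0 / 2)) at_top"
  by (rule tendsto_arcosh_strong) (auto intro!: always_eventually)
 thus ?thesis by (simp add: eq)
qed

section \<open>Limits, compactness and balls\<close>

lemma tendsto_mat2:
 fixes f :: "'a \<Rightarrow> real^2^2"
 shows "(f \<longlongrightarrow> A) F \<longleftrightarrow> (\<forall>i j. ((\<lambda>x. f x $ i $ j) \<longlongrightarrow> A $ i $ j) F)"
 by (metis tendsto_vec_nth vec_tendstoI)

lemma tendsto_mmult [tendsto_intros]:
 fixes f g :: "'a \<Rightarrow> real^2^2"
 assumes "(f \<longlongrightarrow> A) F" "(g \<longlongrightarrow> B) F"
 shows "((\<lambda>x. f x ** g x) \<longlongrightarrow> A ** B) F"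
 unfolding tendsto_mat2 matrix_matrix_mult_def
 using assms by (auto simp: tendsto_mat2 intro!: tendsto_intros)

lemma tendsto_adj [tendsto_intros]:
 fixes f :: "'a \<Rightarrow> real^2^2"
 assumes "(f \<longlongrightarrow> A) F"
 shows "((\<lambda>x. adj (f x)) \<longlongrightarrow> adj A) F"
 using assms by (auto simp: tendsto_mat2 forall_2 adj_def intro!: tendsto_intros)

lemma tendsto_vmult [tendsto_intros]:
 fixes f :: "'a \<Rightarrow> real^2^2"
 assumes "(w \<longlongrightarrow> v) F" "(f \<longlongrightarrow> A) F"
 shows "((\<lambda>x. w x v* f x) \<longlongrightarrow> v v* A) F"
 by (rule vec_tendstoI) (use assms in \<open>auto simp: vector_matrix_mult_def tendsto_mat2 intro!: tendsto_intros tendsto_vec_nth\<close>)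

lemma tendsto_det2 [tendsto_intros]:
 fixes f :: "'a \<Rightarrow> real^2^2"
 assumes "(f \<longlongrightarrow> A) F"
 shows "((\<lambda>x. det (f x)) \<longlongrightarrow> det A) F"
 using assms by (auto simp: tendsto_mat2 det_2 intro!: tendsto_intros)

lemma tendsto_act:
 fixes f :: "'a \<Rightarrow> real^2^2"
 assumes "(f \<longlongrightarrow> A) F" "(g \<longlongrightarrow> z) F" "det A = 1" "z \<in> UH"
 shows "((\<lambda>x. act (f x) (g x)) \<longlongrightarrow> act A z) F"
 unfolding act_def using assms act_denom[OF assms(3), of z]
 by (auto simp: tendsto_mat2 UH_iff intro!: tendsto_intros)

lemma tendsto_pt:
 fixes f :: "'a \<Rightarrow> real^2^2"
 assumes "(f \<longlongrightarrow> A) F" "det A = 1"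
 shows "((\<lambda>x. pt (f x)) \<longlongrightarrow> pt A) F"
 unfolding pt_def using assms by (intro tendsto_act tendsto_const) auto

lemma tendsto_dg [tendsto_intros]:
 assumes "(f \<longlongrightarrow> t) F"
 shows "((\<lambda>x. dg (f x)) \<longlongrightarrow> dg t) F"
 unfolding tendsto_mat2 forall_2 dg_def using assms by (auto intro!: tendsto_intros)

lemma tendsto_hdist:
 assumes "(f \<longlongrightarrow> z) F" "(g \<longlongrightarrow> w) F" "z \<in> UH" "w \<in> UH"
 shows "((\<lambda>x. hdist (f x) (g x)) \<longlongrightarrow> hdist z w) F"
proof -
 have "\<forall>\<^sub>F x in F. Im (f x) > 0" "\<forall>\<^sub>F x in F. Im (g x) > 0"
  using order_tendstoD(1)[OF tendsto_Im[OF assms(1)], of 0] order_tendstoD(1)[OF tendsto_Im[OF assms(2)], of 0] assms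
  by (auto simp: UH_iff)
 hence "\<forall>\<^sub>F x in F. 1 + (cmod (f x - g x))\<^sup>2 / (2 * Im (f x) * Im (g x)) \<ge> 1"
  by eventually_elim simp
 thus ?thesis unfolding hdist_def
  using assms by (intro tendsto_arcosh_strong) (auto simp: UH_iff intro!: tendsto_intros)
qed

lemma tendsto_horo:
 assumes "(f \<longlongrightarrow> z) F" "(w \<longlongrightarrow> v) F" "z \<in> UH" "v \<noteq> 0"
 shows "((\<lambda>x. horo (w x) (f x)) \<longlongrightarrow> horo v z) F"
proof -
 have "of_real (v$1) * z + of_real (v$2) \<noteq> (0::complex)"
  using assms by (auto simp: complex_eq_iff UH_iff vec2_eq_iff)
 thus ?thesis unfolding horo_def
  using assms by (auto simp: UH_iff intro!: tendsto_intros tendsto_vec_nth)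
qed

lemma continuous_on_geo: "det g = 1 ==> continuous_on S (\<lambda>t. geo g t)"
 unfolding continuous_on_def by (auto intro!: tendsto_pt tendsto_intros simp: det_mult1)

text \<open>The norm of a frame is a function of the distance from i to its base point, and
  determinant one is a closed condition.\<close>

lemma frames_compact:
 fixes X :: "nat \<Rightarrow> real^2^2"
 assumes "\<And>n. det (X n) = 1" "\<And>n. hdist \<i> (pt (X n)) \<le> R"
 obtains r g where "strict_mono r" "det g = 1" "(X \<circ> r) \<longlonglongrightarrow> g"
proof -
 have "norm (X n) \<le> sqrt (2 * cosh R)" for n
 proof -
  have "nsq (X n) / 2 = cosh (hdist \<i> (pt (X n)))" using assms(1) by (simp add: cosh_hdist cd_i_pt)
  also have "\<dots> \<le> cosh R"
  proof -
   have "0 \<le> hdist \<i> (pt (X n))" using assms(1) by simp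
   thus ?thesis using assms(2)[of n] by (subst cosh_real_nonneg_le_iff) auto
  qed
  finally have "(norm (X n))\<^sup>2 \<le> 2 * cosh R" by (simp add: nsq_norm)
  thus ?thesis using real_le_rsqrt by blast
 qed
 hence "bounded (range X)" by (auto simp: bounded_iff)
 then obtain g r where r: "strict_mono r" "(X \<circ> r) \<longlonglongrightarrow> g"
  using bounded_imp_convergent_subsequence by blast
 have "(\<lambda>n. det ((X \<circ> r) n)) \<longlonglongrightarrow> det g" using r by (intro tendsto_intros)
 hence "det g = 1" using assms(1) by (simp add: LIMSEQ_const_iff)
 thus ?thesis using that r by blast
qed

lemma UH_seq_compact:
 fixes f :: "nat \<Rightarrow> complex"
 assumes "\<And>n. f n \<in> UH" "\<And>n. hdist \<i> (f n) \<le> R"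
 obtains r z where "strict_mono r" "z \<in> UH" "(f \<circ> r) \<longlonglongrightarrow> z"
proof -
 have "\<forall>n. \<exists>g. det g = 1 \<and> pt g = f n" using ex_frame assms(1) by metis
 then obtain X :: "nat \<Rightarrow> real^2^2" where X: "\<And>n. det (X n) = 1" "\<And>n. pt (X n) = f n" by metis
 then obtain r g where r: "strict_mono r" "det g = 1" "(X \<circ> r) \<longlonglongrightarrow> g"
  using frames_compact[of X R] assms(2) by metis
 hence "(\<lambda>n. pt ((X \<circ> r) n)) \<longlonglongrightarrow> pt g" by (intro tendsto_pt)
 thus ?thesis using that[of r "pt g"] r X by (simp add: o_def)
qed

lemma Im_le_exp_hdist:
 assumes "z \<in> UH" "w \<in> UH" shows "Im w \<le> Im z * exp (hdist z w)"
proof -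
 have "horo (vector [0, 1]) z - horo (vector [0, 1]) w \<le> hdist z w"
  using assms by (intro horo_lipschitz) (auto simp: vec2_eq_iff)
 hence "ln (Im w) - ln (Im z) \<le> hdist z w" using assms by (simp add: horo_def UH_iff ln_div)
 hence "ln (Im w) \<le> ln (Im z * exp (hdist z w))" using assms by (simp add: UH_iff ln_mult)
 thus ?thesis using assms by (simp add: UH_iff)
qed

lemma norm_le_hdist:
 assumes "z \<in> UH" "w \<in> UH"
 shows "(cmod (z - w))\<^sup>2 \<le> 2 * (Im z)\<^sup>2 * exp (hdist z w) * (cosh (hdist z w) - 1)"
proof -
 have "(cmod (z - w))\<^sup>2 = 2 * Im z * Im w * (cd z w - 1)"
  using assms by (simp add: cd_def UH_iff)
 also have "\<dots> \<le> 2 * Im z * (Im z * exp (hdist z w)) * (cd z w - 1)"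
  using assms Im_le_exp_hdist[OF assms] cd_ge1[OF assms] by (intro mult_mono) (auto simp: UH_iff)
 finally show ?thesis using assms by (simp add: cosh_hdist power2_eq_square mult_ac)
qed

lemma hdist_tendsto_0D:
 assumes "((\<lambda>x. hdist z (f x)) \<longlongrightarrow> 0) F" "\<And>x. f x \<in> UH" "z \<in> UH"
 shows "(f \<longlongrightarrow> z) F"
proof -
 have "((\<lambda>x. 2 * (Im z)\<^sup>2 * exp (hdist z (f x)) * (cosh (hdist z (f x)) - 1)) \<longlongrightarrow> 2 * (Im z)\<^sup>2 * exp 0 * (cosh 0 - 1)) F"
  by (intro tendsto_mult tendsto_diff tendsto_exp tendsto_cosh tendsto_const assms)
 hence lim: "((\<lambda>x. 2 * (Im z)\<^sup>2 * exp (hdist z (f x)) * (cosh (hdist z (f x)) - 1)) \<longlongrightarrow> 0) F" by simp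
 have "((\<lambda>x. (cmod (z - f x))\<^sup>2) \<longlongrightarrow> 0) F"
  by (rule tendsto_sandwich[OF always_eventually always_eventually tendsto_const lim])
   (use norm_le_hdist[OF assms(3,2)] in simp_all)
 hence "((\<lambda>x. sqrt ((cmod (z - f x))\<^sup>2)) \<longlongrightarrow> sqrt 0) F" by (rule tendsto_real_sqrt)
 hence "((\<lambda>x. cmod (f x - z)) \<longlongrightarrow> 0) F" by (simp add: norm_minus_commute)
 thus ?thesis by (simp add: tendsto_norm_zero_iff LIM_zero_iff)
qed

definition hball :: "complex \<Rightarrow> real \<Rightarrow> complex set" where
 "hball z r = {w \<in> UH. hdist z w < r}"

lemma open_UH: "open UH"
 unfolding upper_half_plane_def by (rule open_halfspace_Im_gt)

lemma continuous_on_hdist: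
 assumes "continuous_on S f" "continuous_on S g" "\<And>x. x \<in> S ==> f x \<in> UH" "\<And>x. x \<in> S ==> g x \<in> UH"
 shows "continuous_on S (\<lambda>x. hdist (f x) (g x))"
 unfolding continuous_on_def
proof
 fix x assume "x \<in> S"
 thus "((\<lambda>x. hdist (f x) (g x)) \<longlongrightarrow> hdist (f x) (g x)) (at x within S)"
  using assms by (intro tendsto_hdist) (simp_all add: continuous_on_def)
qed

lemma open_hball: "z \<in> UH ==> open (hball z r)"
proof -
 assume z: "z \<in> UH"
 have "continuous_on UH (\<lambda>w. hdist z w)"
  by (rule continuous_on_hdist[of UH "\<lambda>_. z" "\<lambda>w. w"]) (simp_all add: z continuous_on_id)
 from continuous_open_preimage[OF this open_UH open_lessThan]
 have "open (UH \<inter> (\<lambda>w. hdist z w) -` {..<r})" .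
 moreover have "UH \<inter> (\<lambda>w. hdist z w) -` {..<r} = hball z r" by (auto simp: hball_def)
 ultimately show ?thesis by simp
qed

lemma hball_sub: "hball z r \<subseteq> UH" by (auto simp: hball_def)

lemma connected_hball: assumes "z \<in> UH" shows "connected (hball z r)"
proof (rule connectedI_const)
 fix P :: "complex \<Rightarrow> bool"
 assume P: "continuous_on (hball z r) P"
 have "P w = P z" if w: "w \<in> hball z r" for w
 proof -
  obtain g where g: "det g = 1" "pt g = z" "geo g (hdist z w) = w"
   using pair_frame assms w by (auto simp: hball_def)
  let ?I = "(\<lambda>t. geo g t) ` {0..hdist z w}"
  have "?I \<subseteq> hball z r"
  proof clarify
   fix t assume t: "t \<in> {0..hdist z w}"
   have "hdist z (geo g t) = t" using hdist_geo[OF g(1), of 0 t] g t by simp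
   thus "geo g t \<in> hball z r" using g w t by (simp add: hball_def det_mult1)
  qed
  moreover have "connected ?I" using g by (intro connected_continuous_image continuous_on_geo) auto
  moreover have "0 \<le> hdist z w" using assms w by (auto simp: hball_def)
  hence "z \<in> ?I" "w \<in> ?I" using g image_eqI[of z "\<lambda>t. geo g t" 0 "{0..hdist z w}"]
    image_eqI[of w "\<lambda>t. geo g t" "hdist z w" "{0..hdist z w}"] by auto
  ultimately show ?thesis using P connected_continuous_image
   by (smt (verit, best) connected_iff_const continuous_on_subset)
 qed
 thus "\<exists>c. \<forall>s\<in>hball z r. P s = c" by blast
qed

text \<open>The two distances determine \<open>P = exp (- s)\<close> and \<open>Q = exp s\<close>;
  since \<open>P * Q = 1\<close>, the identity for \<open>(a*c + b*d)\<^sup>2 + 1\<close> leaves the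
  real part no room. This later glues a forward and a backward ray into one geodesic.\<close>

lemma geo_extend_unique:
 assumes "det g = 1" "w \<in> UH" "t > 0" "s \<ge> 0"
  and "hdist w (pt g) = s" "hdist w (geo g t) = s + t"
 shows "w = geo g (- s)"
proof -
 obtain h where h: "det h = 1" "pt h = w" using ex_frame assms by blast
 obtain a b c d where k: "adj g ** h = mk a b c d" by (rule mk_cases)
 have det: "a*d - b*c = 1" using det_mult1[of "adj g" h] assms(1) h k by simp
 have hk: "h = g ** mk a b c d" using adj_cancel(2)[OF assms(1), of h] k by simp
 define P where "P = a\<^sup>2 + b\<^sup>2"
 define Q where "Q = c\<^sup>2 + d\<^sup>2"
 have 1: "P + Q = 2 * cosh s"
  using cosh_hdist_geo[OF assms(1) h(1) k, of 0 0] assms h by (simp add: P_def Q_def hdist_commute)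
 have 2: "P * exp (-t) + Q * exp t = 2 * cosh (s + t)"
  using cosh_hdist_geo[OF assms(1) h(1) k, of t 0] assms h by (simp add: P_def Q_def hdist_commute algebra_simps)
 have "exp t \<noteq> exp (-t)" using assms(3) by simp
 moreover have "(Q - exp s) * (exp t - exp (-t)) = 0"
 proof -
  have "P = exp s + exp (-s) - Q" using 1 by (simp add: cosh_def)
  hence "(exp s + exp (-s) - Q) * exp (-t) + Q * exp t = exp (s+t) + exp (-s-t)"
   using 2 by (simp add: cosh_def)
  thus ?thesis by (simp add: algebra_simps flip: exp_add)
 qed
 ultimately have Q: "Q = exp s" by simp
 hence P: "P = exp (-s)" using 1 by (simp add: cosh_def)
 have "(a*c+b*d)\<^sup>2 + (a*d - b*c)\<^sup>2 = P * Q"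
  by (simp add: P_def Q_def power2_eq_square algebra_simps)
 hence "(a*c+b*d)\<^sup>2 = 0" using P Q det by (simp flip: exp_add)
 hence "pt (mk a b c d) = Complex 0 (1 / Q)" using pt_mk[OF det] by (simp add: Q_def)
 also have "\<dots> = pt (dg (- s))" by (simp add: Q pt_dg complex_eq_iff exp_minus inverse_eq_divide)
 finally have "act g (pt (mk a b c d)) = act g (pt (dg (- s)))" by simp
 thus ?thesis using h hk assms(1) det by (simp add: act_pt)
qed

lemma lipschitz_chain:
 fixes f :: "real \<Rightarrow> real"
 assumes "rho > 0" "0 \<le> L"
  and "\<And>s t. 0 \<le> s ==> s \<le> t ==> t \<le> L ==> t - s < rho ==> f t - f s \<le> c * (t - s)"
 shows "f L - f 0 \<le> c * L"
proof -
 obtain n :: nat where n: "n > 0" "L / n < rho"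
 proof -
  obtain n :: nat where "L / rho < n" using reals_Archimedean2 by blast
  moreover from this have "n > 0" using assms by (smt (verit) divide_nonneg_pos gr0I of_nat_0)
  ultimately show ?thesis using that[of n] assms by (simp add: field_simps)
 qed
 define e where "e = L / n"
 have e: "0 \<le> e" "e < rho" "L = n * e" using n assms by (simp_all add: e_def)
 have "f (i * e) - f 0 \<le> c * (i * e)" if "i \<le> n" for i :: nat
  using that
 proof (induction i)
  case (Suc i)
  have "real (Suc i) * e \<le> n * e" using Suc.prems e by (intro mult_right_mono) auto
  moreover have "real (Suc i) * e = real i * e + e" by (simp add: algebra_simps)
  ultimately have "f (Suc i * e) - f (i * e) \<le> c * (Suc i * e - i * e)"
   using e by (intro assms) auto
  thus ?case using Suc by (simp add: algebra_simps)
 qed simp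
 from this[of n] show ?thesis using e by simp
qed

section \<open>Tight functions and the Aubry set\<close>

text \<open>In the application, \<open>G\<close> consists of the matrices that represent \<open>\<Gamma>\<^sub>0\<close>, \<open>phi\<close> is the homomorphism
 induced by \<open>f\<close>, and the kernel \<open>Gam\<close> of \<open>phi\<close> represents \<open>\<Gamma>\<close>.\<close>

locale zcover =
 fixes G :: "(real^2^2) set" and phi :: "real^2^2 \<Rightarrow> int"
 assumes det_G [simp]: "A \<in> G ==> det A = 1"
  and one_G [simp]: "mat 1 \<in> G"
  and mult_G [simp]: "A \<in> G ==> B \<in> G ==> A ** B \<in> G"
  and adj_G [simp]: "A \<in> G ==> adj A \<in> G"
  and uminus_G [simp]: "A \<in> G ==> - A \<in> G"
  and phi_mult: "A \<in> G ==> B \<in> G ==> phi (A ** B) = phi A + phi B"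
  and phi_nontrivial: "\<exists>A\<in>G. phi A \<noteq> 0"
  and cobounded: "\<exists>R. \<forall>z\<in>UH. \<exists>A\<in>G. hdist z (pt A) \<le> R"
  and discrete: "finite {A \<in> G. hdist \<i> (pt A) \<le> r}"
  and free: "A \<in> G ==> z \<in> UH ==> act A z = z ==> A = mat 1 \<or> A = - mat 1"
begin

section \<open>The group, its kernel and powers\<close>

lemma act_G_UH [simp]: "A \<in> G ==> z \<in> UH ==> act A z \<in> UH"
 by (simp add: act_UH)

lemma phi_one [simp]: "phi (mat 1) = 0"
 using phi_mult[of "mat 1" "mat 1"] by simp

lemma phi_adj: "A \<in> G ==> phi (adj A) = - phi A"
 using phi_mult[of A "adj A"] by (simp add: adj_right)

lemma phi_uminus: assumes "A \<in> G" shows "phi (- A) = phi A"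
proof -
 have *: "- mat 1 ** - mat 1 = (mat 1 :: real^2^2)" "- mat 1 ** A = - A"
  by (cases A rule: mk_cases; simp add: mat_one_mk)+
 have "phi (- mat 1) = 0" using phi_mult[of "- mat 1" "- mat 1"] * by simp
 thus ?thesis using phi_mult[of "- mat 1" A] * assms by simp
qed

lemma hdist_act_G: "A \<in> G ==> z \<in> UH ==> w \<in> UH ==> hdist (act A z) (act A w) = hdist z w"
 by (simp add: hdist_act)

lemma act_mult_G: "A \<in> G ==> B \<in> G ==> z \<in> UH ==> act (A ** B) z = act A (act B z)"
 by (simp add: act_mult)

lemma hdist_act_adj: "A \<in> G ==> z \<in> UH ==> w \<in> UH ==> hdist (act (adj A) z) w = hdist z (act A w)"
 using hdist_act_G[of A "act (adj A) z" w] by (simp add: act_adj)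

definition Gam :: "(real^2^2) set" where "Gam = {A \<in> G. phi A = 0}"

lemma Gam_G: "A \<in> Gam ==> A \<in> G" by (simp add: Gam_def)
lemma Gam_one [simp]: "mat 1 \<in> Gam" by (simp add: Gam_def)
lemma Gam_mult [simp]: "A \<in> Gam ==> B \<in> Gam ==> A ** B \<in> Gam" by (simp add: Gam_def phi_mult)
lemma Gam_adj [simp]: "A \<in> Gam ==> adj A \<in> Gam" by (simp add: Gam_def phi_adj)
lemma Gam_uminus [simp]: "A \<in> Gam ==> - A \<in> Gam" by (simp add: Gam_def phi_uminus)

fun mpow :: "real^2^2 \<Rightarrow> nat \<Rightarrow> real^2^2" where
 "mpow A 0 = mat 1" | "mpow A (Suc k) = A ** mpow A k"

lemma mpow_G [simp]: "A \<in> G ==> mpow A k \<in> G"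
 by (induction k) auto

lemma phi_mpow: "A \<in> G ==> phi (mpow A k) = k * phi A"
 by (induction k) (auto simp: phi_mult algebra_simps)

lemma mpow_add: "mpow A (j + k) = mpow A j ** mpow A k"
 by (induction j) (auto simp: matrix_mul_assoc)

lemma hdist_mpow:
 assumes "A \<in> G" "z \<in> UH" shows "hdist z (act (mpow A k) z) \<le> k * hdist z (act A z)"
proof (induction k)
 case (Suc k)
 have "hdist z (act (mpow A (Suc k)) z) \<le> hdist z (act A z) + hdist (act A z) (act A (act (mpow A k) z))"
  using assms by (simp add: act_mult_G hdist_triangle)
 also have "hdist (act A z) (act A (act (mpow A k) z)) = hdist z (act (mpow A k) z)"
  using assms by (simp add: hdist_act_G)
 finally show ?case using Suc by (simp add: algebra_simps)
qed simp

lemma near_orbit: obtains R where "R \<ge> 0" "\<And>z. z \<in> UH ==> \<exists>A\<in>G. hdist \<i> (act A z) \<le> R"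
proof -
 obtain R where R: "\<And>z. z \<in> UH ==> \<exists>A\<in>G. hdist z (pt A) \<le> R" using cobounded by blast
 have "R \<ge> 0" using R[OF i_UH] hdist_nonneg[OF i_UH pt_UH] order_trans det_G by blast
 moreover have "\<exists>A\<in>G. hdist \<i> (act A z) \<le> R" if z: "z \<in> UH" for z
 proof -
  obtain A where "A \<in> G" "hdist z (pt A) \<le> R" using R z by blast
  hence "adj A \<in> G" "hdist \<i> (act (adj A) z) \<le> R"
   using hdist_act_adj[of A z \<i>] z by (simp_all add: pt_def hdist_commute)
  thus ?thesis by blast
 qed
 ultimately show ?thesis using that by blast
qed

text \<open>A Milnor--Svarc estimate: \<open>phi\<close> is Lipschitz for the orbit metric; passing to powers removes
 the additive constant.\<close>

lemma phi_linear_bound: obtains M where "M > 0" "\<And>A z. A \<in> G ==> z \<in> UH ==> phi A \<le> M * hdist z (act A z)"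
proof -
 obtain R where R: "R \<ge> 0" "\<And>z. z \<in> UH ==> \<exists>A\<in>G. hdist \<i> (act A z) \<le> R" using near_orbit by blast
 have R': "\<exists>B\<in>G. hdist z (pt B) \<le> R" if z: "z \<in> UH" for z
 proof -
  obtain A where "A \<in> G" "hdist \<i> (act A z) \<le> R" using R z by blast
  thus ?thesis using hdist_act_adj[of "adj A" z \<i>] z
   by (intro bexI[of _ "adj A"]) (simp_all add: hdist_commute pt_def)
 qed
 define S where "S = {A \<in> G. hdist \<i> (pt A) \<le> 2*R + 1}"
 have fS: "finite S" using discrete by (simp add: S_def)
 define M where "M = Max (insert 1 ((\<lambda>A. \<bar>real_of_int (phi A)\<bar>) ` S))"
 have M1: "M \<ge> 1" "\<And>A. A \<in> S ==> \<bar>real_of_int (phi A)\<bar> \<le> M" using fS by (auto simp: M_def)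
 \<comment> \<open>Walk from i to \<open>w\<close> in unit steps. Group elements within
   \<open>R\<close> of consecutive points differ by an element of the finite set \<open>S\<close>,
   so each step changes \<open>phi\<close> by at most \<open>M\<close>.\<close>
 have ind: "\<bar>real_of_int (phi B)\<bar> \<le> M * (n + 1)" if "w \<in> UH" "hdist \<i> w \<le> n" "B \<in> G" "hdist w (pt B) \<le> R" for n :: nat and w B
  using that
 proof (induction n arbitrary: w B)
  case 0
  hence "w = \<i>" using hdist_zero_iff[of \<i> w] hdist_nonneg[OF i_UH 0(1)] by force
  thus ?case using 0 M1(2)[of B] R by (simp add: S_def)
 next
  case (Suc n)
  obtain g where g: "det g = 1" "pt g = \<i>" "geo g (hdist \<i> w) = w" using pair_frame Suc.prems by (metis i_UH)
  define w' where "w' = geo g (min n (hdist \<i> w))"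
  have w': "w' \<in> UH" "hdist \<i> w' \<le> n" "hdist w' w \<le> 1"
   using g Suc.prems hdist_geo[OF g(1), of 0 "min n (hdist \<i> w)"] hdist_geo[OF g(1), of "min n (hdist \<i> w)" "hdist \<i> w"]
   by (auto simp: w'_def det_mult1)
  obtain B' where B': "B' \<in> G" "hdist w' (pt B') \<le> R" using R' w' by blast
  have "hdist (pt B') (pt B) \<le> hdist (pt B') w' + (hdist w' w + hdist w (pt B))"
   using hdist_triangle[of "pt B'" w' "pt B"] hdist_triangle[of w' w "pt B"] w' B' Suc.prems by simp
  hence "hdist (pt B') (pt B) \<le> 2*R + 1" using w' B' Suc.prems by (simp add: hdist_commute)
  moreover have "hdist (pt B') (pt B) = hdist \<i> (pt (adj B' ** B))"
   using hdist_act_adj[of "adj B'" \<i> "pt B"] B' Suc.prems by (simp add: pt_def act_mult_G)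
  ultimately have "adj B' ** B \<in> S" using B' Suc.prems by (simp add: S_def)
  hence "\<bar>real_of_int (phi (adj B' ** B))\<bar> \<le> M" using M1 by blast
  hence "\<bar>real_of_int (phi B) - phi B'\<bar> \<le> M" using B' Suc.prems by (simp add: phi_mult phi_adj)
  moreover have "\<bar>real_of_int (phi B')\<bar> \<le> M * (n + 1)" using Suc.IH[OF w'(1,2) B'] .
  ultimately show ?case by (simp add: algebra_simps)
 qed
 have lin: "phi A \<le> M * hdist z (act A z) + M * (2 * hdist \<i> z + 2)" if "A \<in> G" "z \<in> UH" for A z
 proof -
  let ?d = "hdist \<i> (pt A)"
  have d: "?d \<ge> 0" using that by simp
  have "phi A \<le> M * (nat \<lceil>?d\<rceil> + 1)"
   using ind[of "pt A" "nat \<lceil>?d\<rceil>" A] that R by (simp add: of_nat_ceiling)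
  also have "\<dots> \<le> M * (?d + 2)" using d M1 by (intro mult_left_mono) linarith+
  also have "?d \<le> hdist \<i> z + hdist z (act A z) + hdist (act A z) (act A \<i>)"
   using hdist_triangle[of \<i> z "act A z"] hdist_triangle[of \<i> "act A z" "act A \<i>"] that by (simp add: pt_def)
  hence "M * (?d + 2) \<le> M * (hdist z (act A z) + 2 * hdist \<i> z + 2)"
   using M1 that by (intro mult_left_mono) (auto simp: hdist_act_G hdist_commute)
  finally show ?thesis by (simp add: algebra_simps)
 qed
 have "phi A \<le> M * hdist z (act A z)" if A: "A \<in> G" "z \<in> UH" for A z
 proof (rule ccontr)
  assume "\<not> ?thesis"
  hence pos: "phi A - M * hdist z (act A z) > 0" by simp
  then obtain k :: nat where k: "k * (phi A - M * hdist z (act A z)) > M * (2 * hdist \<i> z + 2)"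
   using reals_Archimedean3 by blast
  have "k * phi A \<le> M * hdist z (act (mpow A k) z) + M * (2 * hdist \<i> z + 2)"
   using lin[of "mpow A k" z] A by (simp add: phi_mpow)
  also have "\<dots> \<le> M * (k * hdist z (act A z)) + M * (2 * hdist \<i> z + 2)"
   using hdist_mpow[OF A] M1 by simp
  finally show False using k by (simp add: algebra_simps)
 qed
 thus ?thesis using that[of M] M1 by simp
qed

text \<open>The least length per unit of degree. \<open>degree_ratio\<close> identifies it as the
  reciprocal of the supremum in the definition of tightness.\<close>

definition kap :: real where
 "kap = Inf ((\<lambda>(A, z). hdist z (act A z) / phi A) ` ({A \<in> G. phi A \<ge> 1} \<times> UH))"

lemma ex_phi_pos: obtains A where "A \<in> G" "phi A \<ge> 1"
proof -
 obtain A where "A \<in> G" "phi A \<noteq> 0" using phi_nontrivial by blast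
 thus ?thesis using that[of A] that[of "adj A"] by (cases "phi A \<ge> 1") (auto simp: phi_adj)
qed

lemma kap_bdd: "bdd_below ((\<lambda>(A, z). hdist z (act A z) / phi A) ` ({A \<in> G. phi A \<ge> 1} \<times> UH))"
 by (rule bdd_belowI[of _ 0]) auto

lemma kap_pos: "kap > 0"
proof -
 obtain M where M: "M > 0" "\<And>A z. A \<in> G ==> z \<in> UH ==> phi A \<le> M * hdist z (act A z)" using phi_linear_bound by blast
 have "kap \<ge> 1 / M"
  unfolding kap_def
 proof (rule cInf_greatest)
  obtain A where "A \<in> G" "phi A \<ge> 1" using ex_phi_pos .
  thus "(\<lambda>(A, z). hdist z (act A z) / phi A) ` ({A \<in> G. phi A \<ge> 1} \<times> UH) \<noteq> {}" using i_UH by blast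
 next
  fix x assume "x \<in> (\<lambda>(A, z). hdist z (act A z) / phi A) ` ({A \<in> G. phi A \<ge> 1} \<times> UH)"
  then obtain A z where "A \<in> G" "phi A \<ge> 1" "z \<in> UH" "x = hdist z (act A z) / phi A" by auto
  moreover from this have "1 * real_of_int (phi A) \<le> (M * x) * phi A" using M(2)[of A z] by simp
  ultimately have "1 \<le> M * x" using mult_right_le_imp_le[of 1 "real_of_int (phi A)" "M * x"] by simp
  thus "1 / M \<le> x" using M(1) by (simp add: field_simps)
 qed
 thus ?thesis using M by (smt (verit) divide_pos_pos)
qed

lemma kap_le: assumes "A \<in> G" "z \<in> UH" shows "kap * phi A \<le> hdist z (act A z)"
proof (cases "phi A \<ge> 1")
 case True
 have "kap \<le> hdist z (act A z) / phi A" unfolding kap_def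
  by (rule cInf_lower[OF _ kap_bdd]) (use assms True in auto)
 thus ?thesis using True by (simp add: field_simps)
next
 case False
 hence "kap * phi A \<le> 0" using kap_pos by (simp add: mult_nonneg_nonpos)
 thus ?thesis using hdist_nonneg[of z "act A z"] assms by (smt (verit) act_G_UH)
qed

lemma kap_approx: assumes "c > kap" obtains A z where "A \<in> G" "phi A \<ge> 1" "z \<in> UH" "hdist z (act A z) < c * phi A"
proof -
 obtain A0 where "A0 \<in> G" "phi A0 \<ge> 1" using ex_phi_pos .
 hence "(\<lambda>(A, z). hdist z (act A z) / phi A) ` ({A \<in> G. phi A \<ge> 1} \<times> UH) \<noteq> {}" using i_UH by blast
 from cInf_lessD[OF this] assms
 obtain x where "x \<in> (\<lambda>(A, z). hdist z (act A z) / phi A) ` ({A \<in> G. phi A \<ge> 1} \<times> UH)" "x < c"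
  unfolding kap_def by blast
 then obtain A z where "A \<in> G" "phi A \<ge> 1" "z \<in> UH" "hdist z (act A z) / phi A < c" by auto
 thus ?thesis using that[of A z] by (simp add: field_simps)
qed

text \<open>The lifts of the tight representatives, multiplied by the reciprocal \<open>kap\<close> of their Lipschitz constant.\<close>

definition tightf :: "(complex \<Rightarrow> real) set" where
 "tightf = {u. (\<forall>z\<in>UH. \<forall>w\<in>UH. u z - u w \<le> hdist z w) \<and> (\<forall>A\<in>G. \<forall>z\<in>UH. u (act A z) = u z + kap * phi A)}"

lemma tightf_lip: "u \<in> tightf ==> z \<in> UH ==> w \<in> UH ==> u z - u w \<le> hdist z w"
 by (simp add: tightf_def)

lemma tightf_lip_abs: "u \<in> tightf ==> z \<in> UH ==> w \<in> UH ==> \<bar>u z - u w\<bar> \<le> hdist z w"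
 using tightf_lip[of u z w] tightf_lip[of u w z] by (auto simp: hdist_commute)

lemma tightf_act: "u \<in> tightf ==> A \<in> G ==> z \<in> UH ==> u (act A z) = u z + kap * phi A"
 by (simp add: tightf_def)

text \<open>This set turns out to be the preimage of the minimizing lamination.\<close>

definition Aub :: "complex set" where
 "Aub = {z \<in> UH. \<forall>e>0. \<exists>A\<in>G. phi A \<ge> 1 \<and> hdist z (act A z) < kap * phi A + e}"

lemma Aub_UH [simp]: "z \<in> Aub ==> z \<in> UH" unfolding Aub_def by blast

lemma AubI: "z \<in> UH ==> (\<And>e. e > 0 ==> \<exists>A\<in>G. phi A \<ge> 1 \<and> hdist z (act A z) < kap * phi A + e) ==> z \<in> Aub"
 unfolding Aub_def by blast

lemma AubE:
 assumes "z \<in> Aub" "e > 0"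
 obtains A where "A \<in> G" "phi A \<ge> 1" "hdist z (act A z) < kap * phi A + e"
 using assms unfolding Aub_def by blast

text \<open>A McShane extension of the values \<open>kap * phi A\<close> at the orbit points
  \<open>act A z\<close>, with the tips of the cones cut off at radius \<open>r\<close>. Taking the
  whole orbit makes it equivariant, and the cut can leave a plateau around \<open>z\<close>.\<close>

definition peak :: "complex \<Rightarrow> real \<Rightarrow> complex \<Rightarrow> real" where
 "peak z r x = (SUP A\<in>G. kap * phi A - max (hdist x (act A z)) r)"

lemma peak_bound:
 assumes "z \<in> UH" "x \<in> UH" "A \<in> G" shows "kap * phi A - max (hdist x (act A z)) r \<le> hdist z x"
 using kap_le[OF assms(3,1)] hdist_triangle[of z x "act A z"] assms by simp

lemma peak_bdd: "z \<in> UH ==> x \<in> UH ==> bdd_above ((\<lambda>A. kap * phi A - max (hdist x (act A z)) r) ` G)"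
 using peak_bound by (intro bdd_aboveI2) blast

lemma peak_tight: assumes z: "z \<in> UH" shows "peak z r \<in> tightf"
 unfolding tightf_def
proof (clarify, intro conjI ballI)
 have ne: "G \<noteq> {}" using one_G by blast
 fix x y assume xy: "x \<in> UH" "y \<in> UH"
 have "peak z r x \<le> peak z r y + hdist x y"
  unfolding peak_def
 proof (rule cSUP_least[OF ne])
  fix A assume A: "A \<in> G"
  have "hdist y (act A z) \<le> hdist x (act A z) + hdist x y"
   using hdist_triangle[of y x "act A z"] xy z A by (simp add: hdist_commute)
  hence "kap * phi A - max (hdist x (act A z)) r \<le> kap * phi A - max (hdist y (act A z)) r + hdist x y"
   using hdist_nonneg[OF xy] by (auto simp: max_def)
  moreover have "kap * phi A - max (hdist y (act A z)) r \<le> (SUP A\<in>G. kap * phi A - max (hdist y (act A z)) r)"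
   by (rule cSUP_upper[OF A peak_bdd[OF z xy(2)]])
  ultimately show "kap * phi A - max (hdist x (act A z)) r \<le> (SUP A\<in>G. kap * phi A - max (hdist y (act A z)) r) + hdist x y"
   by simp
 qed
 thus "peak z r x - peak z r y \<le> hdist x y" by simp
next
 have ne: "G \<noteq> {}" using one_G by blast
 have le: "peak z r (act B x) \<ge> peak z r x + kap * phi B" if B: "B \<in> G" and x: "x \<in> UH" for B x
 proof -
  have "peak z r x \<le> peak z r (act B x) - kap * phi B"
   unfolding peak_def[of z r x]
  proof (rule cSUP_least[OF ne])
   fix A assume A: "A \<in> G"
   have "kap * phi (B ** A) - max (hdist (act B x) (act (B ** A) z)) r \<le> peak z r (act B x)"
    unfolding peak_def by (rule cSUP_upper[OF _ peak_bdd]) (use A B x z in auto)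
   thus "kap * phi A - max (hdist x (act A z)) r \<le> peak z r (act B x) - kap * phi B"
    using A B x z by (simp add: act_mult_G hdist_act_G phi_mult algebra_simps)
  qed
  thus ?thesis by simp
 qed
 fix B x assume B: "B \<in> G" and x: "x \<in> UH"
 have "peak z r (act (adj B) (act B x)) \<ge> peak z r (act B x) + kap * phi (adj B)"
  using le[of "adj B" "act B x"] B x by simp
 thus "peak z r (act B x) = peak z r x + kap * phi B"
  using le[OF B x] B x by (simp add: act_adj phi_adj)
qed

lemma tightf_nonempty: "\<exists>u. u \<in> tightf" using peak_tight[OF i_UH] by blast

text \<open>Outside \<open>Aub\<close> every return to \<open>z\<close> of positive degree is longer
  than \<open>kap * phi A\<close> by some fixed \<open>e\<close>. Within \<open>e / 2\<close> of
  \<open>z\<close> no other cone then rises above the truncated cone at \<open>z\<close>, and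
  \<open>peak\<close> is constant there.\<close>

lemma flat_outside_Aub:
 assumes "z \<in> UH" "z \<notin> Aub"
 obtains u r where "u \<in> tightf" "r > 0" "\<And>x. x \<in> hball z r ==> u x = u z"
proof -
 obtain e where e: "e > 0" "\<And>A. A \<in> G ==> phi A \<ge> 1 ==> hdist z (act A z) \<ge> kap * phi A + e"
  using assms AubI[of z] not_less by blast
 define r where "r = e / 2"
 have "peak z r x = - r" if x: "x \<in> hball z r" for x
 proof -
  have xU: "x \<in> UH" "hdist x z < r" using x by (auto simp: hball_def hdist_commute)
  have "peak z r x \<le> - r" unfolding peak_def
  proof (rule cSUP_least)
   fix A assume A: "A \<in> G"
   show "kap * phi A - max (hdist x (act A z)) r \<le> - r"
   proof (cases "phi A \<ge> 1")
    case True
    hence "hdist z (act A z) \<ge> kap * phi A + e" using e A by simp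
    moreover have "hdist z (act A z) \<le> hdist x z + hdist x (act A z)"
     using hdist_triangle[of z x "act A z"] assms xU A by (simp add: hdist_commute)
    ultimately show ?thesis using xU by (simp add: r_def max_def)
   next
    case False
    hence "kap * phi A \<le> 0" using kap_pos by (simp add: mult_nonneg_nonpos)
    thus ?thesis by (simp add: max_def)
   qed
  qed (use one_G in blast)
  moreover have "kap * phi (mat 1) - max (hdist x (act (mat 1) z)) r \<le> peak z r x"
   unfolding peak_def by (rule cSUP_upper[OF one_G peak_bdd]) (use assms xU in auto)
  ultimately show ?thesis using xU by simp
 qed
 moreover have "r > 0" using e by (simp add: r_def)
 moreover from this have "z \<in> hball z r" using assms by (simp add: hball_def)
 ultimately show ?thesis using that[of "peak z r" r] peak_tight[OF assms(1)] by simp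
qed

lemma tightf_mean:
 assumes "finite I" "I \<noteq> {}" "\<And>i. i \<in> I ==> u i \<in> tightf"
 shows "(\<lambda>x. (\<Sum>i\<in>I. u i x) / card I) \<in> tightf"
proof -
 have c: "card I > 0" using assms by (simp add: card_gt_0_iff)
 have "(\<Sum>i\<in>I. u i z) / card I - (\<Sum>i\<in>I. u i w) / card I \<le> hdist z w" if "z \<in> UH" "w \<in> UH" for z w
 proof -
  have "(\<Sum>i\<in>I. u i z) - (\<Sum>i\<in>I. u i w) = (\<Sum>i\<in>I. u i z - u i w)" by (simp add: sum_subtractf)
  also have "\<dots> \<le> (\<Sum>i\<in>I. hdist z w)" using assms that by (intro sum_mono tightf_lip)
  finally show ?thesis using c by (simp add: field_simps flip: diff_divide_distrib)
 qed
 moreover have "(\<Sum>i\<in>I. u i (act A z)) / card I = (\<Sum>i\<in>I. u i z) / card I + kap * phi A" if "A \<in> G" "z \<in> UH" for A z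
 proof -
  have "(\<Sum>i\<in>I. u i (act A z)) = (\<Sum>i\<in>I. u i z + kap * phi A)"
   using assms that by (intro sum.cong refl tightf_act)
  thus ?thesis using c by (simp add: sum.distrib add_divide_distrib)
 qed
 ultimately show ?thesis by (simp add: tightf_def)
qed

lemma Aub_act: assumes "z \<in> Aub" "B \<in> G" shows "act B z \<in> Aub"
proof -
 have "\<exists>A\<in>G. phi A \<ge> 1 \<and> hdist (act B z) (act A (act B z)) < kap * phi A + e" if "e > 0" for e
 proof -
  obtain A where A: "A \<in> G" "phi A \<ge> 1" "hdist z (act A z) < kap * phi A + e" using AubE[OF assms(1) \<open>e > 0\<close>] by blast
  have "act (B ** A ** adj B) (act B z) = act B (act A z)"
   using A assms by (simp add: act_mult_G act_adj)
  moreover have "phi (B ** A ** adj B) = phi A" using A assms by (simp add: phi_mult phi_adj)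
  ultimately show ?thesis using A assms
   by (intro bexI[of _ "B ** A ** adj B"]) (auto simp: hdist_act_G)
 qed
 thus ?thesis using assms by (intro AubI) auto
qed

lemma Aub_closed_seq:
 assumes "\<And>n. f n \<in> Aub" "f \<longlonglongrightarrow> z" "z \<in> UH"
 shows "z \<in> Aub"
proof -
 have "\<exists>A\<in>G. phi A \<ge> 1 \<and> hdist z (act A z) < kap * phi A + e" if e: "e > 0" for e
 proof -
  have "(\<lambda>n. hdist z (f n)) \<longlonglongrightarrow> hdist z z" using assms by (intro tendsto_hdist tendsto_const) auto
  hence "\<forall>\<^sub>F n in sequentially. hdist z (f n) < e/4" using e order_tendstoD(2)[of "\<lambda>n. hdist z (f n)" "hdist z z" sequentially "e/4"] by simp
  then obtain n where n: "hdist z (f n) < e/4" by (auto simp: eventually_sequentially)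
  have "e/2 > 0" using e by simp
  then obtain A where A: "A \<in> G" "phi A \<ge> 1" "hdist (f n) (act A (f n)) < kap * phi A + e/2"
   using AubE[OF assms(1)[of n]] by metis
  have "f n \<in> UH" using assms(1) by simp
  hence "hdist z (act A z) \<le> hdist z (f n) + hdist (f n) (act A (f n)) + hdist (act A (f n)) (act A z)"
   using hdist_triangle[of z "f n" "act A z"] hdist_triangle[of "f n" "act A (f n)" "act A z"] assms A by simp
  also have "hdist (act A (f n)) (act A z) = hdist z (f n)" using assms A by (simp add: hdist_act_G hdist_commute)
  finally show ?thesis using A n by (intro bexI[of _ A]) auto
 qed
 thus ?thesis using assms by (intro AubI) auto
qed

text \<open>Averaging finitely many tight functions that are locally constant off the Aubry set gives one
 that is uniformly strict there.\<close>

lemma strict_outside_Aub: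
 assumes e: "e > 0"
 obtains u eta rho where "u \<in> tightf" "0 < eta" "eta \<le> 1" "0 < rho"
  "\<And>x y. x \<in> UH ==> y \<in> UH ==> (\<And>a. a \<in> Aub ==> hdist x a \<ge> e) ==> hdist x y < rho ==>
   \<bar>u y - u x\<bar> \<le> (1 - eta) * hdist x y"
proof -
 obtain R where R: "R \<ge> 0" "\<And>z. z \<in> UH ==> \<exists>A\<in>G. hdist \<i> (act A z) \<le> R" using near_orbit by blast
 define K where "K = {x \<in> UH. hdist \<i> x \<le> R \<and> (\<forall>a\<in>Aub. hdist x a \<ge> e)}"
 have "compact K" unfolding compact_eq_seq_compact_metric seq_compact_def
 proof (intro allI impI)
  fix f :: "nat \<Rightarrow> complex" assume f: "\<forall>n. f n \<in> K"
  hence "\<And>n. f n \<in> UH" "\<And>n. hdist \<i> (f n) \<le> R" by (auto simp: K_def)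
  then obtain r z where r: "strict_mono r" "z \<in> UH" "(f \<circ> r) \<longlonglongrightarrow> z"
   by (rule UH_seq_compact)
  have "(\<lambda>n. hdist \<i> ((f \<circ> r) n)) \<longlonglongrightarrow> hdist \<i> z" by (rule tendsto_hdist[OF tendsto_const r(3) i_UH r(2)])
  hence "hdist \<i> z \<le> R" by (rule LIMSEQ_le_const2) (use f in \<open>auto simp: K_def\<close>)
  moreover have "hdist z a \<ge> e" if "a \<in> Aub" for a
  proof -
   have "(\<lambda>n. hdist ((f \<circ> r) n) a) \<longlonglongrightarrow> hdist z a" by (rule tendsto_hdist[OF r(3) tendsto_const r(2)]) (use that in simp)
   thus ?thesis by (rule LIMSEQ_le_const) (use f that in \<open>auto simp: K_def\<close>)
  qed
  ultimately show "\<exists>l\<in>K. \<exists>r. strict_mono r \<and> (f \<circ> r) \<longlonglongrightarrow> l" using r by (auto simp: K_def)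
 qed
 have "\<exists>u r. u \<in> tightf \<and> r > 0 \<and> (\<forall>y\<in>hball x r. u y = u x)" if "x \<in> K" for x
 proof -
  have "x \<in> UH" "x \<notin> Aub" using that e by (auto simp: K_def dest: bspec[of _ _ x])
  thus ?thesis using flat_outside_Aub by metis
 qed
 then obtain U r where U: "\<And>x. x \<in> K ==> U x \<in> tightf" "\<And>x. x \<in> K ==> r x > 0"
  "\<And>x y. x \<in> K ==> y \<in> hball x (r x) ==> U x y = U x x" by metis
 have "K \<subseteq> (\<Union>x\<in>K. hball x (r x / 2))" using U(2) by (auto simp: hball_def K_def)
 moreover have "\<And>x. x \<in> K ==> open (hball x (r x / 2))" by (intro open_hball) (auto simp: K_def)
 ultimately obtain X where X: "X \<subseteq> K" "finite X" "K \<subseteq> (\<Union>x\<in>X. hball x (r x / 2))"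
  using compactE_image[OF \<open>compact K\<close>, of K "\<lambda>x. hball x (r x / 2)"] by metis
 show ?thesis
 proof (cases "X = {}")
  \<comment> \<open>Here no point stays at distance \<open>e\<close> from \<open>Aub\<close>, so the
    uniform estimate holds vacuously for any tight function.\<close>
  case True
  hence "K = {}" using X by auto
  have no: False if x: "x \<in> UH" and far: "\<And>a. a \<in> Aub ==> hdist x a \<ge> e" for x
  proof -
   obtain A where A: "A \<in> G" "hdist \<i> (act A x) \<le> R" using R x by blast
   have "hdist (act A x) a \<ge> e" if a: "a \<in> Aub" for a
    using hdist_act_adj[of "adj A" x a] a A x far[of "act (adj A) a"] Aub_act[OF a, of "adj A"] by simp
   hence "act A x \<in> K" using A x by (simp add: K_def)
   thus False using \<open>K = {}\<close> by simp
  qed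
  obtain u where "u \<in> tightf" using tightf_nonempty by blast
  thus ?thesis using that[of u 1 1] no by auto
 next
  case False
  define n where "n = card X"
  have n: "n > 0" using False X by (simp add: n_def card_gt_0_iff)
  define u where "u = (\<lambda>x. (\<Sum>i\<in>X. U i x) / card X)"
  have u: "u \<in> tightf" unfolding u_def using X U False by (intro tightf_mean) auto
  define rho where "rho = Min ((\<lambda>x. r x / 2) ` X)"
  have rho: "rho > 0" "\<And>x. x \<in> X ==> rho \<le> r x / 2"
  proof -
   show "rho > 0" unfolding rho_def using X U(2) False by (subst Min_gr_iff) (auto simp: subset_iff)
   show "rho \<le> r x / 2" if "x \<in> X" for x unfolding rho_def by (rule Min_le) (use X that in auto)
  qed
  \<comment> \<open>After translation into \<open>K\<close> one of the \<open>n\<close> functions is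
    constant near the point, so the average has slope at most \<open>1 - 1/n\<close>.\<close>
  have "\<bar>u y - u x\<bar> \<le> (1 - 1/n) * hdist x y" if x: "x \<in> UH" and y: "y \<in> UH"
   and far: "\<And>a. a \<in> Aub ==> hdist x a \<ge> e" and xy: "hdist x y < rho" for x y
  proof -
   obtain A where A: "A \<in> G" "hdist \<i> (act A x) \<le> R" using R x by blast
   have "hdist (act A x) a \<ge> e" if a: "a \<in> Aub" for a
    using hdist_act_adj[of "adj A" x a] a A x far[of "act (adj A) a"] Aub_act[OF a, of "adj A"] by simp
   hence "act A x \<in> K" using A x by (simp add: K_def)
   then obtain k where k: "k \<in> X" "act A x \<in> hball k (r k / 2)" using X by auto
   have kK: "k \<in> K" "k \<in> UH" using k X by (auto simp: K_def)
   have "hdist k (act A y) \<le> hdist k (act A x) + hdist x y"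
    using hdist_triangle[of k "act A x" "act A y"] kK A x y by (simp add: hdist_act_G)
   hence "act A y \<in> hball k (r k)" "act A x \<in> hball k (r k)"
    using k rho(2)[OF k(1)] xy A x y U(2)[OF kK(1)] by (auto simp: hball_def)
   hence "U k (act A y) = U k (act A x)" using U(3)[OF kK(1)] by simp
   hence eq: "U k y = U k x" using tightf_act[OF U(1)[OF kK(1)] A(1)] x y by simp
   have "u y - u x = (\<Sum>i\<in>X. U i y - U i x) / n" by (simp add: u_def n_def sum_subtractf diff_divide_distrib)
   also have "(\<Sum>i\<in>X. U i y - U i x) = (\<Sum>i\<in>X - {k}. U i y - U i x)"
    using X k eq by (simp add: sum.remove)
   finally have "\<bar>u y - u x\<bar> = \<bar>\<Sum>i\<in>X - {k}. U i y - U i x\<bar> / n" using n by simp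
   also have "\<bar>\<Sum>i\<in>X - {k}. U i y - U i x\<bar> \<le> (\<Sum>i\<in>X - {k}. \<bar>U i y - U i x\<bar>)" by (rule sum_abs)
   also have "\<dots> \<le> (\<Sum>i\<in>X - {k}. hdist x y)"
    using X U(1) x y tightf_lip_abs[of _ y x] by (intro sum_mono) (auto simp: hdist_commute)
   also have "\<dots> = (real n - 1) * hdist x y" using X k n by (simp add: n_def of_nat_diff)
   finally show ?thesis using n by (simp add: field_simps)
  qed
  thus ?thesis using that[of u "1/n" rho] u rho(1) n by simp
 qed
qed

text \<open>Otherwise some tight function would have slope at most \<open>1 - eta\<close>
  everywhere, and every return would be longer by the factor \<open>1 / (1 - eta)\<close> than the
  infimum \<open>kap\<close> permits.\<close>

lemma Aub_nonempty: "Aub \<noteq> {}"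
proof
 assume empty: "Aub = {}"
 obtain u eta rho where u: "u \<in> tightf" "0 < eta" "eta \<le> 1" "0 < rho"
  "\<And>x y. x \<in> UH ==> y \<in> UH ==> hdist x y < rho ==> \<bar>u y - u x\<bar> \<le> (1 - eta) * hdist x y"
  using strict_outside_Aub[of 1] empty by (metis empty_iff zero_less_one)
 have glob: "u w - u z \<le> (1 - eta) * hdist z w" if zw: "z \<in> UH" "w \<in> UH" for z w
 proof -
  obtain g where g: "det g = 1" "pt g = z" "geo g (hdist z w) = w" using pair_frame zw by blast
  have "u (geo g (hdist z w)) - u (geo g 0) \<le> (1 - eta) * hdist z w"
  proof (rule lipschitz_chain[OF u(4)])
   fix s t :: real assume st: "0 \<le> s" "s \<le> t" "t \<le> hdist z w" "t - s < rho"
   show "u (geo g t) - u (geo g s) \<le> (1 - eta) * (t - s)"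
    using u(5)[of "geo g s" "geo g t"] g st by (simp add: hdist_geo det_mult1)
  qed (use zw in auto)
  thus ?thesis using g by simp
 qed
 have bound: "kap * phi A \<le> (1 - eta) * hdist z (act A z)" if "A \<in> G" "z \<in> UH" for A z
  using glob[of z "act A z"] that tightf_act[OF u(1) that] by simp
 obtain A where A: "A \<in> G" "phi A \<ge> 1" using ex_phi_pos .
 have "eta < 1"
 proof (rule ccontr)
  assume "\<not> eta < 1"
  hence "kap * phi A \<le> 0" using bound[OF A(1) i_UH] u by simp
  thus False using kap_pos A by (simp add: mult_le_0_iff)
 qed
 hence "kap / (1 - eta) > kap" using kap_pos u by (simp add: field_simps)
 then obtain B z where "B \<in> G" "phi B \<ge> 1" "z \<in> UH" "hdist z (act B z) < kap / (1 - eta) * phi B"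
  using kap_approx by metis
 thus False using bound[of B z] \<open>eta < 1\<close> by (simp add: field_simps)
qed

end

section \<open>Leaves\<close>

context zcover
begin

lemma tightf_tendsto:
 assumes "u \<in> tightf" "(f \<longlongrightarrow> z) F" "z \<in> UH" "\<And>x. f x \<in> UH"
 shows "((\<lambda>x. u (f x)) \<longlongrightarrow> u z) F"
proof -
 have "((\<lambda>x. hdist (f x) z) \<longlongrightarrow> hdist z z) F" using assms by (intro tendsto_hdist tendsto_const)
 hence 0: "((\<lambda>x. hdist (f x) z) \<longlongrightarrow> 0) F" by simp
 have "((\<lambda>x. u (f x) - u z) \<longlongrightarrow> 0) F"
  by (rule Lim_null_comparison[OF always_eventually 0]) (use assms in \<open>simp add: tightf_lip_abs\<close>)
 thus ?thesis by (simp add: LIM_zero_iff)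
qed

text \<open>The curves calibrated by all tight functions at once. Frames are used instead of point
  sets because a leaf then carries the orientation in which these functions increase.\<close>

definition leafs :: "(real^2^2) set" where
 "leafs = {g. det g = 1 \<and> (\<forall>t. geo g t \<in> Aub) \<and> (\<forall>u\<in>tightf. \<forall>t. u (geo g t) = u (pt g) + t)}"

lemma leafs_det [simp]: "g \<in> leafs ==> det g = 1" unfolding leafs_def by blast
lemma leafs_Aub: "g \<in> leafs ==> geo g t \<in> Aub" unfolding leafs_def by blast
lemma leafs_Aub0: "g \<in> leafs ==> pt g \<in> Aub" using leafs_Aub[of g 0] by simp
lemma leafs_tight: "g \<in> leafs ==> u \<in> tightf ==> u (geo g t) = u (pt g) + t" unfolding leafs_def by blast

lemma leafsI:
 assumes "det g = 1" "\<And>t. geo g t \<in> Aub" "\<And>u t. u \<in> tightf ==> u (geo g t) = u (pt g) + t"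
 shows "g \<in> leafs"
 unfolding leafs_def using assms by blast

lemma leafs_dg [simp]: assumes g: "g \<in> leafs" shows "g ** dg s \<in> leafs"
proof (rule leafsI)
 have eq: "g ** dg s ** dg t = g ** dg (s + t)" for t by (simp add: dg_add flip: matrix_mul_assoc)
 show "pt (g ** dg s ** dg t) \<in> Aub" for t unfolding eq by (rule leafs_Aub[OF g])
 show "u (pt (g ** dg s ** dg t)) = u (geo g s) + t" if "u \<in> tightf" for u t
  unfolding eq leafs_tight[OF g that] by simp
qed (use g in \<open>simp add: det_mult1\<close>)

lemma mult_uminus2: "A ** - B = - (A ** B)" "- A ** B = - (A ** B)" for A B :: "real^2^2"
 by (cases A rule: mk_cases; cases B rule: mk_cases; simp)+

lemma leafs_uminus [simp]: assumes g: "g \<in> leafs" shows "- g \<in> leafs"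
proof (rule leafsI)
 show "det (- g) = 1" using leafs_det[OF g] by (cases g rule: mk_cases) simp
 show "pt (- g ** dg t) \<in> Aub" for t using leafs_Aub[OF g] by (simp add: mult_uminus2)
 show "u (pt (- g ** dg t)) = u (pt (- g)) + t" if "u \<in> tightf" for u t
  using leafs_tight[OF g that] by (simp add: mult_uminus2)
qed

lemma leafs_G: assumes g: "g \<in> leafs" and A: "A \<in> G" shows "A ** g \<in> leafs"
proof (rule leafsI)
 have eq: "pt (A ** g ** dg t) = act A (geo g t)" for t
  using g A by (simp add: act_pt det_mult1 matrix_mul_assoc)
 have eq0: "pt (A ** g) = act A (pt g)" using eq[of 0] by simp
 show "det (A ** g) = 1" using g A by (simp add: det_mult1)
 show "pt (A ** g ** dg t) \<in> Aub" for t unfolding eq by (rule Aub_act[OF leafs_Aub[OF g] A])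
 show "u (pt (A ** g ** dg t)) = u (pt (A ** g)) + t" if u: "u \<in> tightf" for u t
  using g A leafs_tight[OF g u, of t] by (simp add: eq eq0 tightf_act[OF u A] det_mult1)
qed

section \<open>Exchanging the halves of two leaves\<close>

lemma cosh_sum_ge:
 fixes x y :: real assumes "x + y \<ge> 4" shows "cosh x + cosh y \<ge> 2 * cosh ((x + y) / 2)" "cosh ((x + y) / 2) \<ge> cosh 2"
proof -
 have "cosh ((x+y)/2 + (x-y)/2) + cosh ((x+y)/2 - (x-y)/2) = 2 * cosh ((x+y)/2) * cosh ((x-y)/2)"
  by (simp only: cosh_add cosh_diff)
 moreover have "(x+y)/2 + (x-y)/2 = x" "(x+y)/2 - (x-y)/2 = y" by (simp_all add: field_simps)
 ultimately have "cosh x + cosh y = 2 * cosh ((x+y)/2) * cosh ((x-y)/2)" by simp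
 moreover have "cosh ((x+y)/2) * 1 \<le> cosh ((x+y)/2) * cosh ((x-y)/2)"
  by (intro mult_left_mono cosh_real_ge_1 cosh_real_nonneg)
 ultimately show "cosh x + cosh y \<ge> 2 * cosh ((x + y) / 2)" by simp
 show "cosh ((x + y) / 2) \<ge> cosh 2" using assms by (simp add: cosh_real_nonneg_le_iff)
qed

text \<open>Mather's exchange: follow one leaf until time -1 and the other from time 1 on, and vice
  versa. A tight function gains exactly 4 on the two crossed segments together, so they cannot be
  shorter than 4.\<close>

lemma leafs_cross:
 assumes g: "g \<in> leafs" and h: "h \<in> leafs" and k: "adj g ** h = mk a b c d"
 defines "D1 \<equiv> hdist (geo g (-1)) (geo h 1)"
  and "D2 \<equiv> hdist (geo h (-1)) (geo g 1)"
  and "dlt \<equiv> cosh (hdist (pt g) (pt h)) - 1"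
 shows "D1 + D2 \<ge> 4" "cosh D1 + cosh D2 = (2 + 2 * dlt - (b\<^sup>2 + c\<^sup>2)) * cosh 2 + (b\<^sup>2 + c\<^sup>2)"
proof -
 obtain u where u: "u \<in> tightf" using tightf_nonempty by blast
 have "u (geo h 1) - u (geo g (-1)) \<le> D1"
  using tightf_lip[OF u, of "geo h 1" "geo g (-1)"] g h by (simp add: D1_def hdist_commute det_mult1)
 moreover have "u (geo g 1) - u (geo h (-1)) \<le> D2"
  using tightf_lip[OF u, of "geo g 1" "geo h (-1)"] g h by (simp add: D2_def hdist_commute det_mult1)
 ultimately show "D1 + D2 \<ge> 4" using leafs_tight[OF g u, of 1] leafs_tight[OF g u, of "-1"] leafs_tight[OF h u, of 1] leafs_tight[OF h u, of "-1"] by simp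
 have 1: "cosh D1 = (a\<^sup>2 * exp 2 + b\<^sup>2 + c\<^sup>2 + d\<^sup>2 * exp (-2)) / 2"
  using cosh_hdist_geo[OF leafs_det[OF g] leafs_det[OF h] k, of "-1" 1] by (simp add: D1_def)
 have 2: "cosh D2 = (a\<^sup>2 * exp (-2) + b\<^sup>2 + c\<^sup>2 + d\<^sup>2 * exp 2) / 2"
  using cosh_hdist_geo[OF leafs_det[OF g] leafs_det[OF h] k, of 1 "-1"] by (simp add: D2_def hdist_commute)
 have 3: "1 + dlt = (a\<^sup>2 + b\<^sup>2 + c\<^sup>2 + d\<^sup>2) / 2"
  using cosh_hdist_geo[OF leafs_det[OF g] leafs_det[OF h] k, of 0 0] by (simp add: dlt_def)
 have 4: "2 + 2 * dlt - (b\<^sup>2 + c\<^sup>2) = a\<^sup>2 + d\<^sup>2" using 3 by simp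
 show "cosh D1 + cosh D2 = (2 + 2 * dlt - (b\<^sup>2 + c\<^sup>2)) * cosh 2 + (b\<^sup>2 + c\<^sup>2)"
  unfolding 4 1 2 by (simp add: cosh_def field_simps)
qed

lemma cosh2_gt1: "cosh (2::real) > 1"
 using cosh_real_strict_mono[of 0 2] by simp

definition cK :: real where "cK = 2 * cosh 2 / (cosh 2 - 1)"

lemma cK_pos: "cK > 0" using cosh2_gt1 by (simp add: cK_def)

text \<open>Convexity of \<open>cosh\<close> turns \<open>D1 + D2 \<ge> 4\<close> into a linear
  inequality for \<open>b\<^sup>2 + c\<^sup>2\<close>, and solving it produces \<open>cK\<close>.
  Leaves through nearby points are thus nearly parallel, the analogue of Mather's Lipschitz graph
  theorem.\<close>

lemma leafs_rel_bound:
 assumes g: "g \<in> leafs" and h: "h \<in> leafs" and k: "adj g ** h = mk a b c d"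
 shows "b\<^sup>2 + c\<^sup>2 \<le> cK * (cosh (hdist (pt g) (pt h)) - 1)"
  and "(a - d)\<^sup>2 \<le> 2 * (cosh (hdist (pt g) (pt h)) - 1)"
proof -
 let ?dlt = "cosh (hdist (pt g) (pt h)) - 1"
 have "2 * cosh 2 \<le> (2 + 2 * ?dlt - (b\<^sup>2 + c\<^sup>2)) * cosh 2 + (b\<^sup>2 + c\<^sup>2)"
  using leafs_cross[OF g h k] cosh_sum_ge[OF leafs_cross(1)[OF g h k]] by linarith
 hence "(b\<^sup>2 + c\<^sup>2) * (cosh 2 - 1) \<le> 2 * cosh 2 * ?dlt" by (simp add: algebra_simps)
 thus "b\<^sup>2 + c\<^sup>2 \<le> cK * ?dlt" using cosh2_gt1 by (simp add: cK_def field_simps)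
 have det: "a*d - b*c = 1" using det_mult1[of "adj g" h] g h k by simp
 have "1 + ?dlt = (a\<^sup>2 + b\<^sup>2 + c\<^sup>2 + d\<^sup>2) / 2"
  using cosh_hdist_geo[OF leafs_det[OF g] leafs_det[OF h] k, of 0 0] by simp
 hence "(a-d)\<^sup>2 + (b+c)\<^sup>2 = 2 * ?dlt" using det by (simp add: power2_eq_square algebra_simps)
 thus "(a-d)\<^sup>2 \<le> 2 * ?dlt" by (smt (verit) zero_le_power2)
qed

lemma leafs_unique:
 assumes "g \<in> leafs" "h \<in> leafs" "pt g = pt h"
 shows "h = g \<or> h = - g"
proof -
 obtain a b c d where k: "adj g ** h = mk a b c d" by (rule mk_cases)
 have hk: "h = g ** mk a b c d" using adj_cancel(2)[of g h] assms k by simp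
 have det: "a*d - b*c = 1" using det_mult1[of "adj g" h] assms k by simp
 have "b\<^sup>2 + c\<^sup>2 \<le> 0" "(a-d)\<^sup>2 \<le> 0" using leafs_rel_bound[OF assms(1,2) k] assms by auto
 hence "b = 0" "c = 0" "a = d" by (auto simp: sum_power2_le_zero_iff)
 moreover hence "a = 1 \<or> a = -1" using det by (auto simp: square_eq_1_iff)
 ultimately have "mk a b c d = mat 1 \<or> mk a b c d = - mat 1" by (auto simp: mat_one_mk)
 thus ?thesis using hk by (auto simp: mult_uminus2)
qed

lemma leafs_closed:
 assumes "\<And>n::nat. X n \<in> leafs" "X \<longlonglongrightarrow> g" shows "g \<in> leafs"
proof -
 have "(\<lambda>n. det (X n)) \<longlonglongrightarrow> det g" using assms by (intro tendsto_intros)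
 hence d: "det g = 1" using assms by (simp add: LIMSEQ_const_iff)
 have lim: "(\<lambda>n. geo (X n) t) \<longlonglongrightarrow> geo g t" for t
  using assms d by (intro tendsto_pt tendsto_intros) (auto simp: det_mult1)
 have "geo g t \<in> Aub" for t
  by (rule Aub_closed_seq[OF _ lim]) (use assms leafs_Aub d in \<open>auto simp: det_mult1\<close>)
 moreover have "u (geo g t) = u (pt g) + t" if u: "u \<in> tightf" for u t
 proof -
  have l: "(\<lambda>n. u (geo (X n) t)) \<longlonglongrightarrow> u (geo g t)" for t
   by (rule tightf_tendsto[OF u lim]) (use d assms in \<open>auto simp: det_mult1\<close>)
  have "(\<lambda>n. u (geo (X n) 0) + t) \<longlonglongrightarrow> u (geo g 0) + t" by (intro tendsto_intros l)
  moreover have "(\<lambda>n. u (geo (X n) 0) + t) = (\<lambda>n. u (geo (X n) t))"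
   using leafs_tight[OF assms(1) u] by auto
  ultimately show ?thesis using LIMSEQ_unique[OF l] by simp
 qed
 ultimately show ?thesis using d by (intro leafsI)
qed

text \<open>From \<open>geo g t\<close> one can continue to a translate of the starting point so
  that the whole loop exceeds \<open>kap * phi A\<close> by at most \<open>e\<close>. This is
  recurrence of the leaf measured by action instead of by distance.\<close>

definition chainrec :: "real^2^2 \<Rightarrow> real \<Rightarrow> bool" where
 "chainrec g t \<longleftrightarrow> (\<forall>e>0. \<exists>A\<in>G. phi A \<ge> 1 \<and> hdist (geo g t) (act A (pt g)) \<le> kap * phi A - t + e)"

text \<open>The sign change reverses the orientation of leaves and exchanges the two ends of the
  cover. It supplies the backward rays here and the second family of horocycles at the end.\<close>

lemma neg: "zcover G (\<lambda>A. - phi A)"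
 by unfold_locales (use phi_nontrivial cobounded discrete free in \<open>auto simp: phi_mult\<close>)

lemma hdist_adj_self: "A \<in> G ==> z \<in> UH ==> hdist z (act (adj A) z) = hdist z (act A z)"
 using hdist_act_adj[of A z z] by (simp add: hdist_commute)

lemma neg_kap: "zcover.kap G (\<lambda>A. - phi A) = kap"
proof -
 have "(\<lambda>(A, z). hdist z (act A z) / of_int (- phi A)) ` ({A \<in> G. - phi A \<ge> 1} \<times> UH) = (\<lambda>(A, z). hdist z (act A z) / phi A) ` ({A \<in> G. phi A \<ge> 1} \<times> UH)"
  (is "?l ` ?X = ?r ` ?Y")
 proof (intro equalityI subsetI)
  fix y assume "y \<in> ?l ` ?X"
  then obtain A z where "A \<in> G" "- phi A \<ge> 1" "z \<in> UH" "y = hdist z (act A z) / of_int (- phi A)" by auto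
  thus "y \<in> ?r ` ?Y" by (intro image_eqI[of _ _ "(adj A, z)"]) (auto simp: phi_adj hdist_adj_self)
 next
  fix y assume "y \<in> ?r ` ?Y"
  then obtain A z where "A \<in> G" "phi A \<ge> 1" "z \<in> UH" "y = hdist z (act A z) / phi A" by auto
  thus "y \<in> ?l ` ?X" by (intro image_eqI[of _ _ "(adj A, z)"]) (auto simp: phi_adj hdist_adj_self)
 qed
 thus ?thesis unfolding zcover.kap_def[OF neg] kap_def by simp
qed

lemma neg_Aub: "zcover.Aub G (\<lambda>A. - phi A) = Aub"
proof -
 have "(\<exists>A\<in>G. - phi A \<ge> 1 \<and> hdist z (act A z) < kap * of_int (- phi A) + e) \<longleftrightarrow> (\<exists>A\<in>G. phi A \<ge> 1 \<and> hdist z (act A z) < kap * phi A + e)"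
  if z: "z \<in> UH" for z e
 proof
  assume "\<exists>A\<in>G. - phi A \<ge> 1 \<and> hdist z (act A z) < kap * of_int (- phi A) + e"
  then obtain A where "A \<in> G" "- phi A \<ge> 1" "hdist z (act A z) < kap * of_int (- phi A) + e" by blast
  thus "\<exists>A\<in>G. phi A \<ge> 1 \<and> hdist z (act A z) < kap * phi A + e" using z by (intro bexI[of _ "adj A"]) (auto simp: phi_adj hdist_adj_self)
 next
  assume "\<exists>A\<in>G. phi A \<ge> 1 \<and> hdist z (act A z) < kap * phi A + e"
  then obtain A where "A \<in> G" "phi A \<ge> 1" "hdist z (act A z) < kap * phi A + e" by blast
  thus "\<exists>A\<in>G. - phi A \<ge> 1 \<and> hdist z (act A z) < kap * of_int (- phi A) + e" using z by (intro bexI[of _ "adj A"]) (auto simp: phi_adj hdist_adj_self)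
 qed
 thus ?thesis unfolding zcover.Aub_def[OF neg] Aub_def neg_kap by blast
qed

lemma neg_tightf: "u \<in> zcover.tightf G (\<lambda>A. - phi A) \<longleftrightarrow> (\<lambda>z. - u z) \<in> tightf"
proof -
 have "(\<forall>z\<in>UH. \<forall>w\<in>UH. u z - u w \<le> hdist z w) \<longleftrightarrow> (\<forall>z\<in>UH. \<forall>w\<in>UH. - u z - - u w \<le> hdist z w)"
  by (metis hdist_commute minus_diff_commute minus_diff_minus minus_minus)
 moreover have "u (act A z) = u z + kap * of_int (- phi A) \<longleftrightarrow> - u (act A z) = - u z + kap * phi A" for A z by (simp add: algebra_simps) argo
 ultimately show ?thesis unfolding zcover.tightf_def[OF neg] tightf_def neg_kap by simp
qed

text \<open>The ray is a limit of geodesics from \<open>z\<close> to translates that are almost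
  optimal and arbitrarily far away. Nearly optimal segments pass on both the recurrence and, through
  it, the unit growth of every tight function.\<close>

lemma ex_forward_ray:
 assumes z: "z \<in> Aub"
 shows "\<exists>g. det g = 1 \<and> pt g = z \<and> (\<forall>t\<ge>0. chainrec g t \<and> geo g t \<in> Aub \<and> (\<forall>u\<in>tightf. u (geo g t) = u z + t))"
proof -
 have zU: "z \<in> UH" using z by simp
 have "\<exists>A. A \<in> G \<and> phi A \<ge> int (n + 1) \<and> hdist z (act A z) \<le> kap * phi A + 1 / (n + 1)" for n :: nat
 proof -
  \<comment> \<open>The error is quadratically small because the power \<open>n + 1\<close> taken
    next, which makes the segment long, multiplies it by \<open>n + 1\<close>.\<close>
  have "0 < 1 / (real n + 1)^2" by simp
  then obtain B where B: "B \<in> G" "phi B \<ge> 1" "hdist z (act B z) < kap * phi B + 1 / (real n + 1)^2"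
   using AubE[OF z] by blast
  let ?A = "mpow B (n + 1)"
  have "hdist z (act ?A z) \<le> (real n + 1) * hdist z (act B z)"
   using hdist_mpow[OF B(1) zU, of "n+1"] by (simp add: add.commute)
  also have "\<dots> \<le> (real n + 1) * (kap * phi B + 1 / (real n + 1)^2)" using B by (intro mult_left_mono) auto
  also have "\<dots> = kap * phi ?A + 1 / (real n + 1)"
  proof -
   have "N * (kap * x + 1 / N^2) = kap * (N * x) + 1 / N" if "N > 0" for N x :: real
    using that by (simp add: field_simps power2_eq_square)
   from this[of "real n + 1" "phi B"] show ?thesis
    by (simp only: phi_mpow[OF B(1)] of_int_mult of_int_of_nat_eq) (simp add: algebra_simps)
  qed
  finally have "hdist z (act ?A z) \<le> kap * phi ?A + 1 / (n + 1)" by (simp add: add.commute)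
  moreover have "phi ?A \<ge> int (n + 1)" using B(2) mult_left_mono[OF B(2), of "int (n + 1)"] by (simp only: phi_mpow[OF B(1)]) simp
  ultimately show ?thesis using B mpow_G by blast
 qed
 then obtain A0 where A0: "\<And>n. A0 n \<in> G" "\<And>n. phi (A0 n) \<ge> int (n + 1)"
  "\<And>n. hdist z (act (A0 n) z) \<le> kap * phi (A0 n) + 1 / (real n + 1)" by (simp add: add.commute) metis
 have "\<exists>g. det g = 1 \<and> pt g = z \<and> geo g (hdist z (act (A0 n) z)) = act (A0 n) z" for n
  using pair_frame[OF zU, of "act (A0 n) z"] A0(1) zU by (metis act_G_UH)
 then obtain X0 :: "nat \<Rightarrow> real^2^2" where X0: "\<And>n. det (X0 n) = 1" "\<And>n. pt (X0 n) = z" "\<And>n. geo (X0 n) (hdist z (act (A0 n) z)) = act (A0 n) z"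
  by metis
 obtain r g where r: "strict_mono r" "det g = 1" "(X0 \<circ> r) \<longlonglongrightarrow> g"
  using frames_compact[of X0 "hdist \<i> z"] X0 by (metis order_refl)
 define A where "A n = A0 (r n)" for n
 define X where "X n = X0 (r n)" for n
 define D where "D n = hdist z (act (A n) z)" for n
 have rn: "r n \<ge> n" for n using r(1) by (rule seq_suble)
 have A: "A n \<in> G" "phi (A n) \<ge> int (n + 1)" "phi (A n) \<ge> 1" for n
  using A0(1,2)[of "r n"] rn[of n] by (auto simp: A_def)
 have D: "D n \<le> kap * phi (A n) + 1 / (real n + 1)" for n
 proof -
  have "1 / (real (r n) + 1) \<le> 1 / (real n + 1)" using rn[of n] by (simp add: field_simps)
  thus ?thesis using A0(3)[of "r n"] by (simp add: D_def A_def)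
 qed
 have Dge: "D n \<ge> kap * (real n + 1)" for n
 proof -
  have "kap * (real n + 1) \<le> kap * phi (A n)" using A(2)[of n] kap_pos by (intro mult_left_mono) auto
  thus ?thesis using kap_le[OF A(1) zU, of n] by (simp add: D_def)
 qed
 have X: "det (X n) = 1" "pt (X n) = z" "geo (X n) (D n) = act (A n) z" for n
  using X0 by (auto simp: X_def D_def A_def)
 have Xlim: "X \<longlonglongrightarrow> g" using r(3) by (simp add: X_def[abs_def] o_def)
 have lim: "(\<lambda>n. geo (X n) t) \<longlonglongrightarrow> geo g t" for t
  using Xlim r(2) by (intro tendsto_pt tendsto_intros) (auto simp: det_mult1)
 have pg: "pt g = z" using lim[of 0] X(2) by (simp add: LIMSEQ_const_iff)
 have pU: "geo g t \<in> UH" for t using r by (simp add: det_mult1)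
 have pXU: "geo (X n) t \<in> UH" for n t using X by (simp add: det_mult1)
 have inv0: "(\<lambda>n. 1 / (real n + 1)) \<longlonglongrightarrow> 0" using LIMSEQ_inverse_real_of_nat by (simp add: inverse_eq_divide add.commute)
 have cr: "chainrec g t" if t: "t \<ge> 0" for t
  unfolding chainrec_def
 proof (intro allI impI)
  fix e :: real assume e: "e > 0"
  have "(\<lambda>n. hdist (geo g t) (geo (X n) t) + 1 / (real n + 1)) \<longlonglongrightarrow> hdist (geo g t) (geo g t) + 0"
   by (intro tendsto_add tendsto_hdist tendsto_const lim pU inv0)
  hence ev1: "\<forall>\<^sub>F n in sequentially. hdist (geo g t) (geo (X n) t) + 1 / (real n + 1) < e"
   using e by (intro order_tendstoD(2)) auto
  obtain N :: nat where "N * kap > t" using reals_Archimedean3[OF kap_pos] by blast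
  with ev1 eventually_ge_at_top[of N] obtain n where n: "hdist (geo g t) (geo (X n) t) + 1 / (real n + 1) < e" "n \<ge> N"
   using eventually_conj[OF ev1 eventually_ge_at_top[of N]] eventually_sequentially by auto
  have "t \<le> N * kap" using \<open>N * kap > t\<close> by simp
  also have "\<dots> \<le> kap * (real n + 1)" using n kap_pos by (simp add: mult.commute)
  also have "\<dots> \<le> D n" by (rule Dge)
  finally have "hdist (geo (X n) t) (act (A n) z) = D n - t"
   using hdist_geo[OF X(1), of n t "D n"] X by simp
  hence "hdist (geo g t) (act (A n) z) \<le> kap * phi (A n) - t + e"
   using hdist_triangle[OF pU pXU, of "act (A n) z" t n t] n D[of n] A zU by simp
  thus "\<exists>A\<in>G. phi A \<ge> 1 \<and> hdist (geo g t) (act A (pt g)) \<le> kap * phi A - t + e"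
   using A pg by blast
 qed
 have fwd: "u (geo g t) = u z + t" if u: "u \<in> tightf" and t: "t \<ge> 0" for u t
 proof (rule antisym)
  show "u (geo g t) \<le> u z + t"
   using tightf_lip[OF u pU zU, of t] hdist_geo[OF r(2), of t 0] pg t by simp
  show "u z + t \<le> u (geo g t)"
  proof (rule field_le_epsilon)
   fix e :: real assume "e > 0"
   then obtain B where B: "B \<in> G" "hdist (geo g t) (act B z) \<le> kap * phi B - t + e"
    using cr[OF t] pg unfolding chainrec_def by blast
   thus "u z + t \<le> u (geo g t) + e"
    using tightf_lip[OF u _ pU, of "act B z" t] tightf_act[OF u B(1) zU] zU by (simp add: hdist_commute)
  qed
 qed
 have fwdA: "geo g t \<in> Aub" if t: "t \<ge> 0" for t
 proof (rule AubI[OF pU])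
  fix e :: real assume "e > 0"
  hence "e/2 > 0" by simp
  then obtain B where B: "B \<in> G" "phi B \<ge> 1" "hdist (geo g t) (act B z) \<le> kap * phi B - t + e/2"
   using cr[OF t] pg unfolding chainrec_def by blast
  have "hdist (act B z) (act B (geo g t)) = t"
   using hdist_act_G[OF B(1) zU pU] hdist_geo[OF r(2), of 0 t] pg t by simp
  hence "hdist (geo g t) (act B (geo g t)) < kap * phi B + e"
   using hdist_triangle[OF pU, of "act B z" "act B (geo g t)" t] B zU pU \<open>e > 0\<close> by simp
  thus "\<exists>A\<in>G. phi A \<ge> 1 \<and> hdist (geo g t) (act A (geo g t)) < kap * phi A + e"
   using B by blast
 qed
 show ?thesis using r(2) pg cr fwd fwdA by blast
qed

text \<open>Replacing \<open>phi\<close> by \<open>- phi\<close> turns a forward ray into a backward one.\<close>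

lemma ex_leaf_chainrec:
 assumes z: "z \<in> Aub"
 shows "\<exists>g\<in>leafs. pt g = z \<and> (\<forall>t\<ge>0. chainrec g t)"
proof -
 have zU: "z \<in> UH" using z by simp
 obtain g where g: "det g = 1" "pt g = z" and fwd: "\<And>t. t \<ge> 0 ==> chainrec g t" "\<And>t. t \<ge> 0 ==> geo g t \<in> Aub"
  "\<And>u t. u \<in> tightf ==> t \<ge> 0 ==> u (geo g t) = u z + t" using ex_forward_ray[OF z] by blast
 obtain h where h: "det h = 1" "pt h = z" and bwd: "\<And>t. t \<ge> 0 ==> geo h t \<in> Aub"
  "\<And>u t. (\<lambda>x. - u x) \<in> tightf ==> t \<ge> 0 ==> u (geo h t) = u z + t"
  using zcover.ex_forward_ray[OF neg, unfolded neg_Aub, OF z] neg_tightf by blast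
 have bwd': "u (geo h s) = u z - s" if "u \<in> tightf" "s \<ge> 0" for u s
  using bwd(2)[of "\<lambda>x. - u x" s] that by simp
 have U: "geo g t \<in> UH" "geo h t \<in> UH" for t using g h by (simp_all add: det_mult1)
 obtain u where u: "u \<in> tightf" using tightf_nonempty by blast
 \<comment> \<open>A tight function gains \<open>s + 1\<close> between the two outer points, so the
   path through \<open>z\<close> is already shortest and has no corner.\<close>
 have eq: "geo h s = geo g (- s)" if s: "s \<ge> 0" for s
 proof (rule geo_extend_unique[OF g(1) U(2), of 1])
  show hz: "hdist (geo h s) (pt g) = s" using hdist_geo[OF h(1), of s 0] g h s by simp
  have "s + 1 \<le> hdist (geo h s) (geo g 1)"
   using tightf_lip[OF u U(1,2), of 1 s] bwd'[OF u s] fwd(3)[OF u, of 1] by (simp add: hdist_commute)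
  moreover have "hdist (geo h s) (geo g 1) \<le> s + 1"
   using hdist_triangle[OF U(2) zU U(1), of s 1] hz hdist_geo[OF g(1), of 0 1] g by simp
  ultimately show "hdist (geo h s) (geo g 1) = s + 1" by simp
 qed (use s in auto)
 have "g \<in> leafs"
 proof (rule leafsI)
  show "det g = 1" by (rule g)
  show "geo g t \<in> Aub" for t using fwd(2)[of t] bwd(1)[of "- t"] eq[of "- t"] by (cases "t \<ge> 0") auto
  show "u (geo g t) = u (pt g) + t" if "u \<in> tightf" for u t
   using fwd(3)[OF that, of t] bwd'[OF that, of "- t"] eq[of "- t"] g by (cases "t \<ge> 0") auto
 qed
 thus ?thesis using g fwd(1) by blast
qed

lemma leafs_chainrec: assumes "g \<in> leafs" "t \<ge> 0" shows "chainrec g t"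
proof -
 obtain h where h: "h \<in> leafs" "pt h = pt g" "\<forall>t\<ge>0. chainrec h t" using ex_leaf_chainrec[OF leafs_Aub0[OF assms(1)]] by blast
 hence "g = h \<or> g = - h" using leafs_unique[of h g] assms by simp
 moreover have "chainrec (- h) t = chainrec h t" by (simp add: chainrec_def mult_uminus2)
 ultimately show ?thesis using h assms by auto
qed

lemma ex_leaf: "z \<in> Aub ==> \<exists>g\<in>leafs. pt g = z"
 using ex_leaf_chainrec by blast

text \<open>The sign of \<open>a * b * c * d\<close> records whether the endpoints interlace.\<close>

lemma leafs_no_cross:
 assumes g: "g \<in> leafs" and h: "h \<in> leafs" and k: "adj g ** h = mk a b c d"
 shows "(a * c) * (b * d) \<ge> 0"
proof (rule ccontr)
 assume neg: "\<not> ?thesis"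
 have det: "a*d - b*c = 1" using det_mult1[of "adj g" h] g h k by simp
 have nz: "a * c \<noteq> 0" "b * d \<noteq> 0" "- (b*d) / (a*c) > 0"
 proof -
  have "P \<noteq> 0 \<and> Q \<noteq> 0 \<and> - Q / P > 0" if "\<not> P * Q \<ge> 0" for P Q :: real
   using that by (auto simp: not_le mult_less_0_iff zero_less_divide_iff divide_less_0_iff)
  from this[OF neg] show "a * c \<noteq> 0" "b * d \<noteq> 0" "- (b*d) / (a*c) > 0" by blast+
 qed
 \<comment> \<open>The real part of \<open>pt (mk a b c d ** dg t)\<close> is proportional to
   \<open>a*c * exp t + b*d * exp (- t)\<close>. This \<open>t\<close> makes it vanish and puts a
   point of the second leaf on the first, against \<open>leafs_unique\<close>.\<close>
 define t where "t = ln (- (b*d) / (a*c)) / 2"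
 have "exp t * exp t = - (b*d) / (a*c)" using nz by (simp add: t_def flip: exp_add)
 hence e: "a*c * exp t + b*d * exp (-t) = 0" using nz by (simp add: exp_minus field_simps)
 have hk: "h = g ** mk a b c d" using adj_cancel(2)[of g h] g k by simp
 have kd: "mk a b c d ** dg t = mk (a * exp (t/2)) (b * exp (-t/2)) (c * exp (t/2)) (d * exp (-t/2))"
  by (simp add: dg_def)
 have det2: "(a * exp (t/2)) * (d * exp (-t/2)) - (b * exp (-t/2)) * (c * exp (t/2)) = 1"
  using det by (simp add: exp_minus field_simps)
 have ex: "exp (t/2) * exp (t/2) = exp t" "exp (-t/2) * exp (-t/2) = exp (-t)" by (simp_all flip: exp_add)
 have "(a * exp (t/2)) * (c * exp (t/2)) + (b * exp (-t/2)) * (d * exp (-t/2)) = a*c * (exp (t/2) * exp (t/2)) + b*d * (exp (-t/2) * exp (-t/2))"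
  by (simp add: algebra_simps)
 also have "\<dots> = 0" unfolding ex by (rule e)
 finally have re: "Re (pt (mk a b c d ** dg t)) = 0" unfolding kd using pt_mk[OF det2] by simp
 have "pt (mk a b c d ** dg t) \<in> UH" using det by (simp add: det_mult1)
 then obtain s where s: "pt (mk a b c d ** dg t) = pt (dg s)"
  using re by (intro that[of "ln (Im (pt (mk a b c d ** dg t)))"]) (simp add: pt_dg complex_eq_iff UH_iff)
 have "geo h t = act g (pt (mk a b c d ** dg t))" using hk g det by (simp add: act_pt det_mult1 matrix_mul_assoc)
 also have "\<dots> = geo g s" using s g by (simp add: act_pt)
 finally have "h ** dg t = g ** dg s \<or> h ** dg t = - (g ** dg s)"
  using leafs_unique[of "g ** dg s" "h ** dg t"] g h by simp
 hence "adj g ** (h ** dg t) = dg s \<or> adj g ** (h ** dg t) = - dg s"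
  using g by (auto simp: adj_cancel mult_uminus2)
 hence "mk a b c d ** dg t = dg s \<or> mk a b c d ** dg t = - dg s" using k by (simp add: matrix_mul_assoc)
 thus False using nz by (auto simp: kd) (auto simp: dg_def)
qed

end

section \<open>The excess of a subsolution\<close>

lemma compact_hcball: "compact {x \<in> UH. hdist \<i> x \<le> R}"
 unfolding compact_eq_seq_compact_metric seq_compact_def
proof (intro allI impI)
 fix f :: "nat \<Rightarrow> complex" assume f: "\<forall>n. f n \<in> {x \<in> UH. hdist \<i> x \<le> R}"
 hence "\<And>n. f n \<in> UH" "\<And>n. hdist \<i> (f n) \<le> R" by auto
 then obtain r z where r: "strict_mono r" "z \<in> UH" "(f \<circ> r) \<longlonglongrightarrow> z" by (rule UH_seq_compact)
 have "(\<lambda>n. hdist \<i> ((f \<circ> r) n)) \<longlonglongrightarrow> hdist \<i> z" by (rule tendsto_hdist[OF tendsto_const r(3) i_UH r(2)])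
 hence "hdist \<i> z \<le> R" by (rule LIMSEQ_le_const2) (use f in auto)
 thus "\<exists>l\<in>{x \<in> UH. hdist \<i> x \<le> R}. \<exists>r. strict_mono r \<and> (f \<circ> r) \<longlonglongrightarrow> l" using r by blast
qed

lemma finite_net:
 assumes "e > 0"
 obtains F where "finite F" "F \<subseteq> UH" "\<And>x. x \<in> UH ==> hdist \<i> x \<le> R ==> \<exists>f\<in>F. hdist f x < e"
proof -
 let ?K = "{x \<in> UH. hdist \<i> x \<le> R}"
 have "?K \<subseteq> (\<Union>x\<in>?K. hball x e)" using assms by (auto simp: hball_def)
 then obtain F where "F \<subseteq> ?K" "finite F" "?K \<subseteq> (\<Union>x\<in>F. hball x e)"
  using compactE_image[OF compact_hcball, of ?K "\<lambda>x. hball x e"] open_hball by (metis (no_types, lifting) mem_Collect_eq)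
 thus ?thesis using that[of F] by (auto simp: hball_def subset_iff)
qed

lemma sinh_ge_self: "x \<ge> 0 ==> sinh x \<ge> (x::real)"
proof -
 assume "x \<ge> 0"
 have "sinh 0 - 0 \<le> sinh x - (x::real)"
 proof (rule DERIV_nonneg_imp_nondecreasing[OF \<open>x \<ge> 0\<close>])
  fix y :: real
  show "\<exists>z. ((\<lambda>x. sinh x - x) has_real_derivative z) (at y) \<and> 0 \<le> z"
   by (rule exI[of _ "cosh y - 1"]) (auto intro!: derivative_eq_intros simp: cosh_real_ge_1)
 qed
 thus ?thesis by simp
qed

text \<open>Cut \<open>{0..B}\<close> into \<open>N\<close> cells: the image of each has length at
  most \<open>2 * \<bar>C\<bar> * (B/N)\<^sup>2\<close>, so the total length is of order
  \<open>1/N\<close>. No regularity of \<open>S\<close> enters.\<close>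

lemma quadratic_image_no_interval:
 fixes f :: "real \<Rightarrow> real"
 assumes S: "S \<subseteq> {0..B}" "B \<ge> 0" and f: "\<And>s t. s \<in> S ==> t \<in> S ==> \<bar>f s - f t\<bar> \<le> C * (s - t)\<^sup>2"
  and sub: "{alp..bet} \<subseteq> f ` S"
 shows "bet \<le> alp"
proof (rule ccontr)
 assume "\<not> bet \<le> alp"
 hence ab: "alp < bet" by simp
 have bound: "bet - alp \<le> 2 * \<bar>C\<bar> * B\<^sup>2 / N" if N: "N > 0" for N :: nat
 proof -
  define P where "P i = S \<inter> {real i * (B/N) .. real (Suc i) * (B/N)}" for i
  define c where "c i = f (SOME s. s \<in> P i)" for i
  define w where "w = \<bar>C\<bar> * (B/N)\<^sup>2"
  have w: "w \<ge> 0" by (simp add: w_def)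
  have cover: "f s \<in> (\<Union>i<N. {c i - w..c i + w})" if s: "s \<in> S" for s
  proof -
   obtain i where i: "i < N" "s \<in> P i"
   proof (cases "B = 0")
    case True thus ?thesis using that[of 0] s S N by (auto simp: P_def)
   next
    case False
    hence B: "B > 0" using S by simp
    define x where "x = s / (B/N)"
    have x: "0 \<le> x" "x \<le> N" using s S B N by (auto simp: x_def field_simps)
    have sx: "s = x * (B/N)" using B N by (simp add: x_def)
    \<comment> \<open>The floor alone would send the right endpoint \<open>x = N\<close> to a cell
      beyond the last one.\<close>
    define i where "i = (if x = N then N - 1 else nat \<lfloor>x\<rfloor>)"
    have "real i \<le> x \<and> x \<le> real (Suc i) \<and> i < N" using x N by (auto simp: i_def of_nat_diff) linarith+
    moreover from this have "real i * (B/N) \<le> x * (B/N)" "x * (B/N) \<le> real (Suc i) * (B/N)"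
     using B by (blast intro: mult_right_mono divide_nonneg_nonneg less_imp_le of_nat_0_le_iff)+
    ultimately have "i < N" "real i * (B/N) \<le> x * (B/N)" "x * (B/N) \<le> real (Suc i) * (B/N)"
     by blast+
    thus ?thesis using that[of i] s by (simp only: P_def sx Int_iff atLeastAtMost_iff simp_thms)
   qed
   define s' where "s' = (SOME s. s \<in> P i)"
   have s': "s' \<in> P i" unfolding s'_def using i by (rule_tac someI)
   have "real (Suc i) * (B/N) = real i * (B/N) + B/N" by (simp add: distrib_right add_divide_distrib)
   moreover have "real i * (B/N) \<le> s" "s \<le> real (Suc i) * (B/N)" "real i * (B/N) \<le> s'" "s' \<le> real (Suc i) * (B/N)"
    using i s' by (simp_all only: P_def Int_iff atLeastAtMost_iff)
   ultimately have "\<bar>s - s'\<bar> \<le> B/N" by linarith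
   hence "\<bar>s - s'\<bar>\<^sup>2 \<le> (B/N)\<^sup>2" by (intro power_mono) auto
   hence "(s - s')\<^sup>2 \<le> (B/N)\<^sup>2" by simp
   hence "\<bar>C\<bar> * (s - s')\<^sup>2 \<le> w" unfolding w_def by (intro mult_left_mono) auto
   moreover have "\<bar>f s - f s'\<bar> \<le> \<bar>C\<bar> * (s - s')\<^sup>2"
    using f[of s s'] s s' by (auto simp: P_def intro!: order_trans[OF _ mult_right_mono[of C "\<bar>C\<bar>"]])
   ultimately have "f s \<in> {c i - w..c i + w}" by (auto simp: c_def s'_def)
   thus ?thesis using i by blast
  qed
  have "{alp..bet} \<subseteq> (\<Union>i<N. {c i - w..c i + w})" using sub cover by blast
  hence "measure lborel {alp..bet} \<le> measure lborel (\<Union>i<N. {c i - w..c i + w})"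
  proof (rule measure_mono_fmeasurable)
   show "(\<Union>i<N. {c i - w..c i + w}) \<in> fmeasurable lborel"
    by (rule fmeasurable.finite_UN) (auto intro!: fmeasurableI simp: emeasure_lborel_Icc_eq)
  qed auto
  also have "\<dots> \<le> (\<Sum>i<N. measure lborel {c i - w..c i + w})"
   by (intro measure_UNION_le) auto
  also have "\<dots> = N * (2 * w)" using w by simp
  finally have "bet - alp \<le> N * (2 * w)" using ab by simp
  thus ?thesis using N by (simp add: w_def power_divide power2_eq_square field_simps)
 qed
 obtain N :: nat where N: "N * (bet - alp) > 2 * \<bar>C\<bar> * B\<^sup>2" using reals_Archimedean3[of "bet - alp"] ab by auto
 moreover have "0 \<le> 2 * \<bar>C\<bar> * B\<^sup>2" by simp
 ultimately have "N > 0" using gr0I by fastforce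
 thus False using bound[of N] N by (simp add: field_simps)
qed

context zcover
begin

text \<open>Points of similar height can be brought together by elements of \<open>G\<close> with
  only finitely many values \<open>m\<close> of \<open>phi\<close>. A fixed representative
  \<open>T m\<close> for each value corrects the element to one of \<open>Gam\<close> at bounded
  cost.\<close>

lemma slab_cobounded:
 assumes u: "u \<in> tightf"
 obtains R where "R \<ge> 0" "\<And>x y. x \<in> UH ==> y \<in> UH ==> \<bar>u x - u y\<bar> \<le> M ==> \<exists>C\<in>Gam. hdist x (act C y) \<le> R"
proof -
 obtain R where R: "R \<ge> 0" "\<And>z. z \<in> UH ==> \<exists>A\<in>G. hdist \<i> (act A z) \<le> R" using near_orbit by blast
 obtain T where T: "\<And>A. A \<in> G ==> T (phi A) \<in> G \<and> phi (T (phi A)) = phi A"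
  by (rule that[of "\<lambda>m. SOME B. B \<in> G \<and> phi B = m"]) (metis (mono_tags, lifting) someI_ex)
 define L where "L = (M + 2*R) / kap"
 define I where "I = {m::int. \<bar>real_of_int m\<bar> \<le> L}"
 have "I \<subseteq> {-\<lceil>L\<rceil>..\<lceil>L\<rceil>}" by (auto simp: I_def) linarith+
 hence fI: "finite I" using finite_subset by blast
 define Q where "Q = Max (insert 0 ((\<lambda>m. hdist \<i> (pt (adj (T m)))) ` I))"
 have Q: "Q \<ge> 0" "\<And>m. m \<in> I ==> hdist \<i> (pt (adj (T m))) \<le> Q" using fI by (auto simp: Q_def)
 have "\<exists>C\<in>Gam. hdist x (act C y) \<le> 2*R + Q" if xy: "x \<in> UH" "y \<in> UH" "\<bar>u x - u y\<bar> \<le> M" for x y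
 proof -
  obtain A where A: "A \<in> G" "hdist \<i> (act A x) \<le> R" using R xy by blast
  obtain B where B: "B \<in> G" "hdist \<i> (act B y) \<le> R" using R xy by blast
  define m where "m = phi (B ** adj A)"
  have m: "m = phi B - phi A" using A B by (simp add: m_def phi_mult phi_adj)
  have Tm: "T m \<in> G" "phi (T m) = m" using T[of "B ** adj A"] A B by (auto simp: m_def)
  have "\<bar>u (act A x) - u (act B y)\<bar> \<le> hdist (act A x) (act B y)" using A B xy by (intro tightf_lip_abs[OF u]) auto
  also have "\<dots> \<le> 2 * R" using hdist_triangle[of "act A x" \<i> "act B y"] A B xy by (simp add: hdist_commute)
  finally have "\<bar>u x - u y - kap * m\<bar> \<le> 2 * R"
   using tightf_act[OF u A(1) xy(1)] tightf_act[OF u B(1) xy(2)] by (simp add: m algebra_simps)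
  hence "\<bar>kap * m\<bar> \<le> M + 2*R" using xy by linarith
  hence mI: "m \<in> I" using kap_pos by (simp add: I_def L_def abs_mult field_simps)
  define C where "C = adj A ** (adj (T m) ** B)"
  have C: "C \<in> Gam" using A B Tm by (simp add: C_def Gam_def phi_mult phi_adj m)
  have "hdist x (act C y) = hdist (act A x) (act (adj (T m)) (act B y))"
   using hdist_act_adj[of "adj A" x "act (adj (T m)) (act B y)"] A B Tm xy by (simp add: C_def act_mult_G)
  also have "\<dots> \<le> hdist (act A x) \<i> + hdist \<i> (pt (adj (T m))) + hdist (act (adj (T m)) \<i>) (act (adj (T m)) (act B y))"
   using hdist_triangle[of "act A x" \<i> "act (adj (T m)) (act B y)"] hdist_triangle[of \<i> "act (adj (T m)) \<i>" "act (adj (T m)) (act B y)"] A B Tm xy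
   by (simp add: pt_def)
  also have "hdist (act (adj (T m)) \<i>) (act (adj (T m)) (act B y)) = hdist \<i> (act B y)"
   using B Tm xy by (intro hdist_act_G) auto
  finally have "hdist x (act C y) \<le> 2*R + Q" using Q(2)[OF mI] A B by (simp add: hdist_commute)
  thus ?thesis using C by blast
 qed
 thus ?thesis using that[of "2*R + Q"] R Q by simp
qed

text \<open>A single leaf crosses all levels of \<open>u\<close> at unit speed. Both points can be
  moved to it by \<open>Gam\<close> at bounded cost, so in the cover distance upwards is height
  difference up to a constant.\<close>

lemma coarse_upper:
 assumes u: "u \<in> tightf"
 obtains C0 where "C0 \<ge> 0" "\<And>x y. x \<in> UH ==> y \<in> UH ==> u x \<le> u y ==> \<exists>A\<in>Gam. hdist x (act A y) \<le> u y - u x + C0"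
proof -
 obtain R where R: "R \<ge> 0" "\<And>x y. x \<in> UH ==> y \<in> UH ==> \<bar>u x - u y\<bar> \<le> 0 ==> \<exists>C\<in>Gam. hdist x (act C y) \<le> R"
  using slab_cobounded[OF u, of 0] by blast
 obtain g where g: "g \<in> leafs" using Aub_nonempty ex_leaf by blast
 let ?l = "\<lambda>z. geo g (u z - u (pt g))"
 have l: "u (?l z) = u z" "?l z \<in> UH" for z using leafs_tight[OF g u] g by (simp_all add: det_mult1)
 have "\<exists>A\<in>Gam. hdist x (act A y) \<le> u y - u x + 2 * R" if xy: "x \<in> UH" "y \<in> UH" "u x \<le> u y" for x y
 proof -
  obtain A where A: "A \<in> Gam" "hdist x (act A (?l x)) \<le> R" using R(2)[of x "?l x"] l xy by auto
  obtain B where B: "B \<in> Gam" "hdist y (act B (?l y)) \<le> R" using R(2)[of y "?l y"] l xy by auto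
  have AG: "A \<in> G" "B \<in> G" using A B Gam_G by auto
  have C: "A ** adj B \<in> Gam" using A B by simp
  have "hdist (?l x) (?l y) = u y - u x" using hdist_geo[of g] g xy by simp
  hence 1: "hdist (act A (?l x)) (act A (?l y)) = u y - u x" using AG l by (simp add: hdist_act_G)
  have "hdist (act A (?l y)) (act (A ** adj B) y) = hdist (?l y) (act (adj B) y)"
   using AG l xy by (simp add: act_mult_G hdist_act_G)
  also have "\<dots> = hdist y (act B (?l y))" using hdist_act_adj[OF AG(2), of y "?l y"] l xy by (simp add: hdist_commute)
  finally have 2: "hdist (act A (?l y)) (act (A ** adj B) y) \<le> R" using B by simp
  have "hdist x (act (A ** adj B) y) \<le> u y - u x + 2 * R"
   using hdist_triangle[of x "act A (?l x)" "act (A ** adj B) y"] hdist_triangle[of "act A (?l x)" "act A (?l y)" "act (A ** adj B) y"]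
    1 2 A(2) AG l xy by simp
  thus ?thesis using C by blast
 qed
 thus ?thesis using that[of "2*R"] R by simp
qed

lemma level_net:
 assumes u: "u \<in> tightf" and e: "e > 0"
 obtains F where "finite F" "F \<subseteq> UH" "\<And>x. x \<in> UH ==> u x = h ==> \<exists>f\<in>F. \<exists>C\<in>Gam. hdist f (act C x) < e"
proof -
 obtain R where R: "R \<ge> 0" "\<And>x y. x \<in> UH ==> y \<in> UH ==> \<bar>u x - u y\<bar> \<le> \<bar>h - u \<i>\<bar> ==> \<exists>C\<in>Gam. hdist x (act C y) \<le> R"
  using slab_cobounded[OF u] by blast
 obtain F where F: "finite F" "F \<subseteq> UH" "\<And>x. x \<in> UH ==> hdist \<i> x \<le> R ==> \<exists>f\<in>F. hdist f x < e" using finite_net[OF e] by blast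
 have "\<exists>f\<in>F. \<exists>C\<in>Gam. hdist f (act C x) < e" if x: "x \<in> UH" "u x = h" for x
 proof -
  obtain C where C: "C \<in> Gam" "hdist \<i> (act C x) \<le> R" using R(2)[of \<i> x] x by (auto simp: abs_minus_commute)
  thus ?thesis using F(3)[of "act C x"] x Gam_G by auto
 qed
 thus ?thesis using that[OF F(1,2)] by blast
qed

text \<open>The last clause is a dynamic programming principle: together with the Lipschitz bound it
  makes \<open>U x\<close> the supremum of \<open>U y - hdist x y\<close> over the points
  \<open>y\<close> of any higher level of \<open>u\<close>. Invariance is asked for under
  \<open>Gam\<close> only.\<close>

definition subsol :: "(complex \<Rightarrow> real) \<Rightarrow> (complex \<Rightarrow> real) \<Rightarrow> bool" where
 "subsol u U \<longleftrightarrow>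
   (\<forall>x\<in>UH. \<forall>y\<in>UH. U x - U y \<le> hdist x y) \<and>
   (\<forall>A\<in>Gam. \<forall>x\<in>UH. U (act A x) = U x) \<and>
   (\<exists>C. \<forall>x\<in>UH. \<bar>u x - U x\<bar> \<le> C) \<and>
   (\<forall>x\<in>UH. \<forall>h\<ge>u x. \<forall>e>0. \<exists>y\<in>UH. u y = h \<and> U x \<le> U y - hdist x y + e)"

lemma conj_Gam: "A \<in> G ==> C \<in> Gam ==> A ** C ** adj A \<in> Gam"
 by (simp add: Gam_def phi_mult phi_adj)

text \<open>Going up a leaf, the excess \<open>u - U\<close> can only grow. In the other
 direction, the leaf is chain recurrent modulo powers of some \<open>A\<close>, and by the semigroup property of
 \<open>U\<close> two of the translates of the excess that agree on a level set agree below it; the pigeonhole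
 principle bounds the power by a number that does not depend on \<open>A\<close>.\<close>

lemma excess_const_on_leaf:
 assumes u: "u \<in> tightf" and U: "subsol u U" and g: "g \<in> leafs"
 shows "u (geo g t) - U (geo g t) = u (pt g) - U (pt g)"
proof -
 define J where "J x = u x - U x" for x
 have Ulip: "U x - U y \<le> hdist x y" if "x \<in> UH" "y \<in> UH" for x y using U that by (simp add: subsol_def)
 have UGam: "U (act A x) = U x" if "A \<in> Gam" "x \<in> UH" for A x using U that by (simp add: subsol_def)
 have Usemi: "\<exists>y\<in>UH. u y = h \<and> U x \<le> U y - hdist x y + e" if "x \<in> UH" "h \<ge> u x" "e > 0" for x h e
  using U that by (simp add: subsol_def)
 obtain C0 where C0: "\<And>x. x \<in> UH ==> \<bar>J x\<bar> \<le> C0" using U unfolding subsol_def J_def by blast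
 have JGam: "J (act A x) = J x" if "A \<in> Gam" "x \<in> UH" for A x
  using that UGam tightf_act[OF u, of A x] by (simp add: J_def Gam_def)
 have Jlip: "\<bar>J x - J y\<bar> \<le> 2 * hdist x y" if "x \<in> UH" "y \<in> UH" for x y
  using that Ulip[of x y] Ulip[of y x] tightf_lip_abs[OF u, of x y] by (simp add: J_def hdist_commute)
 have gU: "geo g t \<in> UH" "pt g \<in> UH" for t using g by (simp_all add: det_mult1)
 have main: "J (geo g t) = J (pt g)" if g: "g \<in> leafs" and t: "t \<ge> 0" for g t
 proof (rule antisym)
  have gU: "geo g t \<in> UH" "pt g \<in> UH" for t using g by (simp_all add: det_mult1)
  show "J (pt g) \<le> J (geo g t)"
   using Ulip[OF gU, of t] leafs_tight[OF g u, of t] hdist_geo[OF leafs_det[OF g], of t 0] t by (simp add: J_def)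
  show "J (geo g t) \<le> J (pt g)"
  proof (rule field_le_epsilon)
   fix e0 :: real assume "e0 > 0"
   \<comment> \<open>Five parts are lost in comparing translates through the net and one in the
     accumulated errors of the chain.\<close>
   define e where "e = e0 / 6"
   have e: "e > 0" using \<open>e0 > 0\<close> by (simp add: e_def)
   let ?y = "pt g"
   define h where "h = u ?y"
   obtain F where F: "finite F" "F \<subseteq> UH" "\<And>x. x \<in> UH ==> u x = h ==> \<exists>f\<in>F. \<exists>C\<in>Gam. hdist f (act C x) < e"
    using level_net[OF u e, of h] by metis
   define L where "L = \<lceil>C0 / e\<rceil> + 1"
   \<comment> \<open>The possible profiles of the excess on the net, rounded to multiples of
     \<open>e\<close>. Their number does not depend on \<open>A\<close>, so the tolerance
     \<open>eps\<close> can be fixed before \<open>A\<close> is chosen.\<close>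
   define V where "V = PiE F (\<lambda>_. {-L..L})"
   have fV: "finite V" using F by (simp add: V_def finite_PiE)
   define N where "N = card V"
   define eps where "eps = e / (real N + 1)"
   have "eps > 0" using e by (simp add: eps_def)
   then obtain A where A: "A \<in> G" "phi A \<ge> 1" "hdist (geo g t) (act A ?y) \<le> kap * phi A - t + eps"
    using leafs_chainrec[OF g t] unfolding chainrec_def by blast
   define Ji where "Ji i x = J (act (mpow A i) x)" for i x
   have mG: "mpow A i \<in> G" for i using A by simp
   define v where "v i = restrict (\<lambda>f. \<lfloor>Ji i f / e\<rfloor>) F" for i
   have vV: "v i \<in> V" for i
   proof -
    have "\<lfloor>Ji i f / e\<rfloor> \<in> {-L..L}" if "f \<in> F" for f
    proof -
     have "\<bar>Ji i f\<bar> \<le> C0" using C0[of "act (mpow A i) f"] F that A by (auto simp: Ji_def)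
     hence "- (C0 / e) \<le> Ji i f / e" "Ji i f / e \<le> C0 / e" using e by (simp_all add: field_simps abs_le_iff)
     thus ?thesis unfolding L_def by simp linarith
    qed
    thus ?thesis by (auto simp: v_def V_def)
   qed
   have "card (v ` {..N}) \<le> N" unfolding N_def using fV vV by (intro card_mono) auto
   hence "\<not> inj_on v {..N}" using pigeonhole[of v "{..N}"] by simp
   then obtain i j where ij: "i < j" "j \<le> N" "v i = v j"
    unfolding inj_on_def by (metis atMost_iff linorder_neqE_nat)
   have onF: "\<bar>Ji i f - Ji j f\<bar> \<le> e" if "f \<in> F" for f
   proof -
    have "\<lfloor>Ji i f / e\<rfloor> = \<lfloor>Ji j f / e\<rfloor>" using fun_cong[OF ij(3), of f] that by (simp add: v_def)
    hence "\<bar>Ji i f / e - Ji j f / e\<bar> \<le> 1" by linarith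
    hence "\<bar>Ji i f - Ji j f\<bar> / e \<le> 1" using e by (simp add: abs_divide flip: diff_divide_distrib)
    thus ?thesis using e by simp
   qed
   have onlevel: "\<bar>Ji i x - Ji j x\<bar> \<le> 5 * e" if x: "x \<in> UH" "u x = h" for x
   proof -
    obtain f C where f: "f \<in> F" "C \<in> Gam" "hdist f (act C x) < e" using F(3)[OF x] by blast
    have fU: "f \<in> UH" "C \<in> G" using f F Gam_G by auto
    have near: "\<bar>Ji k f - Ji k x\<bar> \<le> 2 * e" for k
    proof -
     have "act (mpow A k) (act C x) = act (mpow A k ** C ** adj (mpow A k)) (act (mpow A k) x)"
      using mG[of k] fU x by (simp add: act_mult_G act_adj)
     hence "Ji k x = J (act (mpow A k) (act C x))"
      using JGam[OF conj_Gam[OF mG[of k] f(2)], of "act (mpow A k) x"] mG[of k] x by (simp add: Ji_def)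
     hence "\<bar>Ji k f - Ji k x\<bar> \<le> 2 * hdist (act (mpow A k) f) (act (mpow A k) (act C x))"
      using Jlip[of "act (mpow A k) f" "act (mpow A k) (act C x)"] mG[of k] fU x by (simp add: Ji_def)
     thus ?thesis using f fU x mG[of k] by (simp add: hdist_act_G)
    qed
    show ?thesis using near[of i] near[of j] onF[OF f(1)] by linarith
   qed
   \<comment> \<open>By the last clause of \<open>subsol\<close>, the values of a translate below
     level \<open>h\<close> are governed by its values on that level, where the two translates
     nearly agree.\<close>
   have below: "Ji j x - Ji i x \<le> 5 * e" if x: "x \<in> UH" "u x \<le> h" for x
   proof (rule field_le_epsilon)
    fix d :: real assume d: "d > 0"
    have Ax: "act (mpow A i) x \<in> UH" using mG x by simp
    have "u (act (mpow A i) x) \<le> h + kap * phi (mpow A i)" using tightf_act[OF u mG x(1), of i] x by simp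
    then obtain y where y: "y \<in> UH" "u y = h + kap * phi (mpow A i)" "U (act (mpow A i) x) \<le> U y - hdist (act (mpow A i) x) y + d"
     using Usemi[OF Ax _ d] by blast
    define x' where "x' = act (adj (mpow A i)) y"
    have x': "x' \<in> UH" "act (mpow A i) x' = y" using y mG[of i] by (simp_all add: x'_def act_adj)
    have ux': "u x' = h" using tightf_act[OF u mG x'(1), of i] x' y by simp
    have "Ji i x \<ge> hdist x x' - (h - u x) + Ji i x' - d"
     using y(3) tightf_act[OF u mG x(1), of i] hdist_act_G[OF mG x(1) x'(1), of i] x'(2) y(2) by (simp add: Ji_def J_def)
    moreover have "Ji j x \<le> hdist x x' - (h - u x) + Ji j x'"
     using Ulip[of "act (mpow A j) x'" "act (mpow A j) x"] tightf_act[OF u mG x(1), of j] tightf_act[OF u mG x'(1), of j] ux'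
      hdist_act_G[OF mG x'(1) x(1), of j] x x' mG[of j] by (simp add: Ji_def J_def hdist_commute)
    ultimately show "Ji j x - Ji i x \<le> 5 * e + d" using onlevel[OF x'(1) ux'] by linarith
   qed
   define k where "k = j - i"
   have k: "k \<ge> 1" "k \<le> N" "j = k + i" using ij by (auto simp: k_def)
   have ykU: "act (adj (mpow A i)) ?y \<in> UH" using mG[of i] gU by simp
   have "u (act (adj (mpow A i)) ?y) = h - kap * phi (mpow A i)"
    using tightf_act[OF u, of "adj (mpow A i)" ?y] mG[of i] gU by (simp add: h_def phi_adj)
   moreover have "phi (mpow A i) \<ge> 0" using A by (simp add: phi_mpow)
   hence "kap * phi (mpow A i) \<ge> 0" using kap_pos by simp
   ultimately have "Ji j (act (adj (mpow A i)) ?y) - Ji i (act (adj (mpow A i)) ?y) \<le> 5 * e"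
    using below[OF ykU] by simp
   moreover have "Ji i (act (adj (mpow A i)) ?y) = J ?y" using mG[of i] gU by (simp add: Ji_def act_adj)
   moreover have "Ji j (act (adj (mpow A i)) ?y) = J (act (mpow A k) ?y)"
    using mG[of i] mG[of k] gU ykU by (simp add: Ji_def k(3) mpow_add act_mult_G act_adj)
   ultimately have J1: "J (act (mpow A k) ?y) \<le> J ?y + 5 * e" by simp
   \<comment> \<open>Repeat the near return. Between two returns the path follows a translate of the
     leaf from time 0 to \<open>t\<close>, whose length is exactly its gain, so the errors only add
     up.\<close>
   have chain: "hdist (geo g t) (act (mpow A (Suc n)) ?y) \<le> kap * phi (mpow A (Suc n)) - t + (Suc n) * eps" for n
   proof (induction n)
    case 0 thus ?case using A by simp
   next
    case (Suc n)
    have s1: "hdist (act A ?y) (act A (geo g t)) = t"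
     using hdist_act_G[OF A(1) gU(2) gU(1), of t] hdist_geo[OF leafs_det[OF g], of 0 t] t by simp
    have s2: "hdist (act A (geo g t)) (act (mpow A (Suc (Suc n))) ?y) = hdist (geo g t) (act (mpow A (Suc n)) ?y)"
    proof -
     have "act (mpow A (Suc (Suc n))) ?y = act A (act (mpow A (Suc n)) ?y)"
      using act_mult_G[OF A(1) mG gU(2), of "Suc n"] by simp
     thus ?thesis using hdist_act_G[OF A(1) gU(1) act_G_UH[OF mG gU(2)], of t "Suc n"] by simp
    qed
    have "hdist (geo g t) (act (mpow A (Suc (Suc n))) ?y) \<le>
      hdist (geo g t) (act A ?y) + hdist (act A ?y) (act A (geo g t)) +
      hdist (act A (geo g t)) (act (mpow A (Suc (Suc n))) ?y)"
     using hdist_triangle[of "geo g t" "act A ?y" "act (mpow A (Suc (Suc n))) ?y"]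
      hdist_triangle[of "act A ?y" "act A (geo g t)" "act (mpow A (Suc (Suc n))) ?y"] gU A(1) mG[of "Suc (Suc n)"]
     by (simp del: mpow.simps)
    also have "\<dots> \<le> kap * phi A - t + eps + t + (kap * phi (mpow A (Suc n)) - t + (Suc n) * eps)"
     unfolding s1 s2 using A(3) Suc.IH by simp
    also have "\<dots> = kap * phi (mpow A (Suc (Suc n))) - t + (Suc (Suc n)) * eps"
     using A by (simp add: phi_mpow phi_mult algebra_simps)
    finally show ?case .
   qed
   have "hdist (geo g t) (act (mpow A k) ?y) \<le> kap * phi (mpow A k) - t + k * eps"
    using chain[of "k - 1"] k by simp
   moreover have "k * eps \<le> e"
   proof -
    have "k * eps \<le> (real N + 1) * eps" using k \<open>eps > 0\<close> by (intro mult_right_mono) auto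
    thus ?thesis by (simp add: eps_def)
   qed
   moreover have "U (act (mpow A k) ?y) - U (geo g t) \<le> hdist (geo g t) (act (mpow A k) ?y)"
    using Ulip[of "act (mpow A k) ?y" "geo g t"] mG[of k] gU by (simp add: hdist_commute)
   ultimately have "J (geo g t) \<le> J (act (mpow A k) ?y) + e"
    using leafs_tight[OF g u, of t] tightf_act[OF u mG gU(2), of k] by (simp add: J_def)
   thus "J (geo g t) \<le> J (pt g) + e0" using J1 by (simp add: e_def)
  qed
 qed
 show ?thesis
 proof (cases "t \<ge> 0")
  case True thus ?thesis using main[OF g] by (simp add: J_def)
 next
  case False
  have "g ** dg t ** dg (- t) = g" by (simp add: dg_add flip: matrix_mul_assoc)
  thus ?thesis using main[OF leafs_dg[OF g], of "-t" t] False by (simp add: J_def)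
 qed
qed

text \<open>Use \<open>u\<close> on one crossed segment of \<open>leafs_cross\<close> and
  \<open>U\<close> on the other: as the excess is constant along leaves, the difference of the
  excesses is at most \<open>D1 + D2 - 4\<close>. That surplus is quadratic in the distance of the
  leaves because \<open>cosh\<close> has positive slope at 2.\<close>

lemma excess_quadratic:
 assumes u: "u \<in> tightf" and U: "subsol u U" and g: "g \<in> leafs" and h: "h \<in> leafs"
 shows "(u (pt g) - U (pt g)) - (u (pt h) - U (pt h)) \<le> 2 * cosh 2 / sinh 2 * (cosh (hdist (pt g) (pt h)) - 1)"
proof -
 obtain a b c d where k: "adj g ** h = mk a b c d" by (rule mk_cases)
 define D1 where "D1 = hdist (geo g (-1)) (geo h 1)"
 define D2 where "D2 = hdist (geo h (-1)) (geo g 1)"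
 define dlt where "dlt = cosh (hdist (pt g) (pt h)) - 1"
 have D: "D1 + D2 \<ge> 4" "cosh D1 + cosh D2 = (2 + 2 * dlt - (b\<^sup>2 + c\<^sup>2)) * cosh 2 + (b\<^sup>2 + c\<^sup>2)"
  using leafs_cross[OF g h k] by (simp_all add: D1_def D2_def dlt_def)
 have "(b\<^sup>2 + c\<^sup>2) * 1 \<le> (b\<^sup>2 + c\<^sup>2) * cosh 2" using cosh2_gt1 by (intro mult_left_mono) auto
 hence "cosh D1 + cosh D2 \<le> 2 * (1 + dlt) * cosh 2" using D(2) by (simp add: algebra_simps)
 hence "2 * cosh ((D1 + D2) / 2) \<le> 2 * ((1 + dlt) * cosh 2)"
  using cosh_sum_ge(1)[OF D(1)] by (metis order_trans mult.assoc)
 hence 1: "cosh ((D1 + D2) / 2) \<le> (1 + dlt) * cosh 2" by simp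
 define m where "m = (D1 + D2) / 2 - 2"
 have m: "m \<ge> 0" "(D1 + D2) / 2 = 2 + m" using D by (simp_all add: m_def)
 have s2: "sinh (2::real) > 0" by simp
 have "cosh (2 + m) = cosh 2 * cosh m + sinh 2 * sinh m" by (rule cosh_add)
 also have "\<dots> \<ge> cosh 2 * 1 + sinh 2 * m"
  using m s2 sinh_ge_self[of m] by (intro add_mono mult_left_mono cosh_real_ge_1) auto
 finally have "sinh 2 * m \<le> dlt * cosh 2" using 1 m by (simp add: algebra_simps)
 hence "m \<le> cosh 2 / sinh 2 * dlt" using s2 by (simp add: field_simps)
 hence DD: "D1 + D2 - 4 \<le> 2 * cosh 2 / sinh 2 * dlt" by (simp add: m_def field_simps)
 have gU: "geo g t \<in> UH" "geo h t \<in> UH" for t using g h by (simp_all add: det_mult1)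
 have "u (geo g 1) - u (geo h (-1)) \<le> D2"
  using tightf_lip[OF u gU, of 1 "-1"] by (simp add: D2_def hdist_commute)
 moreover have "U (geo h 1) - U (geo g (-1)) \<le> D1"
  using U gU by (simp add: subsol_def D1_def hdist_commute)
 ultimately show ?thesis
  using DD excess_const_on_leaf[OF u U g, of "-1"] excess_const_on_leaf[OF u U h, of 1]
   leafs_tight[OF g u, of 1] leafs_tight[OF g u, of "-1"] leafs_tight[OF h u, of 1] leafs_tight[OF h u, of "-1"]
  by (simp add: dlt_def)
qed

lemma frame_at_i: assumes "det g = 1" "pt g = \<i>" obtains tht where "0 \<le> tht" "tht < 2*pi" "g = rot tht"
proof -
 obtain a b c d where g: "g = mk a b c d" by (rule mk_cases)
 have det: "a*d - b*c = 1" using assms g by simp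
 have "nsq g / 2 = 1" using cd_i_pt[OF assms(1)] assms(2) by (simp add: cd_def)
 hence "(a-d)\<^sup>2 + (b+c)\<^sup>2 = 0" using det g by (simp add: power2_eq_square algebra_simps)
 hence ad: "a = d" "c = - b" by (auto simp: sum_power2_eq_zero_iff)
 hence "a\<^sup>2 + b\<^sup>2 = 1" using det by (simp add: power2_eq_square)
 then obtain t where "0 \<le> t" "t < 2*pi" "a = cos t" "b = sin t" using sincos_total_2pi by metis
 thus ?thesis using that[of t] g ad by (simp add: rot_def)
qed

text \<open>Modulo \<open>Gam\<close> every leaf crosses one fixed circle, and there the excess varies quadratically.\<close>

lemma excess_image_no_interval:
 assumes u: "u \<in> tightf" and U: "subsol u U" and sub: "{alp..bet} \<subseteq> (\<lambda>x. u x - U x) ` Aub"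
 shows "bet \<le> alp"
proof -
 define J where "J x = u x - U x" for x
 have UGam: "U (act A x) = U x" if "A \<in> Gam" "x \<in> UH" for A x using U that by (simp add: subsol_def)
 have JGam: "J (act A x) = J x" if "A \<in> Gam" "x \<in> UH" for A x
  using that UGam tightf_act[OF u, of A x] by (simp add: J_def Gam_def)
 obtain R where R: "R \<ge> 0" "\<And>x y. x \<in> UH ==> y \<in> UH ==> \<bar>u x - u y\<bar> \<le> 0 ==> \<exists>C\<in>Gam. hdist x (act C y) \<le> R"
  using slab_cobounded[OF u, of 0] by blast
 define S where "S = {tht. 0 \<le> tht \<and> tht \<le> 2*pi \<and> pt (rot tht ** dg R) \<in> Aub}"
 have img: "\<exists>tht\<in>S. J x = J (pt (rot tht ** dg R))" if x: "x \<in> Aub" for x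
 proof -
  obtain g where g: "g \<in> leafs" "pt g = x" using ex_leaf[OF x] by blast
  define g1 where "g1 = g ** dg (u \<i> - u x)"
  have g1: "g1 \<in> leafs" "u (pt g1) = u \<i>" using g leafs_tight[OF g(1) u] by (simp_all add: g1_def)
  have "J (pt g1) = J x" using excess_const_on_leaf[OF u U g(1), of "u \<i> - u x"] g by (simp add: g1_def J_def)
  obtain C where C: "C \<in> Gam" "hdist \<i> (act C (pt g1)) \<le> R" using R(2)[of \<i> "pt g1"] g1 by auto
  have CG: "C \<in> G" using C Gam_G by simp
  define g2 where "g2 = C ** g1"
  have g2: "g2 \<in> leafs" "pt g2 = act C (pt g1)" using g1 CG leafs_G by (simp_all add: g2_def act_pt)
  have J2: "J (pt g2) = J x" using JGam[OF C(1), of "pt g1"] g1 g2 \<open>J (pt g1) = J x\<close> by simp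
  \<comment> \<open>The leaf starts at the level of i and within distance \<open>R\<close> of i;
    after time \<open>R\<close> it is higher by \<open>R\<close>, hence at distance at least
    \<open>R\<close>. So it meets the circle of radius \<open>R\<close> in between.\<close>
  have "hdist \<i> (geo g2 R) \<ge> R"
  proof -
   have "u (pt g2) = u \<i>" using tightf_act[OF u CG, of "pt g1"] C g1 g2 by (simp add: Gam_def)
   hence "u (geo g2 R) - u \<i> = R" using leafs_tight[OF g2(1) u, of R] by simp
   thus ?thesis using tightf_lip[OF u, of "geo g2 R" \<i>] g2 by (simp add: hdist_commute det_mult1)
  qed
  moreover have "continuous_on {0..R} (\<lambda>t. hdist \<i> (geo g2 t))"
   by (rule continuous_on_hdist[OF continuous_on_const continuous_on_geo]) (use g2 in \<open>auto simp: det_mult1\<close>)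
  ultimately obtain t where t: "hdist \<i> (geo g2 t) = R"
   using IVT'[of "\<lambda>t. hdist \<i> (geo g2 t)" 0 R R] C g2 R by auto
  define y where "y = geo g2 t"
  have y: "y \<in> Aub" "J y = J x" using leafs_Aub[OF g2(1)] excess_const_on_leaf[OF u U g2(1), of t] J2 by (simp_all add: y_def J_def)
  obtain f where f: "det f = 1" "pt f = \<i>" "geo f R = y"
   using pair_frame[of \<i> y] y(1) t by (metis Aub_UH i_UH y_def)
  obtain tht where "0 \<le> tht" "tht < 2*pi" "f = rot tht" using frame_at_i[OF f(1,2)] .
  thus ?thesis using f y by (intro bexI[of _ tht]) (auto simp: S_def)
 qed
 \<comment> \<open>On this circle \<open>cosh\<close> of the distance minus 1 equals
   \<open>(sin (t-s))\<^sup>2 * (cosh (2*R) - 1)\<close>, which turns the quadratic bound in the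
   distance into one in the angle.\<close>
 define K where "K = 2 * cosh 2 / sinh 2 * (cosh (2*R) - 1)"
 have quad: "J (pt (rot s ** dg R)) - J (pt (rot t ** dg R)) \<le> K * (s - t)\<^sup>2" if st: "s \<in> S" "t \<in> S" for s t
 proof -
  obtain g where g: "g \<in> leafs" "pt g = pt (rot s ** dg R)" using ex_leaf st by (auto simp: S_def)
  obtain h where h: "h \<in> leafs" "pt h = pt (rot t ** dg R)" using ex_leaf st by (auto simp: S_def)
  have k: "adj (rot s) ** rot t = mk (cos (t-s)) (sin (t-s)) (- sin (t-s)) (cos (t-s))"
   by (simp add: rot_def cos_diff sin_diff algebra_simps)
  have "cosh (hdist (pt g) (pt h)) = (2 * (cos (t-s))\<^sup>2 + (sin (t-s))\<^sup>2 * (exp (2*R) + exp (-2*R))) / 2"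
   using cosh_hdist_geo[OF det_rot det_rot k, of R R] g h by (simp add: algebra_simps)
  also have "\<dots> = (cos (t-s))\<^sup>2 + (sin (t-s))\<^sup>2 * cosh (2*R)" by (simp add: cosh_def field_simps)
  also have "(cos (t-s))\<^sup>2 = 1 - (sin (t-s))\<^sup>2" by (simp add: cos_squared_eq)
  finally have "cosh (hdist (pt g) (pt h)) - 1 = (sin (t-s))\<^sup>2 * (cosh (2*R) - 1)" by (simp add: algebra_simps)
  also have "\<dots> \<le> (t-s)\<^sup>2 * (cosh (2*R) - 1)"
  proof (rule mult_right_mono)
   have "\<bar>sin (t-s)\<bar>\<^sup>2 \<le> \<bar>t-s\<bar>\<^sup>2" by (intro power_mono abs_sin_x_le_abs_x) auto
   thus "(sin (t-s))\<^sup>2 \<le> (t-s)\<^sup>2" by simp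
  qed (simp add: cosh_real_ge_1)
  finally have "2 * cosh 2 / sinh 2 * (cosh (hdist (pt g) (pt h)) - 1) \<le> 2 * cosh 2 / sinh 2 * ((t-s)\<^sup>2 * (cosh (2*R) - 1))"
   by (intro mult_left_mono) (auto simp: cosh_real_nonneg)
  thus ?thesis using excess_quadratic[OF u U g(1) h(1)] g h by (simp add: K_def J_def power2_commute mult_ac)
 qed
 show ?thesis
 proof (rule quadratic_image_no_interval[of S "2*pi" "\<lambda>tht. J (pt (rot tht ** dg R))" K])
  show "S \<subseteq> {0..2*pi}" by (auto simp: S_def)
  show "\<bar>J (pt (rot s ** dg R)) - J (pt (rot t ** dg R))\<bar> \<le> K * (s - t)\<^sup>2" if "s \<in> S" "t \<in> S" for s t
   using quad[OF that] quad[OF that(2,1)] by (simp add: abs_le_iff power2_commute)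
  show "{alp..bet} \<subseteq> (\<lambda>tht. J (pt (rot tht ** dg R))) ` S"
  proof
   fix c assume "c \<in> {alp..bet}"
   then obtain x where "x \<in> Aub" "c = J x" using sub by (auto simp: J_def)
   thus "c \<in> (\<lambda>tht. J (pt (rot tht ** dg R))) ` S" using img[of x] by auto
  qed
 qed simp
qed

text \<open>A jump of size below \<open>e\<close> in the lamination of the cover, written upstairs
  with the group element that realises it.\<close>

definition chainrel :: "real \<Rightarrow> (complex \<times> complex) set" where
 "chainrel e = {(x, y). x \<in> Aub \<and> y \<in> Aub \<and> (\<exists>A\<in>Gam. hdist x (act A y) < e)}"

text \<open>Some value \<open>c\<close> between the two excesses is omitted on \<open>Aub\<close>.
  Modulo \<open>Gam\<close> every leaf meets a fixed ball, so by compactness a whole interval of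
  radius \<open>r\<close> around \<open>c\<close> is omitted; the excess is 2-Lipschitz, and jumps
  below \<open>r\<close> cannot cross an interval of length \<open>2 * r\<close>.\<close>

lemma excess_const_on_component:
 assumes u: "u \<in> tightf" and U: "subsol u U" and xy: "\<And>e. e > 0 ==> (x, y) \<in> (chainrel e)\<^sup>*" and x: "x \<in> Aub" and y: "y \<in> Aub"
 shows "u y - U y \<le> u x - U x"
proof (rule ccontr)
 define J where "J x = u x - U x" for x
 have UGam: "U (act A x) = U x" if "A \<in> Gam" "x \<in> UH" for A x using U that by (simp add: subsol_def)
 have Ulip: "U x - U y \<le> hdist x y" if "x \<in> UH" "y \<in> UH" for x y using U that by (simp add: subsol_def)
 have JGam: "J (act A x) = J x" if "A \<in> Gam" "x \<in> UH" for A x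
  using that UGam tightf_act[OF u, of A x] by (simp add: J_def Gam_def)
 have Jlip: "\<bar>J x - J y\<bar> \<le> 2 * hdist x y" if "x \<in> UH" "y \<in> UH" for x y
  using that Ulip[of x y] Ulip[of y x] tightf_lip_abs[OF u, of x y] by (simp add: J_def hdist_commute)
 assume "\<not> u y - U y \<le> u x - U x"
 hence less: "J x < J y" by (simp add: J_def)
 obtain c where c: "J x < c" "c < J y" "c \<notin> J ` Aub"
 proof -
  define p where "p = J x + (J y - J x) / 3"
  define q where "q = J y - (J y - J x) / 3"
  have pq: "J x < p" "p < q" "q < J y" using less by (simp_all add: p_def q_def field_simps)
  have "\<not> {p..q} \<subseteq> J ` Aub" using excess_image_no_interval[OF u U, of p q] pq by (auto simp: J_def[abs_def])
  then obtain c where "c \<in> {p..q}" "c \<notin> J ` Aub" by blast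
  thus ?thesis using that[of c] pq by auto
 qed
 obtain R where R: "R \<ge> 0" "\<And>x y. x \<in> UH ==> y \<in> UH ==> \<bar>u x - u y\<bar> \<le> 0 ==> \<exists>C\<in>Gam. hdist x (act C y) \<le> R"
  using slab_cobounded[OF u, of 0] by blast
 have gap: "\<exists>r>0. \<forall>z\<in>Aub. \<bar>J z - c\<bar> \<ge> r"
 proof (rule ccontr)
  assume "\<not> ?thesis"
  hence "\<forall>n. \<exists>z\<in>Aub. \<bar>J z - c\<bar> < 1 / (real n + 1)" by (auto simp: not_le)
  then obtain z where z: "\<And>n. z n \<in> Aub" "\<And>n. \<bar>J (z n) - c\<bar> < 1 / (real n + 1)" by metis
  have "\<exists>w\<in>Aub. hdist \<i> w \<le> R \<and> J w = J (z n)" for n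
  proof -
   obtain g where g: "g \<in> leafs" "pt g = z n" using ex_leaf[OF z(1)] by blast
   define g1 where "g1 = g ** dg (u \<i> - u (z n))"
   have g1: "g1 \<in> leafs" "u (pt g1) = u \<i>" using g leafs_tight[OF g(1) u] by (simp_all add: g1_def)
   have J1: "J (pt g1) = J (z n)" using excess_const_on_leaf[OF u U g(1), of "u \<i> - u (z n)"] g by (simp add: g1_def J_def)
   obtain C where C: "C \<in> Gam" "hdist \<i> (act C (pt g1)) \<le> R" using R(2)[of \<i> "pt g1"] g1 by auto
   thus ?thesis using JGam[OF C(1), of "pt g1"] J1 g1 Aub_act[OF leafs_Aub0[OF g1(1)] Gam_G[OF C(1)]] by (intro bexI[of _ "act C (pt g1)"]) auto
  qed
  then obtain w where w: "\<And>n. w n \<in> Aub" "\<And>n. hdist \<i> (w n) \<le> R" "\<And>n. J (w n) = J (z n)" by metis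
  obtain r l where r: "strict_mono r" "l \<in> UH" "(w \<circ> r) \<longlonglongrightarrow> l" using UH_seq_compact[of w R] w by (metis Aub_UH)
  have l: "l \<in> Aub" using Aub_closed_seq[of "w \<circ> r" l] w r by simp
  have wU: "w n \<in> UH" for n using w by simp
  have h0: "(\<lambda>n. 2 * hdist ((w \<circ> r) n) l) \<longlonglongrightarrow> 2 * hdist l l" by (intro tendsto_mult tendsto_const tendsto_hdist r)
  have "(\<lambda>n. J ((w \<circ> r) n) - J l) \<longlonglongrightarrow> 0"
   by (rule Lim_null_comparison[OF always_eventually h0[simplified hdist_self mult_zero_right]]) (use Jlip wU r in simp)
  hence lim1: "(\<lambda>n. J (w (r n))) \<longlonglongrightarrow> J l" by (simp add: LIM_zero_iff)
  have inv0: "(\<lambda>n. 1 / (real n + 1)) \<longlonglongrightarrow> 0" using LIMSEQ_inverse_real_of_nat by (simp add: inverse_eq_divide add.commute)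
  have "(\<lambda>n. J (w n) - c) \<longlonglongrightarrow> 0"
   by (rule Lim_null_comparison[OF always_eventually inv0]) (use z w in \<open>auto intro: less_imp_le\<close>)
  hence "(\<lambda>n. J (w n)) \<longlonglongrightarrow> c" by (simp add: LIM_zero_iff)
  hence "(\<lambda>n. J (w (r n))) \<longlonglongrightarrow> c" using LIMSEQ_subseq_LIMSEQ[OF _ r(1), of "\<lambda>n. J (w n)" c] by (simp add: o_def)
  hence "J l = c" using lim1 LIMSEQ_unique by blast
  thus False using c l by blast
 qed
 then obtain r where r: "r > 0" "\<And>z. z \<in> Aub ==> \<bar>J z - c\<bar> \<ge> r" by blast
 have "(x, y) \<in> (chainrel r)\<^sup>*" using xy r by blast
 hence "J y < c"
 proof (induction rule: rtrancl_induct)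
  case base thus ?case using c by simp
 next
  case (step p q)
  then obtain A where A: "A \<in> Gam" "hdist p (act A q) < r" and pq: "p \<in> Aub" "q \<in> Aub" by (auto simp: chainrel_def)
  have "\<bar>J p - J q\<bar> \<le> 2 * hdist p (act A q)"
   using Jlip[of p "act A q"] JGam[OF A(1), of q] A Gam_G pq by simp
  hence "J q < c + r" using A step.IH r(2)[OF pq(1)] by linarith
  thus ?case using r(2)[OF pq(2)] by linarith
 qed
 thus False using c by simp
qed

end

section \<open>Gaps and the finiteness of the chain classes\<close>

text \<open>The oriented geodesic with endpoints \<open>x\<close> and \<open>1 / y\<close>, which is close to the imaginary axis.\<close>

definition nline :: "real \<Rightarrow> real \<Rightarrow> real^2^2" where
 "nline x y = (let r = sqrt (1 - x*y) in mk (1/r) (x/r) (y/r) (1/r))"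

lemma nline_zero [simp]: "nline 0 0 = mat 1"
 by (simp add: nline_def mat_one_mk)

lemma nline_dg: "dg t ** nline x y = nline (x * exp t) (y * exp (- t)) ** dg t"
proof -
 have e: "exp (t/2) = exp t * exp (-(t/2))" "exp (-(t/2)) = exp (-t) * exp (t/2)" by (simp_all flip: exp_add)
 have "x * exp t * (y * exp (- t)) = x * y * (exp t * exp (-t))" by (simp only: mult_ac)
 hence "x * exp t * (y * exp (- t)) = x * y" by (simp flip: exp_add)
 thus ?thesis
  unfolding nline_def Let_def dg_def by (simp add: mult_ac) (simp flip: e)
qed

text \<open>The endpoints \<open>b/d\<close> and \<open>a/c\<close> of a geodesic do not change
  under the flow or under a change of sign. The normal form keeps them and splits off the time
  parameter.\<close>

lemma nline_normal:
 assumes "a*d - b*c = 1" "a*d > 0"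
 shows "\<exists>s. mk a b c d = nline (b/d) (c/a) ** dg s \<or> mk a b c d = - (nline (b/d) (c/a) ** dg s)"
proof -
 have main: "\<exists>s. mk a b c d = nline (b/d) (c/a) ** dg s" if det: "a*d - b*c = 1" and pos: "a > 0" "d > 0" for a b c d :: real
 proof -
  define s where "s = ln (a/d)"
  have "1 - b/d * (c/a) = (a*d - b*c) / (a*d)" using pos by (simp add: diff_divide_distrib mult.commute)
  hence "1 - b/d * (c/a) = 1 / (a*d)" using det by simp
  hence r: "1 / sqrt (1 - b/d * (c/a)) = sqrt (a*d)" by (simp add: real_sqrt_divide)
  have es: "exp (s/2) = sqrt (a/d)" "exp (-(s/2)) = sqrt (d/a)"
  proof -
   have "(exp (s/2))\<^sup>2 = a/d" using pos by (simp add: s_def flip: exp_double)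
   thus 1: "exp (s/2) = sqrt (a/d)" by (metis exp_ge_zero real_sqrt_unique)
   show "exp (-(s/2)) = sqrt (d/a)" using 1 pos by (simp add: exp_minus real_sqrt_divide)
  qed
  have q: "sqrt (a*d) * sqrt (a/d) = a" "sqrt (a*d) * sqrt (d/a) = d"
   using pos by (simp_all flip: real_sqrt_mult)
  define rho where "rho = 1 / sqrt (1 - b/d * (c/a))"
  have "nline (b/d) (c/a) = mk rho (b/d * rho) (c/a * rho) rho" by (simp add: nline_def Let_def rho_def)
  hence "nline (b/d) (c/a) ** dg s = mk (rho * exp (s/2)) (b/d * (rho * exp (-(s/2)))) (c/a * (rho * exp (s/2))) (rho * exp (-(s/2)))"
   by (simp add: dg_def)
  also have "\<dots> = mk a b c d" using q pos unfolding es rho_def r by simp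
  finally show ?thesis by metis
 qed
 show ?thesis
 proof (cases "a > 0")
  case True
  hence "d > 0" using assms by (simp add: zero_less_mult_iff)
  thus ?thesis using main[OF assms(1) True] by blast
 next
  case False
  hence "- a > 0" "- d > 0" using assms by (auto simp: zero_less_mult_iff)
  then obtain s where "mk (-a) (-b) (-c) (-d) = nline ((-b)/(-d)) ((-c)/(-a)) ** dg s"
   using main[of "-a" "-d" "-b" "-c"] assms by auto
  hence "- mk a b c d = nline (b/d) (c/a) ** dg s" by simp
  thus ?thesis by (metis minus_equation_iff)
 qed
qed

context zcover
begin

section \<open>Order and gaps among nearby leaves\<close>

lemma leafs_uminus_iff [simp]: "- g \<in> leafs \<longleftrightarrow> g \<in> leafs"
 using leafs_uminus[of g] leafs_uminus[of "- g"] by auto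

lemma leafs_dg_iff [simp]: "g ** dg s \<in> leafs \<longleftrightarrow> g \<in> leafs"
proof
 assume "g ** dg s \<in> leafs"
 hence "g ** dg s ** dg (-s) \<in> leafs" by (rule leafs_dg)
 thus "g \<in> leafs" by (simp add: dg_add flip: matrix_mul_assoc)
qed simp

lemma leafs_coord:
 assumes "det F = 1" "h \<in> leafs" "adj F ** h = mk a b c d" "a*d > 0"
 shows "F ** nline (b/d) (c/a) \<in> leafs"
  and "\<exists>s. h = F ** nline (b/d) (c/a) ** dg s \<or> h = - (F ** nline (b/d) (c/a) ** dg s)"
proof -
 have h: "h = F ** mk a b c d" using adj_cancel(2)[of F h] assms by simp
 have det: "a*d - b*c = 1" using det_mult1[of "adj F" h] assms by simp
 obtain s where s: "mk a b c d = nline (b/d) (c/a) ** dg s \<or> mk a b c d = - (nline (b/d) (c/a) ** dg s)"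
  using nline_normal[OF det assms(4)] by blast
 hence hs: "h = F ** nline (b/d) (c/a) ** dg s \<or> h = - (F ** nline (b/d) (c/a) ** dg s)"
  unfolding h by (auto simp: mult_uminus2 matrix_mul_assoc)
 thus "\<exists>s. h = F ** nline (b/d) (c/a) ** dg s \<or> h = - (F ** nline (b/d) (c/a) ** dg s)" by blast
 show "F ** nline (b/d) (c/a) \<in> leafs" using hs assms(2) by auto
qed

lemma small_mult: "\<bar>x\<bar> < 1/2 ==> \<bar>y\<bar> < 1/2 ==> \<bar>x * y\<bar> < 1/4" for x y :: real
 using mult_strict_mono'[of "\<bar>x\<bar>" "1/2" "\<bar>y\<bar>" "1/2"] by (simp add: abs_mult)

lemma adj_nline_mult:
 "adj (nline x1 y1) ** nline x2 y2 =
  mk (s * (1 - x1*y2)) (s * (x2 - x1)) (s * (y2 - y1)) (s * (1 - y1*x2))"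
 if "s = 1 / (sqrt (1 - x1*y1) * sqrt (1 - x2*y2))"
 using that by (simp add: nline_def Let_def diff_divide_distrib algebra_simps)

text \<open>The entries of the relative matrix are positive multiples of 1, \<open>x2 - x1\<close>,
  \<open>y2 - y1\<close> and 1, so the absence of crossings becomes comparability: in these
  coordinates the leaves near \<open>F\<close> form a chain for the product order.\<close>

lemma leafs_chain:
 assumes "det F = 1" "F ** nline x1 y1 \<in> leafs" "F ** nline x2 y2 \<in> leafs"
  and "\<bar>x1\<bar> < 1/2" "\<bar>y1\<bar> < 1/2" "\<bar>x2\<bar> < 1/2" "\<bar>y2\<bar> < 1/2"
 shows "(x2 - x1) * (y2 - y1) \<ge> 0"
proof -
 have p: "x1*y1 < 1" "x2*y2 < 1" "x1*y2 < 1" "y1*x2 < 1"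
  using small_mult[OF assms(4,5)] small_mult[OF assms(6,7)] small_mult[OF assms(4,7)] small_mult[OF assms(5,6)] by auto
 define s where "s = 1 / (sqrt (1 - x1*y1) * sqrt (1 - x2*y2))"
 have s: "s > 0" using p by (simp add: s_def)
 have "adj (F ** nline x1 y1) ** (F ** nline x2 y2) = adj (nline x1 y1) ** nline x2 y2"
  unfolding adj_mult matrix_mul_assoc[symmetric] adj_cancel(1)[OF assms(1)] ..
 from leafs_no_cross[OF assms(2,3) this[unfolded adj_nline_mult[OF s_def]]]
 have "0 \<le> (s * (1 - x1*y2)) * (s * (y2 - y1)) * ((s * (x2 - x1)) * (s * (1 - y1*x2)))" .
 also have "\<dots> = (s * s * s * s * ((1 - x1*y2) * (1 - y1*x2))) * ((x2 - x1) * (y2 - y1))" by (simp only: mult_ac)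
 finally have le: "0 \<le> (s * s * s * s * ((1 - x1*y2) * (1 - y1*x2))) * ((x2 - x1) * (y2 - y1))" .
 have "0 < s * s * s * s * ((1 - x1*y2) * (1 - y1*x2))" using s p by simp
 thus ?thesis using le zero_le_mult_iff[of "s * s * s * s * ((1 - x1*y2) * (1 - y1*x2))" "(x2 - x1) * (y2 - y1)"] by linarith
qed

text \<open>Two neighbouring leaves with no leaf of the closed strip other than the two edges;
  \<open>sig\<close> is 1 or -1 and selects the side of \<open>F\<close>. The bound 1/4 keeps the
  coordinates in the range where \<open>leafs_chain\<close> applies.\<close>

definition gap :: "real \<Rightarrow> real^2^2 \<Rightarrow> real \<Rightarrow> real \<Rightarrow> bool" where
 "gap sig F x y \<longleftrightarrow> F \<in> leafs \<and> F ** nline x y \<in> leafs \<and> 0 < sig*x \<and> sig*x < 1/4 \<and> 0 < sig*y \<and> sig*y < 1/4 \<and>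
  (\<forall>x' y'. F ** nline x' y' \<in> leafs \<longrightarrow> 0 \<le> sig*x' \<longrightarrow> sig*x' \<le> sig*x \<longrightarrow> 0 \<le> sig*y' \<longrightarrow> sig*y' \<le> sig*y \<longrightarrow>
    (x' = 0 \<and> y' = 0) \<or> (x' = x \<and> y' = y))"

lemma gapD:
 assumes "gap sig F x y"
 shows "F \<in> leafs" "F ** nline x y \<in> leafs" "0 < sig*x" "sig*x < 1/4" "0 < sig*y" "sig*y < 1/4"
  "\<And>x' y'. F ** nline x' y' \<in> leafs ==> 0 \<le> sig*x' ==> sig*x' \<le> sig*x ==> 0 \<le> sig*y' ==> sig*y' \<le> sig*y ==>
    (x' = 0 \<and> y' = 0) \<or> (x' = x \<and> y' = y)"
 using assms unfolding gap_def by blast+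

lemma leafs_slide: "F ** dg t ** nline x y \<in> leafs \<longleftrightarrow> F ** nline (x * exp t) (y * exp (-t)) \<in> leafs"
proof -
 have "F ** dg t ** nline x y = F ** nline (x * exp t) (y * exp (-t)) ** dg t"
  using nline_dg[of t x y] by (simp flip: matrix_mul_assoc)
 thus ?thesis by simp
qed

text \<open>The flow contracts one coordinate of the neighbouring leaf and expands the other, which
  allows a thin gap to be normalised to a prescribed second coordinate.\<close>

lemma gap_slide:
 assumes g: "gap sig F x y" and "sig*x*exp (-t) < 1/4" "sig*y*exp t < 1/4"
 shows "gap sig (F ** dg t) (x * exp (-t)) (y * exp t)"
 unfolding gap_def
proof (intro conjI allI impI)
 have e: "exp (-t) * exp t = 1" by (simp flip: exp_add)
 show "F ** dg t \<in> leafs" using gapD(1)[OF g] by simp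
 show "F ** dg t ** nline (x * exp (-t)) (y * exp t) \<in> leafs"
  using gapD(2)[OF g] e by (simp add: leafs_slide mult.assoc mult.commute[of "exp t"])
 show "0 < sig * (x * exp (-t))" "0 < sig * (y * exp t)"
  using gapD(3,5)[OF g] by (simp_all flip: mult.assoc)
 show "sig * (x * exp (-t)) < 1/4" "sig * (y * exp t) < 1/4" using assms by (simp_all add: mult.assoc)
 fix x' y' assume h: "F ** dg t ** nline x' y' \<in> leafs" "0 \<le> sig*x'" "sig*x' \<le> sig*(x * exp (-t))" "0 \<le> sig*y'" "sig*y' \<le> sig*(y*exp t)"
 have 1: "F ** nline (x' * exp t) (y' * exp (-t)) \<in> leafs" using h(1) by (simp add: leafs_slide)
 have "sig*x' * exp t \<le> sig*(x * exp (-t)) * exp t" using h by (intro mult_right_mono) auto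
 also have "\<dots> = sig * x * (exp (-t) * exp t)" by (simp only: mult_ac)
 finally have 2: "sig*(x' * exp t) \<le> sig*x" using e by (simp add: mult.assoc)
 have "sig*y' * exp (-t) \<le> sig*(y * exp t) * exp (-t)" using h by (intro mult_right_mono) auto
 also have "\<dots> = sig * y * (exp (-t) * exp t)" by (simp only: mult_ac)
 finally have 3: "sig*(y' * exp (-t)) \<le> sig*y" using e by (simp add: mult.assoc)
 have "(x' * exp t = 0 \<and> y' * exp (-t) = 0) \<or> (x' * exp t = x \<and> y' * exp (-t) = y)"
  using gapD(7)[OF g 1 _ 2 _ 3] h by (simp flip: mult.assoc)
 thus "(x' = 0 \<and> y' = 0) \<or> (x' = x * exp (-t) \<and> y' = y * exp t)"
  using e by (auto simp: mult.assoc mult.commute[of "exp t"])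
qed

lemma gap_act:
 assumes g: "gap sig F x y" and A: "A \<in> G"
 shows "gap sig (A ** F) x y"
proof -
 have iff: "A ** F ** M \<in> leafs \<longleftrightarrow> F ** M \<in> leafs" for M
  using leafs_G[of "F ** M" A] leafs_G[of "A ** F ** M" "adj A"] A adj_cancel(1)[of A "F ** M"]
  by (auto simp: matrix_mul_assoc)
 show ?thesis using g iff[of "mat 1"] unfolding gap_def by (simp add: iff)
qed

lemma gap_unique:
 assumes sig: "sig = 1 \<or> sig = -1" and g: "gap sig F x y" "gap sig F x' y'"
 shows "x' = x \<and> y' = y"
proof -
 have b: "\<bar>x\<bar> < 1/2" "\<bar>y\<bar> < 1/2" "\<bar>x'\<bar> < 1/2" "\<bar>y'\<bar> < 1/2"
  using gapD(3-6)[OF g(1)] gapD(3-6)[OF g(2)] sig by auto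
 have "(x' - x) * (y' - y) \<ge> 0"
  by (rule leafs_chain[OF leafs_det[OF gapD(1)[OF g(1)]] gapD(2)[OF g(1)] gapD(2)[OF g(2)] b])
 hence "(sig*x' \<le> sig*x \<and> sig*y' \<le> sig*y) \<or> (sig*x \<le> sig*x' \<and> sig*y \<le> sig*y')"
  using sig by (auto simp: zero_le_mult_iff)
 thus ?thesis
  using gapD(7)[OF g(1) gapD(2)[OF g(2)]] gapD(7)[OF g(2) gapD(2)[OF g(1)]] gapD(3,5)[OF g(1)] gapD(3,5)[OF g(2)]
  by fastforce
qed

text \<open>Seen from \<open>F\<close>, the leaf of \<open>F'\<close> has coordinates of size at
  most 1/25, well below \<open>sig * y = 1/8\<close>, so it can be neither the far edge nor beyond
  it. The strip contains no other leaf, hence \<open>F'\<close> lies on the other side or on the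
  leaf of \<open>F\<close>.\<close>

lemma gap_step:
 assumes sig: "sig = 1 \<or> sig = -1" and g: "gap sig F x y" "sig*y = 1/8" and F': "F' \<in> leafs"
  and K: "adj F ** F' = mk a b c d" "\<bar>a - 1\<bar> < 1/100" "\<bar>b\<bar> < 1/100" "\<bar>c\<bar> < 1/100" "\<bar>d - 1\<bar> < 1/100"
 shows "sig * b \<le> 0 \<and> sig * c \<le> 0"
proof (rule ccontr)
 assume neg: "\<not> ?thesis"
 have ad: "a > 1/2" "d > 1/2" using K(2,5) by linarith+
 define X where "X = b/d"
 define Y where "Y = c/a"
 have L: "F ** nline X Y \<in> leafs"
  unfolding X_def Y_def using ad by (intro leafs_coord(1)[OF leafs_det[OF gapD(1)[OF g(1)]] F' K(1)]) auto
 have "\<bar>b\<bar> \<le> 1/25 * d" "\<bar>c\<bar> \<le> 1/25 * a" using K ad by linarith+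
 hence XY: "\<bar>X\<bar> \<le> 1/25" "\<bar>Y\<bar> \<le> 1/25" using ad by (simp_all add: X_def Y_def abs_divide divide_le_eq)
 have sg: "sig * X > 0 \<longleftrightarrow> sig * b > 0" "sig * Y > 0 \<longleftrightarrow> sig * c > 0"
  using ad by (simp_all add: X_def Y_def zero_less_divide_iff)
 have b: "\<bar>x\<bar> < 1/2" "\<bar>y\<bar> < 1/2" "\<bar>X\<bar> < 1/2" "\<bar>Y\<bar> < 1/2"
  using gapD(3-6)[OF g(1)] sig XY by auto
 have det: "det F = 1" using gapD(1)[OF g(1)] by simp
 have c0: "F ** nline 0 0 \<in> leafs" using gapD(1)[OF g(1)] by simp
 have "(X - 0) * (Y - 0) \<ge> 0" by (rule leafs_chain[OF det c0 L]) (use b in auto)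
 hence 1: "sig*X \<ge> 0 \<and> sig*Y \<ge> 0" using neg sg sig by (auto simp: zero_le_mult_iff not_le)
 have "(X - x) * (Y - y) \<ge> 0" by (rule leafs_chain[OF det gapD(2)[OF g(1)] L b])
 moreover have lt: "sig*Y < sig*y" using g(2) XY sig by auto
 ultimately have "sig*X \<le> sig*x" using sig by (auto simp: zero_le_mult_iff)
 hence "(X = 0 \<and> Y = 0) \<or> (X = x \<and> Y = y)" using gapD(7)[OF g(1) L] 1 lt by simp
 thus False using lt neg sg by auto
qed

text \<open>Applying \<open>gap_step\<close> from both gaps gives \<open>b = c = 0\<close>: the
  frames lie on one leaf and differ by a time \<open>t\<close>. Equal second coordinates then leave
  only \<open>t = 0\<close>.\<close>

lemma gap_rigid:
 assumes sig: "sig = 1 \<or> sig = -1" and g: "gap sig F x y" "gap sig F' x' y" "sig*y = 1/8"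
  and K: "adj F ** F' = mk a b c d" "\<bar>a - 1\<bar> < 1/100" "\<bar>b\<bar> < 1/100" "\<bar>c\<bar> < 1/100" "\<bar>d - 1\<bar> < 1/100"
 shows "x' = x"
proof -
 have dets: "det F = 1" "det F' = 1" using gapD(1)[OF g(1)] gapD(1)[OF g(2)] by simp_all
 have "adj F' ** F = adj (adj F ** F')" by (simp add: adj_mult)
 hence K': "adj F' ** F = mk d (-b) (-c) a" using K(1) by simp
 have "sig * b \<le> 0 \<and> sig * c \<le> 0" by (rule gap_step[OF sig g(1,3) gapD(1)[OF g(2)] K])
 moreover have "sig * (-b) \<le> 0 \<and> sig * (-c) \<le> 0"
  by (rule gap_step[OF sig g(2,3) gapD(1)[OF g(1)] K']) (use K in auto)
 ultimately have bc: "b = 0" "c = 0" using sig by auto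
 have "a*d - b*c = 1" using det_mult1[of "adj F" F'] dets K by simp
 moreover have a2: "a > 1/2" using K(2) by linarith
 ultimately have d: "d = 1/a" "a > 1/2" using bc by (auto simp: field_simps)
 define t where "t = 2 * ln a"
 have "exp (t/2) = a" "exp (-t/2) = d" using d by (simp_all add: t_def exp_minus inverse_eq_divide)
 hence "adj F ** F' = dg t" using K(1) bc by (simp add: dg_def)
 hence F': "F' = F ** dg t" using adj_cancel(2)[OF dets(1), of F'] by simp
 hence FF: "F = F' ** dg (-t)" by (simp add: dg_add flip: matrix_mul_assoc)
 have et: "exp t = a\<^sup>2" "exp (-t) = 1 / a\<^sup>2" using d by (simp_all add: t_def exp_minus exp_double inverse_eq_divide)
 have a2: "a\<^sup>2 < 2" "1/a\<^sup>2 < 2"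
 proof -
  have a: "99/100 < a" "a < 101/100" using K(2) by linarith+
  have "a\<^sup>2 \<le> (101/100)\<^sup>2" "(99/100)\<^sup>2 \<le> a\<^sup>2" using a by (intro power_mono; simp)+
  thus "a\<^sup>2 < 2" by (simp add: power2_eq_square)
  have "1 < 2 * a\<^sup>2" using \<open>(99/100)\<^sup>2 \<le> a\<^sup>2\<close> by (simp add: power2_eq_square)
  thus "1/a\<^sup>2 < 2" using d by (simp add: field_simps)
 qed
 \<comment> \<open>One gap has to be slid onto the other without leaving the range below 1/4. Both
   directions cannot fail, because one of \<open>exp t\<close> and \<open>exp (- t)\<close> is at
   most 1.\<close>
 consider "sig * x' * exp t < 1/4" | "sig * x' * exp t \<ge> 1/4" by linarith
 thus ?thesis
 proof cases
  case 1
  have "sig * y * exp (-t) < 1/4" unfolding g(3) et using a2 by simp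
  hence "gap sig (F' ** dg (-t)) (x' * exp t) (y * exp (-t))"
   using gap_slide[OF g(2), of "-t"] 1 by simp
  hence "gap sig F (x' * exp t) (y * exp (-t))" using FF by simp
  from gap_unique[OF sig g(1) this] have e: "x' * exp t = x" "y * exp (-t) = y" by blast+
  have "y \<noteq> 0" using g(3) by auto
  hence "exp (-t) = 1" using e(2) mult_cancel_left2[of y "exp (-t)"] by blast
  hence "t = 0" by simp
  thus ?thesis using e(1) by simp
 next
  case 2
  have "sig * x * exp (-t) < 1/4"
  proof (rule ccontr)
   assume "\<not> ?thesis"
   hence 3: "sig * x * exp (-t) \<ge> 1/4" by simp
   have "sig * x < 1/4" "sig * x' < 1/4" using gapD(4)[OF g(1)] gapD(4)[OF g(2)] by auto
   moreover have "exp t \<ge> 1 \<or> exp (-t) \<ge> 1" by (cases "t \<ge> 0") auto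
   moreover have "sig * x > 0" "sig * x' > 0" using gapD(3)[OF g(1)] gapD(3)[OF g(2)] by auto
   moreover have "exp t \<le> 1 \<or> exp (-t) \<le> 1" by (cases "t \<ge> 0") auto
   ultimately show False using 2 3
    by (smt (verit) mult_left_le)
  qed
  moreover have "sig * y * exp t < 1/4" unfolding g(3) et using a2 by simp
  ultimately have "gap sig (F ** dg t) (x * exp (-t)) (y * exp t)" using gap_slide[OF g(1)] by blast
  hence "gap sig F' (x * exp (-t)) (y * exp t)" using F' by simp
  from gap_unique[OF sig g(2) this] have e: "x * exp (-t) = x'" "y * exp t = y" by blast+
  have "y \<noteq> 0" using g(3) by auto
  hence "exp t = 1" using e(2) mult_cancel_left2[of y "exp t"] by blast
  hence "t = 0" by simp
  thus ?thesis using e(1) by simp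
 qed
qed

text \<open>Sliding a thin gap along the leaf until its second coordinate is \<open>1/8\<close>, and translating the result
 into a compact set, infinitely many of them would accumulate, against \<open>gap_rigid\<close>.\<close>

lemma gap_lower_bound:
 assumes sig: "sig = 1 \<or> sig = -1"
 shows "\<exists>dlt>0. \<forall>F x y. gap sig F x y \<longrightarrow> sig*x < dlt \<longrightarrow> sig*y < dlt \<longrightarrow> False"
proof (rule ccontr)
 assume neg: "\<not> ?thesis"
 obtain R where R: "R \<ge> 0" "\<And>z. z \<in> UH ==> \<exists>A\<in>G. hdist \<i> (act A z) \<le> R" using near_orbit by blast
 have "\<exists>F x. gap sig F x (sig/8) \<and> sig*x < 1 / (real n + 8) \<and> hdist \<i> (pt F) \<le> R" for n :: nat
 proof -
  have "1 / (real n + 8) > 0" by simp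
  then obtain F x y where g: "gap sig F x y" "sig*x < 1 / (real n + 8)" "sig*y < 1 / (real n + 8)" using neg by blast
  have "1 / (real n + 8) \<le> 1/8" by (simp add: field_simps)
  hence y8: "sig*y < 1/8" "sig*x < 1/8" using g(2,3) by linarith+
  define t where "t = ln (1 / (8 * (sig*y)))"
  have yp: "0 < sig*y" using gapD(5)[OF g(1)] .
  have et: "exp t = 1 / (8 * (sig*y))" using yp by (simp add: t_def)
  hence "exp t > 1" using yp y8 by (simp add: field_simps)
  hence t: "t > 0" by simp
  have xs: "sig*x*exp (-t) \<le> sig*x" using gapD(3)[OF g(1)] t by (simp add: mult_left_le)
  have "sig*y*exp t = 1/8"
  proof -
   have "z * (1 / (8 * z)) = 1/8" if "z > 0" for z :: real using that by simp
   from this[OF yp] show ?thesis unfolding et .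
  qed
  hence "gap sig (F ** dg t) (x * exp (-t)) (y * exp t)"
   using gap_slide[OF g(1), of t] xs gapD(4)[OF g(1)] by simp
  moreover have "y * exp t = sig/8" using \<open>sig*y*exp t = 1/8\<close> sig by auto
  ultimately have g2: "gap sig (F ** dg t) (x * exp (-t)) (sig/8)" by simp
  have F2: "F ** dg t \<in> leafs" using gapD(1)[OF g2] .
  hence "geo F t \<in> UH" using leafs_det pt_UH by blast
  then obtain A where A: "A \<in> G" "hdist \<i> (act A (geo F t)) \<le> R" using R by blast
  have "hdist \<i> (pt (A ** (F ** dg t))) \<le> R" using A act_pt[OF det_G[OF A(1)] leafs_det[OF F2]] by simp
  thus ?thesis using gap_act[OF g2 A(1)] xs g(2) by (intro exI[of _ "A ** (F ** dg t)"] exI[of _ "x * exp (-t)"]) (auto simp: mult.assoc)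
 qed
 then obtain F x where F: "\<And>n. gap sig (F n) (x n) (sig/8)" "\<And>n::nat. sig * x n < 1 / (real n + 8)" "\<And>n. hdist \<i> (pt (F n)) \<le> R" by metis
 have dF: "det (F n) = 1" for n using gapD(1)[OF F(1)] by simp
 obtain r L where r: "strict_mono r" "det L = 1" "(F \<circ> r) \<longlonglongrightarrow> L" using frames_compact[of F R] dF F(3) by blast
 have lim: "(\<lambda>n. F (r n)) \<longlonglongrightarrow> L" using r(3) by (simp add: o_def)
 have xpos: "0 < sig * x n" for n using gapD(3)[OF F(1)] .
 \<comment> \<open>The first coordinates are positive and tend to 0, so every gap is followed by a
   strictly thinner one. This provides the two distinct gaps that \<open>gap_rigid\<close>
   forbids.\<close>
 have "\<exists>k\<ge>n. sig * x (r k) < sig * x (r n)" for n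
 proof -
  obtain k :: nat where k: "k * (sig * x (r n)) > 1" using reals_Archimedean3[OF xpos] by blast
  let ?k = "max k n"
  have "?k * (sig * x (r n)) \<ge> k * (sig * x (r n))" using xpos[of "r n"] by (intro mult_right_mono) auto
  hence "?k * (sig * x (r n)) > 1" using k by linarith
  moreover have "real (r ?k) + 8 \<ge> ?k" using seq_suble[OF r(1), of ?k] by linarith
  hence "(real (r ?k) + 8) * (sig * x (r n)) \<ge> ?k * (sig * x (r n))" using xpos[of "r n"] by (intro mult_right_mono) auto
  ultimately have "1 / (real (r ?k) + 8) < sig * x (r n)" by (simp add: field_simps)
  thus ?thesis using F(2)[of "r ?k"] by (intro exI[of _ ?k]) auto
 qed
 then obtain s where s: "\<And>n. s n \<ge> n" "\<And>n. sig * x (r (s n)) < sig * x (r n)" by metis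
 have "filterlim s at_top sequentially"
  unfolding filterlim_at_top eventually_sequentially using s(1) order_trans by blast
 hence lim2: "(\<lambda>n. F (r (s n))) \<longlonglongrightarrow> L" using filterlim_compose[OF lim] by blast
 have "(\<lambda>n. adj (F (r n)) ** F (r (s n))) \<longlonglongrightarrow> adj L ** L" by (intro tendsto_intros lim lim2)
 hence "(\<lambda>n. adj (F (r n)) ** F (r (s n))) \<longlonglongrightarrow> mk 1 0 0 1" using adj_left[OF r(2)] by (simp add: mat_one_mk)
 hence l: "(\<lambda>n. (adj (F (r n)) ** F (r (s n))) $ i $ j) \<longlonglongrightarrow> mk 1 0 0 1 $ i $ j" for i j
  by (simp add: tendsto_mat2)
 have ev: "\<forall>\<^sub>F n in sequentially. \<bar>(adj (F (r n)) ** F (r (s n))) $ i $ j - mk 1 0 0 1 $ i $ j\<bar> < 1/100" for i j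
  using tendstoD[OF l[of i j], of "1/100"] by (simp add: dist_real_def)
 from eventually_conj[OF eventually_conj[OF ev[of 1 1] ev[of 1 2]] eventually_conj[OF ev[of 2 1] ev[of 2 2]]]
 obtain n where n: "\<bar>(adj (F (r n)) ** F (r (s n))) $ 1 $ 1 - 1\<bar> < 1/100" "\<bar>(adj (F (r n)) ** F (r (s n))) $ 1 $ 2\<bar> < 1/100"
  "\<bar>(adj (F (r n)) ** F (r (s n))) $ 2 $ 1\<bar> < 1/100" "\<bar>(adj (F (r n)) ** F (r (s n))) $ 2 $ 2 - 1\<bar> < 1/100"
  unfolding eventually_sequentially by auto
 have "sig * (sig/8) = 1/8" using sig by auto
 hence "x (r (s n)) = x (r n)"
  using gap_rigid[OF sig F(1) F(1) _ mk_collapse[symmetric] n] by blast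
 thus False using s(2)[of n] by simp
qed

end

lemma tendsto_nline:
 assumes "(f \<longlongrightarrow> x) F" "(g \<longlongrightarrow> y) F" "x * y < 1"
 shows "((\<lambda>n. nline (f n) (g n)) \<longlongrightarrow> nline x y) F"
 unfolding tendsto_mat2 forall_2 nline_def Let_def mk_nth
 using assms by (intro conjI tendsto_intros) auto

lemma moebius_monotone:
 fixes p r s t :: real
 assumes "r * s + 1 > 0" "r * t + 1 > 0"
 shows "(s + p) / (r * s + 1) - (t + p) / (r * t + 1) = (s - t) * (1 - p*r) / ((r * s + 1) * (r * t + 1))"
 using assms by (simp add: diff_frac_eq) (simp add: algebra_simps)

context zcover
begin

section \<open>Chains along leaves and a uniform size of jumps\<close>

lemma chainrel_sym: "(x, y) \<in> chainrel e ==> (y, x) \<in> chainrel e"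
proof -
 assume "(x, y) \<in> chainrel e"
 then obtain A where A: "x \<in> Aub" "y \<in> Aub" "A \<in> Gam" "hdist x (act A y) < e" by (auto simp: chainrel_def)
 hence "hdist y (act (adj A) x) < e"
  using hdist_act_adj[of A x y] Gam_G by (simp add: hdist_commute)
 thus ?thesis using A by (auto simp: chainrel_def intro!: bexI[of _ "adj A"])
qed

lemma chainrel_star_sym: "(x, y) \<in> (chainrel e)\<^sup>* ==> (y, x) \<in> (chainrel e)\<^sup>*"
 by (meson chainrel_sym rtrancl_converseI sym_def sym_rtrancl symD)

lemma chainrel_step: "x \<in> Aub ==> y \<in> Aub ==> hdist x y < e ==> (x, y) \<in> (chainrel e)\<^sup>*"
 by (rule r_into_rtrancl) (auto simp: chainrel_def intro!: bexI[of _ "mat 1"])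

lemma leaf_chain:
 assumes m: "m \<in> leafs" and e: "e > 0"
 shows "(pt m, geo m t) \<in> (chainrel e)\<^sup>*"
proof -
 obtain n :: nat where "n * e > \<bar>t\<bar>" using reals_Archimedean3[OF e] by blast
 moreover from this have "n > 0" by (cases n) auto
 ultimately have n: "n > 0" "\<bar>t / n\<bar> < e" by (simp_all add: abs_divide divide_less_eq mult.commute)
 have "(pt m, geo m (k * (t/n))) \<in> (chainrel e)\<^sup>*" for k :: nat
 proof (induction k)
  case 0 thus ?case by simp
 next
  case (Suc k)
  have "k * (t/n) - Suc k * (t/n) = - (t/n)" by (simp add: algebra_simps add_divide_distrib)
  hence "hdist (geo m (k * (t/n))) (geo m (Suc k * (t/n))) < e"
   using hdist_geo[OF leafs_det[OF m], of "k * (t/n)" "Suc k * (t/n)"] n by simp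
  hence "(geo m (k * (t/n)), geo m (Suc k * (t/n))) \<in> (chainrel e)\<^sup>*"
   using leafs_Aub[OF m] by (intro chainrel_step)
  thus ?case using Suc by (rule rtrancl_trans[rotated])
 qed
 from this[of n] show ?thesis using n by simp
qed

text \<open>With one coordinate zero the leaves share an endpoint. Flowing towards it makes them so
  close that a single jump connects them.\<close>

lemma asymptotic_chain:
 assumes F: "F \<in> leafs" and H: "F ** nline x y \<in> leafs" and 0: "x = 0 \<or> y = 0" and e: "e > 0"
 shows "(pt F, pt (F ** nline x y)) \<in> (chainrel e)\<^sup>*"
proof -
 have "nline x y = mk 1 x y 1" using 0 by (auto simp: nline_def)
 hence k: "adj F ** (F ** nline x y) = mk 1 x y 1" using adj_cancel(1)[of F] F by simp
 define t where "t = (if x = 0 then ln (min 1 ((cosh e - 1) / (y\<^sup>2 + 1))) / 2 else - ln (min 1 ((cosh e - 1) / (x\<^sup>2 + 1))) / 2)"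
 have ce: "cosh e > 1" using cosh_real_strict_mono[of 0 e] e by simp
 have aux: "z\<^sup>2 * min 1 ((cosh e - 1) / (z\<^sup>2 + 1)) < 2 * (cosh e - 1)" for z :: real
 proof -
  have "z\<^sup>2 * min 1 ((cosh e - 1) / (z\<^sup>2 + 1)) \<le> z\<^sup>2 * ((cosh e - 1) / (z\<^sup>2 + 1))" by (intro mult_left_mono) auto
  also have "\<dots> = (cosh e - 1) * (z\<^sup>2 / (z\<^sup>2 + 1))" by simp
  also have "\<dots> \<le> (cosh e - 1) * 1"
   using ce by (intro mult_left_mono) (auto simp: divide_le_eq add_pos_nonneg add_nonneg_pos)
  finally have "z\<^sup>2 * min 1 ((cosh e - 1) / (z\<^sup>2 + 1)) \<le> cosh e - 1" by simp
  thus ?thesis using ce by argo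
 qed
 have pos: "min 1 ((cosh e - 1) / (z\<^sup>2 + 1)) > 0" for z :: real using ce by (auto intro!: divide_pos_pos add_nonneg_pos)
 have "cosh (hdist (geo F t) (pt (F ** nline x y ** dg t))) = 1 + (x\<^sup>2 * exp (- 2*t) + y\<^sup>2 * exp (2*t)) / 2"
  using cosh_hdist_geo[OF leafs_det[OF F] leafs_det[OF H] k, of t t] by (simp add: field_simps)
 also have "\<dots> < cosh e"
 proof (cases "x = 0")
  case True
  hence "exp (2*t) = min 1 ((cosh e - 1) / (y\<^sup>2 + 1))" using pos by (simp add: t_def)
  thus ?thesis using True aux[of y] by simp
 next
  case False
  hence "exp (-2*t) = min 1 ((cosh e - 1) / (x\<^sup>2 + 1))" using pos by (simp add: t_def)
  thus ?thesis using False 0 aux[of x] by simp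
 qed
 finally have "hdist (geo F t) (pt (F ** nline x y ** dg t)) < e"
  using F H e by (subst (asm) cosh_real_nonneg_less_iff) (auto simp: det_mult1)
 hence "(geo F t, pt (F ** nline x y ** dg t)) \<in> (chainrel e)\<^sup>*"
  using leafs_Aub[OF F] leafs_Aub[OF H] by (intro chainrel_step)
 thus ?thesis using leaf_chain[OF F e, of t] chainrel_star_sym[OF leaf_chain[OF H e, of t]] by (meson rtrancl_trans)
qed

text \<open>A jump below \<open>e\<close> does not leave an \<open>e\<close>-class, so in
  \<open>Aub\<close> the class and its complement are both closed. The extremal leaves in
  \<open>separated_gap\<close> are attained for this reason.\<close>

lemma chain_class_closed:
 assumes e: "e > 0" and z: "\<And>n. z n \<in> Aub" "z \<longlonglongrightarrow> w" "w \<in> Aub"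
 shows "(\<And>n. (x, z n) \<in> (chainrel e)\<^sup>*) ==> (x, w) \<in> (chainrel e)\<^sup>*"
  and "(\<And>n. (x, z n) \<notin> (chainrel e)\<^sup>*) ==> (x, w) \<notin> (chainrel e)\<^sup>*"
proof -
 have "(\<lambda>n. hdist (z n) w) \<longlonglongrightarrow> hdist w w" using z by (intro tendsto_hdist tendsto_const) auto
 hence "\<forall>\<^sub>F n in sequentially. hdist (z n) w < e" using e order_tendstoD(2)[of _ "hdist w w" _ e] by auto
 then obtain n where "hdist (z n) w < e" by (auto simp: eventually_sequentially)
 hence "(z n, w) \<in> (chainrel e)\<^sup>*" using z by (intro chainrel_step)
 thus "(\<And>n. (x, z n) \<in> (chainrel e)\<^sup>*) ==> (x, w) \<in> (chainrel e)\<^sup>*"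
  "(\<And>n. (x, z n) \<notin> (chainrel e)\<^sup>*) ==> (x, w) \<notin> (chainrel e)\<^sup>*"
  using chainrel_star_sym by (meson rtrancl_trans)+
qed

text \<open>If the leaves \<open>g\<close> and \<open>g ** nline X Y\<close> lie in different chain classes, then between them there
 are consecutive leaves in different classes; these form a gap, since leaves of different classes
 are not asymptotic.\<close>

lemma separated_gap:
 assumes g: "g \<in> leafs" and h: "g ** nline X Y \<in> leafs" and XY: "\<bar>X\<bar> \<le> rho" "\<bar>Y\<bar> \<le> rho" and rho: "rho \<le> 1/16"
  and e: "e > 0" and sep: "(pt g, pt (g ** nline X Y)) \<notin> (chainrel e)\<^sup>*"
 obtains sig F x y where "sig = 1 \<or> sig = -1" "gap sig F x y" "sig * x \<le> 2 * rho" "sig * y \<le> 2 * rho"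
proof -
 define P where "P z \<longleftrightarrow> (pt g, z) \<in> (chainrel e)\<^sup>*" for z
 have gd: "det g = 1" using g by simp
 have h0: "g ** nline 0 0 \<in> leafs" using g by simp
 have "(X - 0) * (Y - 0) \<ge> 0" by (rule leafs_chain[OF gd h0 h]) (use XY rho in auto)
 then obtain sig :: real where sig: "sig = 1 \<or> sig = -1" "sig*X \<ge> 0" "sig*Y \<ge> 0"
  by (auto simp: zero_le_mult_iff intro: that[of 1] that[of "-1"])
 have rho0: "rho \<ge> 0" using XY by linarith
 \<comment> \<open>The leaves in the closed strip between the two given ones. They are pairwise
   comparable, so \<open>sig * (p + q)\<close> ranks them.\<close>
 define S where "S = {(p, q). g ** nline p q \<in> leafs \<and> 0 \<le> sig*p \<and> sig*p \<le> sig*X \<and> 0 \<le> sig*q \<and> sig*q \<le> sig*Y}"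
 have Sb: "\<bar>p\<bar> \<le> rho" "\<bar>q\<bar> \<le> rho" if "(p, q) \<in> S" for p q using that XY sig(1) by (auto simp: S_def)
 have closed_aux: "(\<exists>p q. l = (p, q) \<and> (p, q) \<in> S \<and> ((\<lambda>n. pt (g ** nline (fst (s n)) (snd (s n)))) \<longlonglongrightarrow> pt (g ** nline p q)))"
  if s: "\<And>n. s n \<in> S" "s \<longlonglongrightarrow> l" for s l
 proof -
  obtain p q where l: "l = (p, q)" by (cases l)
  have lims: "(\<lambda>n. fst (s n)) \<longlonglongrightarrow> p" "(\<lambda>n. snd (s n)) \<longlonglongrightarrow> q"
   using tendsto_fst[OF s(2)] tendsto_snd[OF s(2)] l by simp_all
  have sn: "g ** nline (fst (s n)) (snd (s n)) \<in> leafs" "0 \<le> sig*fst (s n)" "sig*fst (s n) \<le> sig*X" "0 \<le> sig * snd (s n)" "sig * snd (s n) \<le> sig*Y" for n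
   using s(1)[of n] by (auto simp: S_def case_prod_beta)
  have pq: "0 \<le> sig*p" "sig*p \<le> sig*X" "0 \<le> sig*q" "sig*q \<le> sig*Y"
   using LIMSEQ_le_const[OF tendsto_mult[OF tendsto_const lims(1)], of 0 sig] LIMSEQ_le_const2[OF tendsto_mult[OF tendsto_const lims(1)], of sig "sig*X"]
    LIMSEQ_le_const[OF tendsto_mult[OF tendsto_const lims(2)], of 0 sig] LIMSEQ_le_const2[OF tendsto_mult[OF tendsto_const lims(2)], of sig "sig*Y"] sn
   by blast+
  have b: "\<bar>p\<bar> < 1/2" "\<bar>q\<bar> < 1/2" using pq XY rho sig(1) by auto
  hence pq1: "p*q < 1" using small_mult[OF b] by linarith
  have lim: "(\<lambda>n. g ** nline (fst (s n)) (snd (s n))) \<longlonglongrightarrow> g ** nline p q"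
   by (intro tendsto_mmult tendsto_const tendsto_nline lims pq1)
  have "g ** nline p q \<in> leafs" by (rule leafs_closed[OF sn(1) lim])
  moreover have "(\<lambda>n. pt (g ** nline (fst (s n)) (snd (s n)))) \<longlonglongrightarrow> pt (g ** nline p q)"
   by (rule tendsto_pt[OF lim]) (use calculation in simp)
  ultimately show ?thesis using l pq by (auto simp: S_def)
 qed
 have compact_part: "compact {s \<in> S. (P (pt (g ** nline (fst s) (snd s))) \<longleftrightarrow> b) \<and> sig * (fst s + snd s) \<le> c}" for b c
 proof -
  let ?T = "{s \<in> S. (P (pt (g ** nline (fst s) (snd s))) \<longleftrightarrow> b) \<and> sig * (fst s + snd s) \<le> c}"
  have "closed ?T" unfolding closed_sequential_limits
  proof (intro allI impI)
   fix s l assume sl: "(\<forall>n. s n \<in> ?T) \<and> s \<longlonglongrightarrow> l"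
   hence sS: "s n \<in> S" for n by auto
   obtain p q where l: "l = (p, q)" "(p, q) \<in> S" and lim: "(\<lambda>n. pt (g ** nline (fst (s n)) (snd (s n)))) \<longlonglongrightarrow> pt (g ** nline p q)"
    using closed_aux[of s l] sS sl by blast
   have A1: "pt (g ** nline (fst (s n)) (snd (s n))) \<in> Aub" for n
    using sS[of n] leafs_Aub0 by (auto simp: S_def case_prod_beta)
   have A2: "pt (g ** nline p q) \<in> Aub" using l leafs_Aub0 by (auto simp: S_def)
   have "P (pt (g ** nline p q)) \<longleftrightarrow> b"
    using chain_class_closed[OF e A1 lim A2, of "pt g"] sl by (cases b) (auto simp: P_def)
   moreover have "sig * (p + q) \<le> c"
   proof (rule LIMSEQ_le_const2)
    have lims: "(\<lambda>n. fst (s n)) \<longlonglongrightarrow> p" "(\<lambda>n. snd (s n)) \<longlonglongrightarrow> q"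
     using sl tendsto_fst[of s l] tendsto_snd[of s l] l by auto
    show "(\<lambda>n. sig * (fst (s n) + snd (s n))) \<longlonglongrightarrow> sig * (p + q)" by (intro tendsto_intros lims)
   qed (use sl in auto)
   ultimately show "l \<in> ?T" using l by simp
  qed
  moreover have "?T \<subseteq> {-rho..rho} \<times> {-rho..rho}" using Sb by (force simp: abs_le_iff)
  hence "bounded ?T" by (rule bounded_subset[rotated]) (intro bounded_Times bounded_closed_interval)
  ultimately show ?thesis by (simp add: compact_eq_bounded_closed)
 qed
 have cont: "continuous_on T (\<lambda>s. sig * (fst s + snd s))" for T :: "(real \<times> real) set" by (intro continuous_intros)
 have XYS: "(X, Y) \<in> S" "(0, 0) \<in> S" using h g sig by (auto simp: S_def)
 have notP: "\<not> P (pt (g ** nline X Y))" and P0: "P (pt (g ** nline 0 0))" using sep by (auto simp: P_def)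
 \<comment> \<open>Take the first leaf \<open>q\<close> that is not in the class of
   \<open>g\<close>, and afterwards the last leaf \<open>p\<close> before it that is. Nothing can
   lie between them.\<close>
 let ?Q = "{s \<in> S. (P (pt (g ** nline (fst s) (snd s))) \<longleftrightarrow> False) \<and> sig * (fst s + snd s) \<le> sig * (X + Y)}"
 have "?Q \<noteq> {}" using XYS notP by fastforce
 from continuous_attains_inf[OF compact_part this cont]
 obtain q where qQ: "q \<in> ?Q" "\<And>s. s \<in> ?Q ==> sig * (fst q + snd q) \<le> sig * (fst s + snd s)" by blast
 obtain q1 q2 where q12: "q = (q1, q2)" by (cases q)
 have qS: "(q1, q2) \<in> S" and qP: "\<not> P (pt (g ** nline q1 q2))" using qQ(1) q12 by auto
 have qmin: "sig * (q1 + q2) \<le> sig * (x + y)" if "(x, y) \<in> S" "\<not> P (pt (g ** nline x y))" for x y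
 proof -
  have "sig * (x + y) \<le> sig * (X + Y)" using that(1) by (auto simp: S_def distrib_left)
  thus ?thesis using qQ(2)[of "(x, y)"] that q12 by auto
 qed
 let ?P = "{s \<in> S. (P (pt (g ** nline (fst s) (snd s))) \<longleftrightarrow> True) \<and> sig * (fst s + snd s) \<le> sig * (q1 + q2)}"
 have "0 \<le> sig * (q1 + q2)" using qS by (auto simp: S_def distrib_left)
 hence "?P \<noteq> {}" using XYS P0 by (intro ex_in_conv[THEN iffD1] exI[of _ "(0, 0)"]) auto
 from continuous_attains_sup[OF compact_part this cont]
 obtain p where pP: "p \<in> ?P" "\<And>s. s \<in> ?P ==> sig * (fst s + snd s) \<le> sig * (fst p + snd p)" by blast
 obtain p1 p2 where p12: "p = (p1, p2)" by (cases p)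
 have pS: "(p1, p2) \<in> S" and pPP: "P (pt (g ** nline p1 p2))" and pq: "sig * (p1 + p2) \<le> sig * (q1 + q2)" using pP(1) p12 by auto
 have pmax: "sig * (x + y) \<le> sig * (p1 + p2)" if "(x, y) \<in> S" "P (pt (g ** nline x y))" "sig * (x + y) \<le> sig * (q1 + q2)" for x y
  using pP(2)[of "(x, y)"] that p12 by auto
 define F where "F = g ** nline p1 p2"
 have F: "F \<in> leafs" using pS by (auto simp: S_def F_def)
 have H: "g ** nline q1 q2 \<in> leafs" using qS by (auto simp: S_def)
 \<comment> \<open>These bounds keep the denominators in the change of coordinates from
   \<open>g\<close> to \<open>F\<close> at 63/64 or more, so coordinates grow by less than the
   factor 2.\<close>
 have pb: "\<bar>p1\<bar> \<le> 1/16" "\<bar>p2\<bar> \<le> 1/16" "\<bar>q1\<bar> \<le> 1/16" "\<bar>q2\<bar> \<le> 1/16" using Sb[OF pS] Sb[OF qS] rho by auto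
 have prod: "\<bar>x * y\<bar> \<le> 1/64" if "\<bar>x\<bar> \<le> 1/16" "\<bar>y\<bar> \<le> 1/4" for x y :: real
  using mult_mono[OF that] by (simp add: abs_mult)
 have prods: "\<bar>p1*q2\<bar> \<le> 1/64" "\<bar>p2*q1\<bar> \<le> 1/64" "\<bar>p1*p2\<bar> \<le> 1/64" "\<bar>q1*q2\<bar> \<le> 1/64"
  by (rule prod; use pb in linarith)+
 have "(q1 - p1) * (q2 - p2) \<ge> 0"
  by (rule leafs_chain[OF gd F[unfolded F_def] H]) (use pb in auto)
 hence le: "sig * p1 \<le> sig * q1" "sig * p2 \<le> sig * q2" using pq sig(1) by (auto simp: zero_le_mult_iff)
 define X' where "X' = (q1 - p1) / (1 - p2*q1)"
 define Y' where "Y' = (q2 - p2) / (1 - p1*q2)"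
 define s where "s = 1 / (sqrt (1 - p1*p2) * sqrt (1 - q1*q2))"
 have s: "s > 0" using prods by (simp add: s_def abs_le_iff)
 have "adj F ** (g ** nline q1 q2) = adj (nline p1 p2) ** nline q1 q2"
  unfolding F_def adj_mult matrix_mul_assoc[symmetric] adj_cancel(1)[OF gd] ..
 also have "\<dots> = mk (s * (1 - p1*q2)) (s * (q1 - p1)) (s * (q2 - p2)) (s * (1 - p2*q1))"
  by (rule adj_nline_mult[OF s_def])
 finally have K: "adj F ** (g ** nline q1 q2) = mk (s * (1 - p1*q2)) (s * (q1 - p1)) (s * (q2 - p2)) (s * (1 - p2*q1))" .
 have Kpos: "s * (1 - p1*q2) * (s * (1 - p2*q1)) > 0" using s prods by (intro mult_pos_pos) (auto simp: abs_le_iff)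
 have XYeq: "s * (q1 - p1) / (s * (1 - p2*q1)) = X'" "s * (q2 - p2) / (s * (1 - p1*q2)) = Y'"
  using s by (simp_all add: X'_def Y'_def)
 have H': "F ** nline X' Y' \<in> leafs" using leafs_coord(1)[OF leafs_det[OF F] H K Kpos] XYeq by simp
 obtain t where "g ** nline q1 q2 = F ** nline X' Y' ** dg t \<or> g ** nline q1 q2 = - (F ** nline X' Y' ** dg t)"
  using leafs_coord(2)[OF leafs_det[OF F] H K Kpos] XYeq by auto
 hence ptH: "pt (g ** nline q1 q2) = pt (F ** nline X' Y' ** dg t)" by auto
 have nochain: "(pt F, pt (F ** nline X' Y')) \<notin> (chainrel e)\<^sup>*"
 proof
  assume "(pt F, pt (F ** nline X' Y')) \<in> (chainrel e)\<^sup>*"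
  hence "(pt F, pt (g ** nline q1 q2)) \<in> (chainrel e)\<^sup>*" using leaf_chain[OF H' e, of t] ptH by (metis rtrancl_trans)
  thus False using pPP qP unfolding P_def F_def by (meson rtrancl_trans)
 qed
 hence nz: "X' \<noteq> 0" "Y' \<noteq> 0" using asymptotic_chain[OF F H' _ e] by blast+
 have dpos: "1 - p2*q1 \<ge> 63/64" "1 - p1*q2 \<ge> 63/64" "1 - p1*p2 \<ge> 63/64" using prods by (auto simp: abs_le_iff)
 have sX: "sig * X' = (sig*q1 - sig*p1) / (1 - p2*q1)" "sig * Y' = (sig*q2 - sig*p2) / (1 - p1*q2)"
  by (simp_all add: X'_def Y'_def right_diff_distrib)
 have up: "sig*q1 - sig*p1 \<le> rho" "sig*q2 - sig*p2 \<le> rho"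
  using pS qS XY sig(1) by (auto simp: S_def)
 have sXb: "0 \<le> sig * X'" "0 \<le> sig * Y'" "sig * X' \<le> 2 * rho" "sig * Y' \<le> 2 * rho"
 proof -
  show "0 \<le> sig * X'" "0 \<le> sig * Y'" unfolding sX using le dpos by (auto intro!: divide_nonneg_nonneg)
  have "rho * 1 \<le> rho * (2 * (1 - p2*q1))" "rho * 1 \<le> rho * (2 * (1 - p1*q2))" using dpos rho0 by (intro mult_left_mono; simp)+
  thus "sig * X' \<le> 2 * rho" "sig * Y' \<le> 2 * rho"
   unfolding sX using up dpos by (subst divide_le_eq; simp add: mult_ac)+
 qed
 have q1eq: "(X' + p1) / (p2 * X' + 1) = q1"
 proof -
  have d: "1 - p2*q1 \<noteq> 0" using dpos by auto
  have "X' + p1 = q1 * (1 - p1*p2) / (1 - p2*q1)" using d by (simp add: X'_def field_simps)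
  moreover have "p2 * X' + 1 = (1 - p1*p2) / (1 - p2*q1)" using d by (simp add: X'_def field_simps)
  ultimately show ?thesis using d dpos by simp
 qed
 have q2eq: "(Y' + p2) / (p1 * Y' + 1) = q2"
 proof -
  have d: "1 - p1*q2 \<noteq> 0" using dpos by auto
  have "Y' + p2 = q2 * (1 - p1*p2) / (1 - p1*q2)" using d by (simp add: Y'_def field_simps)
  moreover have "p1 * Y' + 1 = (1 - p1*p2) / (1 - p1*q2)" using d by (simp add: Y'_def field_simps)
  ultimately show ?thesis using d dpos by simp
 qed
 have "gap sig F X' Y'" unfolding gap_def
 proof (intro conjI allI impI)
  show "F \<in> leafs" "F ** nline X' Y' \<in> leafs" by (fact F, fact H')
  show "0 < sig * X'" "0 < sig * Y'" using sXb nz sig(1) by (auto simp: less_le)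
  show "sig * X' < 1/4" "sig * Y' < 1/4" using sXb rho by auto
  fix x' y' assume m: "F ** nline x' y' \<in> leafs" "0 \<le> sig * x'" "sig * x' \<le> sig * X'" "0 \<le> sig * y'" "sig * y' \<le> sig * Y'"
  have b': "\<bar>x'\<bar> \<le> 1/4" "\<bar>y'\<bar> \<le> 1/4" "\<bar>X'\<bar> \<le> 1/4" "\<bar>Y'\<bar> \<le> 1/4" using m sXb rho sig(1) by auto
  have pr: "\<bar>p1*y'\<bar> \<le> 1/64" "\<bar>p2*x'\<bar> \<le> 1/64" "\<bar>p1*Y'\<bar> \<le> 1/64" "\<bar>p2*X'\<bar> \<le> 1/64"
   by (rule prod; use pb b' in linarith)+
  have dp: "p2*x' + 1 > 0" "p1*y' + 1 > 0" "p2*X' + 1 > 0" "p1*Y' + 1 > 0" using pr by (auto simp: abs_le_iff)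
  have xy1: "x'*y' < 1" using mult_mono[OF b'(1,2)] by (auto simp: abs_mult[symmetric] abs_le_iff)
  \<comment> \<open>The coordinates, seen from \<open>g\<close>, of a leaf in the strip at
    \<open>F\<close>. The change of coordinates is a monotone Moebius map, so the leaf falls between
    \<open>p\<close> and \<open>q\<close>, where extremality applies.\<close>
  define x'' where "x'' = (x' + p1) / (p2*x' + 1)"
  define y'' where "y'' = (y' + p2) / (p1*y' + 1)"
  define w where "w = 1 / (sqrt (1 - p1*p2) * sqrt (1 - x'*y'))"
  have w: "w > 0" using dpos xy1 by (simp add: w_def)
  have "adj g ** (F ** nline x' y') = nline p1 p2 ** nline x' y'"
   unfolding F_def using adj_cancel(1)[OF gd] by (simp flip: matrix_mul_assoc)
  also have "\<dots> = mk (w * (p1*y' + 1)) (w * (x' + p1)) (w * (y' + p2)) (w * (p2*x' + 1))"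
   unfolding w_def nline_def Let_def by (simp add: algebra_simps add_divide_distrib)
  finally have K2: "adj g ** (F ** nline x' y') = mk (w * (p1*y' + 1)) (w * (x' + p1)) (w * (y' + p2)) (w * (p2*x' + 1))" .
  have "w * (p1*y' + 1) * (w * (p2*x' + 1)) > 0" using w dp by simp
  from leafs_coord(1)[OF gd m(1) K2 this] have L: "g ** nline x'' y'' \<in> leafs" using w by (simp add: x''_def y''_def)
  have f1: "x'' - p1 = x' * (1 - p1*p2) / ((p2*x' + 1) * (p2*0 + 1))"
   using moebius_monotone[of p2 x' 0 p1] dp by (simp add: x''_def)
  have f2: "q1 - x'' = (X' - x') * (1 - p1*p2) / ((p2*X' + 1) * (p2*x' + 1))"
   using moebius_monotone[of p2 X' x' p1] dp q1eq by (simp add: x''_def)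
  have f3: "y'' - p2 = y' * (1 - p2*p1) / ((p1*y' + 1) * (p1*0 + 1))"
   using moebius_monotone[of p1 y' 0 p2] dp by (simp add: y''_def)
  have f4: "q2 - y'' = (Y' - y') * (1 - p2*p1) / ((p1*Y' + 1) * (p1*y' + 1))"
   using moebius_monotone[of p1 Y' y' p2] dp q2eq by (simp add: y''_def)
  have dpos': "1 - p2*p1 > 0" "1 - p1*p2 > 0" using dpos by (simp_all add: mult.commute)
  have sgn: "sig * (A * B / C) = (sig * A) * (B / C)" for A B C :: real by simp
  have o: "0 \<le> sig * (x'' - p1)" "0 \<le> sig * (q1 - x'')" "0 \<le> sig * (y'' - p2)" "0 \<le> sig * (q2 - y'')"
   unfolding f1 f2 f3 f4 sgn
   by ((rule mult_nonneg_nonneg, (use m in \<open>simp add: right_diff_distrib\<close>), rule divide_nonneg_nonneg,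
     (use dpos' in simp), (use dp in simp))+)
  have z1: "x' = 0" if "sig * (x'' - p1) = 0" using that dp dpos' sig(1) unfolding f1 by auto
  have z2: "x' = X'" if "sig * (q1 - x'') = 0" using that dp dpos' sig(1) unfolding f2 by auto
  have z3: "y' = 0" if "sig * (y'' - p2) = 0" using that dp dpos' sig(1) unfolding f3 by auto
  have z4: "y' = Y'" if "sig * (q2 - y'') = 0" using that dp dpos' sig(1) unfolding f4 by auto
  have "(x'', y'') \<in> S" using L o pS qS by (auto simp: S_def right_diff_distrib)
  show "(x' = 0 \<and> y' = 0) \<or> (x' = X' \<and> y' = Y')"
  proof (cases "P (pt (g ** nline x'' y''))")
   case True
   have "sig * (x'' + y'') \<le> sig * (q1 + q2)" using o by (simp add: algebra_simps)
   hence "sig * (x'' + y'') \<le> sig * (p1 + p2)" using pmax[OF \<open>(x'', y'') \<in> S\<close> True] by simp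
   hence "sig * (x'' - p1) = 0" "sig * (y'' - p2) = 0" using o unfolding right_diff_distrib distrib_left by linarith+
   thus ?thesis using z1 z3 by blast
  next
   case False
   hence "sig * (q1 + q2) \<le> sig * (x'' + y'')" using qmin[OF \<open>(x'', y'') \<in> S\<close>] by simp
   hence "sig * (q1 - x'') = 0" "sig * (q2 - y'') = 0" using o unfolding right_diff_distrib distrib_left by linarith+
   thus ?thesis using z2 z4 by blast
  qed
 qed
 thus ?thesis using that[OF sig(1) _ sXb(3,4)] by blast
qed

text \<open>If nearby points lay in different \<open>e\<close>-classes, \<open>separated_gap\<close>
  would give a gap thinner than \<open>gap_lower_bound\<close> permits. That bound does not involve
  \<open>e\<close>, so one \<open>eps\<close> serves all \<open>e\<close>.\<close>

lemma aub_uniform: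
 obtains eps where "eps > 0" "\<And>x y e. x \<in> Aub ==> y \<in> Aub ==> hdist x y < eps ==> e > 0 ==> (x, y) \<in> (chainrel e)\<^sup>*"
proof -
 obtain d1 where d1: "d1 > 0" "\<And>F x y. gap 1 F x y ==> 1*x < d1 ==> 1*y < d1 ==> False"
  using gap_lower_bound[of 1] by blast
 obtain d2 where d2: "d2 > 0" "\<And>F x y. gap (-1) F x y ==> (-1)*x < d2 ==> (-1)*y < d2 ==> False"
  using gap_lower_bound[of "-1"] by blast
 define rho where "rho = min (min d1 d2 / 4) (1/16)"
 have rho: "rho > 0" "rho \<le> 1/16" "2*rho < d1" "2*rho < d2" using d1 d2 by (auto simp: rho_def min_def)
 \<comment> \<open>With this choice \<open>leafs_rel_bound\<close> gives
   \<open>\<bar>b\<bar>, \<bar>c\<bar> \<le> rho/2\<close> and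
   \<open>\<bar>a - d\<bar> \<le> 1/2\<close>; then \<open>a\<close> and \<open>d\<close> have
   absolute value at least 1/2, and \<open>b/d\<close>, \<open>c/a\<close> are at most
   \<open>rho\<close>.\<close>
 define eta where "eta = min (1/8) (rho\<^sup>2 / (4 * cK))"
 have eta: "eta > 0" "eta \<le> 1/8" "cK * eta \<le> rho\<^sup>2 / 4" using rho cK_pos by (auto simp: eta_def min_def field_simps)
 define eps where "eps = arcosh (1 + eta)"
 have eps: "eps > 0" "cosh eps = 1 + eta" using eta by (simp_all add: eps_def cosh_arcosh_real)
 have "(x, y) \<in> (chainrel e)\<^sup>*" if xy: "x \<in> Aub" "y \<in> Aub" "hdist x y < eps" and e: "e > 0" for x y e
 proof (rule ccontr)
  assume no: "(x, y) \<notin> (chainrel e)\<^sup>*"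
  obtain g where g: "g \<in> leafs" "pt g = x" using ex_leaf xy by blast
  obtain h where h: "h \<in> leafs" "pt h = y" using ex_leaf xy by blast
  obtain a b c d where k: "adj g ** h = mk a b c d" by (rule mk_cases)
  have det: "a*d - b*c = 1" using det_mult1[of "adj g" h] g h k by simp
  have "cosh (hdist x y) \<le> cosh eps" using xy eps(1) by (subst cosh_real_nonneg_le_iff) auto
  hence c: "cosh (hdist (pt g) (pt h)) - 1 \<le> eta" using eps g h by simp
  have 1: "b\<^sup>2 + c\<^sup>2 \<le> rho\<^sup>2 / 4"
   using leafs_rel_bound(1)[OF g(1) h(1) k] mult_left_mono[OF c, of cK] cK_pos eta(3) by linarith
  have 2: "(a - d)\<^sup>2 \<le> (1/2)\<^sup>2" using leafs_rel_bound(2)[OF g(1) h(1) k] c eta(2) by (simp add: power2_eq_square)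
  have ad: "\<bar>a - d\<bar> \<le> 1/2" using abs_le_square_iff[of "a - d" "1/2"] 2 by simp
  have "(rho/2)\<^sup>2 = rho\<^sup>2 / 4" by (simp add: power_divide)
  hence b2: "b\<^sup>2 \<le> (rho/2)\<^sup>2" "c\<^sup>2 \<le> (rho/2)\<^sup>2" using 1 zero_le_power2[of b] zero_le_power2[of c] by linarith+
  have bc: "\<bar>b\<bar> \<le> rho/2" "\<bar>c\<bar> \<le> rho/2"
   using abs_le_square_iff[of b "rho/2"] abs_le_square_iff[of c "rho/2"] b2 rho by simp_all
  have "\<bar>b * c\<bar> \<le> rho/2 * (rho/2)" unfolding abs_mult using bc rho by (intro mult_mono) auto
  also have "\<dots> \<le> 1/32 * (1/32)" using rho by (intro mult_mono) auto
  finally have adge: "a * d \<ge> 3/4" using det by (auto simp: abs_le_iff)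
  have half: "1/2 \<le> \<bar>z\<bar>" if "z * w \<ge> 3/4" "\<bar>z - w\<bar> \<le> 1/2" for z w :: real
  proof (rule ccontr)
   assume "\<not> ?thesis"
   hence zw: "\<bar>z\<bar> \<le> 1/2" "\<bar>w\<bar> \<le> 1" using that(2) by linarith+
   have "\<bar>z\<bar> * \<bar>w\<bar> \<le> 1/2 * 1" using zw by (intro mult_mono) auto
   thus False using that(1) by (simp add: abs_mult[symmetric] abs_le_iff)
  qed
  have adh: "1/2 \<le> \<bar>a\<bar>" "1/2 \<le> \<bar>d\<bar>" using half[of a d] half[of d a] adge ad by (auto simp: mult.commute abs_minus_commute)
  have "\<bar>b\<bar> \<le> rho * \<bar>d\<bar>" "\<bar>c\<bar> \<le> rho * \<bar>a\<bar>"
   using bc mult_left_mono[OF adh(2), of rho] mult_left_mono[OF adh(1), of rho] rho(1) by linarith+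
  hence XY: "\<bar>b/d\<bar> \<le> rho" "\<bar>c/a\<bar> \<le> rho" using adh by (simp_all add: abs_divide divide_le_eq)
  have pos: "a * d > 0" using adge by linarith
  have L: "g ** nline (b/d) (c/a) \<in> leafs" by (rule leafs_coord(1)[OF leafs_det[OF g(1)] h(1) k pos])
  obtain s where "h = g ** nline (b/d) (c/a) ** dg s \<or> h = - (g ** nline (b/d) (c/a) ** dg s)"
   using leafs_coord(2)[OF leafs_det[OF g(1)] h(1) k pos] by blast
  hence "y = pt (g ** nline (b/d) (c/a) ** dg s)" using h by auto
  hence "(pt (g ** nline (b/d) (c/a)), y) \<in> (chainrel e)\<^sup>*" using leaf_chain[OF L e, of s] by simp
  hence sep: "(pt g, pt (g ** nline (b/d) (c/a))) \<notin> (chainrel e)\<^sup>*" using no g by (meson rtrancl_trans)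
  obtain sig F x' y' where gp: "sig = 1 \<or> sig = -1" "gap sig F x' y'" "sig * x' \<le> 2 * rho" "sig * y' \<le> 2 * rho"
   using separated_gap[OF g(1) L XY rho(2) e sep] by blast
  hence "sig * x' < d1" "sig * y' < d1" "sig * x' < d2" "sig * y' < d2" using rho by linarith+
  thus False using gp(1,2) d1(2)[of F x' y'] d2(2)[of F x' y'] by auto
 qed
 thus ?thesis using that eps(1) by blast
qed

section \<open>The chain classes and their number\<close>

definition crel :: "(complex \<times> complex) set" where
 "crel = {(x, y). x \<in> Aub \<and> y \<in> Aub \<and> (\<forall>e>0. (x, y) \<in> (chainrel e)\<^sup>*)}"

lemma crel_equiv: "equiv Aub crel"
proof (rule equivI)
 show "crel \<subseteq> Aub \<times> Aub" by (auto simp: crel_def)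
 show "refl_on Aub crel" by (auto simp: refl_on_def crel_def)
 show "sym crel" by (auto simp: sym_def crel_def chainrel_star_sym)
 show "trans crel" unfolding trans_def crel_def by clarsimp (meson rtrancl_trans)
qed

lemma crel_Aub: "(x, y) \<in> crel ==> x \<in> Aub \<and> y \<in> Aub" by (simp add: crel_def)

lemma crel_Gam: assumes "x \<in> Aub" "A \<in> Gam" shows "(x, act A x) \<in> crel"
proof -
 have "(act A x, x) \<in> chainrel e" if "e > 0" for e
  using assms that Aub_act[OF assms(1) Gam_G[OF assms(2)]] Gam_G[OF assms(2)] by (auto simp: chainrel_def intro!: bexI[of _ A])
 thus ?thesis using assms Aub_act[OF assms(1) Gam_G[OF assms(2)]]
  by (auto simp: crel_def intro: chainrel_sym)
qed

lemma crel_leaf: "g \<in> leafs ==> (pt g, geo g t) \<in> crel"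
 using leaf_chain leafs_Aub leafs_Aub0 by (auto simp: crel_def)

lemma crel_uniform:
 obtains eps where "eps > 0" "\<And>x y A. x \<in> Aub ==> y \<in> Aub ==> A \<in> Gam ==> hdist x (act A y) < eps ==> (x, y) \<in> crel"
proof -
 obtain eps where eps: "eps > 0" "\<And>x y e. x \<in> Aub ==> y \<in> Aub ==> hdist x y < eps ==> e > 0 ==> (x, y) \<in> (chainrel e)\<^sup>*"
  using aub_uniform by blast
 have "(x, y) \<in> crel" if "x \<in> Aub" "y \<in> Aub" "A \<in> Gam" "hdist x (act A y) < eps" for x y A
 proof -
  have Ay: "act A y \<in> Aub" using that Aub_act Gam_G by blast
  hence "(x, act A y) \<in> crel" using eps(2)[OF that(1) Ay that(4)] that by (simp add: crel_def)
  moreover have "(act A y, y) \<in> crel" using crel_Gam[OF that(2,3)] crel_equiv by (meson equivE symD)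
  ultimately show ?thesis using crel_equiv by (meson equivE transD)
 qed
 thus ?thesis using that eps(1) by blast
qed

text \<open>Each leaf crosses the zero level of \<open>u\<close>, which modulo \<open>Gam\<close> is
  covered by finitely many balls of radius \<open>eps/2\<close>. Points of the lamination in one
  ball belong to one class.\<close>

lemma finite_classes: "finite (Aub // crel)"
proof -
 obtain u where u: "u \<in> tightf" using tightf_nonempty by blast
 obtain eps where eps: "eps > 0" "\<And>x y A. x \<in> Aub ==> y \<in> Aub ==> A \<in> Gam ==> hdist x (act A y) < eps ==> (x, y) \<in> crel"
  using crel_uniform by blast
 have "eps/2 > 0" using eps by simp
 from level_net[OF u this, of 0]
 obtain F where F: "finite F" "F \<subseteq> UH" "\<And>x. x \<in> UH ==> u x = 0 ==> \<exists>f\<in>F. \<exists>C\<in>Gam. hdist f (act C x) < eps/2"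
  by metis
 define N where "N f = {x \<in> Aub. \<exists>C\<in>Gam. hdist f (act C x) < eps/2}" for f
 have "Aub // crel \<subseteq> (\<lambda>f. crel `` {SOME x. x \<in> N f}) ` F"
 proof
  fix K assume "K \<in> Aub // crel"
  then obtain x where x: "x \<in> Aub" "K = crel `` {x}" by (auto simp: quotient_def)
  obtain g where g: "g \<in> leafs" "pt g = x" using ex_leaf x by blast
  define y where "y = geo g (- u x)"
  have y: "y \<in> Aub" "u y = 0" "(x, y) \<in> crel" using leafs_Aub[OF g(1)] leafs_tight[OF g(1) u] crel_leaf[OF g(1)] g by (simp_all add: y_def)
  obtain f C where f: "f \<in> F" "C \<in> Gam" "hdist f (act C y) < eps/2" using F(3)[of y] y by auto
  define z where "z = (SOME x. x \<in> N f)"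
  have "y \<in> N f" using f y by (auto simp: N_def)
  hence "z \<in> N f" unfolding z_def by (rule someI)
  then obtain D where z: "z \<in> Aub" "D \<in> Gam" "hdist f (act D z) < eps/2" by (auto simp: N_def)
  have G: "C \<in> G" "D \<in> G" "f \<in> UH" using f z F Gam_G by auto
  have "hdist (act C y) (act D z) < eps"
   using hdist_triangle[of "act C y" f "act D z"] f z y G by (simp add: hdist_commute)
  moreover have "hdist y (act (adj C ** D) z) = hdist (act C y) (act D z)"
   using hdist_act_adj[of "adj C" y "act D z"] y z G by (simp add: act_mult_G)
  ultimately have "(y, z) \<in> crel" using eps(2)[of y z "adj C ** D"] y z f by simp
  hence "(x, z) \<in> crel" using y(3) crel_equiv by (meson equivE transD)
  hence "K = crel `` {z}" using x equiv_class_eq[OF crel_equiv] by blast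
  thus "K \<in> (\<lambda>f. crel `` {SOME x. x \<in> N f}) ` F" using f by (auto simp: z_def)
 qed
 thus ?thesis using F(1) finite_subset by blast
qed

end

section \<open>Quasi-minimizing horocycles\<close>

context zcover
begin

text \<open>The difference of two tight functions is invariant under the cocompact group, so the
  choice of \<open>u\<close> matters only up to a bounded error.\<close>

lemma tight_diff_bounded:
 assumes u: "u \<in> tightf" and w: "w \<in> tightf"
 obtains C where "\<And>x. x \<in> UH ==> \<bar>u x - w x\<bar> \<le> C"
proof -
 obtain R where R: "R \<ge> 0" "\<And>z. z \<in> UH ==> \<exists>A\<in>G. hdist \<i> (act A z) \<le> R" using near_orbit by blast
 have "\<bar>u x - w x\<bar> \<le> \<bar>u \<i> - w \<i>\<bar> + 2 * R" if x: "x \<in> UH" for x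
 proof -
  obtain A where A: "A \<in> G" "hdist \<i> (act A x) \<le> R" using R x by blast
  have "\<bar>u \<i> - u (act A x)\<bar> \<le> R" "\<bar>w \<i> - w (act A x)\<bar> \<le> R"
   using tightf_lip_abs[OF u i_UH, of "act A x"] tightf_lip_abs[OF w i_UH, of "act A x"] A x by auto
  thus ?thesis using tightf_act[OF u A(1) x] tightf_act[OF w A(1) x] by linarith
 qed
 thus ?thesis using that by blast
qed

text \<open>The vector \<open>v\<close> stands for the horocycle that is a level set of \<open>horo v\<close>. It is quasi-minimizing if a
 ray to its base point climbs \<open>u\<close> at unit speed up to a bounded error.\<close>

definition Qp :: "real^2 \<Rightarrow> bool" where
 "Qp v \<longleftrightarrow> v \<noteq> 0 \<and> (\<exists>u\<in>tightf. \<exists>s. \<forall>x\<in>UH. s \<le> u x + horo v x)"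

lemma Qp_nonzero: "Qp v ==> v \<noteq> 0" by (simp add: Qp_def)

lemma Qp_bound:
 assumes "Qp v" "u \<in> tightf"
 shows "\<exists>s. \<forall>x\<in>UH. s \<le> u x + horo v x"
proof -
 obtain w s where w: "w \<in> tightf" "\<And>x. x \<in> UH ==> s \<le> w x + horo v x" using assms(1) by (auto simp: Qp_def)
 obtain C where C: "\<And>x. x \<in> UH ==> \<bar>u x - w x\<bar> \<le> C" using tight_diff_bounded[OF assms(2) w(1)] by blast
 have "s - C \<le> u x + horo v x" if "x \<in> UH" for x using w(2)[OF that] C[OF that] by linarith
 thus ?thesis by blast
qed

section \<open>The level and the invariant horofunction\<close>

definition lev :: "(complex \<Rightarrow> real) \<Rightarrow> real^2 \<Rightarrow> real" where
 "lev u v = (INF x\<in>UH. u x + horo v x)"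

lemma UH_ne: "UH \<noteq> {}" using i_UH by blast

lemma lev_bdd: assumes "Qp v" "u \<in> tightf" shows "bdd_below ((\<lambda>x. u x + horo v x) ` UH)"
proof -
 obtain s where "\<forall>x\<in>UH. s \<le> u x + horo v x" using Qp_bound[OF assms] by blast
 thus ?thesis by (intro bdd_belowI2[of _ s]) blast
qed

lemma lev_le: "Qp v ==> u \<in> tightf ==> x \<in> UH ==> lev u v \<le> u x + horo v x"
 unfolding lev_def by (rule cINF_lower[OF lev_bdd])

lemma lev_greatest: "(\<And>x. x \<in> UH ==> s \<le> u x + horo v x) ==> s \<le> lev u v"
 unfolding lev_def by (rule cINF_greatest[OF UH_ne])

lemma lev_approx: assumes "Qp v" "u \<in> tightf" "e > 0" obtains x where "x \<in> UH" "u x + horo v x < lev u v + e"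
proof -
 have "\<not> (\<forall>x\<in>UH. lev u v + e \<le> u x + horo v x)"
 proof
  assume "\<forall>x\<in>UH. lev u v + e \<le> u x + horo v x"
  hence "lev u v + e \<le> lev u v" by (intro lev_greatest) blast
  thus False using assms(3) by simp
 qed
 thus ?thesis using that by (auto simp: not_le)
qed

text \<open>The upper envelope of the translates of \<open>- horo v\<close>, a function on the
  cover. By \<open>closure_orb\<close> it depends only on the orbit closure of
  \<open>v\<close>.\<close>

definition Uf :: "real^2 \<Rightarrow> complex \<Rightarrow> real" where
 "Uf v x = (SUP A\<in>Gam. - horo v (act A x))"

lemma Gam_ne: "Gam \<noteq> {}" using Gam_one by blast

lemma Gam_u: "u \<in> tightf ==> A \<in> Gam ==> x \<in> UH ==> u (act A x) = u x"
 using tightf_act[of u A x] Gam_G[of A] by (simp add: Gam_def)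

lemma Uf_bdd: assumes "Qp v" "x \<in> UH" shows "bdd_above ((\<lambda>A. - horo v (act A x)) ` Gam)"
proof -
 obtain u where u: "u \<in> tightf" using tightf_nonempty by blast
 show ?thesis
 proof (rule bdd_aboveI2)
  fix A assume A: "A \<in> Gam"
  show "- horo v (act A x) \<le> u x - lev u v"
   using lev_le[OF assms(1) u, of "act A x"] Gam_u[OF u A assms(2)] Gam_G[OF A] assms by simp
 qed
qed

lemma Uf_ge: "Qp v ==> x \<in> UH ==> A \<in> Gam ==> - horo v (act A x) \<le> Uf v x"
 unfolding Uf_def by (rule cSUP_upper[OF _ Uf_bdd])

lemma Uf_ge1: "Qp v ==> x \<in> UH ==> - horo v x \<le> Uf v x"
 using Uf_ge[of v x "mat 1"] by simp

lemma Uf_least: "(\<And>A. A \<in> Gam ==> - horo v (act A x) \<le> c) ==> Uf v x \<le> c"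
 unfolding Uf_def by (rule cSUP_least[OF Gam_ne])

lemma Uf_approx: assumes "Qp v" "x \<in> UH" "e > 0" obtains A where "A \<in> Gam" "- horo v (act A x) > Uf v x - e"
proof -
 have "\<not> (\<forall>A\<in>Gam. - horo v (act A x) \<le> Uf v x - e)"
 proof
  assume "\<forall>A\<in>Gam. - horo v (act A x) \<le> Uf v x - e"
  hence "Uf v x \<le> Uf v x - e" by (intro Uf_least) blast
  thus False using assms(3) by simp
 qed
 thus ?thesis using that by (auto simp: not_le)
qed

lemma Uf_le: assumes "Qp v" "u \<in> tightf" "x \<in> UH" shows "Uf v x \<le> u x - lev u v"
proof (rule Uf_least)
 fix A assume A: "A \<in> Gam"
 show "- horo v (act A x) \<le> u x - lev u v"
  using lev_le[OF assms(1,2), of "act A x"] Gam_u[OF assms(2) A assms(3)] Gam_G[OF A] assms by simp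
qed

lemma Uf_Gam_le: assumes "Qp v" "x \<in> UH" "B \<in> Gam" shows "Uf v (act B x) \<le> Uf v x"
proof (rule Uf_least)
 fix A assume A: "A \<in> Gam"
 have "act A (act B x) = act (A ** B) x" using A assms Gam_G by (simp add: act_mult_G)
 thus "- horo v (act A (act B x)) \<le> Uf v x" using Uf_ge[OF assms(1,2), of "A ** B"] A assms by simp
qed

lemma Uf_Gam: assumes "Qp v" "x \<in> UH" "B \<in> Gam" shows "Uf v (act B x) = Uf v x"
proof (rule antisym[OF Uf_Gam_le[OF assms]])
 have BG: "B \<in> G" using assms Gam_G by simp
 have "Uf v (act (adj B) (act B x)) \<le> Uf v (act B x)" using Uf_Gam_le[of v "act B x" "adj B"] assms BG by simp
 thus "Uf v x \<le> Uf v (act B x)" using assms BG by (simp add: act_adj)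
qed

lemma Uf_lip: assumes "Qp v" "x \<in> UH" "y \<in> UH" shows "Uf v x - Uf v y \<le> hdist x y"
proof -
 have "Uf v x \<le> Uf v y + hdist x y"
 proof (rule Uf_least)
  fix A assume A: "A \<in> Gam"
  have AG: "A \<in> G" using A Gam_G by simp
  have "horo v (act A y) - horo v (act A x) \<le> hdist x y"
   using horo_lipschitz[OF Qp_nonzero[OF assms(1)], of "act A y" "act A x"] AG assms by (simp add: hdist_act_G hdist_commute)
  thus "- horo v (act A x) \<le> Uf v y + hdist x y" using Uf_ge[OF assms(1,3) A] by simp
 qed
 thus ?thesis by simp
qed

lemma ray_u_unbounded:
 assumes v: "Qp v" and u: "u \<in> tightf" and g: "det g = 1" "(v v* g)$1 = 0"
 shows "u (geo g t) \<ge> lev u v - horo v (pt g) + t"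
 using lev_le[OF v u, of "geo g t"] horo_ray_level[OF g(1) Qp_nonzero[OF v] g(2), of t] g by (simp add: det_mult1)

text \<open>Both nontrivial clauses come from rays to the base point, along which
  \<open>- horo v\<close> grows at unit speed. Climbing above \<open>u x\<close> and returning by
  \<open>coarse_upper\<close> bounds the excess; following the ray from an almost optimal translate
  up to level \<open>h\<close> gives the dynamic programming principle.\<close>

lemma subsol_Uf: assumes v: "Qp v" and u: "u \<in> tightf" shows "subsol u (Uf v)"
 unfolding subsol_def
proof (intro conjI ballI allI impI)
 show "Uf v x - Uf v y \<le> hdist x y" if "x \<in> UH" "y \<in> UH" for x y using Uf_lip[OF v that] .
 show "Uf v (act A x) = Uf v x" if "A \<in> Gam" "x \<in> UH" for A x using Uf_Gam[OF v that(2,1)] .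
 have vn: "v \<noteq> 0" using Qp_nonzero[OF v] .
 show "\<exists>C. \<forall>x\<in>UH. \<bar>u x - Uf v x\<bar> \<le> C"
 proof -
  obtain C0 where C0: "C0 \<ge> 0" "\<And>x y. x \<in> UH ==> y \<in> UH ==> u x \<le> u y ==> \<exists>A\<in>Gam. hdist x (act A y) \<le> u y - u x + C0"
   using coarse_upper[OF u] by blast
  obtain g r where g: "det g = 1" "pt g = \<i>" "(v v* g)$1 = 0" "(v v* g)$2 = r" using horo_ray[OF i_UH] by blast
  have "u x - Uf v x \<le> u \<i> + horo v \<i> + C0" if x: "x \<in> UH" for x
  proof -
   define t where "t = \<bar>u x - lev u v + horo v \<i>\<bar>"
   define y where "y = geo g t"
   have t: "t \<ge> 0" by (simp add: t_def)
   have y: "y \<in> UH" "u x \<le> u y" "horo v y = horo v \<i> - t"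
    using ray_u_unbounded[OF v u g(1,3), of t] horo_ray_level[OF g(1) vn g(3), of t] g by (auto simp: y_def t_def det_mult1)
   obtain A where A: "A \<in> Gam" "hdist x (act A y) \<le> u y - u x + C0" using C0(2)[OF x y(1,2)] by blast
   have AG: "A \<in> G" using A Gam_G by simp
   have "u y \<le> u \<i> + t" using tightf_lip[OF u y(1) i_UH] hdist_geo[OF g(1), of t 0] g t by (simp add: y_def)
   moreover have "horo v (act (adj A) x) - horo v y \<le> hdist x (act A y)"
    using horo_lipschitz[OF vn, of "act (adj A) x" y] hdist_act_adj[OF AG x y(1)] AG x y by simp
   moreover have "- horo v (act (adj A) x) \<le> Uf v x" using Uf_ge[OF v x, of "adj A"] A by simp
   ultimately show ?thesis using A(2) y(3) by linarith
  qed
  moreover have "lev u v \<le> u x - Uf v x" if "x \<in> UH" for x using Uf_le[OF v u that] by simp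
  ultimately have "\<forall>x\<in>UH. \<bar>u x - Uf v x\<bar> \<le> \<bar>u \<i> + horo v \<i> + C0\<bar> + \<bar>lev u v\<bar>" by fastforce
  thus ?thesis by blast
 qed
 fix x h e :: real and z assume z: "z \<in> UH" "u z \<le> h" "0 < e"
 obtain A where A: "A \<in> Gam" "- horo v (act A z) > Uf v z - e" using Uf_approx[OF v z(1,3)] .
 have AG: "A \<in> G" using A Gam_G by simp
 have Az: "act A z \<in> UH" using AG z by simp
 obtain g r where g: "det g = 1" "pt g = act A z" "(v v* g)$1 = 0" "(v v* g)$2 = r" using horo_ray[OF Az] by blast
 have gU: "geo g t \<in> UH" for t using g by (simp add: det_mult1)
 define t where "t = \<bar>h - lev u v + horo v (act A z)\<bar>"
 have "h \<le> u (geo g t)" using ray_u_unbounded[OF v u g(1,3), of t] g by (simp add: t_def)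
 moreover have "u (geo g 0) \<le> h" using g z Gam_u[OF u A(1) z(1)] by simp
 moreover have "continuous_on {0..t} (\<lambda>t. u (geo g t))"
  unfolding continuous_on_def
  by (intro ballI tightf_tendsto[OF u _ gU gU]) (use continuous_on_geo[OF g(1), of "{0..t}"] in \<open>simp add: continuous_on_def\<close>)
 ultimately obtain tau where tau: "0 \<le> tau" "tau \<le> t" "u (pt (g ** dg tau)) = h"
  using IVT'[of "\<lambda>t. u (geo g t)" 0 h t] by (auto simp: t_def)
 define y where "y = act (adj A) (pt (g ** dg tau))"
 have y: "y \<in> UH" using AG gU by (simp add: y_def)
 have "u y = h" using Gam_u[OF u _ gU, of "adj A" tau] A tau by (simp add: y_def)
 moreover have "Uf v y = Uf v (pt (g ** dg tau))" using Uf_Gam[OF v gU, of "adj A" tau] A by (simp add: y_def)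
 moreover have "- horo v (pt (g ** dg tau)) \<le> Uf v (pt (g ** dg tau))" using Uf_ge1[OF v gU] .
 moreover have "horo v (pt (g ** dg tau)) = horo v (act A z) - tau" using horo_ray_level[OF g(1) vn g(3), of tau] g by simp
 moreover have "hdist z y = tau"
  using hdist_act_adj[OF _ gU z(1), of A tau] hdist_geo[OF g(1), of tau 0] g tau AG by (simp add: y_def hdist_commute)
 ultimately show "\<exists>y\<in>UH. u y = h \<and> Uf v z \<le> Uf v y - hdist z y + e" using A(2) y by (intro bexI[of _ y]) auto
qed

section \<open>Asymptotics of rays and the attracting class\<close>

lemma ray_sync:
 assumes g: "det g = 1" "(v v* g)$1 = 0" and h: "det h = 1" "(v v* h)$1 = 0" and v: "v \<noteq> 0"
 shows "((\<lambda>t. hdist (geo g t) (geo h (t + (horo v (pt h) - horo v (pt g))))) \<longlongrightarrow> 0) at_top"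
proof -
 define c where "c = horo v (pt h) - horo v (pt g)"
 have hc: "det (h ** dg c) = 1" "(v v* (h ** dg c))$1 = 0" using h by (simp_all add: det_mult1 flip: vmult_assoc) (simp add: dg_def)
 have "horo v (pt g) = horo v (geo h c)" using horo_ray_level[OF h(1) v h(2), of c] by (simp add: c_def)
 from horo_rays_asymptotic[OF g(1) hc(1) v g(2) hc(2) this]
 show ?thesis by (simp add: dg_add c_def add.commute flip: matrix_mul_assoc)
qed

text \<open>Along such a ray \<open>u + horo v\<close> cannot increase, since \<open>u\<close> gains
  at most what \<open>horo v\<close> loses. All rays to the base point synchronise, so starting one
  at an almost minimal point shows that the limit is the infimum.\<close>

lemma ray_lev:
 assumes v: "Qp v" and u: "u \<in> tightf" and g: "det g = 1" "(v v* g)$1 = 0"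
 shows "((\<lambda>t. u (geo g t) + horo v (geo g t)) \<longlongrightarrow> lev u v) at_top"
proof (rule tendstoI)
 fix e :: real assume e: "e > 0"
 have vn: "v \<noteq> 0" using Qp_nonzero[OF v] .
 have "e/2 > 0" using e by simp
 then obtain x where x: "x \<in> UH" "u x + horo v x < lev u v + e/2" using lev_approx[OF v u] by blast
 obtain h r where h: "det h = 1" "pt h = x" "(v v* h)$1 = 0" "(v v* h)$2 = r" using horo_ray[OF x(1)] by blast
 define c where "c = horo v (pt h) - horo v (pt g)"
 have "\<forall>\<^sub>F t in at_top. hdist (geo g t) (geo h (t + c)) < e/2"
  using order_tendstoD(2)[OF ray_sync[OF g h(1,3) vn], of "e/2"] e by (simp add: c_def)
 moreover have "\<forall>\<^sub>F t in at_top. t \<ge> -c" by (rule eventually_ge_at_top)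
 ultimately show "\<forall>\<^sub>F t in at_top. dist (u (geo g t) + horo v (geo g t)) (lev u v) < e"
 proof eventually_elim
  case (elim t)
  have gU: "geo g t \<in> UH" "geo h (t + c) \<in> UH" using g h by (simp_all add: det_mult1)
  have "u (geo g t) \<le> u (geo h (t + c)) + e/2" using tightf_lip[OF u gU] elim by simp
  moreover have "u (geo h (t + c)) \<le> u x + (t + c)"
   using tightf_lip[OF u gU(2) x(1)] hdist_geo[OF h(1), of "t + c" 0] h elim by simp
  moreover have "horo v (geo g t) = horo v x - (t + c)" using horo_ray_level[OF g(1) vn g(2), of t] h by (simp add: c_def)
  moreover have "lev u v \<le> u (geo g t) + horo v (geo g t)" using lev_le[OF v u gU(1)] .
  ultimately show ?case using x(2) by (simp add: dist_real_def)
 qed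
qed

text \<open>The strict function from \<open>strict_outside_Aub\<close> grows more slowly than unit
  speed on a short stretch that starts away from \<open>Aub\<close>; the loss \<open>m\<close> is
  the same for all such stretches.\<close>

lemma excursion_cost:
 assumes e: "e > 0"
 obtains u m where "u \<in> tightf" "m > 0"
  "\<And>g t. det g = 1 ==> (\<And>a. a \<in> Aub ==> hdist (geo g t) a \<ge> e) ==> \<exists>s>0. u (geo g (t + s)) \<le> u (geo g t) + s - m"
proof -
 obtain u eta rho where u: "u \<in> tightf" "0 < eta" "eta \<le> 1" "0 < rho"
  "\<And>x y. x \<in> UH ==> y \<in> UH ==> (\<And>a. a \<in> Aub ==> hdist x a \<ge> e) ==> hdist x y < rho ==> \<bar>u y - u x\<bar> \<le> (1 - eta) * hdist x y"
  using strict_outside_Aub[OF e] by metis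
 define s where "s = rho / 2"
 have s: "s > 0" "s < rho" using u by (simp_all add: s_def)
 show ?thesis
 proof (rule that[OF u(1), of "eta * s"])
  show "0 < eta * s" using u s by simp
  fix g t assume g: "det g = 1" and far: "\<And>a. a \<in> Aub ==> hdist (geo g t) a \<ge> e"
  have d: "hdist (geo g t) (geo g (t + s)) = s" using hdist_geo[OF g] s by simp
  have "\<bar>u (geo g (t + s)) - u (geo g t)\<bar> \<le> (1 - eta) * s"
   using u(5)[of "geo g t" "geo g (t + s)"] far g s d by (simp add: det_mult1)
  thus "\<exists>s'>0. u (geo g (t + s')) \<le> u (geo g t) + s' - eta * s"
   using s by (intro exI[of _ s]) (auto simp: algebra_simps)
 qed
qed

text \<open>Once \<open>u + horo v\<close> is within \<open>m\<close> of its infimum, an excursion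
  with loss \<open>m\<close> would push it below.\<close>

lemma ray_to_Aub:
 assumes v: "Qp v" and g: "det g = 1" "(v v* g)$1 = 0" and e: "e > 0"
 shows "\<forall>\<^sub>F t in at_top. \<exists>a\<in>Aub. hdist (geo g t) a < e"
proof -
 obtain u m where u: "u \<in> tightf" "m > 0"
  "\<And>g t. det g = 1 ==> (\<And>a. a \<in> Aub ==> hdist (geo g t) a \<ge> e) ==> \<exists>s>0. u (geo g (t + s)) \<le> u (geo g t) + s - m"
  using excursion_cost[OF e] by metis
 have vn: "v \<noteq> 0" using Qp_nonzero[OF v] .
 have "\<forall>\<^sub>F t in at_top. u (geo g t) + horo v (geo g t) < lev u v + m"
  using order_tendstoD(2)[OF ray_lev[OF v u(1) g], of "lev u v + m"] u(2) by simp
 thus ?thesis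
 proof eventually_elim
  case (elim t)
  show ?case
  proof (rule ccontr)
   assume "\<not> ?thesis"
   hence "\<And>a. a \<in> Aub ==> hdist (geo g t) a \<ge> e" by (auto simp: not_less)
   then obtain s where s: "s > 0" "u (geo g (t + s)) \<le> u (geo g t) + s - m" using u(3)[OF g(1)] by blast
   have "lev u v \<le> u (geo g (t + s)) + horo v (geo g (t + s))"
    using lev_le[OF v u(1), of "geo g (t + s)"] g by (simp add: det_mult1)
   thus False using s(2) elim horo_ray_level[OF g(1) vn g(2), of t] horo_ray_level[OF g(1) vn g(2), of "t + s"] by simp
  qed
 qed
qed

lemma crel_trans: "(x, y) \<in> crel ==> (y, z) \<in> crel ==> (x, z) \<in> crel"
 using crel_equiv by (meson equivE transD)
lemma crel_sym: "(x, y) \<in> crel ==> (y, x) \<in> crel"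
 using crel_equiv by (meson equivE symD)

definition eps0 :: real where
 "eps0 = (SOME eps. eps > 0 \<and> (\<forall>x y A. x \<in> Aub \<longrightarrow> y \<in> Aub \<longrightarrow> A \<in> Gam \<longrightarrow> hdist x (act A y) < eps \<longrightarrow> (x, y) \<in> crel))"

lemma eps0: "eps0 > 0" "x \<in> Aub ==> y \<in> Aub ==> A \<in> Gam ==> hdist x (act A y) < eps0 ==> (x, y) \<in> crel"
proof -
 have "\<exists>eps>0. \<forall>x y A. x \<in> Aub \<longrightarrow> y \<in> Aub \<longrightarrow> A \<in> Gam \<longrightarrow> hdist x (act A y) < eps \<longrightarrow> (x, y) \<in> crel"
  using crel_uniform by metis
 from someI_ex[OF this] show "eps0 > 0" "x \<in> Aub ==> y \<in> Aub ==> A \<in> Gam ==> hdist x (act A y) < eps0 ==> (x, y) \<in> crel"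
  unfolding eps0_def by blast+
qed

lemma eps0_near: "x \<in> Aub ==> y \<in> Aub ==> hdist x y < eps0 ==> (x, y) \<in> crel"
 using eps0(2)[of x y "mat 1"] by simp

text \<open>Witnesses at two times at most \<open>eps0/4\<close> apart are closer than three
  quarters of \<open>eps0\<close>, hence in one class. So a ray that stays near \<open>Aub\<close>
  cannot change class.\<close>

lemma ray_same_class:
 assumes g: "det g = 1" and near: "\<And>t. t \<ge> T ==> \<exists>a\<in>Aub. hdist (geo g t) a < eps0/4"
  and a: "a \<in> Aub" "hdist (geo g T) a < eps0/4" and t: "t \<ge> T" and b: "b \<in> Aub" "hdist (geo g t) b < eps0/4"
 shows "(a, b) \<in> crel"
proof -
 have gU: "geo g t \<in> UH" for t using g by (simp add: det_mult1)
 have "(a, b) \<in> crel" if "T \<le> t" "t \<le> T + n * (eps0/4)" "b \<in> Aub" "hdist (geo g t) b < eps0/4" for n :: nat and t b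
  using that
 proof (induction n arbitrary: t b)
  case 0
  hence "t = T" by simp
  hence "hdist a b < eps0" using hdist_triangle[of a "geo g T" b] gU a 0 eps0(1) by (simp add: hdist_commute)
  thus ?case using eps0_near a 0 by blast
 next
  case (Suc n)
  define t' where "t' = max T (t - eps0/4)"
  have t': "T \<le> t'" "t' \<le> T + n * (eps0/4)" "\<bar>t' - t\<bar> \<le> eps0/4"
  proof -
   have "real (Suc n) * (eps0/4) = n * (eps0/4) + eps0/4" by (simp add: distrib_right add_divide_distrib)
   moreover have "0 \<le> n * (eps0/4)" using eps0(1) by simp
   ultimately show "t' \<le> T + n * (eps0/4)" using Suc.prems(2) unfolding t'_def by (intro max.boundedI; linarith)
   show "T \<le> t'" "\<bar>t' - t\<bar> \<le> eps0/4" using Suc.prems(1) eps0(1) unfolding t'_def by (auto simp: max_def)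
  qed
  obtain b' where b': "b' \<in> Aub" "hdist (geo g t') b' < eps0/4" using near t' by blast
  have "(a, b') \<in> crel" using Suc.IH[OF t'(1,2) b'] .
  moreover have "hdist b' b < eps0"
   using hdist_triangle[of b' "geo g t'" b] hdist_triangle[of "geo g t'" "geo g t" b] gU b' Suc.prems
    hdist_geo[OF g, of t' t] t'(3) eps0(1) by (simp add: hdist_commute)
  ultimately show ?case using eps0_near[OF b'(1) Suc.prems(3)] crel_trans by blast
 qed
 note ind = this
 have "eps0/4 > 0" using eps0(1) by simp
 then obtain n :: nat where "n * (eps0/4) > t - T" using reals_Archimedean3 by blast
 hence "t \<le> T + n * (eps0/4)" by linarith
 thus ?thesis using ind[OF t _ b] by blast
qed

text \<open>Asked of a single ray only, because all rays to the base point are asymptotic up to a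
  shift of time; see \<open>att_ray\<close>.\<close>

definition att :: "real^2 \<Rightarrow> complex set \<Rightarrow> bool" where
 "att v C \<longleftrightarrow> (\<exists>g. det g = 1 \<and> (v v* g)$1 = 0 \<and> (\<forall>e>0. \<forall>\<^sub>F t in at_top. \<exists>b\<in>C. hdist (geo g t) b < e))"

lemma att_ray:
 assumes att: "att v C" "C \<subseteq> UH" and v: "v \<noteq> 0" and h: "det h = 1" "(v v* h)$1 = 0" and e: "e > 0"
 shows "\<forall>\<^sub>F t in at_top. \<exists>b\<in>C. hdist (geo h t) b < e"
proof -
 obtain g where g: "det g = 1" "(v v* g)$1 = 0" "\<And>e. e > 0 ==> \<forall>\<^sub>F t in at_top. \<exists>b\<in>C. hdist (geo g t) b < e"
  using att by (auto simp: att_def)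
 define c where "c = horo v (pt g) - horo v (pt h)"
 have e2: "e/2 > 0" using e by simp
 have lim: "filterlim (\<lambda>t. t + c) at_top at_top" by (rule filterlim_at_top_mono[where f = "\<lambda>t. t + c"]) (auto intro: filterlim_tendsto_add_at_top filterlim_ident tendsto_const simp: add.commute[of _ c])
 have "\<forall>\<^sub>F t in at_top. hdist (geo h t) (geo g (t + c)) < e/2"
  using order_tendstoD(2)[OF ray_sync[OF h g(1,2) v], of "e/2"] e by (simp add: c_def)
 moreover have "\<forall>\<^sub>F t in at_top. \<exists>b\<in>C. hdist (geo g (t + c)) b < e/2"
  using filterlim_iff[THEN iffD1, OF lim] g(3)[OF e2] by blast
 ultimately show ?thesis
 proof eventually_elim
  case (elim t)
  then obtain b where b: "b \<in> C" "hdist (geo g (t + c)) b < e/2" by blast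
  hence "hdist (geo h t) b < e"
   using hdist_triangle[of "geo h t" "geo g (t + c)" b] elim(1) g(1) h(1) att(2) by (auto simp: det_mult1)
  thus ?case using b by blast
 qed
qed

lemma att_exists: assumes v: "Qp v" shows "\<exists>C\<in>Aub // crel. att v C"
proof -
 obtain g r where g: "det g = 1" "pt g = \<i>" "(v v* g)$1 = 0" "(v v* g)$2 = r" using horo_ray[OF i_UH] by blast
 have gU: "geo g t \<in> UH" for t using g by (simp add: det_mult1)
 have e4: "eps0/4 > 0" using eps0(1) by simp
 obtain T where T: "\<And>t. t \<ge> T ==> \<exists>a\<in>Aub. hdist (geo g t) a < eps0/4"
  using ray_to_Aub[OF v g(1,3) e4] by (auto simp: eventually_at_top_linorder)
 obtain a where a: "a \<in> Aub" "hdist (geo g T) a < eps0/4" using T by blast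
 define C where "C = crel `` {a}"
 have "\<forall>\<^sub>F t in at_top. \<exists>b\<in>C. hdist (geo g t) b < e" if e: "e > 0" for e
 proof -
  have "min e (eps0/4) > 0" using e e4 by simp
  hence "\<forall>\<^sub>F t in at_top. \<exists>b\<in>Aub. hdist (geo g t) b < min e (eps0/4)" using ray_to_Aub[OF v g(1,3)] by blast
  moreover have "\<forall>\<^sub>F t in at_top. t \<ge> T" by (rule eventually_ge_at_top)
  ultimately show ?thesis
  proof eventually_elim
   case (elim t)
   then obtain b where b: "b \<in> Aub" "hdist (geo g t) b < e" "hdist (geo g t) b < eps0/4" by auto
   have "(a, b) \<in> crel" by (rule ray_same_class[OF g(1) T a elim(2) b(1,3)])
   thus ?case using b by (auto simp: C_def)
  qed
 qed
 hence "att v C" using g by (auto simp: att_def)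
 moreover have "C \<in> Aub // crel" using a by (auto simp: C_def quotient_def)
 ultimately show ?thesis by blast
qed

lemma class_Aub: "C \<in> Aub // crel ==> C \<subseteq> Aub"
 using crel_Aub by (auto simp: quotient_def)

lemma class_UH: "C \<in> Aub // crel ==> C \<subseteq> UH"
 using class_Aub by fastforce

lemma class_crel: "C \<in> Aub // crel ==> a \<in> C ==> b \<in> C ==> (a, b) \<in> crel"
 using quotient_eq_iff[OF crel_equiv] by blast

lemma class_eq: "C \<in> Aub // crel ==> D \<in> Aub // crel ==> a \<in> C ==> b \<in> D ==> (a, b) \<in> crel ==> C = D"
 using quotient_eqI[OF crel_equiv] by metis

lemma class_eq_near: "C \<in> Aub // crel ==> D \<in> Aub // crel ==> a \<in> C ==> b \<in> D ==> hdist a b < eps0 ==> C = D"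
 using class_eq eps0_near class_Aub by blast

lemma att_unique:
 assumes "att v C" "att v D" "C \<in> Aub // crel" "D \<in> Aub // crel" "v \<noteq> 0"
 shows "C = D"
proof -
 obtain g where g: "det g = 1" "(v v* g)$1 = 0" using assms(1) by (auto simp: att_def)
 have e: "eps0/2 > 0" using eps0(1) by simp
 from eventually_conj[OF att_ray[OF assms(1) class_UH[OF assms(3)] assms(5) g e] att_ray[OF assms(2) class_UH[OF assms(4)] assms(5) g e]]
 obtain t b c where bc: "b \<in> C" "c \<in> D" "hdist (geo g t) b < eps0/2" "hdist (geo g t) c < eps0/2"
  unfolding eventually_at_top_linorder by (meson order_refl)
 have "hdist b c < eps0"
  using hdist_triangle[of b "geo g t" c] bc class_UH assms g by (auto simp: hdist_commute det_mult1 subset_iff)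
 thus ?thesis using class_eq_near[OF assms(3,4) bc(1,2)] by blast
qed

lemma att_scaleR: "c \<noteq> 0 ==> att (c *\<^sub>R v) C = att v C"
 by (simp add: att_def vmult_scaleR del: vmult_nth)

lemma excess_const_class:
 assumes u: "u \<in> tightf" and U: "subsol u U" and C: "C \<in> Aub // crel" "a \<in> C" "b \<in> C"
 shows "u a - U a = u b - U b"
 using excess_const_on_component[OF u U, of a b] excess_const_on_component[OF u U, of b a] class_crel[OF C] class_crel[OF C(1,3,2)]
 by (force simp: crel_def)

text \<open>Near the ray the excess is squeezed: \<open>Uf v\<close> is at least
  \<open>- horo v\<close>, and \<open>u + horo v\<close> tends to \<open>lev u v\<close>. As the
  excess is constant on the class, it attains its lower bound on all of it.\<close>

lemma excess_lev_class:
 assumes u: "u \<in> tightf" and v: "Qp v" and att: "att v C" and C: "C \<in> Aub // crel" and a: "a \<in> C"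
 shows "u a - Uf v a = lev u v"
proof (rule antisym)
 have vn: "v \<noteq> 0" using Qp_nonzero[OF v] .
 show "lev u v \<le> u a - Uf v a" using Uf_le[OF v u, of a] class_UH[OF C] a by auto
 show "u a - Uf v a \<le> lev u v"
 proof (rule field_le_epsilon)
  fix e :: real assume "e > 0"
  hence e: "e/4 > 0" by simp
  obtain g where g: "det g = 1" "(v v* g)$1 = 0" using att by (auto simp: att_def)
  have "\<forall>\<^sub>F t in at_top. u (geo g t) + horo v (geo g t) < lev u v + e/2"
   using order_tendstoD(2)[OF ray_lev[OF v u g], of "lev u v + e/2"] \<open>e > 0\<close> by simp
  from eventually_conj[OF this att_ray[OF att class_UH[OF C] vn g e]]
  obtain t b where t: "u (geo g t) + horo v (geo g t) < lev u v + e/2" "b \<in> C" "hdist (geo g t) b < e/4"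
   unfolding eventually_at_top_linorder by (meson order_refl)
  have U: "geo g t \<in> UH" "b \<in> UH" using g t class_UH[OF C] by (auto simp: det_mult1)
  have "u b - Uf v b \<le> u (geo g t) - Uf v (geo g t) + 2 * hdist (geo g t) b"
   using tightf_lip[OF u U(2,1)] Uf_lip[OF v U] by (simp add: hdist_commute)
  moreover have "- horo v (geo g t) \<le> Uf v (geo g t)" using Uf_ge1[OF v U(1)] .
  moreover have "u a - Uf v a = u b - Uf v b" by (rule excess_const_class[OF u subsol_Uf[OF v u] C a t(2)])
  ultimately show "u a - Uf v a \<le> lev u v + e" using t by linarith
 qed
qed

lemma Qp_scaleR: assumes "Qp v" "c \<noteq> 0" shows "Qp (c *\<^sub>R v)"
proof -
 have h: "horo (c *\<^sub>R v) x = horo v x + ln (c\<^sup>2)" if "x \<in> UH" for x using horo_scaleR[OF assms(2) Qp_nonzero[OF assms(1)] that] .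
 obtain u s where u: "u \<in> tightf" "\<And>x. x \<in> UH ==> s \<le> u x + horo v x" using assms(1) by (auto simp: Qp_def)
 hence "\<forall>x\<in>UH. s + ln (c\<^sup>2) \<le> u x + horo (c *\<^sub>R v) x" using h by auto
 thus "Qp (c *\<^sub>R v)" using u(1) assms Qp_nonzero[OF assms(1)] unfolding Qp_def by auto
qed

lemma lev_scaleR: assumes "Qp v" "c \<noteq> 0" "u \<in> tightf" shows "lev u (c *\<^sub>R v) = lev u v + ln (c\<^sup>2)"
proof -
 have Q: "Qp (c *\<^sub>R v)" using Qp_scaleR assms by simp
 have u: "u \<in> tightf" by fact
 have h: "horo (c *\<^sub>R v) x = horo v x + ln (c\<^sup>2)" if "x \<in> UH" for x using horo_scaleR[OF assms(2) Qp_nonzero[OF assms(1)] that] .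
 show "lev u (c *\<^sub>R v) = lev u v + ln (c\<^sup>2)"
 proof (rule antisym)
  show "lev u v + ln (c\<^sup>2) \<le> lev u (c *\<^sub>R v)" using lev_le[OF assms(1) u] h by (intro lev_greatest) auto
  have "lev u (c *\<^sub>R v) - ln (c\<^sup>2) \<le> lev u v" using lev_le[OF Q u] h by (intro lev_greatest) (fastforce simp: algebra_simps)
  thus "lev u (c *\<^sub>R v) \<le> lev u v + ln (c\<^sup>2)" by simp
 qed
qed


section \<open>Orbit closures of quasi-minimizing vectors\<close>

definition orb :: "real^2 \<Rightarrow> (real^2) set" where
 "orb v = (\<lambda>A. v v* A) ` Gam"

lemma orb_uminus: "w \<in> orb v ==> - w \<in> orb v"
proof -
 assume "w \<in> orb v"
 then obtain A where A: "A \<in> Gam" "w = v v* A" by (auto simp: orb_def)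
 hence "- w = v v* (- A)" "- A \<in> Gam" by simp_all
 thus ?thesis unfolding orb_def by blast
qed

lemma closure_orb_uminus: "w \<in> closure (orb v) ==> - w \<in> closure (orb v)"
proof -
 assume "w \<in> closure (orb v)"
 then obtain x where "\<And>n. x n \<in> orb v" "x \<longlonglongrightarrow> w" by (auto simp: closure_sequential)
 hence "\<forall>n. - x n \<in> orb v" "(\<lambda>n. - x n) \<longlonglongrightarrow> - w" using orb_uminus by (auto intro: tendsto_minus)
 thus ?thesis by (auto simp: closure_sequential)
qed

lemma closure_orb:
 assumes w: "w \<in> closure (orb v)" "w \<noteq> 0" and v: "Qp v"
 shows "Qp w" "u \<in> tightf ==> lev u v \<le> lev u w" "x \<in> UH ==> Uf w x \<le> Uf v x"
proof -
 obtain x where x: "\<And>n. x n \<in> orb v" "x \<longlonglongrightarrow> w" using w by (auto simp: closure_sequential)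
 hence "\<forall>n. \<exists>A. A \<in> Gam \<and> x n = v v* A" by (auto simp: orb_def)
 then obtain A where A: "\<And>n. A n \<in> Gam" "\<And>n. x n = v v* A n" by metis
 have AG: "A n \<in> G" for n using A Gam_G by blast
 have hx: "horo (x n) z = horo v (act (A n) z)" if "z \<in> UH" for n z using horo_act[OF det_G[OF AG] that] A by simp
 have lim: "(\<lambda>n. horo (x n) z) \<longlonglongrightarrow> horo w z" if "z \<in> UH" for z using tendsto_horo[OF tendsto_const x(2) that w(2)] .
 have le: "lev u v \<le> u z + horo w z" if u: "u \<in> tightf" and z: "z \<in> UH" for u z
 proof (rule LIMSEQ_le_const)
  show "(\<lambda>n. u z + horo (x n) z) \<longlonglongrightarrow> u z + horo w z" by (intro tendsto_intros lim z)
  show "\<exists>N. \<forall>n\<ge>N. lev u v \<le> u z + horo (x n) z"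
   using lev_le[OF v u act_G_UH[OF AG z]] hx[OF z] Gam_u[OF u A(1) z] by fastforce
 qed
 thus Q: "Qp w" using w tightf_nonempty unfolding Qp_def by blast
 show "lev u v \<le> lev u w" if "u \<in> tightf" for u using le[OF that] by (rule lev_greatest)
 show "Uf w z \<le> Uf v z" if z: "z \<in> UH" for z
 proof (rule Uf_least)
  fix B assume B: "B \<in> Gam"
  have BG: "B \<in> G" using B Gam_G by blast
  have Bz: "act B z \<in> UH" using BG z by simp
  have "(\<lambda>n. - horo (x n) (act B z)) \<longlonglongrightarrow> - horo w (act B z)" by (intro tendsto_intros lim Bz)
  thus "- horo w (act B z) \<le> Uf v z"
  proof (rule LIMSEQ_le_const2)
   have "- horo (x n) (act B z) \<le> Uf v z" for n
    using Uf_ge[OF v Bz A(1), of n] Uf_Gam[OF v z B] hx[OF Bz, of n] by simp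
   thus "\<exists>N. \<forall>n\<ge>N. - horo (x n) (act B z) \<le> Uf v z" by blast
  qed
 qed
qed

text \<open>Far along the ray of \<open>w\<close> one is near the class, where the excess for
  \<open>v\<close> is minimal. Hence some translate of \<open>v\<close> has there almost the level
  of \<open>w\<close> or less. Such translates accumulate at a multiple \<open>c *\<^sub>R w\<close>
  with \<open>c\<^sup>2 \<le> 1\<close>, and equality of the levels excludes
  \<open>c\<^sup>2 < 1\<close>.\<close>

theorem closure_same_class:
 assumes v: "Qp v" and w: "Qp w" and u: "u \<in> tightf" and L: "lev u v = lev u w"
  and C: "C \<in> Aub // crel" "att v C" "att w C"
 shows "w \<in> closure (orb v)"
proof -
 have wn: "w \<noteq> 0" using Qp_nonzero[OF w] .
 obtain h r where h: "det h = 1" "pt h = \<i>" "(w v* h)$1 = 0" "(w v* h)$2 = r" "r \<ge> 0" using horo_ray[OF i_UH] by blast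
 have "r \<noteq> 0" using vmult_nonzero[OF h(1) wn] h(3,4) by (auto simp: vec2_eq_iff simp del: vmult_nth)
 hence r: "r > 0" using h by simp
 have hU: "geo h t \<in> UH" for t using h by (simp add: det_mult1)
 have hw: "horo w (geo h t) = ln (r\<^sup>2 * exp (-t))" for t using horo_geo[OF h(1), of w t] h by (simp del: vmult_nth)
 have "\<exists>t A. t \<ge> real n \<and> A \<in> Gam \<and> horo v (act A (geo h t)) \<le> horo w (geo h t) + 2 / (real n + 1)" for n
 proof -
  define e where "e = 1 / (real n + 1)"
  have e: "e > 0" "e/2 > 0" by (simp_all add: e_def)
  from eventually_conj[OF att_ray[OF C(3) class_UH[OF C(1)] wn h(1,3) e(2)] eventually_ge_at_top[of "real n"]]
  obtain t b where t: "b \<in> C" "hdist (geo h t) b < e/2" "t \<ge> real n"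
   unfolding eventually_at_top_linorder by (meson order_refl)
  have bU: "b \<in> UH" using t class_UH[OF C(1)] by auto
  have "u b - Uf v b = lev u v" by (rule excess_lev_class[OF u v C(2,1) t(1)])
  moreover have "u (geo h t) - u b \<le> e/2" using tightf_lip[OF u hU bU, of t] t by simp
  moreover have "Uf v b - Uf v (geo h t) \<le> e/2" using Uf_lip[OF v bU hU, of t] t by (simp add: hdist_commute)
  moreover have "lev u w \<le> u (geo h t) + horo w (geo h t)" using lev_le[OF w u hU] .
  ultimately have 1: "Uf v (geo h t) \<ge> - horo w (geo h t) - e" using L by linarith
  obtain A where "A \<in> Gam" "- horo v (act A (geo h t)) > Uf v (geo h t) - e" using Uf_approx[OF v hU e(1)] .
  thus ?thesis using 1 t(3) by (intro exI[of _ t] exI[of _ A]) (auto simp: e_def)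
 qed
 then obtain t A where tA: "\<And>n. t n \<ge> real n" "\<And>n. A n \<in> Gam" "\<And>n. horo v (act (A n) (geo h (t n))) \<le> horo w (geo h (t n)) + 2 / (real n + 1)" by metis
 have AG: "A n \<in> G" for n using tA Gam_G by blast
 define x where "x n = (v v* A n) v* h" for n
 have dAh: "det (A n) = 1" for n using AG by simp
 have vn: "v \<noteq> 0" using Qp_nonzero[OF v] .
 have xn0: "x n \<noteq> 0" for n using vmult_nonzero[OF h(1) vmult_nonzero[OF dAh vn]] by (simp add: x_def)
 \<comment> \<open>The level inequality at time \<open>t n\<close>, multiplied by
   \<open>exp (t n)\<close>. The weight \<open>exp (2 * t n)\<close> forces the first coordinate to
   0, and what remains compares the second coordinate with \<open>r\<close>.\<close>
 have bound: "(x n $ 1)\<^sup>2 * exp (2 * t n) + (x n $ 2)\<^sup>2 \<le> r\<^sup>2 * exp (2 / (real n + 1))" for n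
 proof -
  let ?t = "t n"
  have "horo v (act (A n) (geo h ?t)) = ln ((x n $ 1)\<^sup>2 * exp ?t + (x n $ 2)\<^sup>2 * exp (- ?t))"
   using horo_act[OF dAh hU] horo_geo[OF h(1)] by (simp add: x_def del: vmult_nth)
  hence 1: "ln ((x n $ 1)\<^sup>2 * exp ?t + (x n $ 2)\<^sup>2 * exp (- ?t)) \<le> ln (r\<^sup>2 * exp (- ?t)) + 2 / (real n + 1)" using tA(3)[of n] hw by simp
  have pos: "(x n $ 1)\<^sup>2 * exp ?t + (x n $ 2)\<^sup>2 * exp (- ?t) > 0"
  proof -
   have "x n $ 1 \<noteq> 0 \<or> x n $ 2 \<noteq> 0" using xn0[of n] by (auto simp: vec2_eq_iff)
   thus ?thesis by (auto simp: add_pos_nonneg add_nonneg_pos)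
  qed
  have "ln (r\<^sup>2 * exp (- ?t)) + 2 / (real n + 1) = ln (r\<^sup>2 * exp (- ?t) * exp (2 / (real n + 1)))" using r by (simp add: ln_mult)
  hence "(x n $ 1)\<^sup>2 * exp ?t + (x n $ 2)\<^sup>2 * exp (- ?t) \<le> r\<^sup>2 * exp (- ?t) * exp (2 / (real n + 1))" using 1 pos r by simp
  hence "((x n $ 1)\<^sup>2 * exp ?t + (x n $ 2)\<^sup>2 * exp (- ?t)) * exp ?t \<le> r\<^sup>2 * exp (- ?t) * exp (2 / (real n + 1)) * exp ?t" by (rule mult_right_mono) simp
  moreover have "((x n $ 1)\<^sup>2 * exp ?t + (x n $ 2)\<^sup>2 * exp (- ?t)) * exp ?t = (x n $ 1)\<^sup>2 * (exp ?t * exp ?t) + (x n $ 2)\<^sup>2 * (exp (- ?t) * exp ?t)" by (simp add: algebra_simps)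
  moreover have "r\<^sup>2 * exp (- ?t) * exp (2 / (real n + 1)) * exp ?t = r\<^sup>2 * exp (2 / (real n + 1)) * (exp (- ?t) * exp ?t)" by (simp only: mult_ac)
  moreover have "exp ?t * exp ?t = exp (2 * ?t)" "exp (- ?t) * exp ?t = 1" by (simp_all flip: exp_add)
  ultimately show ?thesis by simp
 qed
 have e2: "exp (2 / (real n + 1)) \<le> exp 2" for n :: nat by (simp add: divide_le_eq)
 have "norm (x n) \<le> sqrt (r\<^sup>2 * exp 2)" for n
 proof -
  have "1 \<le> exp (2 * t n)" using tA(1)[of n] by simp
  hence "(x n $ 1)\<^sup>2 * 1 \<le> (x n $ 1)\<^sup>2 * exp (2 * t n)" by (intro mult_left_mono) auto
  hence "(norm (x n))\<^sup>2 \<le> r\<^sup>2 * exp (2 / (real n + 1))" using bound[of n] unfolding norm_vec2 by linarith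
  also have "\<dots> \<le> r\<^sup>2 * exp 2" using e2[of n] by (intro mult_left_mono) auto
  finally show ?thesis by (rule real_le_rsqrt)
 qed
 hence "bounded (range x)" by (auto simp: bounded_iff)
 then obtain l s where s: "strict_mono s" "(x \<circ> s) \<longlonglongrightarrow> l" using bounded_imp_convergent_subsequence by blast
 have lim: "(\<lambda>n. x (s n)) \<longlonglongrightarrow> l" using s(2) by (simp add: o_def)
 have s0: "filterlim (\<lambda>n. real (s n)) at_top sequentially"
  using filterlim_compose[OF filterlim_real_sequentially filterlim_subseq[OF s(1)]] .
 have "(\<lambda>n. 2 * inverse (real (Suc n))) \<longlonglongrightarrow> 2 * 0" by (intro tendsto_mult tendsto_const LIMSEQ_inverse_real_of_nat)
 hence "(\<lambda>n. 2 / (real n + 1)) \<longlonglongrightarrow> 0" by (simp add: divide_inverse add.commute)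
 hence inv0: "(\<lambda>n. 2 / (real (s n) + 1)) \<longlonglongrightarrow> 0" using LIMSEQ_subseq_LIMSEQ[OF _ s(1)] by (fastforce simp: o_def)
 have b2: "(l$2)\<^sup>2 \<le> r\<^sup>2"
 proof (rule LIMSEQ_le)
  show "(\<lambda>n. (x (s n) $ 2)\<^sup>2) \<longlonglongrightarrow> (l$2)\<^sup>2" by (intro tendsto_intros lim)
  have "(\<lambda>n. r\<^sup>2 * exp (2 / (real (s n) + 1))) \<longlonglongrightarrow> r\<^sup>2 * exp 0" by (intro tendsto_intros inv0)
  thus "(\<lambda>n. r\<^sup>2 * exp (2 / (real (s n) + 1))) \<longlonglongrightarrow> r\<^sup>2" by simp
  have "(x n $ 2)\<^sup>2 \<le> r\<^sup>2 * exp (2 / (real n + 1))" for n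
   using bound[of n] zero_le_mult_iff[of "(x n $ 1)\<^sup>2" "exp (2 * t n)"] by (smt (verit) exp_ge_zero zero_le_power2)
  thus "\<exists>N. \<forall>n\<ge>N. (x (s n) $ 2)\<^sup>2 \<le> r\<^sup>2 * exp (2 / (real (s n) + 1))" by blast
 qed
 have l1: "l$1 = 0"
 proof -
  have "(x n $ 1)\<^sup>2 \<le> r\<^sup>2 * exp 2 * exp (- (2 * real n))" for n
  proof -
   have "(x n $ 1)\<^sup>2 * exp (2 * real n) \<le> (x n $ 1)\<^sup>2 * exp (2 * t n)" using tA(1)[of n] by (intro mult_left_mono) auto
   also have "\<dots> \<le> r\<^sup>2 * exp (2 / (real n + 1))" using bound[of n] by (smt (verit) zero_le_power2)
   also have "\<dots> \<le> r\<^sup>2 * exp 2" using e2[of n] by (intro mult_left_mono) auto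
   finally show ?thesis by (simp add: exp_minus field_simps)
  qed
  hence le: "\<exists>N. \<forall>n\<ge>N. (x (s n) $ 1)\<^sup>2 \<le> r\<^sup>2 * exp 2 * exp (- (2 * real (s n)))" by blast
  have "filterlim (\<lambda>n. - (2 * real (s n))) at_bot sequentially"
   unfolding filterlim_uminus_at_bot[symmetric] minus_minus
   by (simp add: filterlim_uminus_at_bot filterlim_tendsto_pos_mult_at_top[OF tendsto_const _ s0])
  hence "(\<lambda>n. exp (- (2 * real (s n)))) \<longlonglongrightarrow> 0" by (rule filterlim_compose[OF exp_at_bot])
  hence "(\<lambda>n. r\<^sup>2 * exp 2 * exp (- (2 * real (s n)))) \<longlonglongrightarrow> r\<^sup>2 * exp 2 * 0" by (intro tendsto_intros)
  moreover have "(\<lambda>n. (x (s n) $ 1)\<^sup>2) \<longlonglongrightarrow> (l$1)\<^sup>2" by (intro tendsto_intros lim)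
  ultimately have "(l$1)\<^sup>2 \<le> r\<^sup>2 * exp 2 * 0" using LIMSEQ_le[OF _ _ le] by blast
  thus ?thesis by simp
 qed
 \<comment> \<open>Evaluating \<open>lev u v\<close> on the orbit of i keeps the orbit of
   \<open>v\<close> away from 0.\<close>
 have lnz: "l \<noteq> 0"
 proof -
  have "exp (lev u v - u \<i>) \<le> (norm (x n))\<^sup>2" for n
  proof -
   have "lev u v \<le> u (act (A n) \<i>) + horo v (act (A n) \<i>)" by (rule lev_le[OF v u]) (use AG in simp)
   moreover have "horo v (act (A n) \<i>) = ln ((norm (x n))\<^sup>2)"
    using horo_act[OF dAh i_UH] horo_pt[OF h(1)] h(2) by (simp add: x_def)
   ultimately have "lev u v - u \<i> \<le> ln ((norm (x n))\<^sup>2)" using Gam_u[OF u tA(2) i_UH] by simp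
   thus ?thesis using xn0[of n] by (metis exp_ln exp_le_cancel_iff zero_less_norm_iff zero_less_power)
  qed
  moreover have "(\<lambda>n. (norm (x (s n)))\<^sup>2) \<longlonglongrightarrow> (norm l)\<^sup>2" by (intro tendsto_intros lim)
  ultimately have "exp (lev u v - u \<i>) \<le> (norm l)\<^sup>2" by (intro LIMSEQ_le_const) auto
  thus ?thesis by auto
 qed
 define w' where "w' = l v* adj h"
 have xw: "x n v* adj h = v v* A n" for n using vmult_cancel(1)[OF h(1)] by (simp add: x_def)
 have "(\<lambda>n. x (s n) v* adj h) \<longlonglongrightarrow> w'" unfolding w'_def by (intro tendsto_intros lim)
 hence w'lim: "(\<lambda>n. v v* A (s n)) \<longlonglongrightarrow> w'" by (simp add: xw)
 have w'cl: "w' \<in> closure (orb v)" unfolding closure_sequential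
  using w'lim tA(2) by (intro exI[of _ "\<lambda>n. v v* A (s n)"]) (auto simp: orb_def)
 define c where "c = l$2 / r"
 have "l = c *\<^sub>R (w v* h)" using l1 h(3,4) r by (auto simp: vec2_eq_iff c_def simp del: vmult_nth)
 hence w'c: "w' = c *\<^sub>R w" using vmult_cancel(1)[OF h(1), of w] by (simp add: w'_def vmult_scaleR)
 have "l$2 \<noteq> 0" using lnz l1 by (auto simp: vec2_eq_iff)
 hence c0: "c \<noteq> 0" using r by (simp add: c_def)
 have w'0: "w' \<noteq> 0" using c0 w'c wn by simp
 have "lev u v \<le> lev u w'" by (rule closure_orb(2)[OF w'cl w'0 v u])
 also have "\<dots> = lev u w + ln (c\<^sup>2)" using lev_scaleR[OF w c0 u] w'c by simp
 finally have "ln (c\<^sup>2) \<ge> 0" using L by simp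
 hence "c\<^sup>2 \<ge> 1" using c0 by simp
 moreover have "c\<^sup>2 \<le> 1" using b2 r by (simp add: c_def power_divide divide_le_eq)
 ultimately have "c\<^sup>2 = 1" by simp
 hence "c = 1 \<or> c = -1" by (simp add: power2_eq_1_iff)
 thus ?thesis using w'cl w'c closure_orb_uminus[of w' v] by auto
qed

text \<open>Equal closures give equal \<open>Uf\<close> and \<open>lev\<close>. At a point
  \<open>d\<close> of the class of \<open>w\<close> the excess for \<open>v\<close> is therefore
  minimal, and a ray to the base point of \<open>v\<close> from a suitable translate of
  \<open>d\<close> has less than \<open>m\<close> to lose. It never makes an excursion, so it stays
  in the class of \<open>d\<close> until it reaches that of \<open>v\<close>.\<close>

lemma closure_class:
 assumes v: "Qp v" and w: "w \<in> closure (orb v)" "v \<in> closure (orb w)" "w \<noteq> 0"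
  and C: "C \<in> Aub // crel" "att v C" and D: "D \<in> Aub // crel" "att w D"
 shows "C = D"
proof -
 have vn: "v \<noteq> 0" using Qp_nonzero[OF v] .
 have Qw: "Qp w" using closure_orb(1)[OF w(1,3) v] .
 have U: "Uf w x = Uf v x" if "x \<in> UH" for x
  using closure_orb(3)[OF w(1,3) v that] closure_orb(3)[OF w(2) vn Qw that] by simp
 have lev: "lev u w = lev u v" if "u \<in> tightf" for u
  using closure_orb(2)[OF w(1,3) v that] closure_orb(2)[OF w(2) vn Qw that] by simp
 have e: "eps0/4 > 0" using eps0(1) by simp
 obtain u m where u: "u \<in> tightf" "m > 0"
  "\<And>g t. det g = 1 ==> (\<And>a. a \<in> Aub ==> hdist (geo g t) a \<ge> eps0/4) ==> \<exists>s>0. u (geo g (t + s)) \<le> u (geo g t) + s - m"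
  using excursion_cost[OF e] by metis
 obtain d where d: "d \<in> D" using D(1) in_quotient_imp_non_empty[OF crel_equiv] by blast
 have dA: "d \<in> Aub" "d \<in> UH" using d class_Aub[OF D(1)] class_UH[OF D(1)] by auto
 have Jd: "u d - Uf v d = lev u v" using excess_lev_class[OF u(1) Qw D(2,1) d] U[OF dA(2)] lev[OF u(1)] by simp
 obtain A where A: "A \<in> Gam" "- horo v (act A d) > Uf v d - m" using Uf_approx[OF v dA(2) u(2)] .
 have AG: "A \<in> G" using A Gam_G by blast
 have Ad: "act A d \<in> UH" "act A d \<in> Aub" using AG dA Aub_act by auto
 obtain g r where g: "det g = 1" "pt g = act A d" "(v v* g)$1 = 0" "(v v* g)$2 = r" using horo_ray[OF Ad(1)] by blast
 have gU: "geo g t \<in> UH" for t using g by (simp add: det_mult1)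
 have lvl: "horo v (geo g t) = horo v (act A d) - t" for t using horo_ray_level[OF g(1) vn g(3), of t] g by simp
 have start: "u (act A d) + horo v (act A d) < lev u v + m" using A(2) Jd Gam_u[OF u(1) A(1) dA(2)] by simp
 have near: "\<exists>a\<in>Aub. hdist (geo g t) a < eps0/4" if t: "t \<ge> 0" for t
 proof (rule ccontr)
  assume "\<not> ?thesis"
  hence "\<And>a. a \<in> Aub ==> hdist (geo g t) a \<ge> eps0/4" by (auto simp: not_less)
  then obtain s where s: "s > 0" "u (geo g (t + s)) \<le> u (geo g t) + s - m" using u(3)[OF g(1)] by blast
  have "lev u v \<le> u (geo g (t + s)) + horo v (geo g (t + s))" using lev_le[OF v u(1) gU] .
  moreover have "u (geo g t) \<le> u (act A d) + t"
   using tightf_lip[OF u(1) gU Ad(1), of t] hdist_geo[OF g(1), of t 0] g t by simp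
  ultimately show False using s start lvl by simp
 qed
 from eventually_conj[OF att_ray[OF C(2) class_UH[OF C(1)] vn g(1,3) e] eventually_ge_at_top[of 0]]
 obtain t b where t: "b \<in> C" "hdist (geo g t) b < eps0/4" "t \<ge> 0"
  unfolding eventually_at_top_linorder by (meson order_refl)
 have "(act A d, b) \<in> crel"
  by (rule ray_same_class[OF g(1) near Ad(2) _ t(3) _ t(2)]) (use g Ad t class_Aub[OF C(1)] e in auto)
 hence "(d, b) \<in> crel" using crel_Gam[OF dA(1) A(1)] crel_trans by blast
 thus ?thesis using class_eq[OF D(1) C(1) d t(1)] by blast
qed

text \<open>A one-Lipschitz function that climbs one ray at full speed must, going backwards along
  any ray to the same base point, be correspondingly large, since the rays synchronise.\<close>

lemma ray_bound:
 assumes f: "\<And>x y. x \<in> UH ==> y \<in> UH ==> f x - f y \<le> hdist x y"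
  and g: "det g = 1" "(v v* g)$1 = 0" and v: "v \<noteq> 0" and ge: "\<And>t. t \<ge> T ==> f (geo g t) \<ge> t - C" and x: "x \<in> UH"
 shows "horo v (pt g) - C \<le> f x + horo v x"
proof (rule field_le_epsilon)
 fix e :: real assume e: "e > 0"
 obtain h r where h: "det h = 1" "pt h = x" "(v v* h)$1 = 0" "(v v* h)$2 = r" using horo_ray[OF x] by blast
 define c where "c = horo v (pt h) - horo v (pt g)"
 have "\<forall>\<^sub>F t in at_top. hdist (geo g t) (geo h (t + c)) < e"
  using order_tendstoD(2)[OF ray_sync[OF g h(1,3) v], of e] e by (simp add: c_def)
 from eventually_conj[OF this eventually_ge_at_top[of "max T (- c)"]]
 obtain t where t: "hdist (geo g t) (geo h (t + c)) < e" "t \<ge> T" "t \<ge> - c"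
  unfolding eventually_at_top_linorder by (metis max.boundedE order_refl)
 have U: "geo g t \<in> UH" "geo h (t + c) \<in> UH" using g h by (simp_all add: det_mult1)
 have "f (geo g t) - f (geo h (t + c)) \<le> e" using f[OF U] t(1) by simp
 moreover have "f (geo h (t + c)) - f x \<le> t + c"
  using f[OF U(2) x] hdist_geo[OF h(1), of "t + c" 0] h t(3) by simp
 ultimately show "horo v (pt g) - C \<le> f x + horo v x + e" using ge[OF t(2)] h(2) by (simp add: c_def)
qed

lemma leaf_Qp:
 assumes g: "g \<in> leafs"
 obtains v where "Qp v" "att v (crel `` {pt g})"
proof -
 obtain v :: "real^2" where "v v* g = vector [0, 1]" using vmult_surj[OF leafs_det[OF g]] by blast
 hence v: "(v v* g)$1 = 0" "(v v* g)$2 = 1" by (simp_all del: vmult_nth)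
 have vn: "v \<noteq> 0" using v(2) by (auto simp del: vmult_nth)
 obtain u where u: "u \<in> tightf" using tightf_nonempty by blast
 have "horo v (pt g) - (- u (pt g)) \<le> u x + horo v x" if x: "x \<in> UH" for x
  by (rule ray_bound[OF tightf_lip[OF u] leafs_det[OF g] v(1) vn _ x, of 0]) (use leafs_tight[OF g u] in auto)
 hence "Qp v" using vn u unfolding Qp_def by blast
 moreover have "att v (crel `` {pt g})"
  unfolding att_def
 proof (intro exI[of _ g] conjI allI impI)
  show "det g = 1" "(v v* g)$1 = 0" using g v by simp_all
  fix e :: real assume "e > 0"
  hence "\<exists>b\<in>crel `` {pt g}. hdist (geo g t) b < e" for t
   using crel_leaf[OF g, of t] by (intro bexI[of _ "geo g t"]) auto
  thus "\<forall>\<^sub>F t in at_top. \<exists>b\<in>crel `` {pt g}. hdist (geo g t) b < e" by simp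
 qed
 ultimately show ?thesis using that by blast
qed

lemma Qp_norm_bound: assumes "Qp v" shows "\<exists>c>0. \<forall>A\<in>Gam. c \<le> norm (v v* A)"
proof -
 obtain u where u: "u \<in> tightf" using tightf_nonempty by blast
 have "exp ((lev u v - u \<i>) / 2) \<le> norm (v v* A)" if A: "A \<in> Gam" for A
 proof -
  have AG: "A \<in> G" using A Gam_G by blast
  have "lev u v \<le> u (act A \<i>) + horo v (act A \<i>)" by (rule lev_le[OF assms u]) (use AG in simp)
  hence "lev u v - u \<i> \<le> horo v (pt A)" using Gam_u[OF u A i_UH] by (simp add: pt_def)
  also have "\<dots> = 2 * ln (norm (v v* A))" using horo_pt[OF det_G[OF AG], of v] vmult_nonzero[OF det_G[OF AG] Qp_nonzero[OF assms]] by (simp add: ln_realpow)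
  finally have "(lev u v - u \<i>) / 2 \<le> ln (norm (v v* A))" by simp
  thus ?thesis using vmult_nonzero[OF det_G[OF AG] Qp_nonzero[OF assms]] by (metis exp_le_cancel_iff exp_ln zero_less_norm_iff)
 qed
 thus ?thesis by (intro exI[of _ "exp ((lev u v - u \<i>) / 2)"]) auto
qed

text \<open>The ray to the base point of such a horocycle is quasi-minimizing, and along it a tight function tends to plus or minus infinity at full speed.\<close>

lemma Qp_or_neg:
 assumes v: "v \<noteq> 0" and c: "c > 0" "\<And>A. A \<in> Gam ==> c \<le> norm (v v* A)" and u: "u \<in> tightf"
 shows "Qp v \<or> (\<exists>s. \<forall>x\<in>UH. s \<le> - u x + horo v x)"
proof -
 obtain C0 where C0: "C0 \<ge> 0" "\<And>x y. x \<in> UH ==> y \<in> UH ==> u x \<le> u y ==> \<exists>A\<in>Gam. hdist x (act A y) \<le> u y - u x + C0"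
  using coarse_upper[OF u] by blast
 obtain g r where g: "det g = 1" "pt g = \<i>" "(v v* g)$1 = 0" "(v v* g)$2 = r" using horo_ray[OF i_UH] by blast
 define R where "R t = geo g t" for t
 have RU: "R t \<in> UH" for t using g by (simp add: R_def det_mult1)
 have R0: "R 0 = \<i>" using g by (simp add: R_def)
 have lvl: "horo v (R t) = horo v \<i> - t" for t using horo_ray_level[OF g(1) v g(3), of t] g by (simp add: R_def)
 have hA: "ln (c\<^sup>2) \<le> horo v (act A \<i>)" if A: "A \<in> Gam" for A
 proof -
  have AG: "A \<in> G" using A Gam_G by blast
  have "c\<^sup>2 \<le> (norm (v v* A))\<^sup>2" using c(1) c(2)[OF A] by (intro power_mono) auto
  moreover have "horo v (act A \<i>) = ln ((norm (v v* A))\<^sup>2)" using horo_pt[OF det_G[OF AG], of v] by (simp add: pt_def)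
  ultimately show ?thesis using c(1) by (smt (verit) ln_le_cancel_iff zero_less_power)
 qed
 define K where "K = horo v \<i> - ln (c\<^sup>2) + C0"
 \<comment> \<open>By \<open>coarse_upper\<close> a path between the orbit of i and
   \<open>R t\<close> costs at most the height difference plus \<open>C0\<close>. On the orbit of i
   the horofunction is at least \<open>ln (c\<^sup>2)\<close>, so this cost cannot be less than
   \<open>t\<close> minus a constant.\<close>
 have far: "t - K \<le> \<bar>u (R t) - u \<i>\<bar>" for t
 proof (cases "u \<i> \<le> u (R t)")
  case True
  then obtain A where A: "A \<in> Gam" "hdist \<i> (act A (R t)) \<le> u (R t) - u \<i> + C0" using C0(2)[OF i_UH RU] by blast
  have AG: "A \<in> G" using A Gam_G by blast
  have "horo v (act (adj A) \<i>) - horo v (R t) \<le> hdist (act (adj A) \<i>) (R t)"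
   by (rule horo_lipschitz[OF v]) (use AG RU in auto)
  hence "horo v (act (adj A) \<i>) - horo v (R t) \<le> u (R t) - u \<i> + C0" using hdist_act_adj[OF AG i_UH RU] A(2) by simp
  thus ?thesis using hA[of "adj A"] A(1) lvl[of t] by (simp add: K_def)
 next
  case False
  then obtain A where A: "A \<in> Gam" "hdist (R t) (act A \<i>) \<le> u \<i> - u (R t) + C0" using C0(2)[OF RU i_UH, of t] by auto
  have AG: "A \<in> G" using A Gam_G by blast
  have "horo v (act A \<i>) - horo v (R t) \<le> hdist (act A \<i>) (R t)"
   by (rule horo_lipschitz[OF v]) (use AG RU in auto)
  thus ?thesis using hA[OF A(1)] lvl[of t] A(2) by (simp add: K_def hdist_commute)
 qed
 have cont: "continuous_on S (\<lambda>t. u (R t))" for S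
  unfolding continuous_on_def R_def
  by (intro ballI tightf_tendsto[OF u _ RU[unfolded R_def] RU[unfolded R_def]])
    (use continuous_on_geo[OF g(1), of S] in \<open>simp add: continuous_on_def\<close>)
 define T where "T = K + 1"
 have nz: "u (R t) \<noteq> u \<i>" if "t \<ge> T" for t using far[of t] that by (auto simp: T_def)
 \<comment> \<open>Beyond \<open>T\<close> the height avoids the value at i, so by the intermediate
   value theorem it stays on one side. The side is the sign of the horocycle.\<close>
 have "(\<forall>t\<ge>T. u (R t) > u \<i>) \<or> (\<forall>t\<ge>T. u (R t) < u \<i>)"
 proof (rule ccontr)
  assume "\<not> ?thesis"
  then obtain s t where st: "s \<ge> T" "t \<ge> T" "u (R s) \<le> u \<i>" "u (R t) \<ge> u \<i>" by (auto simp: not_less)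
  have "\<exists>q\<ge>T. u (R q) = u \<i>"
  proof (cases "s \<le> t")
   case True thus ?thesis using IVT'[of "\<lambda>t. u (R t)" s "u \<i>" t, OF st(3,4) True cont] st(1) by (meson order_trans)
  next
   case False hence "t \<le> s" by simp
   thus ?thesis using IVT2'[of "\<lambda>t. u (R t)" s "u \<i>" t, OF st(3,4) _ cont] st(2) by (meson order_trans)
  qed
  thus False using nz by blast
 qed
 thus ?thesis
 proof
  assume "\<forall>t\<ge>T. u (R t) > u \<i>"
  hence ge: "u (geo g t) \<ge> t - (K - u \<i>)" if "t \<ge> T" for t using far[of t] that by (force simp: R_def)
  have "horo v (pt g) - (K - u \<i>) \<le> u x + horo v x" if x: "x \<in> UH" for x
   by (rule ray_bound[OF tightf_lip[OF u] g(1,3) v ge x])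
  thus ?thesis using v u unfolding Qp_def by blast
 next
  assume "\<forall>t\<ge>T. u (R t) < u \<i>"
  hence ge: "- u (geo g t) \<ge> t - (K + u \<i>)" if "t \<ge> T" for t using far[of t] that by (force simp: R_def)
  have lip: "- u x - - u y \<le> hdist x y" if "x \<in> UH" "y \<in> UH" for x y using tightf_lip[OF u that(2,1)] by (simp add: hdist_commute)
  have "horo v (pt g) - (K + u \<i>) \<le> - u x + horo v x" if x: "x \<in> UH" for x
   by (rule ray_bound[OF lip g(1,3) v ge x])
  thus ?thesis by blast
 qed
qed

end

section \<open>Dense horocycle orbits\<close>

definition crs :: "real^2 \<Rightarrow> real^2 \<Rightarrow> real" where
 "crs v w = v$1 * w$2 - v$2 * w$1"

lemma crs_self [simp]: "crs v v = 0" by (simp add: crs_def)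
lemma crs_commute: "crs w v = - crs v w" by (simp add: crs_def)
lemma crs_scaleR [simp]: "crs (c *\<^sub>R v) w = c * crs v w" "crs v (c *\<^sub>R w) = c * crs v w"
 by (simp_all add: crs_def algebra_simps)
lemma crs_add: "crs (v + v') w = crs v w + crs v' w" "crs w (v + v') = crs w v + crs w v'"
 by (simp_all add: crs_def algebra_simps)
lemma crs_zero [simp]: "crs 0 w = 0" "crs w 0 = 0" by (simp_all add: crs_def)

lemma crs_vmult: "crs (v v* A) (w v* A) = det A * crs v w" for A :: "real^2^2"
 by (cases A rule: mk_cases) (simp add: crs_def algebra_simps)

lemma crs_zero_iff: "w \<noteq> 0 ==> crs v w = 0 \<longleftrightarrow> (\<exists>c. v = c *\<^sub>R w)"
proof
 assume w: "w \<noteq> 0" and z: "crs v w = 0"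
 show "\<exists>c. v = c *\<^sub>R w"
 proof (cases "w$1 = 0")
  case True
  hence w2: "w$2 \<noteq> 0" using w by (auto simp: vec2_eq_iff)
  hence "v$1 = 0" using z True by (simp add: crs_def)
  thus ?thesis using True w2 by (intro exI[of _ "v$2 / w$2"]) (simp add: vec2_eq_iff)
 next
  case False
  thus ?thesis using z by (intro exI[of _ "v$1 / w$1"]) (simp add: vec2_eq_iff crs_def field_simps)
 qed
qed auto

lemma crs_expand: assumes "crs e f \<noteq> 0" shows "v = (crs v f / crs e f) *\<^sub>R e + (crs e v / crs e f) *\<^sub>R f"
proof -
 have "crs e f *\<^sub>R v = crs v f *\<^sub>R e + crs e v *\<^sub>R f" by (simp add: crs_def vec2_eq_iff algebra_simps)
 hence "(1 / crs e f) *\<^sub>R (crs e f *\<^sub>R v) = (1 / crs e f) *\<^sub>R (crs v f *\<^sub>R e + crs e v *\<^sub>R f)" by simp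
 thus ?thesis using assms by (simp add: scaleR_add_right)
qed

lemma tendsto_crs [tendsto_intros]: "(f \<longlongrightarrow> v) F ==> (g \<longlongrightarrow> w) F ==> ((\<lambda>x. crs (f x) (g x)) \<longlongrightarrow> crs v w) F"
 unfolding crs_def by (intro tendsto_intros)

definition tr :: "real^2^2 \<Rightarrow> real" where "tr A = A$1$1 + A$2$2"

text \<open>Elliptic matrices are conjugate to rotations about i, and parabolic ones to matrices
  arbitrarily close to plus or minus the identity. The value 2 of \<open>nsq\<close> means that i is
  fixed, so such a matrix has points of arbitrarily small displacement.\<close>

lemma small_trace_conj:
 fixes A :: "real^2^2"
 assumes "det A = 1" "(tr A)\<^sup>2 \<le> 4" "eps > 0"
 shows "\<exists>g. det g = 1 \<and> nsq (adj g ** A ** g) < 2 + eps"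
proof -
 obtain a b c d where A: "A = mk a b c d" by (rule mk_cases)
 have det: "a*d - b*c = 1" and t: "(a+d)\<^sup>2 \<le> 4" using assms A by (simp_all add: tr_def)
 have sq: "exp (x::real)^2 = exp (2*x)" for x by (simp add: exp_double)
 have dgn: "nsq (adj (dg s) ** mk p q r w ** dg s) = p\<^sup>2 + q\<^sup>2 * exp (-2 * s) + r\<^sup>2 * exp (2 * s) + w\<^sup>2" for s p q r w
  using nsq_dg_mk_dg[of "-s" p q r w s] by simp
 have small: "\<exists>s. y * exp s < eps" if "y \<ge> 0" for y :: real
 proof -
  have "y * exp (ln (eps / (y + 1))) < eps" using that assms(3) by (simp add: field_simps)
  thus ?thesis by blast
 qed
 show ?thesis
 proof (cases "c = 0")
  case True
  hence ad: "a * d = 1" using det by simp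
  have "(a - d)\<^sup>2 = (a+d)\<^sup>2 - 4 * (a * d)" by (simp add: power2_eq_square algebra_simps)
  hence "(a - d)\<^sup>2 \<le> 0" using t ad by simp
  hence "a = d" by simp
  hence a: "a = d" "a\<^sup>2 = 1" using ad by (auto simp: power2_eq_square)
  obtain s where "b\<^sup>2 * exp s < eps" using small[of "b\<^sup>2"] by auto
  hence "nsq (adj (dg (-s/2)) ** A ** dg (-s/2)) < 2 + eps" unfolding A dgn using a True by simp
  thus ?thesis by (intro exI[of _ "dg (-s/2)"]) simp
 next
  case False
  \<comment> \<open>Conjugation by this translation makes the two diagonal entries equal. A diagonal
    conjugation then balances the other two entries, or shrinks the only nonzero one.\<close>
  define x where "x = (a - d) / (2*c)"
  define tau where "tau = (a + d) / 2"
  define q where "q = (tau\<^sup>2 - 1) / c"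
  have xc: "x * c = (a - d) / 2" using False by (simp add: x_def)
  have B: "mk 1 (-x) 0 1 ** A ** mk 1 x 0 1 = mk tau q c tau"
  proof -
   have e1: "a - x * c = tau" "c * x + d = tau" using xc by (simp_all add: tau_def field_simps)
   have "(a - x*c)*x + (b - x*d) = q"
   proof -
    have "c * ((a - x*c)*x + (b - x*d)) = tau * (x * c) + b*c - (x*c)*d" using e1 by (simp add: algebra_simps)
    also have "\<dots> = tau\<^sup>2 - 1" unfolding xc using det by (simp add: tau_def power2_eq_square field_simps)
    finally show ?thesis using False by (simp add: q_def field_simps)
   qed
   thus ?thesis using e1 by (simp add: A algebra_simps)
  qed
  have tau: "tau\<^sup>2 \<le> 1" using t by (simp add: tau_def power_divide)
  have conj: "adj (mk 1 x 0 1 ** dg s) ** A ** (mk 1 x 0 1 ** dg s) = adj (dg s) ** mk tau q c tau ** dg s" for s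
   unfolding B[symmetric] adj_mult by (simp add: matrix_mul_assoc)
  have dets: "det (mk 1 x 0 1 ** dg s) = 1" for s by (rule det_mult1) simp_all
  show ?thesis
  proof (cases "q = 0")
   case True
   hence "tau\<^sup>2 = 1" using False by (simp add: q_def)
   obtain s where "c\<^sup>2 * exp s < eps" using small[of "c\<^sup>2"] by auto
   hence "nsq (adj (dg (s/2)) ** mk tau q c tau ** dg (s/2)) < 2 + eps" unfolding dgn using True \<open>tau\<^sup>2 = 1\<close> by simp
   thus ?thesis using conj dets by metis
  next
   case q: False
   define s where "s = ln (\<bar>q\<bar> / \<bar>c\<bar>) / 2"
   have e: "exp (2 * s) = \<bar>q\<bar> / \<bar>c\<bar>" "exp (-2 * s) = \<bar>c\<bar> / \<bar>q\<bar>" using q False by (simp_all add: s_def exp_minus)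
   have "q\<^sup>2 * exp (-2 * s) = \<bar>q * c\<bar>" "c\<^sup>2 * exp (2 * s) = \<bar>q * c\<bar>"
   proof -
    have mm: "a * a * (b / a) = a * b" if "a \<noteq> 0" for a b :: real using that by simp
    have sqa: "x\<^sup>2 = \<bar>x\<bar> * \<bar>x\<bar>" for x :: real by (simp add: power2_eq_square)
    show "q\<^sup>2 * exp (-2 * s) = \<bar>q * c\<bar>" "c\<^sup>2 * exp (2 * s) = \<bar>q * c\<bar>"
     unfolding e sqa abs_mult using mm[of "\<bar>q\<bar>" "\<bar>c\<bar>"] mm[of "\<bar>c\<bar>" "\<bar>q\<bar>"] q False by (simp_all only: mult.commute abs_eq_0 simp_thms)
   qed
   moreover have "q * c = tau\<^sup>2 - 1" using False by (simp add: q_def)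
   ultimately have "nsq (adj (dg s) ** mk tau q c tau ** dg s) = 2" unfolding dgn using tau by simp
   thus ?thesis using conj dets assms(3) by (metis less_add_same_cancel1)
  qed
 qed
qed

lemma eigenvectors:
 fixes A :: "real^2^2"
 assumes "det A = 1" "tr A = l + 1/l" "l \<noteq> 0" "l\<^sup>2 \<noteq> 1"
 shows "\<exists>e. e \<noteq> 0 \<and> e v* A = l *\<^sub>R e"
proof -
 obtain a b c d where A: "A = mk a b c d" by (rule mk_cases)
 have det: "a*d - b*c = 1" and t: "a + d = l + 1/l" using assms A by (simp_all add: tr_def)
 have char: "l * l = (a + d) * l - 1" using t assms(3) by (simp add: field_simps)
 have 1: "vector [c, l - a] v* A = l *\<^sub>R (vector [c, l - a] :: real^2)"
  using char det by (simp add: A vec2_eq_iff algebra_simps)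
 have 2: "vector [l - d, b] v* A = l *\<^sub>R (vector [l - d, b] :: real^2)"
  using char det by (simp add: A vec2_eq_iff algebra_simps)
 show ?thesis
 proof (cases "c \<noteq> 0 \<or> l \<noteq> a")
  case True
  hence "vector [c, l - a] \<noteq> (0 :: real^2)" by (auto simp: vec2_eq_iff)
  thus ?thesis using 1 by blast
 next
  case False
  hence "l \<noteq> d" using det assms(4) by (auto simp: power2_eq_square)
  hence "vector [l - d, b] \<noteq> (0 :: real^2)" by (auto simp: vec2_eq_iff)
  thus ?thesis using 2 by blast
 qed
qed

definition hyp :: "real^2^2 \<Rightarrow> real^2 \<Rightarrow> real^2 \<Rightarrow> real \<Rightarrow> bool" where
 "hyp A e f l \<longleftrightarrow> l > 1 \<and> e \<noteq> 0 \<and> f \<noteq> 0 \<and> e v* A = l *\<^sub>R e \<and> f v* A = (1/l) *\<^sub>R f"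

lemma hyp_exists:
 assumes "det A = 1" "tr A = 2 * cosh tht" "tht > 0"
 shows "\<exists>e f. hyp A e f (exp tht)"
proof -
 have t: "tr A = exp tht + 1 / exp tht" using assms(2) by (simp add: cosh_def exp_minus inverse_eq_divide)
 have "(exp tht)\<^sup>2 \<noteq> 1" "(1 / exp tht)\<^sup>2 \<noteq> 1" using assms(3) by (simp_all add: power_divide flip: exp_double)
 then obtain e f where "e \<noteq> 0" "e v* A = exp tht *\<^sub>R e" "f \<noteq> 0" "f v* A = (1 / exp tht) *\<^sub>R f"
  using eigenvectors[OF assms(1), of "exp tht"] eigenvectors[OF assms(1), of "1 / exp tht"] t by (auto simp: add.commute)
 thus ?thesis using assms(3) by (auto simp: hyp_def)
qed

lemma hypD: "hyp A e f l ==> l > 1" "hyp A e f l ==> e \<noteq> 0" "hyp A e f l ==> f \<noteq> 0"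
 "hyp A e f l ==> e v* A = l *\<^sub>R e" "hyp A e f l ==> f v* A = (1/l) *\<^sub>R f"
 by (simp_all add: hyp_def)

lemma hyp_crs: assumes "hyp A e f l" "det A = 1" shows "crs e f \<noteq> 0"
proof
 assume "crs e f = 0"
 then obtain c where c: "e = c *\<^sub>R f" using crs_zero_iff[OF hypD(3)[OF assms(1)]] by blast
 have "e v* A = (1/l) *\<^sub>R e" unfolding c vmult_scaleR hypD(5)[OF assms(1)] by simp
 hence "l *\<^sub>R e = (1/l) *\<^sub>R e" using hypD(4)[OF assms(1)] by metis
 hence "l = 1/l" using scaleR_cancel_right[of l e "1/l"] hypD(2)[OF assms(1)] by blast
 hence "l * l = 1" using hypD(1)[OF assms(1)] by (simp add: field_simps)
 moreover have "1 * 1 < l * l" using hypD(1)[OF assms(1)] by (intro mult_strict_mono) auto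
 ultimately show False by simp
qed

lemma hyp_conj: assumes "hyp A e f l" "det B = 1" shows "hyp (adj B ** A ** B) (e v* B) (f v* B) l"
proof -
 have "(x v* B) v* (adj B ** A ** B) = (x v* A) v* B" for x :: "real^2"
  by (simp add: matrix_mul_assoc[symmetric] adj_cancel(2)[OF assms(2)] vmult_assoc)
 thus ?thesis using assms vmult_nonzero[OF assms(2)] by (simp add: hyp_def vmult_scaleR del: vmult_nth)
qed

lemma hyp_eigen:
 assumes h: "hyp A e f l" "det A = 1" and v: "v \<noteq> 0" and c: "v v* A = c *\<^sub>R v"
 shows "crs v e = 0 \<or> crs v f = 0"
proof (rule ccontr)
 assume "\<not> ?thesis"
 hence nz: "crs v e \<noteq> 0" "crs v f \<noteq> 0" by auto
 have "crs (v v* A) (e v* A) = crs v e" "crs (v v* A) (f v* A) = crs v f" using crs_vmult[of v A] h(2) by simp_all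
 hence "c * l * crs v e = crs v e" "c * (1/l) * crs v f = crs v f"
  unfolding c hypD(4)[OF h(1)] hypD(5)[OF h(1)] crs_scaleR by (simp_all only: mult_ac)
 moreover have "a * y = y ==> y \<noteq> 0 ==> a = 1" for a y :: real by simp
 ultimately have "c * l = 1" "c * (1/l) = 1" using nz by blast+
 hence "l * l = 1" using hypD(1)[OF h(1)] by (simp add: field_simps)
 moreover have "1 * 1 < l * l" using hypD(1)[OF h(1)] by (intro mult_strict_mono) auto
 ultimately show False by simp
qed

context zcover
begin

text \<open>Conjugation brings the point into a compact set, where only finitely many elements can
  move it by less than 1; for each of them freeness makes the minimum positive.\<close>

lemma displacement_pos:
 obtains mu where "mu > 0" "\<And>A z. A \<in> G ==> A \<noteq> mat 1 ==> A \<noteq> - mat 1 ==> z \<in> UH ==> mu \<le> hdist z (act A z)"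
proof -
 obtain R where R: "R \<ge> 0" "\<And>z. z \<in> UH ==> \<exists>A\<in>G. hdist \<i> (act A z) \<le> R" using near_orbit by blast
 define F where "F = {A \<in> G. hdist \<i> (pt A) \<le> 2*R + 1} - {mat 1, - mat 1}"
 have fF: "finite F" using discrete by (simp add: F_def)
 let ?K = "{x \<in> UH. hdist \<i> x \<le> R}"
 have "\<exists>m>0. \<forall>z\<in>?K. m \<le> hdist z (act A z)" if A: "A \<in> F" for A
 proof -
  have AG: "A \<in> G" "A \<noteq> mat 1" "A \<noteq> - mat 1" using A by (auto simp: F_def)
  have "continuous_on ?K (act A)" unfolding continuous_on_def
  proof
   fix z assume z: "z \<in> ?K"
   show "(act A \<longlongrightarrow> act A z) (at z within ?K)"
    by (rule tendsto_act[OF tendsto_const tendsto_ident_at det_G[OF AG(1)]]) (use z in blast)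
  qed
  hence cont: "continuous_on ?K (\<lambda>z. hdist z (act A z))"
   by (rule continuous_on_hdist[of ?K "\<lambda>z. z" "act A", OF continuous_on_id]) (use AG(1) in auto)
  have "\<i> \<in> ?K" using R by simp
  hence "?K \<noteq> {}" by blast
  from continuous_attains_inf[OF compact_hcball this cont]
  obtain z where z: "z \<in> ?K" "\<forall>y\<in>?K. hdist z (act A z) \<le> hdist y (act A y)" by blast
  have "act A z \<noteq> z" using free[OF AG(1)] AG z by auto
  hence "hdist z (act A z) > 0"
   using hdist_zero_iff[of z "act A z"] hdist_nonneg[of z "act A z"] AG z by (auto simp: less_le)
  thus ?thesis using z by blast
 qed
 then obtain m where m: "\<And>A. A \<in> F ==> m A > 0" "\<And>A z. A \<in> F ==> z \<in> ?K ==> m A \<le> hdist z (act A z)" by metis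
 define mu where "mu = Min (insert 1 (m ` F))"
 have mu: "mu > 0" "mu \<le> 1" "\<And>A. A \<in> F ==> mu \<le> m A" using fF m(1) by (auto simp: mu_def)
 have "mu \<le> hdist z (act A z)" if A: "A \<in> G" "A \<noteq> mat 1" "A \<noteq> - mat 1" and z: "z \<in> UH" for A z
 proof (rule ccontr)
  assume "\<not> ?thesis"
  hence less: "hdist z (act A z) < mu" by simp
  obtain B where B: "B \<in> G" "hdist \<i> (act B z) \<le> R" using R z by blast
  define A' where "A' = B ** A ** adj B"
  have A'G: "A' \<in> G" using A B by (simp add: A'_def)
  have bk: "A = adj B ** A' ** B" using B by (simp add: A'_def matrix_mul_assoc[symmetric] adj_cancel adj_left)
  have ne: "A' \<noteq> mat 1" "A' \<noteq> - mat 1"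
   using A(2,3) bk B by (auto simp: adj_left mult_uminus2)
  define y where "y = act B z"
  have y: "y \<in> ?K" using B z by (simp add: y_def)
  have A'y: "act A' y = act B (act A z)" using A B z by (simp add: A'_def y_def act_mult_G act_adj)
  hence hy: "hdist y (act A' y) = hdist z (act A z)" using A B z by (simp add: y_def hdist_act_G)
  have "hdist \<i> (pt A') \<le> hdist \<i> y + hdist y (act A' y) + hdist (act A' y) (act A' \<i>)"
   using hdist_triangle[of \<i> y "act A' \<i>"] hdist_triangle[of y "act A' y" "act A' \<i>"] y A'G by (simp add: pt_def)
  also have "hdist (act A' y) (act A' \<i>) = hdist \<i> y" using y A'G by (simp add: hdist_act_G hdist_commute)
  finally have "A' \<in> F" using y hy less mu(2) A'G ne by (simp add: F_def)
  thus False using m(2)[of A' y] mu(3)[of A'] y hy less by simp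
 qed
 thus ?thesis using that mu(1) by blast
qed

lemma trace_gt: assumes "A \<in> G" "A \<noteq> mat 1" "A \<noteq> - mat 1" shows "(tr A)\<^sup>2 > 4"
proof (rule ccontr)
 assume "\<not> ?thesis"
 hence t: "(tr A)\<^sup>2 \<le> 4" by simp
 obtain mu where mu: "mu > 0" "\<And>z. z \<in> UH ==> mu \<le> hdist z (act A z)" using displacement_pos assms by metis
 have c: "cosh mu > 1" using cosh_real_strict_mono[of 0 mu] mu by simp
 hence "2 * (cosh mu - 1) > 0" by simp
 then obtain g where g: "det g = 1" "nsq (adj g ** A ** g) < 2 + 2 * (cosh mu - 1)"
  using small_trace_conj[OF det_G[OF assms(1)] t] by blast
 have "cosh (hdist (pt g) (act A (pt g))) = nsq (adj g ** A ** g) / 2"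
  using cosh_hdist_pt[OF g(1), of "A ** g"] assms(1) g by (simp add: act_pt det_mult1 matrix_mul_assoc)
 hence "cosh (hdist (pt g) (act A (pt g))) < cosh mu" using g by simp
 moreover have "cosh mu \<le> cosh (hdist (pt g) (act A (pt g)))"
  using mu(2)[of "pt g"] mu(1) g by (subst cosh_real_nonneg_le_iff) auto
 ultimately show False by simp
qed

lemma ex_hyp: assumes A: "A \<in> G" "A \<noteq> mat 1" "A \<noteq> - mat 1" shows "\<exists>e f l. hyp A e f l \<or> hyp (- A) e f l"
proof -
 define tht where "tht = arcosh (\<bar>tr A\<bar> / 2)"
 have "2 < \<bar>tr A\<bar>"
 proof (rule ccontr)
  assume "\<not> ?thesis"
  hence "\<bar>tr A\<bar>\<^sup>2 \<le> 2\<^sup>2" by (intro power_mono) auto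
  thus False using trace_gt[OF A] by simp
 qed
 hence t: "\<bar>tr A\<bar> / 2 > 1" by simp
 have tht: "tht > 0" "cosh tht = \<bar>tr A\<bar> / 2" using t by (simp_all add: tht_def cosh_arcosh_real)
 have "tr (- A) = - tr A" by (simp add: tr_def)
 hence "tr A = 2 * cosh tht \<or> tr (- A) = 2 * cosh tht" using tht by auto
 thus ?thesis using hyp_exists[of A tht] hyp_exists[of "- A" tht] tht A uminus_G[OF A(1)] by (metis det_G)
qed

text \<open>Multiples of orbit vectors: the orbit of the base point with all scales filled
  in.\<close>

definition cone :: "(real^2^2) set \<Rightarrow> real^2 \<Rightarrow> (real^2) set" where
 "cone S v = {c *\<^sub>R (v v* B) | c B. B \<in> S}"

text \<open>Flow towards the base point of \<open>w\<close> and bring the frame back to a compact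
  set by elements \<open>B n\<close> of \<open>G\<close>. After rescaling, \<open>x v* B n\<close>
  converges to \<open>w\<close> along a subsequence unless one coordinate of \<open>x v* K\<close>
  vanishes, and this cannot happen for two independent vectors \<open>e\<close> and
  \<open>f\<close>.\<close>

lemma cone_G_dense:
 assumes ef: "crs e f \<noteq> 0"
 shows "w \<in> closure (cone G e) \<union> closure (cone G f)"
proof (cases "w = 0")
 case True
 have "0 *\<^sub>R (e v* mat 1) \<in> cone G e" unfolding cone_def using one_G by blast
 thus ?thesis using True closure_subset by auto
next
 case False
 obtain R where R: "R \<ge> 0" "\<And>z. z \<in> UH ==> \<exists>A\<in>G. hdist \<i> (act A z) \<le> R" using near_orbit by blast
 obtain tht where tht: "(w v* rot tht)$1 = 0" "(w v* rot tht)$2 = norm w" by (rule vec2_rotate)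
 define rho where "rho = rot tht"
 define r where "r = norm w"
 have r: "r > 0" using False by (simp add: r_def)
 have drho: "det rho = 1" by (simp add: rho_def)
 have wback: "w = vector [0, r] v* adj rho"
 proof -
  have "w v* rho = vector [0, r]" using tht by (simp add: vec2_eq_iff rho_def r_def del: vmult_nth)
  thus ?thesis using vmult_cancel(1)[OF drho, of w] by simp
 qed
 have "\<exists>B\<in>G. hdist \<i> (pt (B ** rho ** dg (real n))) \<le> R" for n
 proof -
  have "pt (rho ** dg (real n)) \<in> UH" using drho by (simp add: det_mult1)
  then obtain B where B: "B \<in> G" "hdist \<i> (act B (pt (rho ** dg (real n)))) \<le> R" using R by blast
  thus ?thesis using act_pt[OF det_G[OF B(1)], of "rho ** dg (real n)"] drho by (auto simp: det_mult1 matrix_mul_assoc)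
 qed
 then obtain B where B: "\<And>n. B n \<in> G" "\<And>n. hdist \<i> (pt (B n ** rho ** dg (real n))) \<le> R" by metis
 define kpp where "kpp n = B n ** rho ** dg (real n)" for n
 have dkpp: "det (kpp n) = 1" for n using B(1)[of n] drho by (simp add: kpp_def det_mult1)
 have Bk: "B n = kpp n ** dg (- real n) ** adj rho" for n
 proof -
  have "kpp n ** dg (- real n) = B n ** rho" by (simp add: kpp_def dg_add matrix_mul_assoc[symmetric])
  thus ?thesis using adj_right[OF drho] by (simp add: matrix_mul_assoc[symmetric])
 qed
 have "nsq (kpp n) / 2 \<le> cosh R" for n
 proof -
  have "nsq (kpp n) / 2 = cosh (hdist \<i> (pt (kpp n)))" using dkpp by (simp add: cosh_hdist cd_i_pt)
  also have "\<dots> \<le> cosh R" using B(2)[of n] dkpp[of n] R(1) by (subst cosh_real_nonneg_le_iff) (auto simp: kpp_def[symmetric])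
  finally show ?thesis .
 qed
 hence "norm (kpp n) \<le> sqrt (2 * cosh R)" for n
  using real_le_rsqrt[of "norm (kpp n)" "2 * cosh R"] by (simp add: nsq_norm mult.commute)
 hence "bounded (range kpp)" by (auto simp: bounded_iff)
 then obtain s K where s: "strict_mono s" "(kpp \<circ> s) \<longlonglongrightarrow> K" using bounded_imp_convergent_subsequence by blast
 have lim: "(\<lambda>n. kpp (s n)) \<longlonglongrightarrow> K" using s(2) by (simp add: o_def)
 have dK: "det K = 1" using LIMSEQ_unique[OF tendsto_det2[OF lim]] dkpp by simp
 have main: "w \<in> closure (cone G x)" if y: "(x v* K)$2 \<noteq> 0" for x
 proof -
  define p where "p n = x v* kpp (s n)" for n
  have plim: "p \<longlonglongrightarrow> x v* K" unfolding p_def by (intro tendsto_intros lim)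
  have s0: "filterlim (\<lambda>n. real (s n)) at_top sequentially"
   using filterlim_compose[OF filterlim_real_sequentially filterlim_subseq[OF s(1)]] .
  have e0: "(\<lambda>n. exp (- real (s n))) \<longlonglongrightarrow> 0"
   by (rule filterlim_compose[OF exp_at_bot]) (use s0 in \<open>simp add: filterlim_uminus_at_bot\<close>)
  define q where "q n = (r * exp (- real (s n) / 2) / p n $ 2) *\<^sub>R (x v* B (s n))" for n
  have ev: "\<forall>\<^sub>F n in sequentially. p n $ 2 \<noteq> 0"
   using tendsto_imp_eventually_ne[OF tendsto_vec_nth[OF plim, of 2] y] .
  have qe: "q n = vector [r * (p n $ 1) / (p n $ 2) * exp (- real (s n)), r] v* adj rho" if "p n $ 2 \<noteq> 0" for n
  proof -
   have "x v* B (s n) = (p n v* dg (- real (s n))) v* adj rho" by (simp add: Bk p_def vmult_assoc matrix_mul_assoc)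
   moreover have "(r * exp (- real (s n) / 2) / p n $ 2) *\<^sub>R (p n v* dg (- real (s n))) = vector [r * (p n $ 1) / (p n $ 2) * exp (- real (s n)), r]"
   proof -
    have "exp (- real (s n) / 2) * exp (- real (s n) / 2) = exp (- real (s n))" "exp (- real (s n) / 2) * exp (real (s n) / 2) = 1"
     by (simp_all flip: exp_add)
    thus ?thesis using that by (simp add: vec2_eq_iff dg_def field_simps)
   qed
   ultimately show ?thesis by (simp add: q_def flip: vmult_scaleR)
  qed
  have "(\<lambda>n. vector [r * (p n $ 1) / (p n $ 2) * exp (- real (s n)), r] v* adj rho) \<longlonglongrightarrow> vector [r * ((x v* K) $ 1) / ((x v* K) $ 2) * 0, r] v* adj rho"
  proof (intro tendsto_vmult tendsto_const vec_tendstoI)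
   have l1: "(\<lambda>n. r * (p n $ 1) / (p n $ 2) * exp (- real (s n))) \<longlonglongrightarrow> r * ((x v* K) $ 1) / ((x v* K) $ 2) * 0"
    by (intro tendsto_mult tendsto_divide tendsto_const tendsto_vec_nth plim y e0)
   fix i :: 2
   show "(\<lambda>n. (vector [r * (p n $ 1) / (p n $ 2) * exp (- real (s n)), r] :: real^2) $ i) \<longlonglongrightarrow> (vector [r * ((x v* K) $ 1) / ((x v* K) $ 2) * 0, r] :: real^2) $ i"
    using exhaust_2[of i] l1 by auto
  qed
  hence "(\<lambda>n. vector [r * (p n $ 1) / (p n $ 2) * exp (- real (s n)), r] v* adj rho) \<longlonglongrightarrow> w" using wback by simp
  hence "q \<longlonglongrightarrow> w" by (rule Lim_transform_eventually) (use ev in \<open>eventually_elim, simp add: qe\<close>)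
  moreover have "\<forall>n. q n \<in> cone G x" using B(1) unfolding q_def cone_def by blast
  ultimately show ?thesis unfolding closure_sequential by blast
 qed
 have "(e v* K)$2 \<noteq> 0 \<or> (f v* K)$2 \<noteq> 0"
  using crs_vmult[of e K f] dK ef by (auto simp: crs_def simp del: vmult_nth)
 thus ?thesis using main by blast
qed

lemma ex_moved_direction:
 assumes ef: "crs e f \<noteq> 0"
 shows "\<exists>B\<in>G. \<exists>x\<in>{e, f}. crs (x v* B) e \<noteq> 0 \<and> crs (x v* B) f \<noteq> 0"
proof -
 define w where "w = e + f"
 have w: "crs w e \<noteq> 0" "crs w f \<noteq> 0" using ef by (simp_all add: w_def crs_add crs_commute[of f e])
 obtain x where x: "x \<in> {e, f}" "w \<in> closure (cone G x)" using cone_G_dense[OF ef, of w] by auto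
 then obtain y where y: "\<And>n. y n \<in> cone G x" "y \<longlonglongrightarrow> w" by (auto simp: closure_sequential)
 have "\<forall>\<^sub>F n in sequentially. crs (y n) e \<noteq> 0" "\<forall>\<^sub>F n in sequentially. crs (y n) f \<noteq> 0"
  using tendsto_imp_eventually_ne[OF tendsto_crs[OF y(2) tendsto_const] w(1)] tendsto_imp_eventually_ne[OF tendsto_crs[OF y(2) tendsto_const] w(2)] by auto
 from eventually_conj[OF this] obtain n where n: "crs (y n) e \<noteq> 0" "crs (y n) f \<noteq> 0" unfolding eventually_sequentially by blast
 obtain c B where B: "B \<in> G" "y n = c *\<^sub>R (x v* B)" using y(1)[of n] by (auto simp: cone_def)
 thus ?thesis using n x(1) by (intro bexI[of _ B] bexI[of _ x]) auto
qed

lemma commuting_hyp_share: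
 assumes A: "hyp A e f l" "det A = 1" and B: "det B = 1" and comm: "A ** B = B ** A \<or> A ** B = - (B ** A)" and x: "x = e \<or> x = f"
 shows "crs (x v* B) x = 0"
proof -
 obtain m where m: "x v* A = m *\<^sub>R x" "m = l \<or> m = 1/l" using hypD(4,5)[OF A(1)] x by auto
 have x0: "x \<noteq> 0" using hypD(2,3)[OF A(1)] x by auto
 have l: "l > 1" using hypD(1)[OF A(1)] .
 have "(x v* B) v* A = m *\<^sub>R (x v* B) \<or> (x v* B) v* A = (- m) *\<^sub>R (x v* B)"
  using comm m(1) by (auto simp: vmult_assoc) (metis vmult_assoc vmult_scaleR vmult_uminus(1) minus_minus scaleR_minus_left)+
 then obtain sig where sig: "(x v* B) v* A = (sig * m) *\<^sub>R (x v* B)" "sig = 1 \<or> sig = -1" by (metis mult_1 mult_minus1)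
 have "crs ((x v* B) v* A) (x v* A) = crs (x v* B) x" using crs_vmult A(2) by simp
 hence "sig * m * m * crs (x v* B) x = crs (x v* B) x" unfolding sig(1) m(1) crs_scaleR by (simp only: mult_ac)
 moreover have "a * y = y ==> y = 0 \<or> a = 1" for a y :: real by simp
 ultimately have "crs (x v* B) x = 0 \<or> sig * m * m = 1" by blast
 moreover have "sig * m * m \<noteq> 1"
 proof -
  have "1 * 1 < l * l" using l by (intro mult_strict_mono) auto
  moreover have "1/l * (1/l) < 1" "1/l * (1/l) > 0"
  proof -
   have "1/l * (1/l) = 1 / (l * l)" by simp
   thus "1/l * (1/l) < 1" "1/l * (1/l) > 0" using \<open>1 * 1 < l * l\<close> by simp_all
  qed
  ultimately have "m * m > 1 \<or> m * m < 1" "m * m > 0" using m(2) by auto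
  thus ?thesis using sig(2) by auto
 qed
 ultimately show ?thesis by blast
qed

lemma Gam_comm: "A \<in> G ==> B \<in> G ==> A ** B ** adj A ** adj B \<in> Gam"
 by (simp add: Gam_def phi_mult phi_adj)

lemma comm_trivial:
 assumes "det A = 1" "det B = 1" "A ** B ** adj A ** adj B = mat 1 \<or> A ** B ** adj A ** adj B = - mat 1"
 shows "A ** B = B ** A \<or> A ** B = - (B ** A)"
proof -
 have "A ** B ** adj A ** adj B ** B ** A = A ** B"
  by (simp add: matrix_mul_assoc[symmetric] adj_cancel[OF assms(2)] adj_left[OF assms(1)] adj_left[OF assms(2)])
 hence "A ** B = (A ** B ** adj A ** adj B) ** (B ** A)" by (simp add: matrix_mul_assoc)
 thus ?thesis using assms(3) by (metis matrix_mul_lid mult_uminus2(2))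
qed

text \<open>Commutators lie in \<open>Gam\<close> because \<open>phi\<close> has values in an
  abelian group. A hyperbolic element and a conjugate with a moved axis have a commutator other than
  plus or minus 1, which is then hyperbolic up to sign.\<close>

lemma ex_Gam_hyp: "\<exists>A\<in>Gam. \<exists>e f l. hyp A e f l"
proof -
 obtain A0 where A0: "A0 \<in> G" "phi A0 \<noteq> 0" using phi_nontrivial by blast
 have "A0 \<noteq> mat 1" "A0 \<noteq> - mat 1" using A0 phi_uminus[OF one_G] by auto
 then obtain e f l where "hyp A0 e f l \<or> hyp (- A0) e f l" using ex_hyp[OF A0(1)] by blast
 then obtain A where A: "A \<in> G" "hyp A e f l" using A0 uminus_G by blast
 have ef: "crs e f \<noteq> 0" using hyp_crs[OF A(2)] A by simp
 obtain B x where B: "B \<in> G" "x \<in> {e, f}" "crs (x v* B) e \<noteq> 0" "crs (x v* B) f \<noteq> 0" using ex_moved_direction[OF ef] by blast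
 define A' where "A' = adj B ** A ** B"
 have A': "A' \<in> G" "hyp A' (e v* B) (f v* B) l" using A B hyp_conj[OF A(2) det_G[OF B(1)]] by (simp_all add: A'_def)
 define k where "k = A' ** A ** adj A' ** adj A"
 have kG: "k \<in> Gam" unfolding k_def using Gam_comm A A' by blast
 have "k \<noteq> mat 1 \<and> k \<noteq> - mat 1"
 proof (rule ccontr)
  assume "\<not> ?thesis"
  hence "A' ** A = A ** A' \<or> A' ** A = - (A ** A')" using comm_trivial[of A' A] A A' by (auto simp: k_def)
  moreover have "x v* B = e v* B \<or> x v* B = f v* B" using B(2) by blast
  ultimately have "crs ((x v* B) v* A) (x v* B) = 0"
   by (rule commuting_hyp_share[OF A'(2) det_G[OF A'(1)] det_G[OF A(1)]])
  moreover have xB: "x v* B \<noteq> 0" using B(3) by auto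
  ultimately obtain c where "(x v* B) v* A = c *\<^sub>R (x v* B)" using crs_zero_iff by blast
  from hyp_eigen[OF A(2) det_G[OF A(1)] xB this] have "crs (x v* B) e = 0 \<or> crs (x v* B) f = 0" .
  thus False using B by blast
 qed
 then obtain e' f' l' where "hyp k e' f' l' \<or> hyp (- k) e' f' l'" using ex_hyp Gam_G[OF kG] by blast
 thus ?thesis using kG Gam_uminus by blast
qed

end

lemma crs_move:
 assumes A: "hyp A e f l" "det A = 1" and v: "crs v e \<noteq> 0" "crs v f \<noteq> 0"
 shows "crs (v v* A) v \<noteq> 0"
proof -
 define x where "x = crs v f / crs e f"
 define y where "y = crs e v / crs e f"
 have ef: "crs e f \<noteq> 0" by (rule hyp_crs[OF A])
 have xy: "x \<noteq> 0" "y \<noteq> 0" using v ef by (simp_all add: x_def y_def crs_commute[of e v])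
 have ve: "v = x *\<^sub>R e + y *\<^sub>R f" unfolding x_def y_def by (rule crs_expand[OF ef])
 have "v v* A = x *\<^sub>R (e v* A) + y *\<^sub>R (f v* A)" by (subst ve) (simp add: vec2_eq_iff algebra_simps)
 hence vA: "v v* A = (x * l) *\<^sub>R e + (y * (1/l)) *\<^sub>R f" using hypD(4,5)[OF A(1)] by simp
 have "crs (v v* A) v = x * y * (l - 1/l) * crs e f"
  unfolding vA by (subst ve) (simp add: crs_add crs_commute[of f e] algebra_simps)
 moreover have "l - 1/l > 0"
 proof -
  have "1/l < 1" using hypD(1)[OF A(1)] by simp
  thus ?thesis using hypD(1)[OF A(1)] by linarith
 qed
 ultimately show ?thesis using xy ef by simp
qed

lemma hyp_square: assumes "hyp A e f l" shows "hyp (A ** A) e f (l * l)"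
proof -
 have "1 * 1 < l * l" using hypD(1)[OF assms] by (intro mult_strict_mono) auto
 thus ?thesis using assms by (simp add: hyp_def vmult_assoc[symmetric] vmult_scaleR del: vmult_nth)
qed

lemma fixed_vector_trace:
 fixes A :: "real^2^2"
 assumes "det A = 1" "z \<noteq> 0" "z v* A = z" shows "tr A = 2"
proof -
 obtain a b c d where A: "A = mk a b c d" by (rule mk_cases)
 have eq: "z$1 * (a - 1) + z$2 * c = 0" "z$1 * b + z$2 * (d - 1) = 0" using assms(3) A by (auto simp: vec2_eq_iff algebra_simps)
 have "z$1 * ((a-1)*(d-1) - b*c) = (z$1 * (a - 1) + z$2 * c) * (d-1) - (z$1 * b + z$2 * (d - 1)) * c"
    "z$2 * ((a-1)*(d-1) - b*c) = (z$1 * b + z$2 * (d - 1)) * (a-1) - (z$1 * (a - 1) + z$2 * c) * b" by (simp_all add: algebra_simps)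
 hence "z$1 * ((a-1)*(d-1) - b*c) = 0" "z$2 * ((a-1)*(d-1) - b*c) = 0" unfolding eq by simp_all
 hence "(a-1)*(d-1) - b*c = 0" using assms(2) by (auto simp: vec2_eq_iff)
 moreover have "(a-1)*(d-1) - b*c = (a*d - b*c) - (a + d) + 1" by (simp add: algebra_simps)
 ultimately show ?thesis using assms(1) A by (simp add: tr_def)
qed

text \<open>By Dirichlet's theorem some positive multiple of \<open>t\<close> is close to a multiple
  of \<open>a\<close>, which approximates \<open>- t\<close> by elements of \<open>L\<close>. So
  \<open>L\<close> is a closed group, and it has arbitrarily small nonzero elements.\<close>

lemma closed_semigroup_UNIV:
 fixes L :: "real set"
 assumes cl: "closed L" and add: "\<And>x y. x \<in> L ==> y \<in> L ==> x + y \<in> L" and a: "a > 0" "a \<in> L" "- a \<in> L"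
  and small: "\<And>eps. eps > 0 ==> \<exists>x\<in>L. \<exists>y\<in>L. x \<noteq> y \<and> \<bar>x - y\<bar> < eps"
 shows "L = UNIV"
proof -
 have z: "0 \<in> L" using add[OF a(2,3)] by simp
 have nmul: "of_nat n * x \<in> L" if "x \<in> L" for n :: nat and x
  by (induction n) (auto simp: z distrib_right add.commute intro: add that)
 have zmul: "of_int k * a \<in> L" for k :: int
 proof (cases "k \<ge> 0")
  case True thus ?thesis using nmul[OF a(2), of "nat k"] by simp
 next
  case False thus ?thesis using nmul[OF a(3), of "nat (- k)"] by simp
 qed
 have neg: "- t \<in> L" if t: "t \<in> L" for t
 proof -
  have "\<exists>y\<in>L. dist y (- t) < e" if e: "e > 0" for e
  proof -
   obtain N :: nat where N: "N > 0" "a / N < e"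
   proof -
    obtain N :: nat where "N * e > a" using reals_Archimedean3[OF e] by blast
    moreover from this have "N > 0" using a(1) by (cases N) auto
    ultimately show ?thesis using that[of N] by (simp add: field_simps)
   qed
   obtain h k where hk: "0 < k" "\<bar>of_int k * (t / a) - of_int h\<bar> < 1 / N"
    using Dirichlet_approx[OF N(1), of "t / a"] by blast
   have "of_int k * t - of_int h * a = (of_int k * (t / a) - of_int h) * a" using a(1) by (simp add: left_diff_distrib)
   hence "\<bar>of_int k * t - of_int h * a\<bar> = \<bar>of_int k * (t / a) - of_int h\<bar> * a" using a(1) by (simp add: abs_mult)
   also have "\<dots> < 1 / N * a" using hk(2) a(1) by (rule mult_strict_right_mono)
   finally have less: "\<bar>of_int k * t - of_int h * a\<bar> < e" using N(2) by simp
   have "of_nat (nat (k - 1)) * t + of_int (- h) * a \<in> L" using add nmul[OF t] zmul by blast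
   moreover have "of_nat (nat (k - 1)) * t + of_int (- h) * a - (- t) = of_int k * t - of_int h * a"
    using hk(1) by (simp add: algebra_simps)
   ultimately show ?thesis using less by (auto simp: dist_real_def intro!: bexI)
  qed
  thus ?thesis using cl by (meson closed_approachable)
 qed
 have diff: "x - y \<in> L" if "x \<in> L" "y \<in> L" for x y using add[OF that(1) neg[OF that(2)]] by simp
 have "x \<in> L" for x
 proof -
  have "\<exists>y\<in>L. dist y x < e" if e: "e > 0" for e
  proof -
   obtain d where d: "d \<in> L" "d \<noteq> 0" "\<bar>d\<bar> < e" using small[OF e] diff right_minus_eq by metis
   have "of_int \<lfloor>x / d\<rfloor> * d \<in> L"
   proof (cases "\<lfloor>x / d\<rfloor> \<ge> 0")
    case True thus ?thesis using nmul[OF d(1), of "nat \<lfloor>x / d\<rfloor>"] by simp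
   next
    case False thus ?thesis using nmul[OF neg[OF d(1)], of "nat (- \<lfloor>x / d\<rfloor>)"] by simp
   qed
   moreover have "\<bar>of_int \<lfloor>x / d\<rfloor> * d - x\<bar> \<le> \<bar>d\<bar>"
   proof -
    have "of_int \<lfloor>x / d\<rfloor> * d - x = (of_int \<lfloor>x / d\<rfloor> - x / d) * d" using d(2) by (simp add: algebra_simps)
    moreover have "\<bar>of_int \<lfloor>x / d\<rfloor> - x / d\<bar> \<le> 1" by linarith
    ultimately show ?thesis by (simp add: abs_mult mult_left_le_one_le)
   qed
   ultimately show ?thesis using d(3) by (auto simp: dist_real_def intro!: bexI)
  qed
  thus ?thesis using cl by (meson closed_approachable)
 qed
 thus ?thesis by blast
qed

context zcover
begin

section \<open>Scales in orbit closures\<close>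

lemma closure_orb_vmult: assumes "x \<in> closure (orb v)" "A \<in> Gam" shows "x v* A \<in> closure (orb v)"
proof -
 obtain y where y: "\<And>n. y n \<in> orb v" "y \<longlonglongrightarrow> x" using assms by (auto simp: closure_sequential)
 have "y n v* A \<in> orb v" for n using y(1)[of n] assms(2) by (auto simp: orb_def vmult_assoc simp del: vmult_nth)
 moreover have "(\<lambda>n. y n v* A) \<longlonglongrightarrow> x v* A" by (intro tendsto_intros y)
 ultimately show ?thesis unfolding closure_sequential by (intro exI[of _ "\<lambda>n. y n v* A"]) simp
qed

lemma closure_orb_trans: assumes "x \<in> closure (orb v)" shows "closure (orb x) \<subseteq> closure (orb v)"
 by (rule closure_minimal) (use closure_orb_vmult[OF assms] in \<open>auto simp: orb_def\<close>)

lemma closure_orb_self: "v \<in> closure (orb v)"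
proof -
 have "v v* mat 1 \<in> orb v" unfolding orb_def using Gam_one by blast
 thus ?thesis using closure_subset by auto
qed

lemma closure_orb_scaleR: assumes "x \<in> closure (orb v)" shows "c *\<^sub>R x \<in> closure (orb (c *\<^sub>R v))"
proof -
 obtain y where y: "\<And>n. y n \<in> orb v" "y \<longlonglongrightarrow> x" using assms by (auto simp: closure_sequential)
 have "c *\<^sub>R y n \<in> orb (c *\<^sub>R v)" for n using y(1)[of n] by (auto simp: orb_def vmult_scaleR simp del: vmult_nth)
 moreover have "(\<lambda>n. c *\<^sub>R y n) \<longlonglongrightarrow> c *\<^sub>R x" by (intro tendsto_intros y)
 ultimately show ?thesis unfolding closure_sequential by (intro exI[of _ "\<lambda>n. c *\<^sub>R y n"]) simp
qed

definition horospherical :: "real^2 \<Rightarrow> bool" where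
 "horospherical v \<longleftrightarrow> v \<noteq> 0 \<and> (\<forall>eps>0. \<exists>A\<in>Gam. norm (v v* A) < eps)"

lemma mpow_Gam: "A \<in> Gam ==> mpow A n \<in> Gam"
 by (induction n) auto

lemma eigen_mpow: "v v* A = c *\<^sub>R v ==> v v* mpow A n = (c ^ n) *\<^sub>R v"
 by (induction n) (simp_all add: vmult_assoc[symmetric] vmult_scaleR del: vmult_nth)

lemma eigen_adj: assumes "det A = 1" "v v* A = c *\<^sub>R v" "c \<noteq> 0" shows "v v* adj A = (1/c) *\<^sub>R v"
proof -
 have "(c *\<^sub>R v) v* adj A = v" using vmult_cancel(1)[OF assms(1), of v] assms(2) by simp
 hence "c *\<^sub>R (v v* adj A) = v" by (simp add: vmult_scaleR del: vmult_nth)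
 hence "(1/c) *\<^sub>R (c *\<^sub>R (v v* adj A)) = (1/c) *\<^sub>R v" by simp
 thus ?thesis using assms(3) by simp
qed

lemma hyp_horospherical: assumes k: "k \<in> Gam" "hyp k e f l" shows "horospherical e"
 unfolding horospherical_def
proof (intro conjI allI impI)
 show e: "e \<noteq> 0" using hypD(2)[OF k(2)] .
 have l: "l > 1" using hypD(1)[OF k(2)] .
 fix eps :: real assume "eps > 0"
 hence "eps / norm e > 0" using e by simp
 moreover have "1/l < 1" using l by simp
 ultimately obtain n where n: "(1/l) ^ n < eps / norm e" using real_arch_pow_inv by blast
 have "e v* adj k = (1/l) *\<^sub>R e" by (rule eigen_adj[OF det_G[OF Gam_G[OF k(1)]] hypD(4)[OF k(2)]]) (use l in simp)
 hence "e v* mpow (adj k) n = ((1/l) ^ n) *\<^sub>R e" by (rule eigen_mpow)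
 hence "norm (e v* mpow (adj k) n) < eps" using n l e by (simp add: pos_less_divide_eq del: vmult_nth)
 thus "\<exists>A\<in>Gam. norm (e v* A) < eps" using mpow_Gam[OF Gam_adj[OF k(1)]] by blast
qed

text \<open>If \<open>g\<close> and its conjugate \<open>g'\<close> had a common eigendirection,
  their commutator would fix a vector, have trace 2 and be trivial. So none is common, and
  \<open>h\<close> can be \<open>g'\<close>, or its square when \<open>g'\<close> sends
  \<open>e\<close> to the direction of \<open>f\<close>.\<close>

lemma ex_pair: "\<exists>g\<in>Gam. \<exists>h\<in>Gam. \<exists>e f l. hyp g e f l \<and> crs (e v* h) e \<noteq> 0 \<and> crs (f v* h) f \<noteq> 0 \<and> crs (e v* h) f \<noteq> 0"
proof -
 obtain g e f l where g: "g \<in> Gam" "hyp g e f l" using ex_Gam_hyp by blast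
 have gG: "g \<in> G" using Gam_G[OF g(1)] .
 have ef: "crs e f \<noteq> 0" using hyp_crs[OF g(2)] gG by simp
 obtain B x where B: "B \<in> G" "x \<in> {e, f}" "crs (x v* B) e \<noteq> 0" "crs (x v* B) f \<noteq> 0" using ex_moved_direction[OF ef] by blast
 define g' where "g' = adj B ** g ** B"
 have g': "g' \<in> Gam" "hyp g' (e v* B) (f v* B) l"
  using conj_Gam[of "adj B" g] B(1) g hyp_conj[OF g(2) det_G[OF B(1)]] by (simp_all add: g'_def)
 have g'G: "g' \<in> G" using Gam_G[OF g'(1)] .
 have all: "crs (y v* B) z \<noteq> 0" if yz: "y = e \<or> y = f" "z = e \<or> z = f" for y z
 proof
  assume zero: "crs (y v* B) z = 0"
  have z0: "z \<noteq> 0" using hypD(2,3)[OF g(2)] yz by auto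
  have yB: "y v* B \<noteq> 0" using vmult_nonzero[OF det_G[OF B(1)]] hypD(2,3)[OF g(2)] yz by metis
  have l0: "l \<noteq> 0" "1 / l \<noteq> 0" using hypD(1)[OF g(2)] by auto
  have "\<exists>p. z v* g = p *\<^sub>R z \<and> p \<noteq> 0" using hypD(4,5)[OF g(2)] yz(2) l0 by blast
  then obtain p where p: "z v* g = p *\<^sub>R z" "p \<noteq> 0" by blast
  have "\<exists>q. (y v* B) v* g' = q *\<^sub>R (y v* B) \<and> q \<noteq> 0" using hypD(4,5)[OF g'(2)] yz(1) l0 by blast
  then obtain q where q: "(y v* B) v* g' = q *\<^sub>R (y v* B)" "q \<noteq> 0" by blast
  have "crs z (y v* B) = 0" using zero crs_commute[of z "y v* B"] by simp
  then obtain c where c: "z = c *\<^sub>R (y v* B)" using crs_zero_iff[OF yB] by blast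
  have zq: "z v* g' = q *\<^sub>R z" unfolding c using q(1) by (simp add: vmult_scaleR del: vmult_nth)
  define k where "k = g' ** g ** adj g' ** adj g"
  have kG: "k \<in> G" using g'G gG by (simp add: k_def)
  have e1: "z v* adj g = (1/p) *\<^sub>R z" by (rule eigen_adj[OF det_G[OF gG] p])
  have e2: "z v* adj g' = (1/q) *\<^sub>R z" by (rule eigen_adj[OF det_G[OF g'G] zq q(2)])
  have "z v* k = z" unfolding k_def
   by (simp add: vmult_assoc[symmetric] zq p(1) e1 e2 vmult_scaleR p(2) q(2) del: vmult_nth)
  hence "tr k = 2" using fixed_vector_trace[OF det_G[OF kG] z0] by blast
  hence "k = mat 1 \<or> k = - mat 1" using trace_gt[OF kG] by auto
  hence comm: "g' ** g = g ** g' \<or> g' ** g = - (g ** g')" using comm_trivial[of g' g] g'G gG by (simp add: k_def)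
  have xB0: "x v* B \<noteq> 0" using B(3) by auto
  have "x v* B = e v* B \<or> x v* B = f v* B" using B(2) by blast
  from commuting_hyp_share[OF g'(2) det_G[OF g'G] det_G[OF gG] comm this]
  obtain c' where "(x v* B) v* g = c' *\<^sub>R (x v* B)" using crs_zero_iff[OF xB0] by blast
  from hyp_eigen[OF g(2) det_G[OF gG] xB0 this] show False using B(3,4) by blast
 qed
 have nz: "crs y (e v* B) \<noteq> 0" "crs y (f v* B) \<noteq> 0" if "y = e \<or> y = f" for y
  using all[OF _ that, of e] all[OF _ that, of f] crs_commute[of y "e v* B"] crs_commute[of y "f v* B"] by simp_all
 have m1: "crs (y v* g') y \<noteq> 0" if "y = e \<or> y = f" for y
  by (rule crs_move[OF g'(2) det_G[OF g'G] nz[OF that]])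
 have m2: "crs (y v* (g' ** g')) y \<noteq> 0" if "y = e \<or> y = f" for y
  by (rule crs_move[OF hyp_square[OF g'(2)] _ nz[OF that]]) (use g'G in simp)
 show ?thesis
 proof (cases "crs (e v* g') f = 0")
  case False
  thus ?thesis using g g'(1) m1[of e] m1[of f] by blast
 next
  case True
  have "crs (e v* (g' ** g')) f \<noteq> 0"
  proof
   assume z: "crs (e v* (g' ** g')) f = 0"
   obtain c where c: "e v* g' = c *\<^sub>R f" using True crs_zero_iff[OF hypD(3)[OF g(2)]] by blast
   have "e v* g' \<noteq> 0" using vmult_nonzero[OF det_G[OF g'G] hypD(2)[OF g(2)]] .
   hence "c \<noteq> 0" using c by auto
   moreover have "e v* (g' ** g') = c *\<^sub>R (f v* g')" unfolding vmult_assoc[symmetric] c by (rule vmult_scaleR)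
   ultimately show False using z m1[of f] by simp
  qed
  thus ?thesis using g g'(1) m2[of e] m2[of f] Gam_mult[OF g'(1) g'(1)] by blast
 qed
qed

lemma norm_vmult_le: "\<exists>N>0. \<forall>x. norm (x v* A) \<le> N * norm x" for A :: "real^2^2"
proof -
 have "bounded_linear (\<lambda>x. x v* A)"
  by (rule linear_conv_bounded_linear[THEN iffD1]) (auto intro!: linearI simp: vec2_eq_iff algebra_simps)
 then obtain K where K: "K > 0" "\<And>x. norm (x v* A) \<le> norm x * K" using bounded_linear.pos_bounded by blast
 thus ?thesis by (intro exI[of _ K]) (auto simp: mult.commute)
qed

text \<open>Small orbit points are stretched by powers of
 a hyperbolic element until their expanding component has size one.\<close>

lemma coarse_hit:
 assumes v: "horospherical v" and k: "k \<in> Gam" "hyp k e f l" and h: "h \<in> Gam" "crs (f v* h) f \<noteq> 0"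
 shows "\<exists>c. c \<noteq> 0 \<and> c *\<^sub>R e \<in> closure (orb v)"
proof -
 have kd: "det k = 1" using Gam_G[OF k(1)] by simp
 have ef: "crs e f \<noteq> 0" by (rule hyp_crs[OF k(2) kd])
 have l: "l > 1" using hypD(1)[OF k(2)] .
 obtain N where N: "N > 0" "\<And>x. norm (x v* h) \<le> N * norm x" using norm_vmult_le[of h] by blast
 have "\<exists>x\<in>orb v. norm x < 1 / (real n + 1) \<and> crs x f \<noteq> 0" for n
 proof -
  define eps where "eps = 1 / (real n + 1)"
  have eps: "eps > 0" "min eps (eps / N) > 0" using N by (simp_all add: eps_def)
  then obtain A where A: "A \<in> Gam" "norm (v v* A) < min eps (eps / N)" using v unfolding horospherical_def by blast
  have xo: "v v* A \<in> orb v" using A by (auto simp: orb_def)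
  show ?thesis
  \<comment> \<open>A vector in the direction of \<open>f\<close> would be contracted by the powers
    of \<open>k\<close>. One application of \<open>h\<close> turns it away, at the cost of the
    factor \<open>N\<close>.\<close>
  proof (cases "crs (v v* A) f = 0")
   case False thus ?thesis using A xo by (auto simp: eps_def)
  next
   case True
   obtain b where b: "v v* A = b *\<^sub>R f" using True crs_zero_iff[OF hypD(3)[OF k(2)]] by blast
   have "v v* A \<noteq> 0" using vmult_nonzero[OF det_G[OF Gam_G[OF A(1)]]] v by (simp add: horospherical_def)
   hence "b \<noteq> 0" using b by auto
   hence "crs ((v v* A) v* h) f \<noteq> 0" using h(2) by (simp add: b vmult_scaleR del: vmult_nth)
   moreover have "(v v* A) v* h \<in> orb v" using A h by (auto simp: orb_def vmult_assoc simp del: vmult_nth)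
   moreover have "norm ((v v* A) v* h) < eps"
   proof -
    have "N * norm (v v* A) < N * (eps / N)" using A(2) N(1) by (intro mult_strict_left_mono) auto
    thus ?thesis using N(2)[of "v v* A"] N(1) by simp
   qed
   ultimately show ?thesis by (auto simp: eps_def)
  qed
 qed
 then obtain x where x: "\<And>n. x n \<in> orb v" "\<And>n::nat. norm (x n) < 1 / (real n + 1)" "\<And>n. crs (x n) f \<noteq> 0" by metis
 have inv0: "(\<lambda>n. 1 / (real n + 1)) \<longlonglongrightarrow> 0" using LIMSEQ_inverse_real_of_nat by (simp add: inverse_eq_divide add.commute)
 have x0: "x \<longlonglongrightarrow> 0" by (rule Lim_null_comparison[OF always_eventually inv0]) (simp add: less_imp_le[OF x(2)])
 define a where "a n = crs (x n) f / crs e f" for n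
 define b where "b n = crs e (x n) / crs e f" for n
 have a0: "a \<longlonglongrightarrow> 0"
  using tendsto_divide[OF tendsto_crs[OF x0 tendsto_const[of f]] tendsto_const[of "crs e f"]] ef by (simp add: a_def[abs_def])
 have b0: "b \<longlonglongrightarrow> 0"
  using tendsto_divide[OF tendsto_crs[OF tendsto_const[of e] x0] tendsto_const[of "crs e f"]] ef by (simp add: b_def[abs_def])
 have anz: "a n \<noteq> 0" for n using x(3) ef by (simp add: a_def)
 have xe: "x n = a n *\<^sub>R e + b n *\<^sub>R f" for n unfolding a_def b_def by (rule crs_expand[OF ef])
 have "\<exists>p. 1 \<le> \<bar>a n\<bar> * l ^ p \<and> \<bar>a n\<bar> * l ^ p \<le> max l \<bar>a n\<bar>" for n
 proof -
  obtain p0 where "l ^ p0 > 1 / \<bar>a n\<bar>" using real_arch_pow[OF l] by blast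
  hence ex: "1 \<le> \<bar>a n\<bar> * l ^ p0" using anz[of n] by (simp add: field_simps)
  \<comment> \<open>The least such power overshoots 1 at most by the factor \<open>l\<close>, unless
    it is 0. This keeps the stretched components bounded.\<close>
  define p where "p = (LEAST p. 1 \<le> \<bar>a n\<bar> * l ^ p)"
  have p: "1 \<le> \<bar>a n\<bar> * l ^ p" unfolding p_def by (rule LeastI[of _ p0]) (rule ex)
  have "\<bar>a n\<bar> * l ^ p \<le> max l \<bar>a n\<bar>"
  proof (cases p)
   case 0 thus ?thesis by simp
  next
   case (Suc m)
   hence "m < p" by simp
   hence "\<not> 1 \<le> \<bar>a n\<bar> * l ^ m" unfolding p_def by (rule not_less_Least)
   hence "l * (\<bar>a n\<bar> * l ^ m) \<le> l * 1" using l by (intro mult_left_mono) auto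
   thus ?thesis using Suc by (simp add: mult_ac)
  qed
  thus ?thesis using p by blast
 qed
 then obtain p where p: "\<And>n. 1 \<le> \<bar>a n\<bar> * l ^ p n" "\<And>n. \<bar>a n\<bar> * l ^ p n \<le> max l \<bar>a n\<bar>" by metis
 define y where "y n = x n v* mpow k (p n)" for n
 have ye: "y n = (a n * l ^ p n) *\<^sub>R e + (b n * (1/l) ^ p n) *\<^sub>R f" for n
 proof -
  have "y n = a n *\<^sub>R (e v* mpow k (p n)) + b n *\<^sub>R (f v* mpow k (p n))"
   unfolding y_def by (subst xe) (simp add: vec2_eq_iff algebra_simps)
  thus ?thesis using eigen_mpow[OF hypD(4)[OF k(2)]] eigen_mpow[OF hypD(5)[OF k(2)]] by simp
 qed
 have yo: "y n \<in> orb v" for n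
  using x(1)[of n] mpow_Gam[OF k(1), of "p n"] by (auto simp: y_def orb_def vmult_assoc simp del: vmult_nth)
 have "bounded (range a)" using convergent_imp_bounded[OF a0] .
 then obtain K where K: "\<And>n. \<bar>a n\<bar> \<le> K" by (auto simp: bounded_iff)
 have "\<bar>a n * l ^ p n\<bar> \<le> max l K" for n
 proof -
  have "\<bar>a n * l ^ p n\<bar> = \<bar>a n\<bar> * l ^ p n" using l by (simp add: abs_mult)
  thus ?thesis using p(2)[of n] K[of n] by linarith
 qed
 hence "bounded (range (\<lambda>n. a n * l ^ p n))" by (auto simp: bounded_iff)
 then obtain c s where s: "strict_mono s" "((\<lambda>n. a n * l ^ p n) \<circ> s) \<longlonglongrightarrow> c" using bounded_imp_convergent_subsequence by blast
 have clim: "(\<lambda>n. a (s n) * l ^ p (s n)) \<longlonglongrightarrow> c" using s(2) by (simp add: o_def)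
 have "1 \<le> \<bar>c\<bar>"
 proof (rule LIMSEQ_le_const[OF tendsto_rabs[OF clim]])
  show "\<exists>N. \<forall>n\<ge>N. 1 \<le> \<bar>a (s n) * l ^ p (s n)\<bar>" using p(1) l by (simp add: abs_mult)
 qed
 have "(\<lambda>n. b n * (1/l) ^ p n) \<longlonglongrightarrow> 0"
 proof (rule Lim_null_comparison[OF always_eventually tendsto_rabs_zero[OF b0]], rule allI)
  fix n
  have "(1/l) ^ p n \<le> 1" using l by (intro power_le_one) auto
  thus "norm (b n * (1/l) ^ p n) \<le> \<bar>b n\<bar>" using l by (simp add: abs_mult mult_left_le)
 qed
 hence "(\<lambda>n. b (s n) * (1/l) ^ p (s n)) \<longlonglongrightarrow> 0" using LIMSEQ_subseq_LIMSEQ[OF _ s(1)] by (fastforce simp: o_def)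
 hence "(\<lambda>n. y (s n)) \<longlonglongrightarrow> c *\<^sub>R e + 0 *\<^sub>R f" unfolding ye by (intro tendsto_intros clim)
 hence "c *\<^sub>R e \<in> closure (orb v)" unfolding closure_sequential using yo by (intro exI[of _ "\<lambda>n. y (s n)"]) simp
 thus ?thesis using \<open>1 \<le> \<bar>c\<bar>\<close> by (intro exI[of _ c]) auto
qed

lemma closure_orb_pos: "c *\<^sub>R x \<in> closure (orb v) ==> \<bar>c\<bar> *\<^sub>R x \<in> closure (orb v)"
 using closure_orb_uminus[of "c *\<^sub>R x" v] by (auto simp: abs_if)

text \<open>The logarithms of the scales of \<open>e\<close> in its own orbit closure form a closed
  semigroup \<open>L\<close> that contains \<open>ln l\<close> and \<open>- ln l\<close>. It also
  contains the logarithms of the diagonal coefficients \<open>alp B\<close>, and the products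
  \<open>h ** mpow g n ** h\<close> provide distinct ones that accumulate.\<close>

lemma eigen_closure_all_scales:
 assumes g: "g \<in> Gam" "hyp g e f l" and h: "h \<in> Gam" "crs (e v* h) e \<noteq> 0" "crs (f v* h) f \<noteq> 0" "crs (e v* h) f \<noteq> 0"
 shows "s > 0 ==> s *\<^sub>R e \<in> closure (orb e)"
proof -
 have gd: "det g = 1" using Gam_G[OF g(1)] by simp
 have l: "l > 1" using hypD(1)[OF g(2)] .
 have ef: "crs e f \<noteq> 0" by (rule hyp_crs[OF g(2) gd])
 define L where "L = {t. exp t *\<^sub>R e \<in> closure (orb e)}"
 have cl: "closed L"
  unfolding L_def closed_sequential_limits
 proof (intro allI impI)
  fix x t assume a: "(\<forall>n. x n \<in> {t. exp t *\<^sub>R e \<in> closure (orb e)}) \<and> x \<longlonglongrightarrow> t"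
  hence "(\<lambda>n. exp (x n) *\<^sub>R e) \<longlonglongrightarrow> exp t *\<^sub>R e" by (intro tendsto_intros) auto
  thus "t \<in> {t. exp t *\<^sub>R e \<in> closure (orb e)}" using a closed_sequentially[OF closed_closure, of "\<lambda>n. exp (x n) *\<^sub>R e" "orb e"] by auto
 qed
 have add: "x + y \<in> L" if "x \<in> L" "y \<in> L" for x y
 proof -
  have "exp x *\<^sub>R e \<in> closure (orb e)" "exp y *\<^sub>R e \<in> closure (orb e)" using that by (simp_all add: L_def)
  hence "exp y *\<^sub>R (exp x *\<^sub>R e) \<in> closure (orb e)"
   using closure_orb_scaleR[of "exp x *\<^sub>R e" e "exp y"] closure_orb_trans[of "exp y *\<^sub>R e" e] by blast
  thus ?thesis by (simp add: L_def exp_add mult.commute)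
 qed
 have adjg: "e v* adj g = (1/l) *\<^sub>R e" by (rule eigen_adj[OF gd hypD(4)[OF g(2)]]) (use l in simp)
 have lnl: "ln l \<in> L" "- ln l \<in> L"
 proof -
  have "e v* g \<in> orb e" "e v* adj g \<in> orb e" using g(1) Gam_adj unfolding orb_def by blast+
  thus "ln l \<in> L" "- ln l \<in> L"
   using hypD(4)[OF g(2)] adjg l closure_subset[of "orb e"] by (auto simp: L_def exp_minus inverse_eq_divide)
 qed
 have nlnl: "- (real n * ln l) \<in> L" for n
 proof (induction n)
  case 0 thus ?case using add[OF lnl] by simp
 next
  case (Suc n)
  from add[OF this lnl(2)] show ?case by (simp add: algebra_simps)
 qed
 define alp where "alp B = crs (e v* B) f / crs e f" for B
 have q0: "(\<lambda>n. (1/l) ^ n) \<longlonglongrightarrow> 0" using l by (intro LIMSEQ_power_zero) simp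
 \<comment> \<open>Conjugating \<open>B\<close> by powers of \<open>g\<close> keeps the coefficient
   of \<open>e\<close> in \<open>e v* B\<close> and contracts that of \<open>f\<close> to 0.\<close>
 have alpL: "ln \<bar>alp B\<bar> \<in> L" if B: "B \<in> Gam" "alp B \<noteq> 0" for B
 proof -
  define b where "b = crs e (e v* B) / crs e f"
  have eB: "e v* B = alp B *\<^sub>R e + b *\<^sub>R f" unfolding alp_def b_def by (rule crs_expand[OF ef])
  define k where "k n = mpow (adj g) n ** B ** mpow g n" for n
  have "e v* k n = alp B *\<^sub>R e + (b * ((1/l) ^ n * (1/l) ^ n)) *\<^sub>R f" for n
  proof -
   have "e v* k n = (1/l) ^ n *\<^sub>R ((e v* B) v* mpow g n)"
    unfolding k_def vmult_assoc[symmetric] eigen_mpow[OF adjg] by (simp add: vmult_scaleR del: vmult_nth)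
   also have "(e v* B) v* mpow g n = alp B *\<^sub>R (e v* mpow g n) + b *\<^sub>R (f v* mpow g n)"
    unfolding eB by (simp add: vec2_eq_iff algebra_simps)
   finally show ?thesis
    using eigen_mpow[OF hypD(4)[OF g(2)]] eigen_mpow[OF hypD(5)[OF g(2)]] l by (simp add: scaleR_add_right power_one_over)
  qed
  moreover have "(\<lambda>n. alp B *\<^sub>R e + (b * ((1/l) ^ n * (1/l) ^ n)) *\<^sub>R f) \<longlonglongrightarrow> alp B *\<^sub>R e + (b * (0 * 0)) *\<^sub>R f"
   by (intro tendsto_add tendsto_scaleR tendsto_mult tendsto_const q0)
  ultimately have "(\<lambda>n. e v* k n) \<longlonglongrightarrow> alp B *\<^sub>R e" by simp
  moreover have "e v* k n \<in> orb e" for n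
   unfolding orb_def k_def using Gam_mult[OF Gam_mult[OF mpow_Gam[OF Gam_adj[OF g(1)]] B(1)] mpow_Gam[OF g(1)]] by blast
  ultimately have "alp B *\<^sub>R e \<in> closure (orb e)" unfolding closure_sequential by (intro exI[of _ "\<lambda>n. e v* k n"]) simp
  hence "\<bar>alp B\<bar> *\<^sub>R e \<in> closure (orb e)" by (rule closure_orb_pos)
  thus ?thesis using B(2) by (simp add: L_def)
 qed
 define P where "P = alp h"
 define r where "r = crs e (e v* h) / crs e f * (crs (f v* h) f / crs e f)"
 have P: "P \<noteq> 0" "r \<noteq> 0" using h ef by (simp_all add: P_def alp_def r_def crs_commute[of e "e v* h"])
 \<comment> \<open>The coefficient of \<open>h ** mpow g n ** h\<close>, divided by
   \<open>l ^ n\<close>. It tends to \<open>P\<^sup>2\<close> without reaching it, because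
   \<open>r\<close> is nonzero.\<close>
 define y where "y n = P\<^sup>2 + r * ((1/l) ^ n * (1/l) ^ n)" for n
 have y: "alp (h ** mpow g n ** h) = y n * l ^ n" for n
 proof -
  define b where "b = crs e (e v* h) / crs e f"
  have "e v* h = P *\<^sub>R e + b *\<^sub>R f" unfolding P_def alp_def b_def by (rule crs_expand[OF ef])
  hence "e v* (h ** mpow g n) = P *\<^sub>R (e v* mpow g n) + b *\<^sub>R (f v* mpow g n)"
   unfolding vmult_assoc[symmetric] by (simp add: vec2_eq_iff algebra_simps)
  also have "\<dots> = (P * l ^ n) *\<^sub>R e + (b * (1/l) ^ n) *\<^sub>R f"
   using eigen_mpow[OF hypD(4)[OF g(2)]] eigen_mpow[OF hypD(5)[OF g(2)]] by simp
  finally have "e v* (h ** mpow g n ** h) = (P * l ^ n) *\<^sub>R (e v* h) + (b * (1/l) ^ n) *\<^sub>R (f v* h)"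
   unfolding vmult_assoc[symmetric] by (simp add: vec2_eq_iff algebra_simps)
  hence "alp (h ** mpow g n ** h) = P * l ^ n * P + b * (1/l) ^ n * (crs (f v* h) f / crs e f)"
   unfolding alp_def P_def by (simp add: crs_add add_divide_distrib)
  thus ?thesis using l by (simp add: y_def r_def b_def power2_eq_square power_one_over field_simps)
 qed
 have yn: "y n \<noteq> P\<^sup>2" for n using P l by (simp add: y_def)
 have "y \<longlonglongrightarrow> P\<^sup>2 + r * (0 * 0)" unfolding y_def[abs_def] by (intro tendsto_add tendsto_mult tendsto_const q0)
 hence ylim: "y \<longlonglongrightarrow> P\<^sup>2" by simp
 hence ypos: "\<forall>\<^sub>F n in sequentially. y n > 0" using P(1) by (intro order_tendstoD(1)[OF ylim]) simp
 have yL: "ln (y n) \<in> L" if "y n > 0" for n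
 proof -
  have "ln \<bar>y n * l ^ n\<bar> \<in> L" using alpL[of "h ** mpow g n ** h"] y[of n] h(1) mpow_Gam[OF g(1), of n] that l by simp
  from add[OF this nlnl[of n]] have "ln (y n * l ^ n) + - (real n * ln l) \<in> L" using that l by simp
  thus ?thesis using that l by (simp add: ln_mult ln_realpow)
 qed
 have PL: "ln (P\<^sup>2) \<in> L"
 proof -
  have "ln \<bar>P\<bar> \<in> L" using alpL[OF h(1)] P(1) by (simp add: P_def)
  moreover have "ln (P\<^sup>2) = ln \<bar>P\<bar> + ln \<bar>P\<bar>" using ln_mult[of "\<bar>P\<bar>" "\<bar>P\<bar>"] P(1) by (simp add: power2_eq_square)
  ultimately show ?thesis using add by metis
 qed
 have "L = UNIV"
 proof (rule closed_semigroup_UNIV[OF cl add, of "ln l"])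
  show "ln l > 0" "ln l \<in> L" "- ln l \<in> L" using l lnl by auto
  fix eps :: real assume eps: "eps > 0"
  have "(\<lambda>n. ln (y n)) \<longlonglongrightarrow> ln (P\<^sup>2)" using ylim P(1) by (intro tendsto_ln) auto
  from tendstoD[OF this eps] have "\<forall>\<^sub>F n in sequentially. dist (ln (y n)) (ln (P\<^sup>2)) < eps \<and> y n > 0" using ypos by (rule eventually_conj)
  then obtain n where n: "dist (ln (y n)) (ln (P\<^sup>2)) < eps" "y n > 0" unfolding eventually_sequentially by blast
  have "ln (y n) \<noteq> ln (P\<^sup>2)" using yn[of n] n(2) P(1) by (subst ln_inj_iff) auto
  thus "\<exists>x\<in>L. \<exists>y\<in>L. x \<noteq> y \<and> \<bar>x - y\<bar> < eps" using n yL PL by (auto simp: dist_real_def)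
 qed
 thus "s *\<^sub>R e \<in> closure (orb e)" if "s > 0" for s
 proof -
  have "ln s \<in> L" using \<open>L = UNIV\<close> by simp
  thus ?thesis using that by (simp add: L_def)
 qed
qed

lemma eigen_in_cone_closure:
 assumes k: "k \<in> Gam" "hyp k e f l" and h: "h \<in> Gam" "crs (f v* h) f \<noteq> 0" and x: "x \<noteq> 0"
 shows "c *\<^sub>R e \<in> closure (cone Gam x)"
proof -
 have kd: "det k = 1" using Gam_G[OF k(1)] by simp
 have ef: "crs e f \<noteq> 0" by (rule hyp_crs[OF k(2) kd])
 have l: "l > 1" using hypD(1)[OF k(2)] .
 have *: "c *\<^sub>R e \<in> closure (cone Gam x)" if B: "B \<in> Gam" "crs (x v* B) f \<noteq> 0" for B
 proof -
  define a where "a = crs (x v* B) f / crs e f"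
  define b where "b = crs e (x v* B) / crs e f"
  have a0: "a \<noteq> 0" using B ef by (simp add: a_def)
  have xe: "x v* B = a *\<^sub>R e + b *\<^sub>R f" unfolding a_def b_def by (rule crs_expand[OF ef])
  have "(c / a * (1/l) ^ n) *\<^sub>R (x v* (B ** mpow k n)) = c *\<^sub>R e + (c / a * b * ((1/l) ^ n * (1/l) ^ n)) *\<^sub>R f" for n
  proof -
   have "x v* (B ** mpow k n) = a *\<^sub>R (e v* mpow k n) + b *\<^sub>R (f v* mpow k n)"
    unfolding vmult_assoc[symmetric] xe by (simp add: vec2_eq_iff algebra_simps)
   also have "\<dots> = (a * l ^ n) *\<^sub>R e + (b * (1/l) ^ n) *\<^sub>R f"
    using eigen_mpow[OF hypD(4)[OF k(2)]] eigen_mpow[OF hypD(5)[OF k(2)]] by simp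
   finally show ?thesis using a0 l by (simp add: scaleR_add_right power_one_over)
  qed
  moreover have q0: "(\<lambda>n. (1/l) ^ n) \<longlonglongrightarrow> 0" using l by (intro LIMSEQ_power_zero) simp
  have "(\<lambda>n. c *\<^sub>R e + (c / a * b * ((1/l) ^ n * (1/l) ^ n)) *\<^sub>R f) \<longlonglongrightarrow> c *\<^sub>R e + (c / a * b * (0 * 0)) *\<^sub>R f"
   by (intro tendsto_add tendsto_scaleR tendsto_mult tendsto_const q0)
  ultimately have "(\<lambda>n. (c / a * (1/l) ^ n) *\<^sub>R (x v* (B ** mpow k n))) \<longlonglongrightarrow> c *\<^sub>R e" by simp
  moreover have "(c / a * (1/l) ^ n) *\<^sub>R (x v* (B ** mpow k n)) \<in> cone Gam x" for n
   unfolding cone_def using Gam_mult[OF B(1) mpow_Gam[OF k(1)]] by blast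
  ultimately show ?thesis unfolding closure_sequential by (intro exI[of _ "\<lambda>n. (c / a * (1/l) ^ n) *\<^sub>R (x v* (B ** mpow k n))"]) simp
 qed
 show ?thesis
 proof (cases "crs x f = 0")
  case False
  thus ?thesis using *[of "mat 1"] by simp
 next
  case True
  then obtain b where b: "x = b *\<^sub>R f" using crs_zero_iff[OF hypD(3)[OF k(2)]] by blast
  hence "crs (x v* h) f \<noteq> 0" using x h(2) by (auto simp: vmult_scaleR simp del: vmult_nth)
  thus ?thesis using *[OF h(1)] by blast
 qed
qed

lemma hyp_adj: assumes "hyp g e f l" "det g = 1" shows "hyp (adj g) f e l"
 using assms eigen_adj[OF assms(2) hypD(4)[OF assms(1)]] eigen_adj[OF assms(2) hypD(5)[OF assms(1)]]
 by (simp add: hyp_def del: vmult_nth)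

text \<open>\<open>Gam\<close> is normal in \<open>G\<close>, so it contains the conjugates of
  \<open>g\<close> by elements of \<open>G\<close>, whose eigenvectors fill the cones of
  \<open>e\<close> and \<open>f\<close> over the larger group. Each of them is a limit of multiples
  of vectors \<open>x v* A\<close> with \<open>A\<close> in \<open>Gam\<close>, and those cones are
  dense by \<open>cone_G_dense\<close>.\<close>

lemma cone_Gam_dense: assumes x: "x \<noteq> 0" shows "closure (cone Gam x) = UNIV"
proof -
 obtain g h e f l where g: "g \<in> Gam" "hyp g e f l" and h: "h \<in> Gam" "crs (e v* h) e \<noteq> 0" "crs (f v* h) f \<noteq> 0"
  using ex_pair by blast
 have gd: "det g = 1" using Gam_G[OF g(1)] by simp
 have "c *\<^sub>R (e' v* B) \<in> closure (cone Gam x)"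
  if B: "B \<in> G" and g': "g' \<in> Gam" "hyp g' e' f' l" and h': "crs (f' v* h) f' \<noteq> 0" for B g' e' f' c
 proof (rule eigen_in_cone_closure[OF _ hyp_conj[OF g'(2) det_G[OF B]] _ _ x])
  show "adj B ** g' ** B \<in> Gam" "adj B ** h ** B \<in> Gam" using conj_Gam[of "adj B"] B g'(1) h(1) by simp_all
  have "(f' v* B) v* (adj B ** h ** B) = (f' v* h) v* B"
   by (simp add: matrix_mul_assoc[symmetric] adj_cancel(2)[OF det_G[OF B]] vmult_assoc)
  thus "crs ((f' v* B) v* (adj B ** h ** B)) (f' v* B) \<noteq> 0" using h' B by (simp add: crs_vmult)
 qed
 hence "cone G e \<subseteq> closure (cone Gam x)" "cone G f \<subseteq> closure (cone Gam x)"
  using g h hyp_adj[OF g(2) gd] Gam_adj[OF g(1)] unfolding cone_def by blast+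
 hence "closure (cone G e) \<union> closure (cone G f) \<subseteq> closure (cone Gam x)" by (simp add: closure_minimal)
 thus ?thesis using cone_G_dense[OF hyp_crs[OF g(2) gd]] by blast
qed

theorem horospherical_dense: assumes v: "horospherical v" shows "closure (orb v) = UNIV"
proof -
 obtain g h e f l where g: "g \<in> Gam" "hyp g e f l" and h: "h \<in> Gam" "crs (e v* h) e \<noteq> 0" "crs (f v* h) f \<noteq> 0" "crs (e v* h) f \<noteq> 0"
  using ex_pair by blast
 obtain c where c: "c \<noteq> 0" "c *\<^sub>R e \<in> closure (orb v)" using coarse_hit[OF v g h(1,3)] by blast
 have cv: "\<bar>c\<bar> *\<^sub>R e \<in> closure (orb v)" by (rule closure_orb_pos[OF c(2)])
 have pos: "s *\<^sub>R e \<in> closure (orb v)" if "s > 0" for s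
 proof -
  have "(s / \<bar>c\<bar>) *\<^sub>R e \<in> closure (orb e)" by (rule eigen_closure_all_scales[OF g h]) (use that c in simp)
  hence "\<bar>c\<bar> *\<^sub>R ((s / \<bar>c\<bar>) *\<^sub>R e) \<in> closure (orb (\<bar>c\<bar> *\<^sub>R e))" by (rule closure_orb_scaleR)
  thus ?thesis using closure_orb_trans[OF cv] c(1) by auto
 qed
 have zero: "0 \<in> closure (orb v)"
  unfolding closure_approachable using v by (force simp: horospherical_def orb_def dist_norm simp del: vmult_nth)
 have "s *\<^sub>R e \<in> closure (orb v)" for s
  using pos[of s] pos[of "- s"] closure_orb_uminus[of "- s *\<^sub>R e" v] zero by (cases s "0::real" rule: linorder_cases) auto
 hence "s *\<^sub>R (e v* A) \<in> closure (orb v)" if "A \<in> Gam" for s A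
  using closure_orb_vmult[OF _ that] by (metis vmult_scaleR)
 hence "cone Gam e \<subseteq> closure (orb v)" by (auto simp: cone_def simp del: vmult_nth)
 hence "closure (cone Gam e) \<subseteq> closure (orb v)" by (simp add: closure_minimal)
 thus ?thesis using cone_Gam_dense[OF hypD(2)[OF g(2)]] by blast
qed

end

section \<open>The number of shapes\<close>

context zcover
begin

section \<open>The sign symmetry and a complete invariant of orbit closures\<close>

lemma neg_Gam: "zcover.Gam G (\<lambda>A. - phi A) = Gam"
 unfolding zcover.Gam_def[OF neg] Gam_def by simp

lemma neg_orb: "zcover.orb G (\<lambda>A. - phi A) = orb"
 unfolding zcover.orb_def[OF neg, abs_def] orb_def[abs_def] neg_Gam ..

lemma neg_crel: "zcover.crel G (\<lambda>A. - phi A) = crel"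
 unfolding zcover.crel_def[OF neg] crel_def zcover.chainrel_def[OF neg] chainrel_def neg_Aub neg_Gam ..

abbreviation "Qm \<equiv> zcover.Qp G (\<lambda>A. - phi A)"

lemma Qm_def: "Qm v \<longleftrightarrow> v \<noteq> 0 \<and> (\<exists>u\<in>tightf. \<exists>s. \<forall>x\<in>UH. s \<le> - u x + horo v x)"
 unfolding zcover.Qp_def[OF neg]
proof (intro conj_cong refl iffI)
 assume "\<exists>u\<in>zcover.tightf G (\<lambda>A. - phi A). \<exists>s. \<forall>x\<in>UH. s \<le> u x + horo v x"
 then obtain u s where "(\<lambda>z. - u z) \<in> tightf" "\<forall>x\<in>UH. s \<le> u x + horo v x" by (auto simp: neg_tightf)
 thus "\<exists>u\<in>tightf. \<exists>s. \<forall>x\<in>UH. s \<le> - u x + horo v x" by (intro bexI[of _ "\<lambda>z. - u z"] exI[of _ s]) auto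
next
 assume "\<exists>u\<in>tightf. \<exists>s. \<forall>x\<in>UH. s \<le> - u x + horo v x"
 then obtain u s where "u \<in> tightf" "\<forall>x\<in>UH. s \<le> - u x + horo v x" by auto
 thus "\<exists>u\<in>zcover.tightf G (\<lambda>A. - phi A). \<exists>s. \<forall>x\<in>UH. s \<le> u x + horo v x"
  by (intro bexI[of _ "\<lambda>z. - u z"] exI[of _ s]) (auto simp: neg_tightf)
qed

text \<open>Adding the two lower bounds cancels the tight functions up to a constant and bounds
  \<open>horo v\<close> below, but it tends to minus infinity along a ray to its base point.\<close>

lemma Qp_Qm_disjoint: assumes "Qp v" "Qm v" shows False
proof -
 have v: "v \<noteq> 0" using assms(1) by (rule Qp_nonzero)
 obtain u s where u: "u \<in> tightf" "\<And>x. x \<in> UH ==> s \<le> - u x + horo v x" using assms(2) by (auto simp: Qm_def)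
 obtain g r where g: "det g = 1" "pt g = \<i>" "(v v* g)$1 = 0" "(v v* g)$2 = r" using horo_ray[OF i_UH] by blast
 define t where "t = horo v (pt g) - (lev u v + s) / 2 + 1"
 have "geo g t \<in> UH" using g by (simp add: det_mult1)
 hence "lev u v + s \<le> 2 * horo v (geo g t)" using lev_le[OF assms(1) u(1)] u(2) by (smt (verit))
 thus False unfolding horo_ray_level[OF g(1) v g(3)] t_def by argo
qed

definition shape :: "real^2 \<Rightarrow> real^2 \<Rightarrow> bool" where
 "shape v w \<longleftrightarrow> (\<exists>c>0. closure (orb w) = closure (orb (c *\<^sub>R v)))"

text \<open>Scaling shifts the level freely and keeps the class, so only the class remains:
  \<open>closure_same_class\<close> applies after matching levels, and \<open>closure_class\<close>
  is the converse.\<close>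

lemma shape_class:
 assumes v: "Qp v" and w: "Qp w" and C: "C \<in> Aub // crel" "att v C" and D: "D \<in> Aub // crel" "att w D"
 shows "shape v w \<longleftrightarrow> C = D"
proof
 assume "shape v w"
 then obtain c where c: "c > 0" "closure (orb w) = closure (orb (c *\<^sub>R v))" by (auto simp: shape_def)
 have "w \<in> closure (orb (c *\<^sub>R v))" "c *\<^sub>R v \<in> closure (orb w)" using c(2) closure_orb_self by auto
 from closure_class[OF Qp_scaleR[OF v, of c] this Qp_nonzero[OF w] C(1) _ D] show "C = D" using c(1) C by (simp add: att_scaleR)
next
 assume CD: "C = D"
 obtain u where u: "u \<in> tightf" using tightf_nonempty by blast
 define c where "c = exp ((lev u w - lev u v) / 2)"
 have c: "c > 0" "c \<noteq> 0" by (simp_all add: c_def)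
 have "ln (c\<^sup>2) = lev u w - lev u v" by (simp add: c_def flip: exp_double)
 hence l: "lev u (c *\<^sub>R v) = lev u w" using lev_scaleR[OF v c(2) u] by simp
 have Q: "Qp (c *\<^sub>R v)" and a: "att (c *\<^sub>R v) C" "att w C" using Qp_scaleR[OF v c(2)] C D CD c by (simp_all add: att_scaleR)
 have "w \<in> closure (orb (c *\<^sub>R v))" "c *\<^sub>R v \<in> closure (orb w)"
  using closure_same_class[OF Q w u l C(1) a] closure_same_class[OF w Q u l[symmetric] C(1) a(2,1)] by blast+
 hence "closure (orb w) = closure (orb (c *\<^sub>R v))" using closure_orb_trans by blast
 thus "shape v w" using c by (auto simp: shape_def)
qed

lemma shape_Qp: assumes "shape v w" "Qp v" "w \<noteq> 0" shows "Qp w"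
proof -
 obtain c where c: "c > 0" "closure (orb w) = closure (orb (c *\<^sub>R v))" using assms(1) by (auto simp: shape_def)
 show ?thesis using closure_orb(1)[of w "c *\<^sub>R v"] Qp_scaleR[OF assms(2), of c] c closure_orb_self[of w] assms(3) by auto
qed

lemma shape_sym: assumes "shape v w" shows "shape w v"
proof -
 obtain c where c: "c > 0" "closure (orb w) = closure (orb (c *\<^sub>R v))" using assms(1) by (auto simp: shape_def)
 have "closure (orb (c' *\<^sub>R x)) = (\<lambda>y. c' *\<^sub>R y) ` closure (orb x)" if "c' > 0" for c' x
 proof -
  have "orb (c' *\<^sub>R x) = (\<lambda>y. c' *\<^sub>R y) ` orb x" by (auto simp: orb_def vmult_scaleR simp del: vmult_nth)
  thus ?thesis by (simp add: closure_scaleR[symmetric])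
 qed
 hence "closure (orb ((1/c) *\<^sub>R w)) = closure (orb v)" using c by (simp add: image_image)
 thus ?thesis using c(1) unfolding shape_def by (intro exI[of _ "1/c"]) simp
qed

lemma class_leaf: assumes "C \<in> Aub // crel" obtains g where "g \<in> leafs" "C = crel `` {pt g}"
proof -
 obtain z where "z \<in> Aub" "C = crel `` {z}" using assms by (auto simp: quotient_def)
 thus ?thesis using ex_leaf[of z] that by blast
qed

lemma class_Qp: assumes "C \<in> Aub // crel" shows "\<exists>v. Qp v \<and> att v C"
 using class_leaf[OF assms] leaf_Qp by metis

lemma horospherical_not_Qp: "Qp v ==> \<not> horospherical v"
 using Qp_norm_bound[of v] by (force simp: horospherical_def)

lemma horospherical_cases: assumes "v \<noteq> 0" shows "horospherical v \<or> Qp v \<or> Qm v"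
proof (rule disjCI)
 assume n: "\<not> (Qp v \<or> Qm v)"
 obtain u where u: "u \<in> tightf" using tightf_nonempty by blast
 show "horospherical v"
  unfolding horospherical_def
 proof (intro conjI assms allI impI, rule ccontr)
  fix e :: real assume "e > 0" "\<not> (\<exists>A\<in>Gam. norm (v v* A) < e)"
  thus False using Qp_or_neg[OF assms _ _ u, of e] n u by (force simp: Qm_def assms)
 qed
qed

text \<open>The value \<open>None\<close> stands for the dense orbits; otherwise the sign and the
  attracting class are recorded. By \<open>att_unique\<close> the choice is forced.\<close>

definition key :: "real^2 \<Rightarrow> (bool \<times> complex set) option" where
 "key v = (if horospherical v then None else Some (Qp v, SOME C. C \<in> Aub // crel \<and> att v C))"

lemma att_ex: assumes "v \<noteq> 0" "\<not> horospherical v" shows "\<exists>C. C \<in> Aub // crel \<and> att v C"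
proof (cases "Qp v")
 case True thus ?thesis using att_exists by blast
next
 case False
 hence "Qm v" using horospherical_cases assms by blast
 thus ?thesis using zcover.att_exists[OF neg, of v] unfolding neg_Aub neg_crel by blast
qed

lemma key_att: assumes "v \<noteq> 0" "\<not> horospherical v" "C \<in> Aub // crel" "att v C" shows "key v = Some (Qp v, C)"
proof -
 have "(SOME C. C \<in> Aub // crel \<and> att v C) = C"
  using someI_ex[OF att_ex[OF assms(1,2)]] att_unique[OF _ assms(4) _ assms(3,1)] by blast
 thus ?thesis using assms by (simp add: key_def)
qed

lemma neg_shape: "zcover.shape G (\<lambda>A. - phi A) = shape"
 unfolding zcover.shape_def[OF neg, abs_def] shape_def[abs_def] neg_orb ..

lemma neg_horospherical: "zcover.horospherical G (\<lambda>A. - phi A) = horospherical"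
 unfolding zcover.horospherical_def[OF neg, abs_def] horospherical_def[abs_def] neg_Gam ..

theorem shape_key: assumes v: "v \<noteq> 0" and w: "w \<noteq> 0" shows "shape v w \<longleftrightarrow> key v = key w"
proof -
 have inv: "(horospherical v \<longleftrightarrow> horospherical w) \<and> (Qp v \<longleftrightarrow> Qp w)" if "shape v w"
  using that shape_sym[OF that] v w shape_Qp zcover.shape_Qp[OF neg, unfolded neg_shape]
   horospherical_cases horospherical_not_Qp zcover.horospherical_not_Qp[OF neg, unfolded neg_horospherical] by metis
 show ?thesis
 proof (cases "horospherical v \<or> horospherical w")
  case True
  have "shape v w" if "horospherical v" "horospherical w"
   using horospherical_dense that unfolding shape_def by (intro exI[of _ 1]) simp
  thus ?thesis using True inv by (auto simp: key_def)
 next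
  case False
  then obtain C D where C: "C \<in> Aub // crel" "att v C" and D: "D \<in> Aub // crel" "att w D" using att_ex v w by meson
  have k: "key v = Some (Qp v, C)" "key w = Some (Qp w, D)" using key_att[OF v _ C] key_att[OF w _ D] False by auto
  show ?thesis
  proof (cases "Qp v = Qp w")
   case True
   hence "Qp v \<and> Qp w \<or> Qm v \<and> Qm w" using horospherical_cases v w False by blast
   hence "shape v w \<longleftrightarrow> C = D"
    using shape_class C D zcover.shape_class[OF neg, unfolded neg_shape neg_Aub neg_crel] by metis
   thus ?thesis using k True by simp
  next
   case False
   thus ?thesis using k inv by auto
  qed
 qed
qed

theorem key_range: "key ` {v. v \<noteq> 0} = insert None (Some ` (UNIV \<times> (Aub // crel)))"
proof (intro equalityI subsetI)
 fix k assume "k \<in> key ` {v. v \<noteq> 0}"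
 then obtain v where v: "v \<noteq> 0" "k = key v" by blast
 show "k \<in> insert None (Some ` (UNIV \<times> (Aub // crel)))"
 proof (cases "horospherical v")
  case True thus ?thesis using v by (simp add: key_def)
 next
  case False
  then obtain C where "C \<in> Aub // crel" "att v C" using att_ex v by blast
  thus ?thesis using key_att[OF v(1) False] v(2) by auto
 qed
next
 fix k :: "(bool \<times> complex set) option" assume k: "k \<in> insert None (Some ` (UNIV \<times> (Aub // crel)))"
 show "k \<in> key ` {v. v \<noteq> 0}"
 proof (cases k)
  case None
  obtain A e f l where "A \<in> Gam" "hyp A e f l" using ex_Gam_hyp by blast
  hence "horospherical e" by (rule hyp_horospherical)
  thus ?thesis using None by (auto simp: key_def horospherical_def image_iff)
 next
  case (Some p)
  then obtain b C where C: "C \<in> Aub // crel" "k = Some (b, C)" using k by auto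
  show ?thesis
  proof (cases b)
   case True
   obtain v where v: "Qp v" "att v C" using class_Qp[OF C(1)] by blast
   hence "key v = Some (True, C)" using key_att[OF Qp_nonzero[OF v(1)] horospherical_not_Qp[OF v(1)] C(1)] by simp
   thus ?thesis using C True Qp_nonzero[OF v(1)] by (auto simp: image_iff)
  next
   case False
   obtain v where v: "Qm v" "att v C" using zcover.class_Qp[OF neg, unfolded neg_Aub neg_crel, OF C(1)] by blast
   have v0: "v \<noteq> 0" "\<not> horospherical v" "\<not> Qp v"
    using zcover.Qp_nonzero[OF neg v(1)] zcover.horospherical_not_Qp[OF neg v(1), unfolded neg_horospherical] Qp_Qm_disjoint v(1) by blast+
   hence "key v = Some (False, C)" using key_att[OF v0(1,2) C(1) v(2)] by simp
   thus ?thesis using C False v0 by (auto simp: image_iff)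
  qed
 qed
qed

theorem card_key: "card (key ` {v. v \<noteq> 0}) = 2 * card (Aub // crel) + 1"
proof -
 have "card (insert None (Some ` ((UNIV :: bool set) \<times> (Aub // crel)))) = Suc (card ((UNIV :: bool set) \<times> (Aub // crel)))"
  using finite_classes by (subst card_insert_disjoint) (auto simp: card_image)
 thus ?thesis unfolding key_range by (simp add: card_cartesian_product)
qed

end

section \<open>Surfaces\<close>

lemma uminus_mult: "(- A) ** B = - (A ** B)" "A ** (- B) = - (A ** B)" for A B :: "real^2^2"
 by (cases A rule: mk_cases; cases B rule: mk_cases; simp)+

lemma psl_eq_iff: "psl A = psl B \<longleftrightarrow> A = B \<or> A = - B"
 by (auto simp: psl_eq doubleton_eq_iff)

lemma psl_uminus [simp]: "psl (- A) = psl A" by (simp add: psl_eq_iff)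

lemma psl_mult: "psl A \<otimes>\<^bsub>PSL2R\<^esub> psl B = psl (A ** B)"
 by (auto simp: PSL2R_def FactGroup_def set_mult_def SL2R_def psl_eq uminus_mult)

lemma psl_one: "\<one>\<^bsub>PSL2R\<^esub> = psl (mat 1)"
 by (simp add: PSL2R_def FactGroup_def psl_eq)

lemma group_PSL2R: "group PSL2R"
proof (rule groupI)
 fix x assume "x \<in> carrier PSL2R"
 then obtain A where "det A = 1" "x = psl A" by (auto simp: carrier_PSL2R)
 thus "\<exists>y\<in>carrier PSL2R. y \<otimes>\<^bsub>PSL2R\<^esub> x = \<one>\<^bsub>PSL2R\<^esub>"
  by (intro bexI[of _ "psl (adj A)"]) (auto simp: carrier_PSL2R psl_mult psl_one adj_left)
qed (auto simp: carrier_PSL2R psl_mult psl_one det_mult1 matrix_mul_assoc)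

lemma continuous_on_act: "det A = 1 ==> S \<subseteq> UH ==> continuous_on S (act A)"
 unfolding continuous_on_def by (intro ballI tendsto_act tendsto_const tendsto_ident_at) auto

text \<open>Common setting for the group of the closed surface and for its kernel. Matrices replace
  elements of the projective group, so closure under negation is required.\<close>

locale mgroup =
 fixes M :: "(real^2^2) set"
 assumes det_M [simp]: "A \<in> M ==> det A = 1"
  and one_M [simp]: "mat 1 \<in> M"
  and mult_M [simp]: "A \<in> M ==> B \<in> M ==> A ** B \<in> M"
  and adj_M [simp]: "A \<in> M ==> adj A \<in> M"
  and uminus_M [simp]: "A \<in> M ==> - A \<in> M"
begin

abbreviation "proj \<equiv> surface_proj (psl ` M)"
abbreviation "quo \<equiv> surface_topology (psl ` M)"

lemma proj_def: "proj z = (\<lambda>A. act A z) ` M"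
 unfolding surface_proj_def image_image psl_act_eq_act ..

lemma proj_self: "z \<in> proj z"
 unfolding proj_def by (rule image_eqI[of _ _ "mat 1"]) auto

lemma proj_act [simp]: assumes "A \<in> M" "z \<in> UH" shows "proj (act A z) = proj z"
proof -
 have "act B (act A z) \<in> proj z" if "B \<in> M" for B
  using that assms by (auto simp: proj_def act_mult[symmetric])
 moreover have "act B z \<in> proj (act A z)" if "B \<in> M" for B
 proof -
  have "act B z = act (B ** adj A) (act A z)" using that assms by (simp add: act_mult act_UH act_adj)
  thus ?thesis using that assms by (auto simp: proj_def)
 qed
 ultimately show ?thesis unfolding proj_def[of z] proj_def[of "act A z"] by (auto simp: proj_def)
qed

lemma proj_eq: assumes "z \<in> UH" shows "proj z = proj w \<longleftrightarrow> (\<exists>A\<in>M. w = act A z)"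
proof
 assume "proj z = proj w"
 thus "\<exists>A\<in>M. w = act A z" using proj_self[of w] by (auto simp: proj_def)
qed (use assms in auto)

lemma surface_eq: "surface (psl ` M) = proj ` UH" by (simp add: surface_def)

lemma topspace_quo [simp]: "topspace quo = proj ` UH"
 by (simp add: surface_topology_def topspace_quotient_topology)

lemma quotient_proj: "quotient_map (top_of_set UH) quo proj"
 unfolding surface_topology_def by (rule quotient_map_quotient_topology)

lemma openin_quo: "openin quo U \<longleftrightarrow> U \<subseteq> proj ` UH \<and> open {z \<in> UH. proj z \<in> U}"
 by (simp add: surface_topology_def openin_quotient_topology openin_open_eq[OF open_UH])

lemma open_proj: assumes "open V" "V \<subseteq> UH" shows "openin quo (proj ` V)"
proof -
 have eq: "{z \<in> UH. proj z \<in> proj ` V} = (\<Union>A\<in>M. UH \<inter> act A -` V)"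
 proof (intro equalityI subsetI)
  fix z assume "z \<in> {z \<in> UH. proj z \<in> proj ` V}"
  then obtain w where "z \<in> UH" "w \<in> V" "proj z = proj w" by blast
  thus "z \<in> (\<Union>A\<in>M. UH \<inter> act A -` V)" using proj_eq[of z w] by auto
 next
  fix z assume "z \<in> (\<Union>A\<in>M. UH \<inter> act A -` V)"
  then obtain A where "A \<in> M" "z \<in> UH" "act A z \<in> V" by blast
  thus "z \<in> {z \<in> UH. proj z \<in> proj ` V}" using proj_act[of A z] by (metis (mono_tags) image_eqI mem_Collect_eq)
 qed
 have "open (UH \<inter> act A -` V)" if "A \<in> M" for A
  using that assms by (intro continuous_open_preimage continuous_on_act open_UH) auto
 thus ?thesis unfolding openin_quo eq using assms by blast
qed

text \<open>The infimum runs over both orbits, but an isometry moves one point back. With a strict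
  inequality the question whether the infimum is attained does not arise.\<close>

lemma sd_less:
 assumes "z \<in> UH" "w \<in> UH"
 shows "surface_dist (proj z) (proj w) < e \<longleftrightarrow> (\<exists>A\<in>M. hdist z (act A w) < e)"
proof -
 have "surface_dist (proj z) (proj w) < e \<longleftrightarrow> (\<exists>x\<in>proj z \<times> proj w. (case x of (a, b) \<Rightarrow> hdist a b) < e)"
  unfolding surface_dist_def
  by (rule cINF_less_iff)
   (use proj_self assms in \<open>auto simp: proj_def act_UH intro!: bdd_belowI[of _ 0]\<close>)
 also have "\<dots> \<longleftrightarrow> (\<exists>A\<in>M. \<exists>B\<in>M. hdist (act A z) (act B w) < e)" by (auto simp: proj_def)
 also have "\<dots> \<longleftrightarrow> (\<exists>A\<in>M. hdist z (act A w) < e)"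
 proof
  assume "\<exists>A\<in>M. \<exists>B\<in>M. hdist (act A z) (act B w) < e"
  then obtain A B where AB: "A \<in> M" "B \<in> M" "hdist (act A z) (act B w) < e" by blast
  have "hdist (act (adj A) (act A z)) (act (adj A) (act B w)) = hdist (act A z) (act B w)" using AB assms by (intro hdist_act) (auto intro: act_UH)
  hence "hdist z (act (adj A ** B) w) < e" using AB assms by (simp add: act_mult act_adj)
  thus "\<exists>A\<in>M. hdist z (act A w) < e" using AB by (intro bexI[of _ "adj A ** B"]) auto
 next
  assume "\<exists>A\<in>M. hdist z (act A w) < e"
  then obtain A where "A \<in> M" "hdist (act (mat 1) z) (act A w) < e" by auto
  thus "\<exists>A\<in>M. \<exists>B\<in>M. hdist (act A z) (act B w) < e" using one_M by blast
 qed
 finally show ?thesis .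
qed

lemma sd_le: "z \<in> UH ==> w \<in> UH ==> surface_dist (proj z) (proj w) \<le> hdist z w"
proof (rule field_le_epsilon)
 fix e :: real assume zw: "z \<in> UH" "w \<in> UH" and e: "e > 0"
 hence "surface_dist (proj z) (proj w) < hdist z w + e" unfolding sd_less[OF zw] by (intro bexI[of _ "mat 1"]) auto
 thus "surface_dist (proj z) (proj w) \<le> hdist z w + e" by simp
qed

lemma sd_near: "z \<in> UH ==> proj ` hball z e = {q \<in> surface (psl ` M). surface_dist (proj z) q < e}"
proof (intro equalityI subsetI)
 fix q assume z: "z \<in> UH" and "q \<in> {q \<in> surface (psl ` M). surface_dist (proj z) q < e}"
 then obtain w where w: "w \<in> UH" "q = proj w" "surface_dist (proj z) (proj w) < e" by (auto simp: surface_eq)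
 then obtain A where "A \<in> M" "hdist z (act A w) < e" using sd_less z by blast
 thus "q \<in> proj ` hball z e" using w proj_act[of A w] by (intro image_eqI[of _ _ "act A w"]) (auto simp: hball_def act_UH)
next
 fix q assume "z \<in> UH" "q \<in> proj ` hball z e"
 thus "q \<in> {q \<in> surface (psl ` M). surface_dist (proj z) q < e}"
  using sd_le by (force simp: hball_def surface_eq)
qed

end

section \<open>From closed surface groups to matrix groups\<close>

definition mats :: "(real^2^2) set set \<Rightarrow> (real^2^2) set" where
 "mats \<Gamma> = {A. det A = 1 \<and> psl A \<in> \<Gamma>}"

lemma mats_psl: "A \<in> mats \<Gamma> ==> psl A \<in> \<Gamma>" by (simp add: mats_def)

lemma psl_mats: "\<Gamma> \<subseteq> carrier PSL2R ==> psl ` mats \<Gamma> = \<Gamma>"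
 by (auto simp: mats_def carrier_PSL2R)

locale surface_group =
 fixes H0 assumes csg: "closed_surface_group H0"
begin

lemma subgrp: "subgroup H0 PSL2R" using csg by (simp add: closed_surface_group_def)

lemma psl_mats0: "psl ` mats H0 = H0" by (rule psl_mats[OF subgroup.subset[OF subgrp]])

sublocale mgroup "mats H0"
proof
 fix A assume A: "A \<in> mats H0"
 hence d: "det A = 1" "psl A \<in> H0" by (auto simp: mats_def)
 show "det A = 1" by fact
 have "inv\<^bsub>PSL2R\<^esub> psl A = psl (adj A)"
  using d by (intro group.inv_equality[OF group_PSL2R]) (auto simp: psl_mult psl_one adj_left carrier_PSL2R)
 thus "adj A \<in> mats H0" using d subgroup.m_inv_closed[OF subgrp d(2)] by (simp add: mats_def)
 show "- A \<in> mats H0" using d by (simp add: mats_def det_2)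
 fix B assume "B \<in> mats H0"
 thus "A ** B \<in> mats H0" using d subgroup.m_closed[OF subgrp, of "psl A" "psl B"] by (auto simp: mats_def psl_mult det_mult1)
next
 show "mat 1 \<in> mats H0" using subgroup.one_closed[OF subgrp] by (simp add: mats_def psl_one)
qed

lemma quo0: "quo = surface_topology H0" "proj = surface_proj H0" "surface (psl ` mats H0) = surface H0"
 by (simp_all add: psl_mats0)

lemma ex_isolating_nbhd: "\<exists>W. open W \<and> mat 1 \<in> W \<and> (\<forall>A\<in>mats H0. A \<in> W \<longrightarrow> A = mat 1 \<or> A = - mat 1)"
proof -
 have one: "psl (mat 1) \<in> H0" by (rule mats_psl[OF one_M])
 have "openin (subtopology PSL2R_topology H0) {psl (mat 1)}" using csg one by (simp add: closed_surface_group_def)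
 then obtain U where U: "openin PSL2R_topology U" "{psl (mat 1)} = U \<inter> H0" by (auto simp: openin_subtopology)
 have "openin (top_of_set (carrier SL2R)) {A \<in> carrier SL2R. psl A \<in> U}"
  using U(1) by (simp add: PSL2R_topology_def openin_quotient_topology)
 then obtain W where W: "open W" "{A \<in> carrier SL2R. psl A \<in> U} = carrier SL2R \<inter> W" by (auto simp: openin_open)
 have sl: "A \<in> carrier SL2R \<longleftrightarrow> det A = 1" for A by (simp add: SL2R_def)
 have "mat 1 \<in> W" using U(2) W(2) sl[of "mat 1"] by auto
 moreover have "A = mat 1 \<or> A = - mat 1" if "A \<in> mats H0" "A \<in> W" for A
 proof -
  have "psl A \<in> U" using W(2) sl[of A] that by auto
  hence "psl A \<in> U \<inter> H0" using mats_psl[OF that(1)] by blast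
  thus ?thesis unfolding U(2)[symmetric] by (simp add: psl_eq_iff)
 qed
 ultimately show ?thesis using W(1) by blast
qed

text \<open>An infinite bounded set would contain a convergent sequence of distinct elements.
  Quotients of consecutive terms tend to the identity, which is isolated up to sign.\<close>

lemma discrete0: "finite {A \<in> mats H0. hdist \<i> (pt A) \<le> r}"
proof (rule ccontr)
 assume "infinite {A \<in> mats H0. hdist \<i> (pt A) \<le> r}"
 then obtain a :: "nat \<Rightarrow> real^2^2" where a: "inj a" "range a \<subseteq> {A \<in> mats H0. hdist \<i> (pt A) \<le> r}"
  using infinite_countable_subset by blast
 hence aM: "a n \<in> mats H0" "hdist \<i> (pt (a n)) \<le> r" for n by auto
 obtain s g where s: "strict_mono s" "det g = 1" "(a \<circ> s) \<longlonglongrightarrow> g"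
  using frames_compact[of a r] aM by auto
 define b where "b n = adj (a (s n)) ** a (s (Suc n))" for n
 have l: "(\<lambda>n. a (s n)) \<longlonglongrightarrow> g" using s(3) by (simp add: o_def)
 have lim: "b \<longlonglongrightarrow> mat 1"
  unfolding b_def[abs_def] adj_left[OF s(2), symmetric] by (intro tendsto_intros l LIMSEQ_Suc[OF l])
 obtain W where W: "open W" "mat 1 \<in> W" "\<And>A. A \<in> mats H0 ==> A \<in> W ==> A = mat 1 \<or> A = - mat 1" using ex_isolating_nbhd by blast
 have "mat 1 \<noteq> (- mat 1 :: real^2^2)" by (simp add: mat_one_mk)
 hence "open (W - {- mat 1})" "mat 1 \<in> W - {- mat 1}" using W by (auto intro: open_delete)
 then obtain n where n: "b n \<in> W - {- mat 1}"
  using topological_tendstoD[OF lim] by (metis (no_types, lifting) eventually_sequentially order_refl)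
 have "b n \<in> mats H0" using aM by (simp add: b_def)
 hence "b n = mat 1" using W(3) n by blast
 hence "a (s n) ** b n = a (s n)" by simp
 hence "a (s (Suc n)) = a (s n)" using adj_cancel(2)[of "a (s n)"] aM det_M unfolding b_def by metis
 hence "s (Suc n) = s n" using a(1) by (simp add: inj_eq)
 thus False using strict_monoD[OF s(1), of n "Suc n"] by simp
qed

lemma cobounded0: "\<exists>R. \<forall>z\<in>UH. \<exists>A\<in>mats H0. hdist z (pt A) \<le> R"
proof -
 define B where "B n = proj ` hball \<i> (real n)" for n
 have "compact_space quo" using csg by (simp add: quo0 closed_surface_group_def)
 moreover have "openin quo (B n)" for n unfolding B_def by (rule open_proj) (auto simp: open_hball hball_sub)
 moreover have "proj z \<in> (\<Union>n. B n)" if "z \<in> UH" for z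
 proof -
  obtain n where "hdist \<i> z < real n" using reals_Archimedean2 by blast
  thus ?thesis using that by (auto simp: B_def hball_def)
 qed
 hence "topspace quo \<subseteq> \<Union>(range B)" by auto
 ultimately obtain F where F: "finite F" "F \<subseteq> range B" "topspace quo \<subseteq> \<Union>F" unfolding compact_space_alt by (metis (no_types, lifting) imageE)
 then obtain N where N: "finite N" "F = B ` N" by (meson finite_subset_image)
 have "\<exists>A\<in>mats H0. hdist z (pt A) \<le> real (Max N)" if z: "z \<in> UH" for z
 proof -
  have "proj z \<in> \<Union>F" using F(3) z by auto
  then obtain n w where n: "n \<in> N" "w \<in> hball \<i> (real n)" "proj z = proj w" unfolding N(2) B_def by blast
  then obtain A where A: "A \<in> mats H0" "w = act A z" using proj_eq[OF z] by blast
  have "hdist (act (adj A) \<i>) (act (adj A) (act A z)) = hdist \<i> (act A z)" using A z by (intro hdist_act) (auto intro: act_UH)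
  hence "hdist z (pt (adj A)) < real n" using n(2) A z by (simp add: hball_def pt_def act_adj hdist_commute)
  moreover have "real n \<le> real (Max N)" using N(1) n(1) by simp
  ultimately show ?thesis using A by (intro bexI[of _ "adj A"]) auto
 qed
 thus ?thesis by blast
qed

lemma free0: "A \<in> mats H0 ==> z \<in> UH ==> act A z = z ==> A = mat 1 \<or> A = - mat 1"
proof -
 assume "A \<in> mats H0" "z \<in> UH" "act A z = z"
 hence "psl A = psl (mat 1)"
  using csg mats_psl[of A H0] unfolding closed_surface_group_def psl_one by (metis psl_act_eq_act)
 thus ?thesis unfolding psl_eq_iff .
qed

end

section \<open>Maps to the circle\<close>

lemma circle_proj_eq: "circle_proj x = circle_proj y \<longleftrightarrow> x - y \<in> \<int>"
proof
 assume "circle_proj x = circle_proj y"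
 moreover have "x \<in> circle_proj x" by (simp add: circle_proj_def)
 ultimately show "x - y \<in> \<int>" by (simp add: circle_proj_def)
next
 assume d: "x - y \<in> \<int>"
 have "a - x \<in> \<int> \<longleftrightarrow> a - y \<in> \<int>" for a
  using Ints_add[of "a - x" "x - y"] Ints_diff[of "a - y" "x - y"] d by auto
 thus "circle_proj x = circle_proj y" by (simp add: circle_proj_def)
qed

lemma circle_proj_add_int [simp]: "circle_proj (x + of_int n) = circle_proj x"
 by (simp add: circle_proj_eq)

lemma quotient_circle: "quotient_map euclideanreal circle_topology circle_proj"
 unfolding circle_topology_def by (rule quotient_map_quotient_topology)

lemma topspace_circle: "topspace circle_topology = range circle_proj"
 by (simp add: circle_topology_def topspace_quotient_topology)

lemma continuous_map_circle_proj: "continuous_on S l ==> continuous_map (top_of_set S) circle_topology (\<lambda>x. circle_proj (l x))"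
 using continuous_map_compose[OF _ quotient_imp_continuous_map[OF quotient_circle], of "top_of_set S" l] by (simp add: o_def)

text \<open>Compose with the exponential to reach the nonzero complex numbers, where maps from
  contractible sets have continuous logarithms. The imaginary part divided by \<open>2 * pi\<close>
  is the lift.\<close>

lemma ex_lift_contractible:
 fixes S :: "'a::real_normed_vector set"
 assumes c: "continuous_map (top_of_set S) circle_topology c" and S: "contractible S"
 shows "\<exists>l. continuous_on S l \<and> (\<forall>x\<in>S. c x = circle_proj (l x))"
proof -
 define E where "E p = exp (2 * of_real pi * \<i> * complex_of_real (SOME y. y \<in> p))" for p
 have E: "E (circle_proj x) = exp (2 * of_real pi * \<i> * complex_of_real x)" for x
 proof -
  have "(SOME y. y \<in> circle_proj x) \<in> circle_proj x" by (rule someI[of _ x]) (simp add: circle_proj_def)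
  then obtain n where "(SOME y. y \<in> circle_proj x) - x = of_int n" unfolding circle_proj_def by (auto elim: Ints_cases)
  hence n: "(SOME y. y \<in> circle_proj x) = x + of_int n" by simp
  show ?thesis unfolding E_def n exp_eq by (rule exI[of _ n]) (simp add: algebra_simps)
 qed
 have "continuous_map euclideanreal euclidean (E \<circ> circle_proj)"
  unfolding o_def E by (simp, intro continuous_intros)
 hence "continuous_map circle_topology euclidean E" by (rule continuous_compose_quotient_map[OF quotient_circle])
 hence "continuous_on S (E \<circ> c)" using continuous_map_compose[OF c] by force
 moreover have "(E \<circ> c) z \<noteq> 0" for z by (simp add: E_def)
 ultimately obtain g where g: "continuous_on S g" "\<And>x. x \<in> S ==> (E \<circ> c) x = exp (g x)"
  using continuous_logarithm_on_contractible[OF _ S] by metis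
 have "c x = circle_proj (Im (g x) / (2 * pi))" if x: "x \<in> S" for x
 proof -
  have "c x \<in> range circle_proj" using c x topspace_circle unfolding continuous_map_def by auto
  then obtain y where y: "c x = circle_proj y" by blast
  hence "exp (2 * of_real pi * \<i> * complex_of_real y) = exp (g x)" using g(2)[OF x] E by simp
  then obtain n where "2 * of_real pi * \<i> * complex_of_real y = g x + (of_int (2 * n) * pi) * \<i>" unfolding exp_eq by blast
  from arg_cong[OF this, of Im] have "2 * pi * y = Im (g x) + 2 * of_int n * pi" by simp
  hence "y - Im (g x) / (2 * pi) = of_int n" by (simp add: field_simps)
  thus ?thesis unfolding y circle_proj_eq by simp
 qed
 moreover have "continuous_on S (\<lambda>x. Im (g x) / (2 * pi))" using g(1) by (intro continuous_intros) auto
 ultimately show ?thesis by blast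
qed

lemma continuous_integer_constant:
 fixes d :: "'a::topological_space \<Rightarrow> real"
 assumes "connected S" "continuous_on S d" "\<And>x. x \<in> S ==> d x \<in> \<int>" "a \<in> S" "b \<in> S"
 shows "d a = d b"
proof -
 have "d constant_on S"
 proof (rule continuous_discrete_range_constant[OF assms(1,2)])
  fix x assume x: "x \<in> S"
  have "1 \<le> norm (d y - d x)" if "y \<in> S \<and> d y \<noteq> d x" for y
   using Ints_nonzero_abs_ge1[of "d y - d x"] assms(3)[OF x] assms(3)[of y] that by auto
  thus "\<exists>e>0. \<forall>y. y \<in> S \<and> d y \<noteq> d x \<longrightarrow> e \<le> norm (d y - d x)" by (intro exI[of _ 1]) auto
 qed
 thus ?thesis using assms(4,5) by (auto simp: constant_on_def)
qed

lemma circle_degree_eq: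
 assumes "continuous_on {0..1} l" "\<And>t. t \<in> {0..1} ==> c t = circle_proj (l t)" "l 1 - l 0 = of_int n"
 shows "circle_degree c = n"
 unfolding circle_degree_def
proof (rule the_equality)
 show "\<exists>l. continuous_on {0..1} l \<and> (\<forall>t\<in>{0..1}. c t = circle_proj (l t)) \<and> l 1 - l 0 = of_int n" using assms by blast
 fix m assume "\<exists>l. continuous_on {0..1} l \<and> (\<forall>t\<in>{0..1}. c t = circle_proj (l t)) \<and> l 1 - l 0 = of_int m"
 then obtain k where k: "continuous_on {0..1} k" "\<And>t. t \<in> {0..1} ==> c t = circle_proj (k t)" "k 1 - k 0 = of_int m" by blast
 have "k 0 - l 0 = k 1 - l 1"
 proof (rule continuous_integer_constant[of "{0..1}" "\<lambda>t. k t - l t"])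
  show "continuous_on {0..1} (\<lambda>t. k t - l t)" using k assms by (intro continuous_intros) auto
  show "k t - l t \<in> \<int>" if "t \<in> {0..1}" for t using k(2)[OF that] assms(2)[OF that] circle_proj_eq by metis
 qed auto
 hence "real_of_int m = of_int n" using k(3) assms(3) by simp
 thus "m = n" by simp
qed

lemma setdist_circle_le: "setdist (circle_proj x) (circle_proj y) \<le> \<bar>x - y\<bar>"
 using setdist_le_dist[of x "circle_proj x" y "circle_proj y"] by (simp add: circle_proj_def dist_real_def)

lemma setdist_circle: assumes "\<bar>x - y\<bar> \<le> 1/2" shows "setdist (circle_proj x) (circle_proj y) = \<bar>x - y\<bar>"
proof (rule antisym[OF setdist_circle_le le_setdistI])
 fix a b assume "a \<in> circle_proj x" "b \<in> circle_proj y"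
 then obtain m n where "a - x = of_int m" "b - y = of_int n" unfolding circle_proj_def by (auto elim!: Ints_cases)
 hence ab: "a - b = (x - y) + of_int (m - n)" by simp
 show "\<bar>x - y\<bar> \<le> dist a b"
 proof (cases "m = n")
  case True thus ?thesis using ab by (simp add: dist_real_def)
 next
  case False
  hence "1 \<le> \<bar>m - n\<bar>" by simp
  hence "1 \<le> \<bar>real_of_int (m - n)\<bar>" by linarith
  thus ?thesis using ab assms unfolding dist_real_def by linarith
 qed
qed (auto simp: circle_proj_def intro: exI[of _ x] exI[of _ y])

lemma locally_compact_interval: "locally_compact_space (top_of_set {0..1::real})"
 by (intro compact_imp_locally_compact_space compact_space_subtopology) simp

lemma convex_UH: "convex UH" unfolding upper_half_plane_def by (rule convex_halfspace_Im_gt)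

context surface_group
begin

section \<open>Lifts of circle maps to the upper half-plane\<close>

definition lift :: "(complex set \<Rightarrow> real set) \<Rightarrow> (complex \<Rightarrow> real) \<Rightarrow> bool" where
 "lift g v \<longleftrightarrow> continuous_on UH v \<and> (\<forall>z\<in>UH. g (proj z) = circle_proj (v z))"

abbreviation hom :: "(complex set \<Rightarrow> real set) \<Rightarrow> real^2^2 \<Rightarrow> int" where
 "hom g A \<equiv> induced_hom H0 g (psl A)"

lemma ex_lift: assumes "continuous_map quo circle_topology g" shows "\<exists>v. lift g v"
proof -
 have "continuous_map (top_of_set UH) circle_topology (g \<circ> proj)"
  by (rule continuous_map_compose[OF quotient_imp_continuous_map[OF quotient_proj] assms])
 from ex_lift_contractible[OF this convex_imp_contractible[OF convex_UH]] show ?thesis by (simp add: lift_def)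
qed

lemma continuous_map_lift: assumes "lift g v" shows "continuous_map quo circle_topology g"
proof (rule continuous_compose_quotient_map[OF quotient_proj])
 have "continuous_map (top_of_set UH) circle_topology (\<lambda>z. circle_proj (v z))"
  using assms by (intro continuous_map_circle_proj) (simp add: lift_def)
 thus "continuous_map (top_of_set UH) circle_topology (g \<circ> proj)"
  by (rule continuous_map_eq) (use assms in \<open>auto simp: lift_def\<close>)
qed

text \<open>The increment of the lift under \<open>A\<close> is an integer and continuous in the
  point, hence constant. At i it is the degree that defines \<open>induced_hom\<close>.\<close>

lemma lift_act: assumes v: "lift g v" and A: "A \<in> mats H0" and z: "z \<in> UH"
 shows "v (act A z) = v z + hom g A"
proof -
 have const: "v (act A z) - v z = v (act A w) - v w" if "w \<in> UH" for w
 proof (rule continuous_integer_constant[OF convex_connected[OF convex_UH]])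
  have "continuous_on UH (\<lambda>z. v (act A z))"
   by (rule continuous_on_compose2[of UH v]) (use v A in \<open>auto simp: lift_def act_UH intro!: continuous_on_act\<close>)
  thus "continuous_on UH (\<lambda>z. v (act A z) - v z)" using v by (intro continuous_intros) (auto simp: lift_def)
  fix z assume z: "z \<in> UH"
  hence "circle_proj (v (act A z)) = circle_proj (v z)" using v A by (metis lift_def act_UH det_M proj_act)
  thus "v (act A z) - v z \<in> \<int>" unfolding circle_proj_eq .
 qed (use z that in auto)
 let ?p = "linepath \<i> (act A \<i>)"
 have p: "?p t \<in> UH" if "t \<in> {0..1}" for t
  using that convex_UH A act_UH[of A \<i>] unfolding linepath_def by (intro convexD_alt) auto
 have "circle_proj (v (act A \<i>)) = circle_proj (v \<i>)" using v A by (metis lift_def act_UH det_M proj_act i_UH)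
 then obtain n where n: "v (act A \<i>) - v \<i> = of_int n" unfolding circle_proj_eq by (auto elim: Ints_cases)
 have "hom g A = n"
  unfolding induced_hom_def psl_act_eq_act
 proof (rule circle_degree_eq)
  show "continuous_on {0..1} (v \<circ> ?p)"
   by (rule continuous_on_compose[OF continuous_on_linepath continuous_on_subset[of UH]]) (use v p in \<open>auto simp: lift_def\<close>)
  show "g (surface_proj H0 (?p t)) = circle_proj ((v \<circ> ?p) t)" if "t \<in> {0..1}" for t
   using v p[OF that] by (simp add: lift_def psl_mats0)
  show "(v \<circ> ?p) 1 - (v \<circ> ?p) 0 = of_int n" using n by (simp add: linepath_def)
 qed
 thus ?thesis using const[OF i_UH] n by simp
qed

text \<open>Lift the homotopy to the product of the interval and the half-plane; the integer
  increment under \<open>A\<close> is then constant in time as well.\<close>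

lemma homotopic_hom:
 assumes H: "homotopic_with (\<lambda>_. True) quo circle_topology g h" and A: "A \<in> mats H0"
 shows "hom g A = hom h A"
proof -
 obtain K where K: "continuous_map (prod_topology (top_of_set {0..1::real}) quo) circle_topology K" "\<And>x. K (0, x) = g x" "\<And>x. K (1, x) = h x"
  using H unfolding homotopic_with_def by blast
 have "continuous_map (top_of_set ({0..1::real} \<times> UH)) (prod_topology (top_of_set {0..1}) quo) (\<lambda>(t, z). (t, proj z))"
  unfolding prod_topology_subtopology_eu[symmetric]
  by (intro quotient_imp_continuous_map quotient_map_prod_right quotient_proj locally_compact_interval) (simp add: Hausdorff_space_subtopology)
 from ex_lift_contractible[OF continuous_map_compose[OF this K(1)]]
 obtain U where U: "continuous_on ({0..1} \<times> UH) U" "\<And>t z. t \<in> {0..1} ==> z \<in> UH ==> K (t, proj z) = circle_proj (U (t, z))"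
  using convex_imp_contractible[OF convex_Times[OF convex_real_interval(5)[of 0 "1::real"] convex_UH]] by auto
 have c: "continuous_on S (\<lambda>p. U (fst p, act A (snd p)))" if "S \<subseteq> {0..1} \<times> UH" for S
 proof (rule continuous_on_compose2[OF U(1)])
  have "continuous_on S (\<lambda>p. act A (snd p))"
   by (rule continuous_on_compose2[OF continuous_on_act[of A UH] continuous_on_snd[OF continuous_on_id]]) (use A that in auto)
  thus "continuous_on S (\<lambda>p. (fst p, act A (snd p)))" by (intro continuous_intros)
 qed (use A that in \<open>fastforce intro!: act_UH\<close>)
 define d where "d p = U (fst p, act A (snd p)) - U p" for p
 have "d (0, \<i>) = d (1, \<i>)"
 proof (rule continuous_integer_constant[of "{0..1} \<times> UH" d])
  show "connected ({0..1::real} \<times> UH)" using convex_UH by (intro convex_connected convex_Times) auto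
  show "continuous_on ({0..1} \<times> UH) d" unfolding d_def by (intro continuous_on_diff c U(1)) simp
  fix p assume "p \<in> {0..1::real} \<times> UH"
  then obtain t z where p: "p = (t, z)" "t \<in> {0..1}" "z \<in> UH" by auto
  hence "circle_proj (U (t, act A z)) = circle_proj (U (t, z))" using U(2)[of t z] U(2)[of t "act A z"] A act_UH[of A z] by simp
  thus "d p \<in> \<int>" using p circle_proj_eq by (simp add: d_def)
 qed auto
 moreover have slice: "continuous_on UH (\<lambda>z. U (t, z))" if "t \<in> {0..1}" for t
  by (rule continuous_on_compose2[OF U(1)]) (use that in \<open>auto intro!: continuous_intros\<close>)
 have "lift g (\<lambda>z. U (0, z))" "lift h (\<lambda>z. U (1, z))" using slice U(2) K(2,3) by (auto simp: lift_def) (metis K(2,3) U(2) atLeastAtMost_iff order_refl zero_le_one)+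
 ultimately show ?thesis using lift_act[of g "\<lambda>z. U (0, z)" A \<i>] lift_act[of h "\<lambda>z. U (1, z)" A \<i>] A by (simp add: d_def)
qed

definition rep :: "complex set \<Rightarrow> complex" where "rep p = (SOME z. z \<in> p)"

lemma rep: assumes "z \<in> UH" obtains A where "A \<in> mats H0" "rep (proj z) = act A z"
proof -
 have "rep (proj z) \<in> proj z" unfolding rep_def using proj_self by (rule someI)
 thus ?thesis using that by (auto simp: proj_def)
qed

text \<open>Interpolate linearly between the lifts. As both transform by the same integers, the
  interpolation descends to the surface.\<close>

lemma hom_homotopic:
 assumes v: "lift g v" and w: "lift h w" and eq: "\<And>A. A \<in> mats H0 ==> hom g A = hom h A"
 shows "homotopic_with (\<lambda>_. True) quo circle_topology g h"
proof -
 define K where "K = (\<lambda>(t, p). circle_proj (v (rep p) + t * (w (rep p) - v (rep p))))"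
 have K: "K (t, proj z) = circle_proj (v z + t * (w z - v z))" if z: "z \<in> UH" for t z
 proof -
  obtain A where A: "A \<in> mats H0" "rep (proj z) = act A z" by (rule rep[OF z])
  have "v (act A z) + t * (w (act A z) - v (act A z)) = v z + t * (w z - v z) + of_int (hom h A)"
   using lift_act[OF v A(1) z] lift_act[OF w A(1) z] eq[OF A(1)] by simp
  thus ?thesis unfolding K_def A(2) prod.case by (metis circle_proj_add_int)
 qed
 have "continuous_map (prod_topology (top_of_set {0..1}) quo) circle_topology K"
 \<comment> \<open>Continuity is checked upstairs: the product of the locally compact interval with
   a quotient map is again a quotient map.\<close>
 proof (rule continuous_compose_quotient_map[OF quotient_map_prod_right[OF _ _ quotient_proj]])
  show "locally_compact_space (top_of_set {0..1::real})" by (rule locally_compact_interval)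
  show "Hausdorff_space (top_of_set {0..1::real}) \<or> regular_space (top_of_set {0..1::real})" by (simp add: Hausdorff_space_subtopology)
  have "continuous_map (top_of_set ({0..1} \<times> UH)) circle_topology (\<lambda>p. circle_proj (v (snd p) + fst p * (w (snd p) - v (snd p))))"
   using v w unfolding lift_def
   by (intro continuous_map_circle_proj continuous_on_add continuous_on_mult continuous_on_diff continuous_on_fst continuous_on_id
    continuous_on_compose2[of UH v _ snd] continuous_on_compose2[of UH w _ snd] continuous_on_snd) auto
  thus "continuous_map (prod_topology (top_of_set {0..1}) (top_of_set UH)) circle_topology (K \<circ> (\<lambda>(t, z). (t, proj z)))"
   unfolding prod_topology_subtopology_eu by (rule continuous_map_eq) (auto simp: K)
 qed
 thus ?thesis using v w K by (subst homotopic_with) (auto simp: lift_def intro!: exI[of _ K])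
qed

end

locale circle_map = surface_group +
 fixes f assumes cf: "continuous_map (surface_topology H0) circle_topology f"
  and nonconst: "\<nexists>c. homotopic_with (\<lambda>_. True) (surface_topology H0) circle_topology f (\<lambda>_. c)"
begin

lemma ex_lift_f: obtains v where "lift f v"
 using ex_lift[of f] cf by (auto simp: quo0)

lemma lift_const: "lift (\<lambda>_. circle_proj 0) (\<lambda>_. 0)" by (simp add: lift_def)

lemma hom_nontrivial: "\<exists>A\<in>mats H0. hom f A \<noteq> 0"
proof (rule ccontr)
 assume n: "\<not> ?thesis"
 obtain v where v: "lift f v" by (rule ex_lift_f)
 have "hom (\<lambda>_. circle_proj 0) A = 0" if "A \<in> mats H0" for A using lift_act[OF lift_const that i_UH] by simp
 hence "homotopic_with (\<lambda>_. True) quo circle_topology f (\<lambda>_. circle_proj 0)"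
  using n by (intro hom_homotopic[OF v lift_const]) auto
 thus False using nonconst by (auto simp: quo0)
qed

sublocale zcover "mats H0" "hom f"
proof
 fix A B assume AB: "A \<in> mats H0" "B \<in> mats H0"
 obtain v where v: "lift f v" by (rule ex_lift_f)
 have "act (A ** B) \<i> = act A (act B \<i>)" using AB by (simp add: act_mult)
 hence "real_of_int (hom f (A ** B)) = hom f A + hom f B"
  using lift_act[OF v mult_M[OF AB] i_UH] lift_act[OF v AB(1), of "act B \<i>"] lift_act[OF v AB(2) i_UH] AB by (simp add: act_UH)
 thus "hom f (A ** B) = hom f A + hom f B" by linarith
qed (simp_all add: hom_nontrivial cobounded0 discrete0 free0)

section \<open>Circle maps given by tight functions\<close>

definition circ :: "(complex \<Rightarrow> real) \<Rightarrow> complex set \<Rightarrow> real set" where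
 "circ u p = circle_proj (u (rep p) / kap)"

lemma circ_proj: assumes "u \<in> tightf" "z \<in> UH" shows "circ u (proj z) = circle_proj (u z / kap)"
proof -
 obtain A where A: "A \<in> mats H0" "rep (proj z) = act A z" by (rule rep[OF assms(2)])
 have "u (act A z) / kap = u z / kap + hom f A"
  using tightf_act[OF assms(1) A(1) assms(2)] kap_pos by (simp add: field_simps)
 thus ?thesis unfolding circ_def A(2) by simp
qed

lemma continuous_on_tightf: "u \<in> tightf ==> continuous_on UH u"
 unfolding continuous_on_sequentially o_def by (blast intro: tightf_tendsto)

lemma lift_circ: "u \<in> tightf ==> lift (circ u) (\<lambda>z. u z / kap)"
 unfolding lift_def by (simp add: circ_proj) (intro continuous_intros continuous_on_tightf, use kap_pos in auto)

lemma hom_circ: assumes u: "u \<in> tightf" and A: "A \<in> mats H0" shows "hom (circ u) A = hom f A"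
proof -
 have "u (act A \<i>) / kap = u \<i> / kap + hom f A" using tightf_act[OF u A i_UH] kap_pos by (simp add: field_simps)
 thus ?thesis using lift_act[OF lift_circ[OF u] A i_UH] by simp
qed

lemma in_class: assumes "lift h w" shows "h \<in> homotopy_class_of H0 f \<longleftrightarrow> (\<forall>A\<in>mats H0. hom h A = hom f A)"
proof -
 obtain v where "lift f v" by (rule ex_lift_f)
 thus ?thesis
  using homotopic_hom[of f h] hom_homotopic[OF _ assms, of f v] by (auto simp: homotopy_class_of_def quo0)
qed

lemma class_lift: assumes "h \<in> homotopy_class_of H0 f" obtains w where "lift h w"
proof -
 have "continuous_map quo circle_topology h"
  using assms homotopic_with_imp_continuous_maps unfolding homotopy_class_of_def quo0 by blast
 thus ?thesis using ex_lift that by blast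
qed

lemma class_lift_act: assumes "h \<in> homotopy_class_of H0 f" "lift h w" "A \<in> mats H0" "z \<in> UH"
 shows "w (act A z) = w z + hom f A"
 using lift_act[OF assms(2-4)] assms(1,3) in_class[OF assms(2)] by simp

lemma lipschitz_const_le: "0 \<le> L ==> (\<And>p q. p \<in> S ==> q \<in> S ==> setdist (h p) (h q) \<le> L * surface_dist p q) ==> lipschitz_const h S \<le> ereal L"
 unfolding lipschitz_const_def by (rule INF_lower) blast

lemma lipschitz_const_mono: "S \<subseteq> T ==> lipschitz_const h S \<le> lipschitz_const h T"
 unfolding lipschitz_const_def by (rule INF_superset_mono) auto

lemma lipschitz_const_geodesic:
 assumes g: "det g = 1" and c: "c > 0" and w: "lift h w" "\<And>t. w (geo g t) = w (pt g) + t * c"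
  and dlt: "dlt > 0" "\<And>t. 0 \<le> t ==> t < dlt ==> proj (geo g t) \<in> S"
 shows "ereal c \<le> lipschitz_const h S"
 unfolding lipschitz_const_def
proof (rule INF_greatest)
 fix L assume "L \<in> {L. 0 \<le> L \<and> (\<forall>p\<in>S. \<forall>q\<in>S. setdist (h p) (h q) \<le> L * surface_dist p q)}"
 hence L: "0 \<le> L" "\<And>p q. p \<in> S ==> q \<in> S ==> setdist (h p) (h q) \<le> L * surface_dist p q" by auto
 \<comment> \<open>So short that the circle distance of the images is the difference of the lifts,
   for which the limit is 1/2.\<close>
 define t where "t = min (dlt / 2) (1 / (2 * c))"
 have t: "0 < t" "t < dlt" "t * c \<le> 1/2"
 proof -
  show "0 < t" "t < dlt" using dlt(1) c by (auto simp: t_def min_def)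
  have "t * c \<le> 1 / (2 * c) * c" using c by (intro mult_right_mono) (auto simp: t_def)
  thus "t * c \<le> 1/2" using c by simp
 qed
 have U: "geo g s \<in> UH" for s using g by (simp add: det_mult1)
 have "t * c = setdist (circle_proj (w (geo g t))) (circle_proj (w (geo g 0)))"
  using t c by (subst setdist_circle) (simp_all add: w(2))
 also have "\<dots> \<le> L * surface_dist (proj (geo g t)) (proj (geo g 0))"
  using L(2)[OF dlt(2) dlt(2), of t 0] t w(1) U g by (simp add: lift_def)
 also have "\<dots> \<le> L * t" using sd_le[OF U U, of t 0] hdist_geo[OF g, of t 0] t L(1) by (intro mult_left_mono) auto
 finally show "ereal c \<le> ereal L" using t(1) by (simp add: mult.commute)
qed

lemma lift_lipschitz:
 assumes w: "lift h w" and K: "lipschitz_const h (surface H0) \<le> ereal K" and z: "z \<in> UH" "z' \<in> UH"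
 shows "w z' - w z \<le> K * hdist z z'"
proof (rule field_le_epsilon)
 fix e :: real assume e: "e > 0"
 \<comment> \<open>The Lipschitz constant is an infimum, so some constant below this
   \<open>L\<close> is admissible; over the whole segment the surplus amounts to at most
   \<open>e\<close>.\<close>
 define L where "L = K + e / (hdist z z' + 1)"
 have D: "hdist z z' \<ge> 0" using z by simp
 hence "L > K" using e by (simp add: L_def)
 hence "lipschitz_const h (surface H0) < ereal L" using K by (metis ereal_less_ereal_Ex le_less_trans less_ereal.simps(1))
 then obtain L' where L': "L' < L" "0 \<le> L'" "\<And>p q. p \<in> surface H0 ==> q \<in> surface H0 ==> setdist (h p) (h q) \<le> L' * surface_dist p q"
  unfolding lipschitz_const_def INF_less_iff by auto
 obtain g where g: "det g = 1" "pt g = z" "geo g (hdist z z') = z'" by (rule pair_frame[OF z])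
 have U: "geo g s \<in> UH" for s using g by (simp add: det_mult1)
 define k where "k t = w (geo g t)" for t
 have "continuous_on {0..hdist z z'} k"
  unfolding k_def by (rule continuous_on_compose2[of UH w, OF _ continuous_on_geo[OF g(1)]]) (use w U in \<open>auto simp: lift_def\<close>)
 hence "uniformly_continuous_on {0..hdist z z'} k" by (intro compact_uniformly_continuous) auto
 from this[unfolded uniformly_continuous_on_def, rule_format, of "1/2"]
 obtain rho where rho: "rho > 0" "\<And>s t. s \<in> {0..hdist z z'} ==> t \<in> {0..hdist z z'} ==> dist t s < rho ==> dist (k t) (k s) < 1/2" by auto
 have "k (hdist z z') - k 0 \<le> L * (hdist z z')"
 proof (rule lipschitz_chain[OF rho(1) D])
  fix s t assume st: "0 \<le> s" "s \<le> t" "t \<le> hdist z z'" "t - s < rho"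
  hence "\<bar>k t - k s\<bar> \<le> 1/2" using rho(2)[of s t] by (simp add: dist_real_def)
  hence "\<bar>k t - k s\<bar> = setdist (circle_proj (k t)) (circle_proj (k s))" by (simp add: setdist_circle)
  also have "\<dots> \<le> L' * surface_dist (proj (geo g t)) (proj (geo g s))"
   using L'(3)[of "proj (geo g t)" "proj (geo g s)"] w U by (simp add: lift_def k_def surface_eq flip: quo0)
  also have "\<dots> \<le> L' * (t - s)" using sd_le[OF U U, of t s] hdist_geo[OF g(1), of t s] st L'(2) by (intro mult_left_mono) auto
  also have "\<dots> \<le> L * (t - s)" using L'(1) st by (intro mult_right_mono) auto
  finally show "k t - k s \<le> L * (t - s)" by simp
 qed
 also have "L * hdist z z' \<le> K * hdist z z' + e"
  using D e by (simp add: L_def field_simps)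
 finally show "w z' - w z \<le> K * hdist z z' + e" using g by (simp add: k_def)
qed

lemma circ_lipschitz: assumes u: "u \<in> tightf" and p: "p \<in> surface H0" and q: "q \<in> surface H0"
 shows "setdist (circ u p) (circ u q) \<le> 1 / kap * surface_dist p q"
proof (rule ccontr)
 obtain z w where zw: "z \<in> UH" "p = proj z" "w \<in> UH" "q = proj w" using p q by (auto simp: surface_eq simp flip: quo0)
 assume "\<not> ?thesis"
 hence "surface_dist p q < kap * setdist (circ u p) (circ u q)" using kap_pos by (simp add: field_simps)
 then obtain A where A: "A \<in> mats H0" "hdist z (act A w) < kap * setdist (circ u p) (circ u q)" using sd_less zw by blast
 have AU: "act A w \<in> UH" using A zw by (simp add: act_UH)
 have "setdist (circ u p) (circ u q) \<le> \<bar>u z / kap - u (act A w) / kap\<bar>"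
  using circ_proj[OF u zw(1)] circ_proj[OF u AU] proj_act[OF A(1) zw(3)] setdist_circle_le zw by metis
 also have "\<dots> = \<bar>u z - u (act A w)\<bar> / kap" using kap_pos by (simp add: diff_divide_distrib[symmetric])
 also have "\<dots> \<le> hdist z (act A w) / kap" using tightf_lip_abs[OF u zw(1) AU] kap_pos by (simp add: divide_right_mono)
 finally show False using A(2) kap_pos by (simp add: field_simps)
qed

lemma lipschitz_const_circ: assumes u: "u \<in> tightf" shows "lipschitz_const (circ u) (surface H0) = ereal (1 / kap)"
proof (rule antisym)
 show "lipschitz_const (circ u) (surface H0) \<le> ereal (1 / kap)" using circ_lipschitz[OF u] kap_pos by (intro lipschitz_const_le) auto
 obtain z where "z \<in> Aub" using Aub_nonempty by blast
 then obtain g where g: "g \<in> leafs" using ex_leaf by blast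
 show "ereal (1 / kap) \<le> lipschitz_const (circ u) (surface H0)"
 proof (rule lipschitz_const_geodesic[OF leafs_det[OF g] _ lift_circ[OF u], of _ 1])
  show "u (geo g t) / kap = u (pt g) / kap + t * (1 / kap)" for t using leafs_tight[OF g u, of t] by (simp add: add_divide_distrib)
  show "proj (geo g t) \<in> surface H0" for t using g by (simp add: surface_eq det_mult1 flip: quo0)
 qed (use kap_pos in auto)
qed

text \<open>The lifts of \<open>h\<close> and \<open>circ u\<close> differ by a function
  \<open>dlt\<close> that descends to the surface and so has equal values at the ends of a closed
  curve. The degree can thus be read from \<open>circ u\<close>, which is Lipschitz with constant
  \<open>1 / kap\<close>, on steps short enough for circle distances to be differences of
  lifts.\<close>

lemma degree_le_length:
 assumes w: "lift h w" "h \<in> homotopy_class_of H0 f" and c: "closed_curve H0 c"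
 shows "ereal (kap * circle_degree (h \<circ> c)) \<le> curve_length c"
proof -
 obtain u where u: "u \<in> tightf" using tightf_nonempty by blast
 have cc: "continuous_map (top_of_set {0..1}) quo c" "c 0 = c 1" using c by (auto simp: closed_curve_def quo0)
 have cS: "\<exists>z\<in>UH. c t = proj z" if "t \<in> {0..1}" for t using subsetD[OF continuous_map_image_subset_topspace[OF cc(1)], of "c t"] that by auto
 have cs: "c t \<in> surface H0" if "t \<in> {0..1}" for t using cS[OF that] by (auto simp: surface_eq simp flip: quo0)
 have "continuous_map (top_of_set {0..1}) circle_topology (circ u \<circ> c)"
  by (rule continuous_map_compose[OF cc(1) continuous_map_lift[OF lift_circ[OF u]]])
 from ex_lift_contractible[OF this convex_imp_contractible[OF convex_real_interval(5)]]
 obtain l where l: "continuous_on {0..1} l" "\<And>t. t \<in> {0..1} ==> circ u (c t) = circle_proj (l t)" by auto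
 define dlt where "dlt p = w (rep p) - u (rep p) / kap" for p
 have dlt: "dlt (proj z) = w z - u z / kap" if z: "z \<in> UH" for z
 proof -
  obtain A where A: "A \<in> mats H0" "rep (proj z) = act A z" by (rule rep[OF z])
  show ?thesis unfolding dlt_def A(2)
   using class_lift_act[OF w(2,1) A(1) z] tightf_act[OF u A(1) z] kap_pos by (simp add: field_simps)
 qed
 have "continuous_map (top_of_set UH) euclideanreal (\<lambda>z. w z - u z / kap)"
  using w lift_circ[OF u] by (simp add: lift_def continuous_on_diff)
 hence "continuous_map (top_of_set UH) euclideanreal (dlt \<circ> proj)" by (rule continuous_map_eq) (simp add: dlt)
 hence "continuous_map quo euclideanreal dlt" by (rule continuous_compose_quotient_map[OF quotient_proj])
 hence dltc: "continuous_on {0..1} (dlt \<circ> c)" using continuous_map_compose[OF cc(1)] by force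
 have "circle_proj (l 1) = circle_proj (l 0)" using l(2)[of 0] l(2)[of 1] cc(2) by simp
 then obtain n where n: "l 1 - l 0 = of_int n" unfolding circle_proj_eq by (auto elim: Ints_cases)
 have deg: "circle_degree (h \<circ> c) = n"
 proof (rule circle_degree_eq)
  show "continuous_on {0..1} (\<lambda>t. l t + (dlt \<circ> c) t)" by (intro continuous_on_add l(1) dltc)
  show "(l 1 + (dlt \<circ> c) 1) - (l 0 + (dlt \<circ> c) 0) = of_int n" using n cc(2) by simp
  fix t :: real assume t: "t \<in> {0..1}"
  then obtain z where z: "z \<in> UH" "c t = proj z" using cS by blast
  have "circle_proj (l t) = circle_proj (u z / kap)" using l(2)[OF t] z circ_proj[OF u] by simp
  moreover have "w z - (l t + dlt (c t)) = u z / kap - l t" using dlt[OF z(1)] z(2) by simp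
  ultimately have "circle_proj (w z) = circle_proj (l t + dlt (c t))" unfolding circle_proj_eq by (metis Ints_minus minus_diff_eq)
  thus "(h \<circ> c) t = circle_proj (l t + (dlt \<circ> c) t)" using w z by (simp add: lift_def)
 qed
 have "uniformly_continuous_on {0..1} l" using l(1) by (intro compact_uniformly_continuous) auto
 from this[unfolded uniformly_continuous_on_def, rule_format, of "1/2"]
 obtain rho where rho: "rho > 0" "\<And>s t. s \<in> {0..1} ==> t \<in> {0..1} ==> dist t s < rho ==> dist (l t) (l s) < 1/2" by auto
 obtain N :: nat where N: "inverse (of_nat (Suc N)) < rho" using reals_Archimedean[OF rho(1)] by blast
 define m where "m = Suc N"
 have m: "m > 0" "1 / real m < rho" using N by (auto simp: m_def inverse_eq_divide)
 define tau where "tau i = real i / real m" for i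
 have tau: "tau i \<in> {0..1}" if "i \<le> m" for i using that m by (simp add: tau_def)
 have step: "kap * (l (tau (Suc i)) - l (tau i)) \<le> surface_dist (c (tau i)) (c (tau (Suc i)))" if i: "i < m" for i
 proof -
  have T: "tau i \<in> {0..1}" "tau (Suc i) \<in> {0..1}" using i tau by auto
  have "tau (Suc i) - tau i = 1 / real m" by (simp add: tau_def diff_divide_distrib[symmetric])
  moreover have "0 < 1 / real m" using m by simp
  ultimately have "dist (tau i) (tau (Suc i)) < rho" using m(2) unfolding dist_real_def by linarith
  from rho(2)[OF T(2,1) this] have "\<bar>l (tau i) - l (tau (Suc i))\<bar> \<le> 1/2" unfolding dist_real_def by linarith
  hence "\<bar>l (tau i) - l (tau (Suc i))\<bar> = setdist (circ u (c (tau i))) (circ u (c (tau (Suc i))))" using T l(2) by (simp add: setdist_circle)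
  also have "\<dots> \<le> 1 / kap * surface_dist (c (tau i)) (c (tau (Suc i)))" by (rule circ_lipschitz[OF u cs cs]) (use T in auto)
  finally have "kap * \<bar>l (tau i) - l (tau (Suc i))\<bar> \<le> surface_dist (c (tau i)) (c (tau (Suc i)))" using kap_pos by (simp add: field_simps)
  moreover have "kap * (l (tau (Suc i)) - l (tau i)) \<le> kap * \<bar>l (tau i) - l (tau (Suc i))\<bar>" using kap_pos by (intro mult_left_mono) auto
  ultimately show ?thesis by linarith
 qed
 define ts where "ts = map tau [0..<Suc m]"
 have ts: "sorted ts" "set ts \<subseteq> {0..1}" "length ts = Suc m" "\<And>i. i \<le> m ==> ts ! i = tau i"
 proof -
  show "sorted ts" unfolding ts_def sorted_map by (rule sorted_wrt_mono_rel[OF _ sorted_upt]) (auto simp: tau_def divide_right_mono)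
  show "set ts \<subseteq> {0..1}" using tau by (auto simp: ts_def less_Suc_eq_le simp del: upt_Suc)
  show "length ts = Suc m" by (simp add: ts_def)
  show "ts ! i = tau i" if "i \<le> m" for i using that unfolding ts_def by (subst nth_map) (auto simp del: upt_Suc)
 qed
 have "kap * of_int n = (\<Sum>i<m. kap * (l (tau (Suc i)) - l (tau i)))"
  using m n by (simp add: sum_distrib_left[symmetric] sum_lessThan_telescope[of "\<lambda>i. l (tau i)"]) (simp add: tau_def)
 also have "\<dots> \<le> (\<Sum>i<m. surface_dist (c (tau i)) (c (tau (Suc i))))" using step by (intro sum_mono) auto
 also have "\<dots> = (\<Sum>i<length ts - 1. surface_dist (c (ts ! i)) (c (ts ! Suc i)))" using ts(3,4) by simp
 finally have "ereal (kap * of_int n) \<le> ereal (\<Sum>i<length ts - 1. surface_dist (c (ts ! i)) (c (ts ! Suc i)))" by simp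
 also have "\<dots> \<le> curve_length c" unfolding curve_length_def by (rule SUP_upper) (use ts in auto)
 finally show ?thesis unfolding deg .
qed

end

context circle_map
begin

section \<open>Degree against length, and the minimizing lamination\<close>

lemma curve_length_geodesic:
 assumes g: "det g = 1" and D: "D \<ge> 0"
 shows "curve_length (\<lambda>t. proj (geo g (D * t))) \<le> ereal D"
 unfolding curve_length_def
proof (rule SUP_least)
 fix ts :: "real list" assume "ts \<in> {ts. sorted ts \<and> set ts \<subseteq> {0..1}}"
 hence ts: "sorted ts" "set ts \<subseteq> {0..1}" by auto
 have U: "geo g s \<in> UH" for s using g by (simp add: det_mult1)
 let ?d = "\<lambda>i. surface_dist (proj (geo g (D * ts ! i))) (proj (geo g (D * ts ! Suc i)))"
 have "(\<Sum>i<length ts - 1. ?d i) \<le> (\<Sum>i<length ts - 1. D * ts ! Suc i - D * ts ! i)"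
 proof (rule sum_mono)
  fix i assume "i \<in> {..<length ts - 1}"
  hence "ts ! i \<le> ts ! Suc i" using ts(1) by (auto simp: sorted_nth_mono)
  hence "D * ts ! i \<le> D * ts ! Suc i" using D by (rule mult_left_mono)
  thus "?d i \<le> D * ts ! Suc i - D * ts ! i" using sd_le[OF U U, of "D * ts ! i" "D * ts ! Suc i"] hdist_geo[OF g, of "D * ts ! i" "D * ts ! Suc i"] by simp
 qed
 also have "\<dots> = D * ts ! (length ts - 1) - D * ts ! 0" by (rule sum_lessThan_telescope)
 also have "\<dots> \<le> D"
 proof (cases "ts = []")
  case True thus ?thesis using D by simp
 next
  case False
  hence "ts ! (length ts - 1) \<in> set ts" "ts ! 0 \<in> set ts" by auto
  hence "ts ! (length ts - 1) \<le> 1" "0 \<le> ts ! 0" using ts(2) by auto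
  hence "D * ts ! (length ts - 1) \<le> D * 1" "0 \<le> D * ts ! 0" using D by (intro mult_left_mono mult_nonneg_nonneg; simp)+
  thus ?thesis by linarith
 qed
 finally show "ereal (\<Sum>i<length ts - 1. ?d i) \<le> ereal D" by simp
qed

text \<open>For the lower bound, the geodesic from \<open>z\<close> to an almost optimal translate
  closes up to a curve of degree \<open>hom f A\<close>. Its length is positive and finite, being
  between \<open>kap * hom f A\<close> and \<open>D\<close>.\<close>

lemma degree_ratio:
 assumes h: "h \<in> homotopy_class_of H0 f"
 shows "(SUP c\<in>{c. closed_curve H0 c \<and> curve_length c > 0}. ereal (of_int (circle_degree (h \<circ> c))) / curve_length c) = ereal (1 / kap)"
  (is "?S = _")
proof (rule antisym)
 obtain w where w: "lift h w" by (rule class_lift[OF h])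
 show "?S \<le> ereal (1 / kap)"
 proof (rule SUP_least)
  fix c assume "c \<in> {c. closed_curve H0 c \<and> curve_length c > 0}"
  hence c: "closed_curve H0 c" "curve_length c > 0" by auto
  have "ereal (kap * circle_degree (h \<circ> c)) \<le> curve_length c" by (rule degree_le_length[OF w h c(1)])
  thus "ereal (of_int (circle_degree (h \<circ> c))) / curve_length c \<le> ereal (1 / kap)"
   using c(2) kap_pos by (cases "curve_length c") (auto simp: field_simps)
 qed
 have "ereal (1 / c) \<le> ?S" if ck: "c > kap" for c
 proof -
  obtain A z where A: "A \<in> mats H0" "hom f A \<ge> 1" "z \<in> UH" "hdist z (act A z) < c * hom f A" by (rule kap_approx[OF ck])
  define D where "D = hdist z (act A z)"
  have AU: "act A z \<in> UH" using A by (simp add: act_UH)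
  have D: "D \<ge> 0" using A AU by (simp add: D_def)
  obtain g where g: "det g = 1" "pt g = z" "geo g D = act A z" unfolding D_def by (rule pair_frame[OF A(3) AU])
  have U: "geo g s \<in> UH" for s using g by (simp add: det_mult1)
  define gam where "gam t = proj (geo g (D * t))" for t
  have geo: "continuous_on {0..1} (\<lambda>t. geo g (D * t))"
   by (rule continuous_on_compose2[OF continuous_on_geo[OF g(1), of UNIV]]) (auto intro: continuous_intros)
  hence "continuous_map (top_of_set {0..1}) (top_of_set UH) (\<lambda>t. geo g (D * t))" using U by (simp add: continuous_map_in_subtopology image_subset_iff)
  from continuous_map_compose[OF this quotient_imp_continuous_map[OF quotient_proj]]
  have "continuous_map (top_of_set {0..1}) quo gam" by (simp add: o_def gam_def[abs_def])
  moreover have "gam 0 = gam 1" using g A by (simp add: gam_def)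
  ultimately have cl: "closed_curve H0 gam" by (simp add: closed_curve_def quo0)
  have deg: "circle_degree (h \<circ> gam) = hom f A"
  proof (rule circle_degree_eq)
   show "continuous_on {0..1} (\<lambda>t. w (geo g (D * t)))"
    by (rule continuous_on_compose2[OF _ geo, of UH w]) (use w U in \<open>auto simp: lift_def\<close>)
   show "(h \<circ> gam) t = circle_proj (w (geo g (D * t)))" for t using w U by (simp add: lift_def gam_def)
   show "w (geo g (D * 1)) - w (geo g (D * 0)) = of_int (hom f A)"
    using class_lift_act[OF h w A(1,3)] g by simp
  qed
  have lo: "ereal (kap * hom f A) \<le> curve_length gam" using degree_le_length[OF w h cl] deg by simp
  have hi: "curve_length gam \<le> ereal D" unfolding gam_def[abs_def] by (rule curve_length_geodesic[OF g(1) D])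
  have pos: "0 < kap * real_of_int (hom f A)" using kap_pos A(2) by simp
  obtain len where len: "curve_length gam = ereal len" using lo hi by (cases "curve_length gam") auto
  have l: "0 < len" "len \<le> D" using lo hi pos len by auto
  have "c > 0" using ck kap_pos by simp
  have "len \<le> c * hom f A" using l A(4) by (simp add: D_def)
  hence "1 / c \<le> hom f A / len" using \<open>c > 0\<close> l by (simp add: field_simps)
  hence "ereal (1 / c) \<le> ereal (of_int (circle_degree (h \<circ> gam))) / curve_length gam" using l by (simp add: deg len)
  also have "\<dots> \<le> ?S" by (rule SUP_upper) (use cl l len in auto)
  finally show ?thesis .
 qed
 hence *: "ereal (1 / (kap + inverse (real (Suc n)))) \<le> ?S" for n by simp
 have "(\<lambda>n. 1 / (kap + inverse (real (Suc n)))) \<longlonglongrightarrow> 1 / (kap + 0)" using kap_pos by (intro tendsto_intros LIMSEQ_inverse_real_of_nat) auto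
 hence "(\<lambda>n. ereal (1 / (kap + inverse (real (Suc n))))) \<longlonglongrightarrow> ereal (1 / kap)" by simp
 from LIMSEQ_le_const2[OF this] * show "ereal (1 / kap) \<le> ?S" by blast
qed

lemma tight_iff: "h \<in> homotopy_class_of H0 f ==> tight H0 h \<longleftrightarrow> lipschitz_const h (surface H0) = ereal (1 / kap)"
 unfolding tight_def by (simp only: degree_ratio)

lemma circ_class: "u \<in> tightf ==> circ u \<in> homotopy_class_of H0 f"
 using in_class[OF lift_circ] hom_circ by blast

lemma circ_tight: "u \<in> tightf ==> tight H0 (circ u)"
 using tight_iff[OF circ_class] lipschitz_const_circ by blast

text \<open>The lift of a tight map times \<open>kap\<close> belongs to \<open>tightf\<close>, so it
  grows at unit speed along the leaf through \<open>z\<close>, and the map attains its Lipschitz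
  constant there at every scale.\<close>

lemma Aub_stretch:
 assumes z: "z \<in> Aub" and h: "h \<in> homotopy_class_of H0 f" "tight H0 h"
 shows "proj z \<in> stretch_set H0 h"
proof -
 obtain w where w: "lift h w" by (rule class_lift[OF h(1)])
 have K: "lipschitz_const h (surface H0) = ereal (1 / kap)" using tight_iff h by blast
 have tw: "(\<lambda>x. kap * w x) \<in> tightf"
  unfolding tightf_def
 proof (intro CollectI conjI ballI)
  fix x y assume "x \<in> UH" "y \<in> UH"
  thus "kap * w x - kap * w y \<le> hdist x y"
   using lift_lipschitz[OF w, of "1 / kap" y x] K kap_pos by (simp add: field_simps hdist_commute)
  show "kap * w (act A x) = kap * w x + kap * hom f A" if "A \<in> mats H0" for A
   using class_lift_act[OF h(1) w that \<open>x \<in> UH\<close>] by (simp add: algebra_simps)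
 qed
 obtain g where g: "g \<in> leafs" "pt g = z" using ex_leaf[OF z] by blast
 have geo: "w (geo g t) = w (pt g) + t * (1 / kap)" for t
  using leafs_tight[OF g(1) tw, of t] kap_pos by (simp add: field_simps)
 have p: "proj z \<in> surface H0" using z by (simp add: surface_eq flip: quo0)
 have "local_lipschitz_const H0 h (proj z) = ereal (1 / kap)"
  unfolding local_lipschitz_const_def
 proof (rule antisym)
  show "(INF r\<in>{0<..}. lipschitz_const h {q \<in> surface H0. surface_dist (proj z) q < r}) \<le> ereal (1 / kap)"
   unfolding K[symmetric] by (rule INF_lower2[of 1]) (auto intro: lipschitz_const_mono)
  show "ereal (1 / kap) \<le> (INF r\<in>{0<..}. lipschitz_const h {q \<in> surface H0. surface_dist (proj z) q < r})"
  proof (rule INF_greatest, rule lipschitz_const_geodesic[OF leafs_det[OF g(1)] _ w geo])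
   fix r t :: real assume r: "r \<in> {0<..}" and t: "0 \<le> t" "t < r"
   have "geo g t \<in> hball z r" using hdist_geo[OF leafs_det[OF g(1)], of 0 t] g t by (simp add: hball_def det_mult1)
   thus "proj (geo g t) \<in> {q \<in> surface H0. surface_dist (proj z) q < r}"
    using sd_near[OF Aub_UH[OF z], of r] unfolding quo0(3) by blast
  qed (use kap_pos in auto)
 qed
 thus ?thesis using p K by (simp add: stretch_set_def)
qed

text \<open>The function of \<open>flat_outside_Aub\<close> induces a tight map that is constant
  near the point, with local Lipschitz constant 0.\<close>

lemma stretch_Aub:
 assumes z: "z \<in> UH" "z \<notin> Aub"
 shows "\<exists>h. h \<in> homotopy_class_of H0 f \<and> tight H0 h \<and> proj z \<notin> stretch_set H0 h"
proof -
 obtain u r where u: "u \<in> tightf" "r > 0" "\<And>x. x \<in> hball z r ==> u x = u z" by (rule flat_outside_Aub[OF z]) blast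
 have "lipschitz_const (circ u) {q \<in> surface H0. surface_dist (proj z) q < r} \<le> ereal 0"
 proof (rule lipschitz_const_le)
  fix p q assume "p \<in> {q \<in> surface H0. surface_dist (proj z) q < r}" "q \<in> {q \<in> surface H0. surface_dist (proj z) q < r}"
  hence "p \<in> proj ` hball z r" "q \<in> proj ` hball z r" unfolding sd_near[OF z(1)] quo0(3) .
  moreover have "circ u p' = circle_proj (u z / kap)" if "p' \<in> proj ` hball z r" for p'
   using that circ_proj[OF u(1)] u(3) by (auto simp: hball_def)
  ultimately have "circ u p = circle_proj (u z / kap)" "circ u q = circle_proj (u z / kap)" by blast+
  thus "setdist (circ u p) (circ u q) \<le> 0 * surface_dist p q" using setdist_circle_le[of "u z / kap" "u z / kap"] by simp
 qed simp
 hence "local_lipschitz_const H0 (circ u) (proj z) \<le> ereal 0"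
  unfolding local_lipschitz_const_def using u(2) by (intro INF_lower2[of r]) auto
 also have "\<dots> < lipschitz_const (circ u) (surface H0)" using lipschitz_const_circ[OF u(1)] kap_pos by simp
 finally have "proj z \<notin> stretch_set H0 (circ u)" unfolding stretch_set_def by (auto dest: less_imp_neq)
 thus ?thesis using circ_class circ_tight u(1) by blast
qed

theorem minimizing_lamination_eq: "minimizing_lamination H0 f = proj ` Aub"
proof (intro equalityI subsetI)
 fix p assume p: "p \<in> minimizing_lamination H0 f"
 then obtain z where z: "z \<in> UH" "p = proj z" by (auto simp: minimizing_lamination_def surface_eq simp flip: quo0)
 thus "p \<in> proj ` Aub" using p stretch_Aub[OF z(1)] by (fastforce simp: minimizing_lamination_def)
next
 fix p assume "p \<in> proj ` Aub"
 then obtain z where "z \<in> Aub" "p = proj z" by blast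
 thus "p \<in> minimizing_lamination H0 f" using Aub_stretch by (auto simp: minimizing_lamination_def surface_eq simp flip: quo0)
qed

lemma cover_group_eq: "cover_group H0 f = psl ` Gam"
proof -
 have "cover_group H0 f = {P \<in> H0. induced_hom H0 f P = 0}" by (simp add: cover_group_def kernel_def integer_group_def)
 also have "\<dots> = psl ` Gam" unfolding Gam_def by (subst psl_mats0[symmetric]) blast
 finally show ?thesis .
qed

sublocale cov: mgroup Gam
 by unfold_locales (auto intro: det_G[OF Gam_G])

lemma cov_proj_sub: "cov.proj z \<subseteq> proj z"
 unfolding cov.proj_def proj_def using Gam_G by blast

theorem lifted_lamination_eq: "lifted_lamination H0 f = cov.proj ` Aub"
 unfolding lifted_lamination_def minimizing_lamination_eq cover_group_eq cov.surface_eq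
proof (intro equalityI subsetI)
 fix p assume "p \<in> {p \<in> cov.proj ` UH. \<exists>q\<in>proj ` Aub. p \<subseteq> q}"
 then obtain z w where z: "z \<in> UH" "p = cov.proj z" "w \<in> Aub" "cov.proj z \<subseteq> proj w" by blast
 hence "z \<in> proj w" using cov.proj_self by blast
 then obtain A where "A \<in> mats H0" "z = act A w" by (auto simp: proj_def)
 hence "z \<in> Aub" using Aub_act z(3) by simp
 thus "p \<in> cov.proj ` Aub" using z by blast
next
 fix p assume "p \<in> cov.proj ` Aub"
 thus "p \<in> {p \<in> cov.proj ` UH. \<exists>q\<in>proj ` Aub. p \<subseteq> q}" using cov_proj_sub Aub_UH by blast
qed

end

section \<open>Weak components\<close>

context circle_map
begin

lemma class_closed: "C \<in> Aub // crel ==> a \<in> C ==> (a, b) \<in> crel ==> b \<in> C"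
 using in_quotient_imp_closed[OF crel_equiv] by blast

lemma class_Gam: "C \<in> Aub // crel ==> a \<in> C ==> A \<in> Gam ==> act A a \<in> C"
 using class_closed crel_Gam class_Aub by blast

lemma proj_class: assumes C: "C \<in> Aub // crel" and z: "z \<in> UH" shows "cov.proj z \<in> cov.proj ` C \<longleftrightarrow> z \<in> C"
proof
 assume "cov.proj z \<in> cov.proj ` C"
 then obtain c where "c \<in> C" "cov.proj z = cov.proj c" by blast
 then obtain A where "A \<in> Gam" "c = act A z" using cov.proj_eq[OF z] by blast
 thus "z \<in> C" using class_Gam[OF C \<open>c \<in> C\<close>, of "adj A"] z by (simp add: act_adj)
qed blast

text \<open>Points of other classes keep the distance \<open>eps0\<close>, and points outside
  \<open>Aub\<close> a positive distance because \<open>Aub\<close> is closed.\<close>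

lemma class_complement_open: assumes C: "C \<in> Aub // crel" shows "open (UH - C)"
proof (subst open_subopen, intro ballI)
 fix z assume z: "z \<in> UH - C"
 have "\<exists>r>0. \<forall>a\<in>C. r \<le> hdist z a"
 proof (cases "z \<in> Aub")
  case True
  have "eps0 \<le> hdist z a" if "a \<in> C" for a
  proof (rule ccontr)
   assume "\<not> eps0 \<le> hdist z a"
   hence "(a, z) \<in> crel" using eps0_near[OF True, of a] class_Aub[OF C] that crel_sym by auto
   thus False using class_closed[OF C that] z by blast
  qed
  thus ?thesis using eps0(1) by blast
 next
  case False
  show ?thesis
  proof (rule ccontr)
   assume "\<not> ?thesis"
   hence "\<exists>a\<in>C. hdist z a < inverse (real (Suc n))" for n by (metis inverse_positive_iff_positive not_less of_nat_0_less_iff zero_less_Suc)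
   then obtain a where a: "\<And>n. a n \<in> C" "\<And>n::nat. hdist z (a n) < inverse (real (Suc n))" by metis
   have U: "a n \<in> UH" "a n \<in> Aub" for n using a(1) class_Aub[OF C] class_UH[OF C] by blast+
   have "(\<lambda>n. hdist z (a n)) \<longlonglongrightarrow> 0"
    by (rule Lim_null_comparison[OF always_eventually LIMSEQ_inverse_real_of_nat]) (use a(2) U z in \<open>simp add: less_imp_le del: of_nat_Suc\<close>)
   hence "a \<longlonglongrightarrow> z" using U z by (intro hdist_tendsto_0D) auto
   thus False using Aub_closed_seq[of a z] U z False by blast
  qed
 qed
 then obtain r where r: "r > 0" "\<And>a. a \<in> C ==> r \<le> hdist z a" by blast
 have "hball z r \<subseteq> UH - C" using r(2) by (force simp: hball_def)
 thus "\<exists>T. open T \<and> z \<in> T \<and> T \<subseteq> UH - C" using z r(1) open_hball[of z r] by (intro exI[of _ "hball z r"]) (auto simp: hball_def)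
qed

definition leaf :: "real^2^2 \<Rightarrow> complex set set" where
 "leaf g = range (\<lambda>t. cov.proj (geo g t))"

lemma leaf_UH: "g \<in> leafs ==> geo g t \<in> UH" by (simp add: det_mult1)

lemma leaf_meet:
 assumes g: "g \<in> leafs" and h: "h \<in> leafs" and eq: "cov.proj (geo g s) = cov.proj (geo h t)"
 shows "leaf h \<subseteq> leaf g"
proof -
 obtain A where A: "A \<in> Gam" "geo h t = act A (geo g s)" using eq cov.proj_eq[OF leaf_UH[OF g]] by blast
 have AG: "A \<in> mats H0" using A Gam_G by blast
 have "geo h t = pt (A ** (g ** dg s))" using A g AG by (simp add: act_pt det_mult1)
 hence *: "A ** (g ** dg s) = h ** dg t \<or> A ** (g ** dg s) = - (h ** dg t)"
  using leafs_unique[OF leafs_dg[OF h] leafs_G[OF leafs_dg[OF g] AG]] by blast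
 have "cov.proj (geo h x) = cov.proj (geo g (s + (x - t)))" for x
 proof -
  have "h ** dg x = h ** dg t ** dg (x - t)" by (simp add: matrix_mul_assoc[symmetric] dg_add)
  hence "geo h x = pt (A ** (g ** dg s) ** dg (x - t))" using * by (auto simp: uminus_mult)
  also have "\<dots> = act A (geo g (s + (x - t)))"
   using AG g by (simp add: act_pt det_mult1 matrix_mul_assoc[symmetric] dg_add)
  finally show ?thesis using cov.proj_act[OF A(1) leaf_UH[OF g]] by simp
 qed
 thus ?thesis unfolding leaf_def by blast
qed

text \<open>A tight function descends to the cover and increases strictly along the leaf, so the
  leaf cannot return to a point; in the cover there are no closed leaves.\<close>

lemma leaf_simple: assumes g: "g \<in> leafs" shows "simple_geodesic (psl ` Gam) (leaf g)"
 unfolding simple_geodesic_def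
proof (intro exI[of _ "\<lambda>t. geo g t"] conjI disjI1)
 show "range (\<lambda>t. geo g t) \<subseteq> UH" using leaf_UH[OF g] by blast
 show "\<forall>s t. hdist (geo g s) (geo g t) = \<bar>s - t\<bar>" using hdist_geo[OF leafs_det[OF g]] by blast
 show "leaf g = range (cov.proj \<circ> (\<lambda>t. geo g t))" by (simp add: leaf_def o_def)
 obtain u where u: "u \<in> tightf" using tightf_nonempty by blast
 show "inj (cov.proj \<circ> (\<lambda>t. geo g t))"
 proof (rule injI)
  fix s t assume "(cov.proj \<circ> (\<lambda>t. geo g t)) s = (cov.proj \<circ> (\<lambda>t. geo g t)) t"
  then obtain A where "A \<in> Gam" "geo g t = act A (geo g s)" using cov.proj_eq[OF leaf_UH[OF g]] by auto
  hence "u (geo g t) = u (geo g s)" using Gam_u[OF u _ leaf_UH[OF g]] by simp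
  thus "s = t" using leafs_tight[OF g u] by simp
 qed
qed

lemma class_lamination: assumes C: "C \<in> Aub // crel" shows "geodesic_lamination (psl ` Gam) (cov.proj ` C)"
 unfolding geodesic_lamination_def
proof (intro conjI exI[of _ "leaf ` {g \<in> leafs. pt g \<in> C}"] ballI)
 have "topspace cov.quo - cov.proj ` C = cov.proj ` (UH - C)" using proj_class[OF C] class_UH[OF C] by auto
 moreover have "openin cov.quo (cov.proj ` (UH - C))" by (rule cov.open_proj[OF class_complement_open[OF C]]) blast
 ultimately show "closedin cov.quo (cov.proj ` C)" using class_UH[OF C] by (auto simp: closedin_def)
 show "simple_geodesic (psl ` Gam) l" if "l \<in> leaf ` {g \<in> leafs. pt g \<in> C}" for l using that leaf_simple by blast
 show "disjoint (leaf ` {g \<in> leafs. pt g \<in> C})"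
  unfolding pairwise_def disjnt_iff
 proof (intro ballI impI allI notI)
  fix l m p assume "l \<in> leaf ` {g \<in> leafs. pt g \<in> C}" "m \<in> leaf ` {g \<in> leafs. pt g \<in> C}" "l \<noteq> m" and p: "p \<in> l \<and> p \<in> m"
  then obtain g h where gh: "g \<in> leafs" "h \<in> leafs" "l = leaf g" "m = leaf h" by blast
  then obtain s t where st: "p = cov.proj (geo g s)" "p = cov.proj (geo h t)" using p by (auto simp: leaf_def)
  thus False using leaf_meet[of g h s t] leaf_meet[of h g t s] gh \<open>l \<noteq> m\<close> by auto
 qed
 have "geo g t \<in> C" if "g \<in> leafs" "pt g \<in> C" for g t using class_closed[OF C that(2) crel_leaf[OF that(1)]] .
 hence "leaf g \<subseteq> cov.proj ` C" if "g \<in> leafs" "pt g \<in> C" for g using that by (auto simp: leaf_def)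
 moreover have "cov.proj c \<in> \<Union>(leaf ` {g \<in> leafs. pt g \<in> C})" if c: "c \<in> C" for c
 proof -
  obtain g where g: "g \<in> leafs" "pt g = c" using ex_leaf class_Aub[OF C] c by blast
  have "cov.proj c \<in> leaf g" unfolding leaf_def by (rule range_eqI[of _ _ 0]) (simp add: g)
  thus ?thesis using g c by blast
 qed
 ultimately show "cov.proj ` C = \<Union>(leaf ` {g \<in> leafs. pt g \<in> C})" by blast
qed

lemma nbhd_eq:
 assumes "nu \<subseteq> cov.proj ` UH"
 shows "nbhd (psl ` Gam) nu e = cov.proj ` (\<Union>z\<in>{z \<in> UH. cov.proj z \<in> nu}. hball z e)"
proof (intro equalityI subsetI)
 fix p assume "p \<in> nbhd (psl ` Gam) nu e"
 then obtain w z where w: "w \<in> UH" "p = cov.proj w" "z \<in> UH" "cov.proj z \<in> nu" "surface_dist (cov.proj w) (cov.proj z) < e"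
  using assms unfolding nbhd_def cov.surface_eq by blast
 then obtain A where A: "A \<in> Gam" "hdist w (act A z) < e" using cov.sd_less by blast
 hence "w \<in> hball (act A z) e" "act A z \<in> {z \<in> UH. cov.proj z \<in> nu}" using w by (auto simp: hball_def hdist_commute act_UH)
 thus "p \<in> cov.proj ` (\<Union>z\<in>{z \<in> UH. cov.proj z \<in> nu}. hball z e)" using w(2) by blast
next
 fix p assume "p \<in> cov.proj ` (\<Union>z\<in>{z \<in> UH. cov.proj z \<in> nu}. hball z e)"
 then obtain z w where z: "z \<in> UH" "cov.proj z \<in> nu" "w \<in> UH" "hdist w z < e" "p = cov.proj w" by (auto simp: hball_def hdist_commute)
 have "surface_dist p (cov.proj z) < e" using cov.sd_le[OF z(3,1)] z(4,5) by simp
 thus "p \<in> nbhd (psl ` Gam) nu e" using z unfolding nbhd_def cov.surface_eq by blast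
qed

lemma nbhd_open: "nu \<subseteq> cov.proj ` UH ==> openin cov.quo (nbhd (psl ` Gam) nu e)"
 unfolding nbhd_eq by (intro cov.open_proj open_UN ballI open_hball) (auto simp: hball_def)

lemma nbhd_self: "nu \<subseteq> cov.proj ` UH ==> e > 0 ==> nu \<subseteq> nbhd (psl ` Gam) nu e"
 unfolding nbhd_eq by (fastforce simp: hball_def)

lemma class_nbhd_connected:
 assumes C: "C \<in> Aub // crel" and e: "e > 0"
 shows "connectedin cov.quo (nbhd (psl ` Gam) (cov.proj ` C) e)"
proof -
 define N where "N = nbhd (psl ` Gam) (cov.proj ` C) e"
 have CU: "cov.proj ` C \<subseteq> cov.proj ` UH" using class_UH[OF C] by blast
 have "{z \<in> UH. cov.proj z \<in> cov.proj ` C} = C" using proj_class[OF C] class_UH[OF C] by auto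
 hence N: "N = cov.proj ` (\<Union>b\<in>C. hball b e)" unfolding N_def nbhd_eq[OF CU] by simp
 let ?R = "connected_component_of (subtopology cov.quo N)"
 have ball: "?R (cov.proj b) (cov.proj w)" if b: "b \<in> C" and w: "w \<in> hball b e" for b w
 proof -
  have "connectedin (top_of_set UH) (hball b e)"
   using connected_hball[of b e] class_UH[OF C] b hball_sub by (auto simp: connectedin_subtopology)
  hence "connectedin cov.quo (cov.proj ` hball b e)"
   by (rule connectedin_continuous_map_image[OF quotient_imp_continuous_map[OF cov.quotient_proj]])
  moreover have "cov.proj ` hball b e \<subseteq> N" unfolding N using b by blast
  moreover have "b \<in> hball b e" using b class_UH[OF C] e by (auto simp: hball_def)
  ultimately show ?thesis unfolding connected_component_of_def connectedin_subtopology using w by blast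
 qed
 have chain: "?R (cov.proj b) (cov.proj b')" if b: "b \<in> C" and b': "b' \<in> C" for b b'
 proof -
  \<comment> \<open>Jumps below \<open>e\<close> stay in the ball around the previous point, and
    jumps below \<open>eps0\<close> keep the chain inside the class.\<close>
  have "(b, b') \<in> (chainrel (min e eps0))\<^sup>*" using class_crel[OF C b b'] e eps0(1) by (auto simp: crel_def)
  hence "b' \<in> C \<and> ?R (cov.proj b) (cov.proj b')"
  proof (induction rule: rtrancl_induct)
   case base
   have "b \<in> hball b e" using b class_UH[OF C] e by (auto simp: hball_def)
   thus ?case using ball[OF b, of b] b by blast
  next
   case (step y z)
   then obtain A where A: "y \<in> Aub" "z \<in> Aub" "A \<in> Gam" "hdist y (act A z) < min e eps0" by (auto simp: chainrel_def)
   have z: "z \<in> C" using class_closed[OF C _ eps0(2)[OF A(1-3)]] A(4) step by simp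
   have "act A z \<in> hball y e" using A by (auto simp: hball_def act_UH)
   hence "?R (cov.proj y) (cov.proj z)" using ball[of y "act A z"] step A by simp
   from connected_component_of_trans[OF conjunct2[OF step.IH] this] show ?case using z by blast
  qed
  thus ?thesis by blast
 qed
 have NU: "N \<subseteq> cov.proj ` UH" using hball_sub unfolding N by blast
 have "connected_space (subtopology cov.quo N)"
  unfolding connected_space_iff_connected_component
 proof (intro ballI)
  fix p q assume "p \<in> topspace (subtopology cov.quo N)" "q \<in> topspace (subtopology cov.quo N)"
  hence "p \<in> N" "q \<in> N" by (simp_all only: topspace_subtopology Int_iff)
  then obtain b w b' w' where b: "b \<in> C" "w \<in> hball b e" "p = cov.proj w" and b': "b' \<in> C" "w' \<in> hball b' e" "q = cov.proj w'"
   unfolding N by blast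
  have "?R p (cov.proj b)" using ball[OF b(1,2)] b(3) by (simp only: connected_component_of_sym)
  moreover have "?R (cov.proj b) (cov.proj b')" by (rule chain[OF b(1) b'(1)])
  moreover have "?R (cov.proj b') q" using ball[OF b'(1,2)] b'(3) by simp
  ultimately show "?R p q" by (rule connected_component_of_trans[OF connected_component_of_trans])
 qed
 thus ?thesis using NU unfolding connectedin_def N_def by simp
qed

lemma class_weakly_connected:
 assumes C: "C \<in> Aub // crel"
 shows "weakly_connected_sublamination (psl ` Gam) (cov.proj ` Aub) (cov.proj ` C)"
 unfolding weakly_connected_sublamination_def
 using class_lamination[OF C] class_nbhd_connected[OF C] class_Aub[OF C] in_quotient_imp_non_empty[OF crel_equiv C] by blast

text \<open>The parts of the sublamination inside and outside one class are at distance at least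
  \<open>eps0\<close>, so their neighbourhoods of radius \<open>eps0 / 2\<close> are disjoint open
  sets that would disconnect it.\<close>

lemma weakly_connected_sub_class:
 assumes w: "weakly_connected_sublamination (psl ` Gam) (cov.proj ` Aub) nu"
 shows "\<exists>C\<in>Aub // crel. nu \<subseteq> cov.proj ` C"
proof -
 obtain a where a: "a \<in> Aub" "cov.proj a \<in> nu" and nA: "nu \<subseteq> cov.proj ` Aub" using w unfolding weakly_connected_sublamination_def by blast
 define C where "C = crel `` {a}"
 have C: "C \<in> Aub // crel" "a \<in> C" unfolding C_def using a(1) quotientI[of a Aub crel] equiv_class_self[OF crel_equiv, of a] by blast+
 define e where "e = eps0 / 2"
 have e: "e > 0" using eps0(1) by (simp add: e_def)
 define E1 where "E1 = nbhd (psl ` Gam) (nu \<inter> cov.proj ` C) e"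
 define E2 where "E2 = nbhd (psl ` Gam) (nu - cov.proj ` C) e"
 have nU: "nu \<subseteq> cov.proj ` UH" using nA Aub_UH by blast
 hence sub: "nu \<inter> cov.proj ` C \<subseteq> cov.proj ` UH" "nu - cov.proj ` C \<subseteq> cov.proj ` UH" by auto
 have "E1 \<inter> E2 = {}"
 proof (rule ccontr)
  assume "E1 \<inter> E2 \<noteq> {}"
  then obtain p where "p \<in> E1" "p \<in> E2" by blast
  then obtain z w z' w' where z: "z \<in> UH" "cov.proj z \<in> cov.proj ` C" "w \<in> hball z e" "p = cov.proj w"
   and z': "z' \<in> UH" "cov.proj z' \<in> nu - cov.proj ` C" "w' \<in> hball z' e" "p = cov.proj w'"
   unfolding E1_def E2_def nbhd_eq[OF sub(1)] nbhd_eq[OF sub(2)] by blast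
  have zC: "z \<in> C" "z' \<notin> C" using z z' proj_class[OF C(1)] by auto
  have wU: "w \<in> UH" "w' \<in> UH" using z z' by (auto simp: hball_def)
  obtain b where "b \<in> Aub" "cov.proj z' = cov.proj b" using z'(2) nA by blast
  then obtain B where "B \<in> Gam" "z' = act B b" using cov.proj_eq[of b z'] Aub_UH by metis
  hence z'A: "z' \<in> Aub" using Aub_act \<open>b \<in> Aub\<close> Gam_G by simp
  have zA: "z \<in> Aub" using zC class_Aub[OF C(1)] by blast
  obtain A where A: "A \<in> Gam" "w = act A w'" using cov.proj_eq[OF wU(2)] z(4) z'(4) by metis
  have AU: "act A z' \<in> UH" using A z' by (simp add: act_UH)
  have "hdist w (act A z') = hdist w' z'" unfolding A(2) using A wU z' by (intro hdist_act) auto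
  hence "hdist z (act A z') < eps0"
   using hdist_triangle[OF z(1) wU(1) AU] z(3) z'(3) by (simp add: hball_def e_def hdist_commute)
  hence "(z, z') \<in> crel" by (rule eps0(2)[OF zA z'A A(1)])
  thus False using class_closed[OF C(1) zC(1)] zC(2) by blast
 qed
 moreover have "nbhd (psl ` Gam) nu e \<subseteq> E1 \<union> E2" unfolding E1_def E2_def nbhd_def by blast
 moreover have "E1 \<inter> nbhd (psl ` Gam) nu e \<noteq> {}"
  using nbhd_self[OF sub(1) e] nbhd_self[OF nU e] a C(2) unfolding E1_def by blast
 moreover have "openin cov.quo E1" "openin cov.quo E2" unfolding E1_def E2_def by (intro nbhd_open sub)+
 moreover have "connectedin cov.quo (nbhd (psl ` Gam) nu e)" using w e unfolding weakly_connected_sublamination_def by blast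
 ultimately have "E2 \<inter> nbhd (psl ` Gam) nu e = {}" unfolding connectedin by blast
 hence "nu - cov.proj ` C = {}" using nbhd_self[OF sub(2) e] nbhd_self[OF nU e] unfolding E2_def by blast
 thus ?thesis using C(1) by blast
qed

lemma proj_class_sub: assumes "C \<in> Aub // crel" "D \<in> Aub // crel" "cov.proj ` C \<subseteq> cov.proj ` D" shows "C = D"
proof -
 obtain c where c: "c \<in> C" using in_quotient_imp_non_empty[OF crel_equiv assms(1)] by blast
 hence "c \<in> D" using proj_class[OF assms(2)] class_UH[OF assms(1)] assms(3) by blast
 thus ?thesis using class_eq[OF assms(1,2) c] class_crel[OF assms(1) c c] by blast
qed

theorem weak_components_eq: "weak_components (psl ` Gam) (cov.proj ` Aub) = (\<lambda>C. cov.proj ` C) ` (Aub // crel)"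
proof (intro equalityI subsetI)
 fix mu assume "mu \<in> weak_components (psl ` Gam) (cov.proj ` Aub)"
 hence m: "weakly_connected_sublamination (psl ` Gam) (cov.proj ` Aub) mu"
  "\<And>nu. weakly_connected_sublamination (psl ` Gam) (cov.proj ` Aub) nu ==> mu \<subseteq> nu ==> nu = mu" by (auto simp: weak_components_def)
 obtain C where "C \<in> Aub // crel" "mu \<subseteq> cov.proj ` C" using weakly_connected_sub_class[OF m(1)] by blast
 thus "mu \<in> (\<lambda>C. cov.proj ` C) ` (Aub // crel)" using m(2)[OF class_weakly_connected] by blast
next
 fix mu assume "mu \<in> (\<lambda>C. cov.proj ` C) ` (Aub // crel)"
 then obtain C where C: "C \<in> Aub // crel" "mu = cov.proj ` C" by blast
 have "nu = mu" if n: "weakly_connected_sublamination (psl ` Gam) (cov.proj ` Aub) nu" "mu \<subseteq> nu" for nu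
 proof -
  obtain D where D: "D \<in> Aub // crel" "nu \<subseteq> cov.proj ` D" using weakly_connected_sub_class[OF n(1)] by blast
  hence "C = D" using proj_class_sub[OF C(1) D(1)] C(2) n(2) by blast
  thus ?thesis using C(2) D(2) n(2) by blast
 qed
 thus "mu \<in> weak_components (psl ` Gam) (cov.proj ` Aub)" using class_weakly_connected[OF C(1)] C(2) by (auto simp: weak_components_def)
qed

theorem weak_components_count:
 "finite (weak_components (psl ` Gam) (cov.proj ` Aub))" "card (weak_components (psl ` Gam) (cov.proj ` Aub)) = card (Aub // crel)"
proof -
 have "inj_on (\<lambda>C. cov.proj ` C) (Aub // crel)" by (rule inj_onI) (simp add: proj_class_sub)
 thus "card (weak_components (psl ` Gam) (cov.proj ` Aub)) = card (Aub // crel)" unfolding weak_components_eq by (rule card_image)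
 show "finite (weak_components (psl ` Gam) (cov.proj ` Aub))" unfolding weak_components_eq using finite_classes by simp
qed

end

section \<open>Closures of horocycle orbits\<close>

definition row1 :: "real^2^2 \<Rightarrow> real^2" where "row1 g = vector [1, 0] v* g"

lemma row1_mult: "row1 (g ** A) = row1 g v* A" by (simp add: row1_def vmult_assoc del: vmult_nth)

lemma row1_mk: "row1 (mk a b c d) = vector [a, b]" by (simp add: row1_def vec2_eq_iff)

lemma row1_nonzero: "det g = 1 ==> row1 g \<noteq> 0"
 unfolding row1_def by (rule vmult_nonzero) (simp_all add: vec2_eq_iff)

lemma row1_surj: assumes "v \<noteq> 0" obtains g where "det g = 1" "row1 g = v"
proof -
 have n: "(v$1)\<^sup>2 + (v$2)\<^sup>2 \<noteq> 0" using assms by (auto simp: vec2_eq_iff sum_power2_eq_zero_iff)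
 define r where "r = (v$1)\<^sup>2 + (v$2)\<^sup>2"
 have "v$1 * (v$1 / r) - v$2 * (- (v$2) / r) = ((v$1)\<^sup>2 + (v$2)\<^sup>2) / r" by (simp add: power2_eq_square add_divide_distrib)
 hence "det (mk (v$1) (v$2) (- (v$2) / r) (v$1 / r)) = 1" using n by (simp add: r_def)
 thus ?thesis using that[of "mk (v$1) (v$2) (- (v$2) / r) (v$1 / r)"] by (simp add: row1_mk vec2_eq_iff)
qed

lemma row1_eq: assumes "det g = 1" "det h = 1" "row1 g = row1 h" shows "\<exists>s. g = mk 1 0 s 1 ** h"
proof -
 obtain a b c d where k: "g ** adj h = mk a b c d" by (rule mk_cases)
 have "row1 (g ** adj h) = row1 (h ** adj h)" unfolding row1_mult assms(3) ..
 hence "vector [a, b] = (vector [1, 0] :: real^2)" using assms by (simp add: k row1_mk adj_right mat_one_mk)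
 hence ab: "a = 1" "b = 0" by (simp_all add: vec2_eq_iff)
 have "det (g ** adj h) = 1" using assms by (simp add: det_mult1)
 hence "g ** adj h = mk 1 0 c 1" using ab by (simp add: k)
 hence "mk 1 0 c 1 ** h = g" using assms by (metis adj_left matrix_mul_assoc matrix_mul_rid)
 thus ?thesis by metis
qed

lemma continuous_on_row1: "continuous_on S row1"
 unfolding continuous_on_def row1_def by (intro ballI tendsto_intros)

context zcover
begin

text \<open>The first row of a matrix is a complete invariant of its orbit under left multiplication by the lower
 unipotent group, so that horocycle orbits become \<open>Gam\<close>-orbits of row vectors.\<close>

definition coset :: "real^2^2 \<Rightarrow> (real^2^2) set set" where
 "coset g = psl g <#\<^bsub>PSL2R\<^esub> (psl ` Gam)"

lemma lcos_psl: "psl g <#\<^bsub>PSL2R\<^esub> (psl ` S) = psl ` (\<lambda>A. g ** A) ` S"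
 by (auto simp: l_coset_def psl_mult)

lemma lcos_coset: "psl a <#\<^bsub>PSL2R\<^esub> coset g = coset (a ** g)"
 unfolding coset_def lcos_psl by (simp add: image_image matrix_mul_assoc)

lemma coset_eq: assumes "det g = 1" shows "coset g = coset h \<longleftrightarrow> (\<exists>A\<in>Gam. h = g ** A)"
proof
 assume "coset g = coset h"
 moreover have "psl h \<in> coset h" unfolding coset_def lcos_psl using Gam_one by (metis (no_types) imageI matrix_mul_rid)
 ultimately have "psl h \<in> coset g" by simp
 then obtain A where "A \<in> Gam" "psl h = psl (g ** A)" unfolding coset_def lcos_psl by blast
 hence "h = g ** A \<or> h = g ** (- A)" by (simp add: psl_eq_iff uminus_mult)
 thus "\<exists>A\<in>Gam. h = g ** A" using \<open>A \<in> Gam\<close> by auto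
next
 assume "\<exists>A\<in>Gam. h = g ** A"
 then obtain A where A: "A \<in> Gam" "h = g ** A" by blast
 have "(\<lambda>B. g ** A ** B) ` Gam = (\<lambda>B. g ** B) ` Gam"
 proof (intro equalityI subsetI)
  fix x assume "x \<in> (\<lambda>B. g ** A ** B) ` Gam"
  then obtain B where B: "B \<in> Gam" "x = g ** A ** B" by blast
  show "x \<in> (\<lambda>B. g ** B) ` Gam" using B(2) Gam_mult[OF A(1) B(1)] by (auto simp: matrix_mul_assoc intro!: image_eqI[of _ _ "A ** B"])
 next
  fix x assume "x \<in> (\<lambda>B. g ** B) ` Gam"
  then obtain B where B: "B \<in> Gam" "x = g ** B" by blast
  have "x = g ** A ** (adj A ** B)" unfolding B(2) matrix_mul_assoc[symmetric] adj_cancel(2)[OF det_G[OF Gam_G[OF A(1)]]] ..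
  thus "x \<in> (\<lambda>B. g ** A ** B) ` Gam" using Gam_mult[OF Gam_adj[OF A(1)] B(1)] by blast
 qed
 thus "coset g = coset h" unfolding coset_def lcos_psl A(2) by simp
qed

abbreviation "utt \<equiv> unit_tangent_topology (psl ` Gam)"

lemma bundle_eq: "unit_tangent_bundle (psl ` Gam) = coset ` {g. det g = 1}"
 by (auto simp: unit_tangent_bundle_def LCOSETS_def carrier_PSL2R coset_def)

lemma openin_utt: "openin utt U \<longleftrightarrow> U \<subseteq> coset ` {g. det g = 1} \<and> openin (top_of_set {g. det g = 1}) {g. det g = 1 \<and> coset g \<in> U}"
proof -
 have c: "carrier SL2R = {g. det g = 1}" by (simp add: SL2R_def)
 have t: "topspace PSL2R_topology = psl ` {g. det g = 1}" by (simp add: PSL2R_topology_def topspace_quotient_topology c)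
 have e: "{x \<in> topspace (top_of_set {g. det g = 1}). psl x \<in> {x \<in> psl ` {g. det g = 1}. x <#\<^bsub>PSL2R\<^esub> psl ` Gam \<in> U}} = {g. det g = 1 \<and> coset g \<in> U}"
  by (auto simp: coset_def)
 have "openin PSL2R_topology {x \<in> psl ` {g. det g = 1}. x <#\<^bsub>PSL2R\<^esub> psl ` Gam \<in> U} \<longleftrightarrow> openin (top_of_set {g. det g = 1}) {g. det g = 1 \<and> coset g \<in> U}"
  unfolding PSL2R_topology_def openin_quotient_topology c e by auto
 thus ?thesis
  unfolding unit_tangent_topology_def openin_quotient_topology t by (simp add: image_image coset_def)
qed

lemma topspace_utt: "topspace utt = coset ` {g. det g = 1}"
 by (simp add: unit_tangent_topology_def topspace_quotient_topology PSL2R_topology_def SL2R_def image_image coset_def)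

definition rowset :: "(real^2) set \<Rightarrow> (real^2^2) set set set" where
 "rowset S = {coset h | h. det h = 1 \<and> row1 h \<in> S}"

lemma coset_in_rowset:
 assumes S: "\<And>x A. x \<in> S ==> A \<in> Gam ==> x v* A \<in> S" and h: "det h = 1"
 shows "coset h \<in> rowset S \<longleftrightarrow> row1 h \<in> S"
proof
 assume "coset h \<in> rowset S"
 then obtain k where k: "coset h = coset k" "det k = 1" "row1 k \<in> S" by (auto simp: rowset_def)
 then obtain A where "A \<in> Gam" "h = k ** A" using coset_eq[OF k(2), of h] by metis
 thus "row1 h \<in> S" using S k(3) by (simp add: row1_mult del: vmult_nth)
qed (use h in \<open>auto simp: rowset_def\<close>)

lemma horocycle_elt_eq: "horocycle_elt s = psl (mk 1 0 s 1)" by (simp add: horocycle_elt_def mk_def)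

lemma geodesic_elt_eq: "geodesic_elt t = psl (dg t)" by (simp add: geodesic_elt_def dg_def mk_def)

lemma N_orbit_eq: assumes g: "det g = 1" shows "N_orbit (coset g) = rowset (orb (row1 g))"
proof (intro equalityI subsetI)
 fix x assume "x \<in> N_orbit (coset g)"
 then obtain s where x: "x = coset (mk 1 0 s 1 ** g)" by (auto simp: N_orbit_def horocycle_elt_eq lcos_coset)
 have "row1 (mk 1 0 s 1 ** g) = row1 g" unfolding row1_mult row1_mk by (simp only: row1_def)
 hence "row1 (mk 1 0 s 1 ** g) \<in> orb (row1 g)" using Gam_one unfolding orb_def by (metis image_eqI vmult_one)
 moreover have "det (mk 1 0 s 1 ** g) = 1" using g by (intro det_mult1) simp_all
 ultimately show "x \<in> rowset (orb (row1 g))" unfolding x rowset_def by blast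
next
 fix x assume "x \<in> rowset (orb (row1 g))"
 then obtain h A where h: "x = coset h" "det h = 1" "A \<in> Gam" "row1 h = row1 (g ** A)" by (auto simp: rowset_def orb_def row1_mult)
 have gA: "det (g ** A) = 1" using g h(3) Gam_G by (simp add: det_mult1)
 obtain s where s: "h = mk 1 0 s 1 ** (g ** A)" using row1_eq[OF h(2) gA h(4)] by blast
 have "det (mk 1 0 s 1 ** g) = 1" using g by (intro det_mult1) simp_all
 hence "coset (mk 1 0 s 1 ** g) = coset h" using h(3) s by (auto simp: coset_eq matrix_mul_assoc)
 thus "x \<in> N_orbit (coset g)" unfolding h(1) N_orbit_def horocycle_elt_eq lcos_coset by blast
qed

text \<open>A closed \<open>Gam\<close>-invariant set of rows has an open saturated complement,
  which gives one inclusion. For the other, convergent rows are completed to convergent matrices of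
  determinant one.\<close>

theorem closure_N_orbit: assumes g: "det g = 1" shows "utt closure_of N_orbit (coset g) = rowset (closure (orb (row1 g)))"
proof (intro equalityI subsetI)
 define K where "K = closure (orb (row1 g))"
 have K: "x v* A \<in> K" if "x \<in> K" "A \<in> Gam" for x A using closure_orb_vmult that unfolding K_def by blast
 have K': "x v* A \<in> - K" if "x \<in> - K" "A \<in> Gam" for x A
 proof
  assume "x v* A \<in> K"
  hence "(x v* A) v* adj A \<in> K" using K Gam_adj[OF that(2)] by blast
  thus False using that Gam_G by (simp add: vmult_cancel(1) del: vmult_nth)
 qed
 fix x assume x: "x \<in> utt closure_of N_orbit (coset g)"
 then obtain h where h: "det h = 1" "x = coset h" unfolding in_closure_of topspace_utt by blast
 show "x \<in> rowset (closure (orb (row1 g)))"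
 proof (rule ccontr)
  assume "x \<notin> rowset (closure (orb (row1 g)))"
  hence "row1 h \<in> - K" using h by (auto simp: K_def rowset_def)
  hence "x \<in> rowset (- K)" using h by (auto simp: rowset_def)
  moreover have "openin utt (rowset (- K))"
   unfolding openin_utt
  proof
   have "{h. det h = 1 \<and> coset h \<in> rowset (- K)} = {h. det h = 1} \<inter> row1 -` (- K)" using coset_in_rowset[OF K'] by auto
   moreover have "openin (top_of_set {h. det h = 1}) ({h. det h = 1} \<inter> row1 -` (- K))"
    by (rule continuous_openin_preimage_gen[OF continuous_on_row1]) (simp add: K_def open_Compl)
   ultimately show "openin (top_of_set {g. det g = 1}) {g. det g = 1 \<and> coset g \<in> rowset (- K)}" by (simp only:)
  qed (auto simp: rowset_def)
  ultimately obtain y where y: "y \<in> rowset (orb (row1 g))" "y \<in> rowset (- K)" using x g N_orbit_eq unfolding in_closure_of by metis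
  then obtain k where k: "y = coset k" "det k = 1" "row1 k \<in> orb (row1 g)" by (auto simp: rowset_def)
  hence "row1 k \<in> - K" using y(2) coset_in_rowset[OF K', of k] by blast
  thus False using k(3) closure_subset unfolding K_def by blast
 qed
next
 fix x assume "x \<in> rowset (closure (orb (row1 g)))"
 then obtain h where h: "x = coset h" "det h = 1" "row1 h \<in> closure (orb (row1 g))" by (auto simp: rowset_def)
 obtain a b c d where m: "h = mk a b c d" by (rule mk_cases)
 obtain w where w: "\<And>n. w n \<in> orb (row1 g)" "w \<longlonglongrightarrow> row1 h" using h(3) by (auto simp: closure_sequential)
 \<comment> \<open>Dividing the second row of \<open>h\<close> by \<open>D n\<close> restores
   determinant one under the approximating first row.\<close>
 define D where "D n = w n $ 1 * d - w n $ 2 * c" for n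
 define H where "H n = mk (w n $ 1) (w n $ 2) (c / D n) (d / D n)" for n
 have w12: "(\<lambda>n. w n $ 1) \<longlonglongrightarrow> a" "(\<lambda>n. w n $ 2) \<longlonglongrightarrow> b"
  using tendsto_vec_nth[OF w(2), of 1] tendsto_vec_nth[OF w(2), of 2] by (simp_all add: m row1_mk)
 have "D \<longlonglongrightarrow> a * d - b * c" unfolding D_def[abs_def] by (intro tendsto_diff tendsto_mult tendsto_const w12)
 hence D: "D \<longlonglongrightarrow> 1" using h(2) m by simp
 have "(\<lambda>n. c / D n) \<longlonglongrightarrow> c / 1" "(\<lambda>n. d / D n) \<longlonglongrightarrow> d / 1" by (intro tendsto_divide tendsto_const D; simp)+
 hence H: "H \<longlonglongrightarrow> h" using w12 by (simp add: tendsto_mat2 forall_2 H_def m)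
 have ne: "\<forall>\<^sub>F n in sequentially. D n \<noteq> 0" using D by (rule tendsto_imp_eventually_ne) simp
 show "x \<in> utt closure_of N_orbit (coset g)"
  unfolding in_closure_of topspace_utt
 proof (intro conjI allI impI)
  show "x \<in> coset ` {g. det g = 1}" using h by blast
  fix T assume "x \<in> T \<and> openin utt T"
  hence T: "coset h \<in> T" "openin (top_of_set {g. det g = 1}) {g. det g = 1 \<and> coset g \<in> T}" using h(1) openin_utt by auto
  then obtain Q where Q: "open Q" "{g. det g = 1 \<and> coset g \<in> T} = {g. det g = 1} \<inter> Q" unfolding openin_open by blast
  have "h \<in> Q" using Q(2) T(1) h(2) by blast
  hence "\<forall>\<^sub>F n in sequentially. H n \<in> Q" using topological_tendstoD[OF H Q(1)] by blast
  hence "\<forall>\<^sub>F n in sequentially. H n \<in> Q \<and> D n \<noteq> 0" using ne by (rule eventually_conj)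
  then obtain n where n: "H n \<in> Q" "D n \<noteq> 0" unfolding eventually_sequentially by blast
  have "det (H n) = (w n $ 1 * d - w n $ 2 * c) / D n" by (simp add: H_def diff_divide_distrib)
  hence dH: "det (H n) = 1" using n(2) by (simp add: D_def)
  have "row1 (H n) = w n" by (simp add: H_def row1_mk vec2_eq_iff)
  hence "coset (H n) \<in> N_orbit (coset g)" using w(1)[of n] dH by (auto simp: N_orbit_eq[OF g] rowset_def)
  moreover have "coset (H n) \<in> T" using Q(2) n(1) dH by blast
  ultimately show "\<exists>y. y \<in> N_orbit (coset g) \<and> y \<in> T" by blast
 qed
qed

abbreviation "Cl v \<equiv> rowset (closure (orb v))"

section \<open>Counting orbit closures up to the geodesic flow\<close>

lemma N_orbit_closures_eq: "N_orbit_closures (psl ` Gam) = Cl ` {v. v \<noteq> 0}"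
proof -
 have "N_orbit_closures (psl ` Gam) = (\<lambda>g. Cl (row1 g)) ` {g. det g = 1}"
  unfolding N_orbit_closures_def bundle_eq image_image using closure_N_orbit by (intro image_cong) auto
 also have "\<dots> = Cl ` {v. v \<noteq> 0}"
 proof (intro equalityI subsetI)
  fix x assume "x \<in> (\<lambda>g. Cl (row1 g)) ` {g. det g = 1}"
  thus "x \<in> Cl ` {v. v \<noteq> 0}" using row1_nonzero by blast
 next
  fix x assume "x \<in> Cl ` {v. v \<noteq> 0}"
  then obtain v where "v \<noteq> 0" "x = Cl v" by blast
  thus "x \<in> (\<lambda>g. Cl (row1 g)) ` {g. det g = 1}" using row1_surj[of v] by (metis (mono_tags, lifting) image_eqI mem_Collect_eq)
 qed
 finally show ?thesis .
qed

lemma Cl_eq: assumes "v \<noteq> 0" "w \<noteq> 0" shows "Cl v = Cl w \<longleftrightarrow> closure (orb v) = closure (orb w)"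
proof
 have "closure (orb v) \<subseteq> closure (orb w)" if eq: "Cl v = Cl w" and v: "v \<noteq> 0" for v w
 proof -
  obtain h where h: "det h = 1" "row1 h = v" by (rule row1_surj[OF v])
  have "coset h \<in> Cl v" using h closure_orb_self by (auto simp: rowset_def)
  hence "v \<in> closure (orb w)" using eq coset_in_rowset[OF closure_orb_vmult h(1)] h(2) by simp
  thus ?thesis by (rule closure_orb_trans)
 qed
 thus "Cl v = Cl w ==> closure (orb v) = closure (orb w)" using assms by (metis subset_antisym)
qed simp

lemma A_translate_Cl: "A_translate t (Cl v) = Cl (exp (t/2) *\<^sub>R v)"
proof -
 have r: "row1 (dg t ** h) = exp (t/2) *\<^sub>R row1 h" for t h by (simp add: row1_def vec2_eq_iff dg_def flip: vmult_assoc)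
 have sub: "A_translate t (Cl v) \<subseteq> Cl (exp (t/2) *\<^sub>R v)" for t v
 proof
  fix x assume "x \<in> A_translate t (Cl v)"
  then obtain h where h: "det h = 1" "row1 h \<in> closure (orb v)" "x = coset (dg t ** h)"
   by (auto simp: A_translate_def rowset_def geodesic_elt_eq lcos_coset)
  thus "x \<in> Cl (exp (t/2) *\<^sub>R v)" using closure_orb_scaleR[OF h(2), of "exp (t/2)"] r[of t h] det_mult1[OF det_dg h(1), of t]
   unfolding rowset_def by (metis (mono_tags, lifting) mem_Collect_eq)
 qed
 have "Cl (exp (t/2) *\<^sub>R v) \<subseteq> A_translate t (Cl v)"
 proof
  fix x assume x: "x \<in> Cl (exp (t/2) *\<^sub>R v)"
  hence "geodesic_elt (- t) <#\<^bsub>PSL2R\<^esub> x \<in> A_translate (- t) (Cl (exp (t/2) *\<^sub>R v))" by (auto simp: A_translate_def)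
  also have "\<dots> \<subseteq> Cl v" using sub[of "- t" "exp (t/2) *\<^sub>R v"] by (simp flip: exp_add)
  finally have y: "geodesic_elt (- t) <#\<^bsub>PSL2R\<^esub> x \<in> Cl v" .
  obtain h where "x = coset h" using x by (auto simp: rowset_def)
  hence "x = geodesic_elt t <#\<^bsub>PSL2R\<^esub> (geodesic_elt (- t) <#\<^bsub>PSL2R\<^esub> x)" by (simp add: geodesic_elt_eq lcos_coset matrix_mul_assoc dg_add)
  thus "x \<in> A_translate t (Cl v)" unfolding A_translate_def using y by blast
 qed
 thus ?thesis using sub by blast
qed

lemma A_equiv_Cl: assumes "v \<noteq> 0" "w \<noteq> 0" shows "(Cl v, Cl w) \<in> A_equiv (psl ` Gam) \<longleftrightarrow> key v = key w"
proof -
 have "(Cl v, Cl w) \<in> A_equiv (psl ` Gam) \<longleftrightarrow> (\<exists>t. Cl w = Cl (exp (t/2) *\<^sub>R v))"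
  using assms by (simp add: A_equiv_def N_orbit_closures_eq A_translate_Cl)
 also have "\<dots> \<longleftrightarrow> (\<exists>t. closure (orb w) = closure (orb (exp (t/2) *\<^sub>R v)))" using assms by (simp add: Cl_eq)
 also have "\<dots> \<longleftrightarrow> shape v w"
 proof
  assume "shape v w"
  then obtain c where c: "c > 0" "closure (orb w) = closure (orb (c *\<^sub>R v))" by (auto simp: shape_def)
  hence "c = exp (2 * ln c / 2)" by simp
  thus "\<exists>t. closure (orb w) = closure (orb (exp (t/2) *\<^sub>R v))" using c(2) by metis
 qed (auto simp: shape_def intro: exI[of _ "exp _"])
 also have "\<dots> \<longleftrightarrow> key v = key w" by (rule shape_key[OF assms])
 finally show ?thesis .
qed

theorem card_N_orbit_closures: "card (N_orbit_closures (psl ` Gam) // A_equiv (psl ` Gam)) = 2 * card (Aub // crel) + 1"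
proof -
 define F where "F k = {Cl w | w. w \<noteq> 0 \<and> key w = k}" for k
 have cls: "A_equiv (psl ` Gam) `` {Cl v} = F (key v)" if v: "v \<noteq> 0" for v
 proof (intro equalityI subsetI)
  fix D assume D: "D \<in> A_equiv (psl ` Gam) `` {Cl v}"
  hence "D \<in> N_orbit_closures (psl ` Gam)" by (auto simp: A_equiv_def)
  then obtain w where w: "w \<noteq> 0" "D = Cl w" unfolding N_orbit_closures_eq by blast
  thus "D \<in> F (key v)" using D A_equiv_Cl[OF v w(1)] by (auto simp: F_def)
 next
  fix D assume "D \<in> F (key v)"
  then obtain w where w: "w \<noteq> 0" "D = Cl w" "key w = key v" by (auto simp: F_def)
  thus "D \<in> A_equiv (psl ` Gam) `` {Cl v}" using A_equiv_Cl[OF v w(1)] by simp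
 qed
 have "N_orbit_closures (psl ` Gam) // A_equiv (psl ` Gam) = (\<lambda>v. A_equiv (psl ` Gam) `` {Cl v}) ` {v. v \<noteq> 0}"
  unfolding quotient_def N_orbit_closures_eq by blast
 also have "\<dots> = (\<lambda>v. F (key v)) ` {v. v \<noteq> 0}" using cls by (intro image_cong) auto
 also have "\<dots> = F ` key ` {v. v \<noteq> 0}" by (simp add: image_image)
 finally have q: "N_orbit_closures (psl ` Gam) // A_equiv (psl ` Gam) = F ` key ` {v. v \<noteq> 0}" .
 have "inj_on F (key ` {v. v \<noteq> 0})"
 proof (rule inj_onI, clarify)
  fix v w :: "real^2" assume v: "v \<noteq> 0" "w \<noteq> 0" and eq: "F (key v) = F (key w)"
  have "Cl v \<in> F (key v)" unfolding F_def using v(1) by (intro CollectI exI[of _ v] conjI refl)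
  hence "Cl v \<in> F (key w)" unfolding eq .
  hence "(Cl w, Cl v) \<in> A_equiv (psl ` Gam)" unfolding cls[OF v(2), symmetric] by (rule ImageE) blast
  hence "key w = key v" by (rule iffD1[OF A_equiv_Cl[OF v(2,1)]])
  thus "key v = key w" ..
 qed
 thus ?thesis unfolding q by (simp add: card_image card_key)
qed

end

theorem corollary1p6:
 fixes \<Gamma>\<^sub>0 \<Gamma> :: "(real^2^2) set set"
  and f :: "complex set \<Rightarrow> real set"
  and \<Lambda> :: "complex set set"
 assumes "closed_surface_group \<Gamma>\<^sub>0"
  and "continuous_map (surface_topology \<Gamma>\<^sub>0) circle_topology f"
  and "\<nexists>c. homotopic_with (\<lambda>_. True) (surface_topology \<Gamma>\<^sub>0) circle_topology f (\<lambda>_. c)"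
  and "\<Gamma> = cover_group \<Gamma>\<^sub>0 f"
  and "\<Lambda> = lifted_lamination \<Gamma>\<^sub>0 f"
 shows "finite (weak_components \<Gamma> \<Lambda>)
  \<and> card (N_orbit_closures \<Gamma> // A_equiv \<Gamma>) = 2 * card (weak_components \<Gamma> \<Lambda>) + 1"
proof -
 interpret circle_map \<Gamma>\<^sub>0 f by unfold_locales (use assms(1-3) in auto)
 show ?thesis
  unfolding assms(4,5) cover_group_eq lifted_lamination_eq
  using weak_components_count card_N_orbit_closures by simp
qed

end
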